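(* Suppose that $n\ge 3$, and let $0<\alpha<1$. Let $L_0=\Delta_{\mathbb{H}^n}-f'(U_0(t))$ be the linearized Allen-Cahn operator at the one-dimensional solution $U_0$, and let $\beta$ and the weighted Hölder spaces $\mathcal{C}^{k,\alpha}_{\mu,\delta}(\mathbb{H}^n,H)$ be as in the context. Fix any $\delta\in(0,\tfrac12(n-2))$ and $\mu\in(0,\beta)$. Then $$L_0:\mathcal{C}^{2,\alpha}_{\mu,\delta}(\mathbb{H}^n,H)\longrightarrow\mathcal{C}^{0,\alpha}_{\mu,\delta}(\mathbb{H}^n,H)$$ is an isomorphism.
   Context: $F\in \mathcal{C}^\infty(\mathbb{R})$ is a nondegenerate double-well potential: $F\ge 0$, $F^{-1}(0)=\{\pm1\}$, $F''(\pm1)>0$, $F$ is monotone decreasing on $(-\infty,-1)$ and monotone increasing on $(1,\infty)$; $f=F'$. Write $\mathbb{H}^n=\mathbb{R}_t\times\mathbb{H}^{n-1}$ with metric $g=dt^2+\cosh^2 t\,g_{\mathbb{H}^{n-1}}$, so $t$ is the signed distance to the totally geodesic hyperplane $H=\{t=0\}$ and $\Delta_{\mathbb{H}^n}=\partial_t^2+(n-1)\tanh t\,\partial_t+\operatorname{sech}^2 t\,\Delta_{\mathbb{H}^{n-1}}$. $U_0:\mathbb{R}\to\mathbb{R}$ is the unique solution (known to exist) of $U_0''(t)+(n-1)\tanh t\,U_0'(t)-f(U_0(t))=0$ with $U_0(t)\to\pm1$ as $t\to\pm\infty$. Thus $$L_0=\partial_t^2+(n-1)\tanh t\,\partial_t+\operatorname{sech}^2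 t\,\Delta_{\mathbb{H}^{n-1}}-f'(U_0(t)).$$ Let $\gamma_\pm=f'(\pm1)>0$, $\beta_\pm=\frac{n-1}{2}+\sqrt{\frac{(n-1)^2}{4}+\gamma_\pm}$ and $\beta=\min\{\beta_+,\beta_-\}$. $\mathcal{C}^{k,\alpha}(\mathbb{H}^n)$ is the ordinary Hölder space, with norm the supremum over all balls of radius $1$ of the $\mathcal{C}^{k,\alpha}$ norm on that ball with respect to the hyperbolic metric. Let $\rho=\operatorname{sech} r$, where $r$ is the distance in $\mathbb{H}^{n-1}$ from a fixed point $o$, regarded as a function on $\mathbb{H}^n$ independent of $t$. Then $$\mathcal{C}^{k,\alpha}_{\mu,\delta}(\mathbb{H}^n,H)=\{u=\operatorname{sech}(\mu t)\,\rho^\delta\,\tilde u:\ \tilde u\in \mathcal{C}^{k,\alpha}(\mathbb{H}^n)\},$$ with norm $\|u\|_{k,\alpha,\mu,\delta}=\|\tilde u\|_{\mathcal{C}^{k,\alpha}}$. *)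

theory Defs
  imports "HOL-Analysis.Analysis"
begin

text \<open>A Riemannian manifold covered by one chart is a Euclidean space \<^typ>\<open>'b\<close> with a metric
  \<open>G x v w\<close>, where \<open>x\<close> is the base point and \<open>v\<close>, \<open>w\<close> are tangent vectors at \<open>x\<close>.\<close>

type_synonym 'b metric = "'b \<Rightarrow> 'b \<Rightarrow> 'b \<Rightarrow> real"

abbreviation dderiv :: "('b::euclidean_space \<Rightarrow> real) \<Rightarrow> 'b \<Rightarrow> 'b \<Rightarrow> real" where
  "dderiv h x v \<equiv> frechet_derivative h (at x) v"

primrec Ck :: "nat \<Rightarrow> ('b::euclidean_space \<Rightarrow> real) \<Rightarrow> bool" where
  "Ck 0 u \<longleftrightarrow> continuous_on UNIV u"
| "Ck (Suc k) u \<longleftrightarrow> (\<forall>x. u differentiable (at x)) \<and> (\<forall>v. Ck k (\<lambda>x. dderiv u x v))"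

text \<open>The vector metrically dual to a covector.\<close>

definition sharp :: "'b::euclidean_space metric \<Rightarrow> 'b \<Rightarrow> ('b \<Rightarrow> real) \<Rightarrow> 'b" where
  "sharp G x \<phi> = (THE z. \<forall>y. G x z y = \<phi> y)"

text \<open>The Levi-Civita connection on constant coordinate vector fields, by the Koszul formula:
  \<open>christoffel G x v w\<close> is the vector with components \<open>\<Gamma>\<^sup>k\<^sub>i\<^sub>j v\<^sup>i w\<^sup>j\<close>.\<close>

definition christoffel :: "'b::euclidean_space metric \<Rightarrow> 'b \<Rightarrow> 'b \<Rightarrow> 'b \<Rightarrow> 'b" where
  "christoffel G x v w = sharp G x (\<lambda>y.
     (dderiv (\<lambda>p. G p w y) x v + dderiv (\<lambda>p. G p v y) x w - dderiv (\<lambda>p. G p v w) x y) / 2)"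

text \<open>\<open>covd G u k x [v\<^sub>1, \<dots>, v\<^sub>k]\<close> is the \<open>k\<close>-th covariant derivative of the function \<open>u\<close>,
  a \<open>k\<close>-linear form on the tangent space at \<open>x\<close>; the direction of the last differentiation is the
  head of the list.\<close>

primrec covd :: "'b::euclidean_space metric \<Rightarrow> ('b \<Rightarrow> real) \<Rightarrow> nat \<Rightarrow> 'b \<Rightarrow> 'b list \<Rightarrow> real" where
  "covd G u 0 = (\<lambda>x vs. u x)"
| "covd G u (Suc k) = (\<lambda>x vs. dderiv (\<lambda>p. covd G u k p (tl vs)) x (hd vs)
      - (\<Sum>i<k. covd G u k x ((tl vs)[i := christoffel G x (hd vs) (tl vs ! i)])))"

text \<open>The Laplace-Beltrami operator, as the trace of the Hessian \<open>g\<^sup>i\<^sup>j \<nabla>\<^sup>2\<^sub>i\<^sub>j u\<close>: the vector dual to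
  the coordinate covector \<open>dx\<^sup>i\<close> has components \<open>g\<^sup>i\<^sup>j\<close>.\<close>

definition laplace :: "'b::euclidean_space metric \<Rightarrow> ('b \<Rightarrow> real) \<Rightarrow> 'b \<Rightarrow> real" where
  "laplace G u x = (\<Sum>b\<in>Basis. covd G u 2 x [b, sharp G x (\<lambda>y. b \<bullet> y)])"

abbreviation velocity :: "(real \<Rightarrow> 'b::euclidean_space) \<Rightarrow> real \<Rightarrow> 'b" where
  "velocity \<gamma> s \<equiv> vector_derivative \<gamma> (at s within {0..1})"

definition curve_length :: "'b::euclidean_space metric \<Rightarrow> (real \<Rightarrow> 'b) \<Rightarrow> real" where
  "curve_length G \<gamma> = integral {0..1} (\<lambda>s. sqrt (G (\<gamma> s) (velocity \<gamma> s) (velocity \<gamma> s)))"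

text \<open>The curves are \<open>C\<^sup>1\<close> up to the endpoints, so the speed is continuous and integrable. A
  \<^const>\<open>valid_path\<close> may have infinite length, for which the integral would return \<open>0\<close>.\<close>

definition rdist :: "'b::euclidean_space metric \<Rightarrow> 'b \<Rightarrow> 'b \<Rightarrow> real" where
  "rdist G x y =
     Inf (curve_length G ` {\<gamma>. \<gamma> C1_differentiable_on {0..1} \<and> \<gamma> 0 = x \<and> \<gamma> 1 = y})"

definition rball :: "'b::euclidean_space metric \<Rightarrow> 'b \<Rightarrow> real \<Rightarrow> 'b set" where
  "rball G p R = {x. rdist G p x < R}"

definition parallel_along ::
  "'b::euclidean_space metric \<Rightarrow> (real \<Rightarrow> 'b) \<Rightarrow> (real \<Rightarrow> 'b) \<Rightarrow> bool" where
  "parallel_along G \<gamma> V \<longleftrightarrow> (\<forall>s\<in>{0..1}.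
     (V has_vector_derivative - christoffel G (\<gamma> s) (velocity \<gamma> s) (V s)) (at s within {0..1}))"

definition geodesic :: "'b::euclidean_space metric \<Rightarrow> (real \<Rightarrow> 'b) \<Rightarrow> bool" where
  "geodesic G \<gamma> \<longleftrightarrow> \<gamma> differentiable_on {0..1} \<and> parallel_along G \<gamma> (velocity \<gamma>)"

definition unit_lists :: "'b::euclidean_space metric \<Rightarrow> nat \<Rightarrow> 'b \<Rightarrow> 'b list set" where
  "unit_lists G k x = {vs. length vs = k \<and> (\<forall>v\<in>set vs. G x v v = 1)}"

definition sup_covd ::
  "'b::euclidean_space metric \<Rightarrow> ('b \<Rightarrow> real) \<Rightarrow> nat \<Rightarrow> 'b set \<Rightarrow> ennreal" where
  "sup_covd G u k B = (SUP x\<in>B. SUP vs\<in>unit_lists G k x. ennreal \<bar>covd G u k x vs\<bar>)"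

text \<open>The \<open>\<alpha>\<close>-Hoelder seminorm over \<open>B\<close> of the \<open>k\<close>-th covariant derivative. The values of this
  tensor at two points are compared by parallel transport along geodesics in \<open>B\<close> joining them,
  where \<open>Vs\<close> is a list of \<open>k\<close> parallel unit vector fields. For \<open>k = 0\<close> this is the quotient
  \<open>\<bar>u y - u x\<bar> / d(x,y)\<^sup>\<alpha>\<close>. It is meant for manifolds in which any geodesic is the unique one between its
  endpoints, and for geodesically convex \<open>B\<close>, as is the case for balls in hyperbolic space.\<close>

definition holder_seminorm ::
  "'b::euclidean_space metric \<Rightarrow> ('b \<Rightarrow> real) \<Rightarrow> nat \<Rightarrow> real \<Rightarrow> 'b set \<Rightarrow> ennreal" where
  "holder_seminorm G u k \<alpha> B =
     (SUP (\<gamma>, Vs) \<in> {(\<gamma>, Vs). geodesic G \<gamma> \<and> \<gamma> ` {0..1} \<subseteq> B \<and> \<gamma> 0 \<noteq> \<gamma> 1 \<and>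
          (\<forall>V\<in>set Vs. parallel_along G \<gamma> V) \<and> map (\<lambda>V. V 0) Vs \<in> unit_lists G k (\<gamma> 0)}.
        ennreal (\<bar>covd G u k (\<gamma> 1) (map (\<lambda>V. V 1) Vs) - covd G u k (\<gamma> 0) (map (\<lambda>V. V 0) Vs)\<bar>
          / rdist G (\<gamma> 0) (\<gamma> 1) powr \<alpha>))"

definition holder_norm_on ::
  "'b::euclidean_space metric \<Rightarrow> nat \<Rightarrow> real \<Rightarrow> 'b set \<Rightarrow> ('b \<Rightarrow> real) \<Rightarrow> ennreal" where
  "holder_norm_on G k \<alpha> B u = (\<Sum>j\<le>k. sup_covd G u j B) + holder_seminorm G u k \<alpha> B"

definition holder_enorm ::
  "'b::euclidean_space metric \<Rightarrow> nat \<Rightarrow> real \<Rightarrow> ('b \<Rightarrow> real) \<Rightarrow> ennreal" where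
  "holder_enorm G k \<alpha> u = (SUP p. holder_norm_on G k \<alpha> (rball G p 1) u)"

definition holder_space ::
  "'b::euclidean_space metric \<Rightarrow> nat \<Rightarrow> real \<Rightarrow> ('b \<Rightarrow> real) set" where
  "holder_space G k \<alpha> = {u. Ck k u \<and> holder_enorm G k \<alpha> u < \<infinity>}"

text \<open>The hyperboloid \<open>{(x\<^sub>0, x). x\<^sub>0 = sqrt (1 + |x|\<^sup>2)}\<close> in Minkowski space, in the global chart
  \<open>x\<close>. This is the metric induced by \<open>|dx|\<^sup>2 - dx\<^sub>0\<^sup>2\<close>; its curvature is \<open>-1\<close>.\<close>

definition ghyp :: "'a::euclidean_space metric" where
  "ghyp x v w = v \<bullet> w - (x \<bullet> v) * (x \<bullet> w) / (1 + x \<bullet> x)"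

text \<open>The metric \<open>dt\<^sup>2 + cosh\<^sup>2 t g\<close> on the product of the line with hyperbolic space.
  The result is hyperbolic space of one dimension more than \<^typ>\<open>'a\<close>, in Fermi coordinates about
  the totally geodesic hyperplane \<open>t = 0\<close>.\<close>

definition gfermi :: "(real \<times> 'a::euclidean_space) metric" where
  "gfermi = (\<lambda>(t, x) (a, v) (b, w). a * b + (cosh t)\<^sup>2 * ghyp x v w)"

definition sech :: "real \<Rightarrow> real" where
  "sech s = 1 / cosh s"

definition weight :: "'a::euclidean_space \<Rightarrow> real \<Rightarrow> real \<Rightarrow> real \<times> 'a \<Rightarrow> real" where
  "weight q \<mu> \<delta> = (\<lambda>(t, x). sech (\<mu> * t) * sech (rdist ghyp q x) powr \<delta>)"

definition weighted_space ::
  "'a::euclidean_space \<Rightarrow> nat \<Rightarrow> real \<Rightarrow> real \<Rightarrow> real \<Rightarrow> (real \<times> 'a \<Rightarrow> real) set" where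
  "weighted_space q k \<alpha> \<mu> \<delta> =
     {\<lambda>z. weight q \<mu> \<delta> z * w z | w. w \<in> holder_space gfermi k \<alpha>}"

text \<open>The weight is positive, so the unweighted function is recovered by division.\<close>

definition weighted_norm ::
  "'a::euclidean_space \<Rightarrow> nat \<Rightarrow> real \<Rightarrow> real \<Rightarrow> real \<Rightarrow> (real \<times> 'a \<Rightarrow> real) \<Rightarrow> real" where
  "weighted_norm q k \<alpha> \<mu> \<delta> u = enn2real (holder_enorm gfermi k \<alpha> (\<lambda>z. u z / weight q \<mu> \<delta> z))"

definition double_well :: "(real \<Rightarrow> real) \<Rightarrow> bool" where
  "double_well F \<longleftrightarrow>
     (\<forall>k. Ck k F) \<and> (\<forall>s. F s \<ge> 0) \<and> {s. F s = 0} = {-1, 1} \<and>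
     deriv (deriv F) (-1) > 0 \<and> deriv (deriv F) 1 > 0 \<and>
     antimono_on {..<-1} F \<and> mono_on {1<..} F"

definition one_dim_solution :: "nat \<Rightarrow> (real \<Rightarrow> real) \<Rightarrow> (real \<Rightarrow> real) \<Rightarrow> bool" where
  "one_dim_solution n F U \<longleftrightarrow>
     Ck 2 U \<and>
     (\<forall>t. deriv (deriv U) t + (real n - 1) * tanh t * deriv U t - deriv F (U t) = 0) \<and>
     (U \<longlongrightarrow> 1) at_top \<and> (U \<longlongrightarrow> -1) at_bot"

definition L0 ::
  "(real \<Rightarrow> real) \<Rightarrow> (real \<Rightarrow> real) \<Rightarrow> (real \<times> 'a::euclidean_space \<Rightarrow> real) \<Rightarrow> real \<times> 'a \<Rightarrow> real" where
  "L0 F U u = (\<lambda>(t, x). laplace gfermi u (t, x) - deriv (deriv F) (U t) * u (t, x))"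

definition indicial :: "nat \<Rightarrow> real \<Rightarrow> real" where
  "indicial n \<gamma> = (real n - 1) / 2 + sqrt ((real n - 1)\<^sup>2 / 4 + \<gamma>)"

definition beta :: "nat \<Rightarrow> (real \<Rightarrow> real) \<Rightarrow> real" where
  "beta n F = min (indicial n (deriv (deriv F) 1)) (indicial n (deriv (deriv F) (-1)))"

definition normed_isomorphism ::
  "('b \<Rightarrow> real) set \<Rightarrow> (('b \<Rightarrow> real) \<Rightarrow> real) \<Rightarrow> ('c \<Rightarrow> real) set \<Rightarrow> (('c \<Rightarrow> real) \<Rightarrow> real) \<Rightarrow>
     (('b \<Rightarrow> real) \<Rightarrow> ('c \<Rightarrow> real)) \<Rightarrow> bool" where
  "normed_isomorphism V NV W NW T \<longleftrightarrow>
     (\<forall>u\<in>V. \<forall>v\<in>V. \<forall>a b. T (\<lambda>x. a * u x + b * v x) = (\<lambda>y. a * T u y + b * T v y)) \<and>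
     bij_betw T V W \<and>
     (\<exists>C. \<forall>u\<in>V. NW (T u) \<le> C * NV u) \<and>
     (\<exists>C. \<forall>u\<in>V. NV u \<le> C * NW (T u))"

end

(* Dividing by the weight turns L_0 into an operator Lt on the unweighted Hoelder spaces, with a bounded
  first-order term. A positive bounded supersolution of Lt, built from U' and powers of sech, gives through the
  maximum principle |w| <= M h / (K + c0) for every bounded w with |K w - Lt w| <= M h, for all K >= 0. This
  yields injectivity and makes K (K - Lt)^-1 a contraction in the sup norm weighted by h.
  For large K the resolvent is constructed with Schauder estimates by a Neumann series whose parametrix is the
  time integral of exp(-K t) times a Gaussian in the Minkowski product of the hyperboloid model. The equation
  Lt w = g then reads k = -g + K (K - Lt)^-1 k with w = (K - Lt)^-1 k, and it is solved by a second Neumann series,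
  in the weighted sup norm plus a small multiple of the Hoelder seminorm. *)
theory Submission
 imports Defs "HOL-Probability.Distributions"
begin

text \<open>The Hoelder seminorm compares Hessians by parallel transport, so third derivatives of
  the kernel have to be bounded along geodesics, uniformly on a noncompact space. In the hyperboloid
  model connection, geodesics and parallel fields become linear algebra in Minkowski space.
  Homogeneity supplies the uniformity: the mass of the kernel is the same at every point, so a
  constant may be subtracted from the data without changing any derivative, which gains
  t^(\<alpha>/2). The coefficient -f'(U0) may be positive, hence the maximum principle is applied to
  a quotient by a barrier. U' is a supersolution because differentiating its equation produces the
  extra term -(n-1) sech^2 t U'. Far out, sech (\<mu> t) is a strict supersolution precisely below
  the indicial roots, and this is how \<mu> < \<beta> enters. Two series are used because the
  parametrix, cut off at time 1, has a small residual only for large K, whereas the passage to K = 0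
  rests on the sup estimate, with ratio K / (K + c0).\<close>

section \<open>Minkowski space and the hyperboloid\<close>

definition mink :: "real * 'w::euclidean_space => real * 'w => real" where
 "mink a b = snd a \<bullet> snd b - fst a * fst b"

abbreviation tends (infixr "--->" 55) where "(f ---> l) F \<equiv> filterlim f (nhds l) F"
abbreviation seq_tends (infixr "----->" 60) where "(X :: nat => 'a::topological_space) -----> L \<equiv> (X ---> L) sequentially"
abbreviation scale (infixr "*R" 75) where "r *R x \<equiv> scaleR r (x :: 'a::real_vector)"

lemma bounded_bilinear_mink: "bounded_bilinear (mink :: real * 'w::euclidean_space => _)"
proof -
 have eq: "mink = (%a b::real * 'w. a \<bullet> (- fst b, snd b))"
  by (auto simp: mink_def fun_eq_iff inner_prod_def)
 have "bounded_linear (%b::real * 'w. (- fst b, snd b))"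
  by (intro bounded_linear_Pair bounded_linear_minus bounded_linear_fst bounded_linear_snd)
 from bounded_bilinear.comp[OF bounded_bilinear_inner bounded_linear_ident this]
 show ?thesis by (simp add: eq)
qed

interpretation mink: bounded_bilinear "mink :: real * 'w::euclidean_space => _"
 by (rule bounded_bilinear_mink)

lemmas mink_simps = mink.add_left mink.add_right mink.diff_left mink.diff_right
 mink.scaleR_left mink.scaleR_right mink.minus_left mink.minus_right mink.zero_left mink.zero_right

lemma mink_sym: "mink a b = mink b a"
 by (simp add: mink_def inner_commute mult.commute)

definition hyperboloid :: "(real * 'w::euclidean_space) set" where
 "hyperboloid = {Y. mink Y Y = -1 \<and> fst Y > 0}"

lemma mink_self: "mink Y Y = (norm (snd Y))\<^sup>2 - (fst Y)\<^sup>2"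
 by (simp only: mink_def power2_norm_eq_inner) (simp add: power2_eq_square)

lemma hyperboloid_iff: "Y \<in> hyperboloid \<longleftrightarrow> fst Y = sqrt (1 + (norm (snd Y))\<^sup>2)"
proof
 assume "Y \<in> hyperboloid"
 then have "(fst Y)\<^sup>2 = 1 + (norm (snd Y))\<^sup>2" "fst Y > 0"
  by (auto simp: hyperboloid_def mink_self)
 then show "fst Y = sqrt (1 + (norm (snd Y))\<^sup>2)" by (metis abs_of_pos real_sqrt_abs)
next
 assume a: "fst Y = sqrt (1 + (norm (snd Y))\<^sup>2)"
 then have "(fst Y)\<^sup>2 = 1 + (norm (snd Y))\<^sup>2" by simp
 moreover have "fst Y > 0" using a by (simp add: add_pos_nonneg)
 ultimately show "Y \<in> hyperboloid" by (simp add: hyperboloid_def mink_self)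
qed

lemma norm_snd_less_fst: "Y \<in> hyperboloid ==> norm (snd Y) < fst Y"
 by (simp add: hyperboloid_iff real_less_rsqrt)

lemma fst_hyperboloid_ge1: "Y \<in> hyperboloid ==> fst Y >= 1"
 by (simp add: hyperboloid_iff)

text \<open>The tangent space at \<open>Y\<close> is orthogonal to a timelike vector, hence
  spacelike: orthogonality and Cauchy-Schwarz bound the time component of \<open>v\<close> by its
  spatial norm, strictly unless \<open>v\<close> = 0, because \<open>norm (snd Y)\<close> <
  \<open>fst Y\<close>.\<close>

lemma mink_tangent_nonneg:
 assumes "Y \<in> hyperboloid" "mink Y v = 0"
 shows "mink v v >= 0" "mink v v = 0 ==> v = 0"
proof -
 have p: "fst Y > 0" using assms(1) by (simp add: hyperboloid_def)
 have e: "snd Y \<bullet> snd v = fst Y * fst v" using assms(2) by (simp add: mink_def)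
 have "fst Y * \<bar>fst v\<bar> = \<bar>snd Y \<bullet> snd v\<bar>" using e p by (simp add: abs_mult)
 also have "... <= norm (snd Y) * norm (snd v)" by (rule Cauchy_Schwarz_ineq2)
 finally have 1: "fst Y * \<bar>fst v\<bar> <= norm (snd Y) * norm (snd v)" .
 have le: "norm (snd Y) * norm (snd v) <= fst Y * norm (snd v)"
  using norm_snd_less_fst[OF assms(1)] by (intro mult_right_mono) auto
 have "\<bar>fst v\<bar> <= norm (snd v)"
  using 1 le p by (meson order_trans mult_le_cancel_left_pos)
 then have sq: "\<bar>fst v\<bar>\<^sup>2 <= (norm (snd v))\<^sup>2" by (intro power_mono) auto
 then show "mink v v >= 0"
  by (simp add: mink_self)
 show "v = 0" if "mink v v = 0"
 proof -
  have eqs: "\<bar>fst v\<bar>\<^sup>2 = (norm (snd v))\<^sup>2"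
   using that by (simp add: mink_self)
  then have eqn: "\<bar>fst v\<bar> = norm (snd v)" using power2_eq_iff_nonneg[of "\<bar>fst v\<bar>" "norm (snd v)"] by simp
  have "norm (snd v) = 0"
  proof (rule ccontr)
   assume "norm (snd v) ~= 0"
   then have "norm (snd Y) * norm (snd v) < fst Y * norm (snd v)"
    using norm_snd_less_fst[OF assms(1)] by (intro mult_strict_right_mono) auto
   with 1 eqn show False by simp
  qed
  then show ?thesis using eqn by (simp add: prod_eq_iff)
 qed
qed

lemma mink_tangent_Cauchy_Schwarz:
 assumes Y: "Y \<in> hyperboloid" and v: "mink Y v = 0" and w: "mink Y w = 0"
 shows "\<bar>mink v w\<bar> <= sqrt (mink v v) * sqrt (mink w w)"
proof -
 have vv: "mink v v >= 0" and ww: "mink w w >= 0" using mink_tangent_nonneg(1) assms by blast+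
 have "(mink v w)\<^sup>2 <= mink v v * mink w w"
 proof (cases "mink v v = 0")
  case True
  then have "v = 0" using mink_tangent_nonneg(2)[OF Y v] by simp
  then show ?thesis by (simp add: mink_simps)
 next
  case False
  then have pos: "mink v v > 0" using vv by simp
  define c where "c = mink v w / mink v v"
  have "mink Y (w - c *R v) = 0" using v w by (simp add: mink_simps)
  then have "0 <= mink (w - c *R v) (w - c *R v)" by (rule mink_tangent_nonneg(1)[OF Y])
  also have "... = mink w w - 2 * c * mink v w + c * c * mink v v"
   by (simp add: mink_simps mink_sym[of w v] algebra_simps)
  also have "... = mink w w - (mink v w)\<^sup>2 / mink v v"
   using pos by (simp add: c_def field_simps power2_eq_square)
  finally show ?thesis using pos by (simp add: field_simps)
 qed
 then have "sqrt ((mink v w)\<^sup>2) <= sqrt (mink v v * mink w w)" by (rule real_sqrt_le_mono)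
 then show ?thesis by (simp add: real_sqrt_mult)
qed

text \<open>All three parts come from the tangential part \<open>x\<close> of \<open>W\<close> at
  \<open>Y\<close>, whose square length is \<open>(mink Y W)\<^sup>2 - 1\<close>. The third part
  becomes the gradient estimate for the Minkowski product; its last factor is the sinh of the
  distance.\<close>

lemma mink_hyperboloid:
 assumes Y: "Y \<in> hyperboloid" and W: "W \<in> hyperboloid"
 shows mink_hyperboloid_ge1: "- mink Y W >= 1"
  and mink_hyperboloid_eq: "- mink Y W = 1 ==> Y = W"
  and mink_tangent_bound: "mink Y v = 0 ==> \<bar>mink v W\<bar> <= sqrt (mink v v) * sqrt ((mink Y W)\<^sup>2 - 1)"
proof -
 have YY: "mink Y Y = -1" and WW: "mink W W = -1" using assms by (auto simp: hyperboloid_def)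
 define x where "x = W + mink Y W *R Y"
 have x: "mink Y x = 0" by (simp add: x_def mink_simps YY)
 have xx: "mink x x = (mink Y W)\<^sup>2 - 1"
  by (simp add: x_def mink_simps YY WW mink_sym[of W Y] algebra_simps power2_eq_square)
 have nn: "(mink Y W)\<^sup>2 >= 1" using mink_tangent_nonneg(1)[OF Y x] xx by simp
 have "snd Y \<bullet> snd W <= norm (snd Y) * norm (snd W)" by (rule norm_cauchy_schwarz)
 also have "... <= fst Y * fst W"
  using norm_snd_less_fst[OF Y] norm_snd_less_fst[OF W] fst_hyperboloid_ge1[OF Y]
  by (intro mult_mono) auto
 finally have "mink Y W <= 0" by (simp add: mink_def)
 moreover have "1 <= \<bar>mink Y W\<bar>" using nn abs_le_square_iff[of 1 "mink Y W"] by simp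
 ultimately show "- mink Y W >= 1" by simp
 show "Y = W" if "- mink Y W = 1"
 proof -
  have my: "mink Y W = -1" using that by simp
  then have "x = 0" using mink_tangent_nonneg(2)[OF Y x] xx by simp
  then show ?thesis by (simp add: x_def my)
 qed
 show "\<bar>mink v W\<bar> <= sqrt (mink v v) * sqrt ((mink Y W)\<^sup>2 - 1)" if v: "mink Y v = 0"
 proof -
  have "mink v x = mink v W" using v by (simp add: x_def mink_simps mink_sym[of v Y])
  then show ?thesis using mink_tangent_Cauchy_Schwarz[OF Y v x] xx by simp
 qed
qed

lemma dderivI: "(f has_derivative f') (at x) ==> dderiv f x v = f' v"
 by (metis frechet_derivative_at)

lemma dderiv_linear: "f differentiable (at x) ==> linear (dderiv f x)"
 by (simp add: frechet_derivative_works has_derivative_linear)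

section \<open>Charts of the hyperboloid and their Levi-Civita connection\<close>

text \<open>A global chart of the hyperboloid whose metric is the pulled back Minkowski form. It is
  kept abstract because the weight lives on the (n-1)-dimensional space with \<open>ghyp\<close> and
  the operator on the n-dimensional one with \<open>gfermi\<close>. The inverse \<open>Xi\<close> is
  differentiated in the ambient space, which avoids calculus on the submanifold.\<close>

locale hyperbolic_chart =
 fixes G :: "'w::euclidean_space metric"
  and X :: "'w => real * 'w" and X' :: "'w => 'w => real * 'w" and X'' :: "'w => 'w => 'w => real * 'w"
  and Xi :: "real * 'w => 'w" and Xi' :: "real * 'w => real * 'w => 'w"
  and Xi'' :: "real * 'w => real * 'w => real * 'w => 'w"
 assumes X_deriv: "(X has_derivative X' p) (at p)"
  and X'_deriv: "((%p. X' p v) has_derivative (%h. X'' p h v)) (at p)"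
  and X''_cont: "continuous_on UNIV (%p. X'' p v w)"
  and X''_sym: "X'' p v w = X'' p w v"
  and X_in: "X p \<in> hyperboloid"
  and G_eq: "G p v w = mink (X' p v) (X' p w)"
  and Xi_X: "Xi (X p) = p"
  and X_Xi: "Y \<in> hyperboloid ==> X (Xi Y) = Y"
  and Xi_deriv: "Y \<in> hyperboloid ==> (Xi has_derivative Xi' Y) (at Y)"
  and Xi'_deriv: "Y \<in> hyperboloid ==> ((%Y. Xi' Y e) has_derivative (%h. Xi'' Y h e)) (at Y)"
begin

lemma X'_linear: "linear (X' p)" and X'_bl: "bounded_linear (X' p)"
 using X_deriv has_derivative_bounded_linear has_derivative_linear by blast+

lemmas X'_simps = linear_add[OF X'_linear] linear_diff[OF X'_linear] linear_cmul[OF X'_linear]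
 linear_0[OF X'_linear] linear_neg[OF X'_linear] linear_sum[OF X'_linear]

lemma X''_linear1: "linear (%h. X'' p h v)"
 using X'_deriv has_derivative_linear by blast

lemma X''_linear2: "linear (X'' p h)"
proof -
 have "(%x. X'' p x h) = X'' p h" by (rule ext) (rule X''_sym)
 then show ?thesis using X''_linear1[of p h] by simp
qed

lemma Xi'_linear: "Y \<in> hyperboloid ==> linear (Xi' Y)"
 using Xi_deriv has_derivative_linear by blast

lemma mink_XX [simp]: "mink (X p) (X p) = -1"
 using X_in[of p] by (simp add: hyperboloid_def)

lemma X_inj: "X p = X q \<longleftrightarrow> p = q"
 by (metis Xi_X)

lemma isCont_X: "isCont X p"
 using X_deriv has_derivative_continuous by blast

lemma continuous_on_X: "continuous_on S X"
 using isCont_X continuous_at_imp_continuous_on by blast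

lemma continuous_on_X': "continuous_on S (%p. X' p v)"
 using has_derivative_continuous[OF X'_deriv] by (intro continuous_at_imp_continuous_on) auto

lemma mink_X_X' [simp]: "mink (X p) (X' p v) = 0" "mink (X' p v) (X p) = 0"
proof -
 have "((%p. mink (X p) (X p)) has_derivative (%h. mink (X p) (X' p h) + mink (X' p h) (X p))) (at p)"
  by (rule mink.FDERIV[OF X_deriv X_deriv])
 moreover have "((%p. mink (X p) (X p)) has_derivative (%h. 0)) (at p)" by simp
 ultimately have "(%h. mink (X p) (X' p h) + mink (X' p h) (X p)) = (%h. 0)"
  by (rule has_derivative_unique)
 from fun_cong[OF this, of v] show "mink (X p) (X' p v) = 0" "mink (X' p v) (X p) = 0"
  using mink_sym[of "X p" "X' p v"] by auto
qed

lemma mink_X_X'': "mink (X p) (X'' p v w) = - G p v w"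
proof -
 have "((%p. mink (X p) (X' p w)) has_derivative (%h. mink (X p) (X'' p h w) + mink (X' p h) (X' p w))) (at p)"
  by (rule mink.FDERIV[OF X_deriv X'_deriv])
 moreover have "((%p. mink (X p) (X' p w)) has_derivative (%h. 0)) (at p)" by simp
 ultimately have "(%h. mink (X p) (X'' p h w) + mink (X' p h) (X' p w)) = (%h. 0)"
  by (rule has_derivative_unique)
 from fun_cong[OF this, of v] show ?thesis by (simp add: G_eq)
qed

lemma Xi'_X': "Xi' (X p) (X' p v) = v"
proof -
 have "((%p. Xi (X p)) has_derivative (%h. Xi' (X p) (X' p h))) (at p)"
  by (rule has_derivative_compose[OF X_deriv Xi_deriv[OF X_in]])
 moreover have "((%p. Xi (X p)) has_derivative (%h. h)) (at p)" by (simp add: Xi_X)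
 ultimately have "(%h. Xi' (X p) (X' p h)) = (%h. h)" by (rule has_derivative_unique)
 then show ?thesis by metis
qed

lemma X'_inj: "X' p v = X' p w \<longleftrightarrow> v = w"
 by (metis Xi'_X')

text \<open>Differentiating \<open>Xi\<close> after \<open>X\<close> shows only that
  \<open>Xi'\<close> is a left inverse of \<open>X'\<close>. That it is a right inverse on tangent
  vectors follows by differentiating \<open>X\<close> after \<open>Xi\<close> along a curve in the
  hyperboloid with velocity \<open>e\<close>.\<close>

lemma X'_Xi':
 assumes e: "mink (X p) e = 0"
 shows "X' p (Xi' (X p) e) = e"
proof -
 define y where "y = snd (X p)"
 \<comment> \<open>The straight line from \<open>y\<close> in direction \<open>snd e\<close>, lifted
   to the hyperboloid; tangency of \<open>e\<close> makes the time component of its initial velocity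
   equal to \<open>fst e\<close>.\<close>
 define c where "c s = (sqrt (1 + (y + s *R snd e) \<bullet> (y + s *R snd e)), y + s *R snd e)" for s
 have ch: "c s \<in> hyperboloid" for s by (simp add: c_def hyperboloid_iff power2_norm_eq_inner)
 have x0: "fst (X p) = sqrt (1 + y \<bullet> y)" using X_in[of p] by (simp add: y_def hyperboloid_iff power2_norm_eq_inner)
 have c0: "c 0 = X p" using x0 by (simp add: c_def y_def prod_eq_iff)
 have pos: "1 + y \<bullet> y > 0" by (simp add: add_pos_nonneg)
 have "fst e * fst (X p) = y \<bullet> snd e" using e by (simp add: mink_def y_def algebra_simps)
 then have e0: "fst e = (y \<bullet> snd e) / sqrt (1 + y \<bullet> y)" using x0 pos by (simp add: field_simps)
 have "((%s. 1 + (y + s *R snd e) \<bullet> (y + s *R snd e)) has_real_derivative 2 * (y \<bullet> snd e)) (at 0)"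
  unfolding has_field_derivative_def
  by (auto intro!: derivative_eq_intros simp: fun_eq_iff inner_commute algebra_simps)
 from DERIV_chain2[where f=sqrt and Da="inverse (sqrt (1 + y \<bullet> y)) / 2", OF _ this] have d: "((%s. sqrt (1 + (y + s *R snd e) \<bullet> (y + s *R snd e))) has_real_derivative
   2 * (y \<bullet> snd e) * (inverse (sqrt (1 + y \<bullet> y)) / 2)) (at 0)"
  using DERIV_real_sqrt[OF pos] by (simp add: mult.commute)
 have "(c has_vector_derivative (2 * (y \<bullet> snd e) * (inverse (sqrt (1 + y \<bullet> y)) / 2), snd e)) (at 0)"
  unfolding c_def
  by (intro has_vector_derivative_Pair d[unfolded has_real_derivative_iff_has_vector_derivative])
    (auto intro!: derivative_eq_intros)
 moreover have "(2 * (y \<bullet> snd e) * (inverse (sqrt (1 + y \<bullet> y)) / 2), snd e) = e"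
 proof (rule prod_eqI)
  show "fst (2 * (y \<bullet> snd e) * (inverse (sqrt (1 + y \<bullet> y)) / 2), snd e) = fst e"
   unfolding e0 fst_conv by (simp add: inverse_eq_divide)
 qed (simp only: snd_conv)
 ultimately have cd: "(c has_vector_derivative e) (at 0)" by (simp only:)
 have "((%s. Xi (c s)) has_derivative (%h. Xi' (c 0) (h *R e))) (at 0)"
  using has_derivative_compose[OF cd[unfolded has_vector_derivative_def] Xi_deriv[OF ch]] .
 then have "((%s. X (Xi (c s))) has_derivative (%h. X' (Xi (c 0)) (Xi' (c 0) (h *R e)))) (at 0)"
  using has_derivative_compose[OF _ X_deriv] by blast
 moreover have "((%s. X (Xi (c s))) has_derivative (%h. h *R e)) (at 0)"
  using cd X_Xi[OF ch] by (simp add: has_vector_derivative_def)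
 ultimately have "(%h. X' (Xi (c 0)) (Xi' (c 0) (h *R e))) = (%h. h *R e)"
  by (rule has_derivative_unique)
 from fun_cong[OF this, of 1] show ?thesis by (simp add: c0 Xi_X)
qed

lemma G_sym: "G p v w = G p w v" by (simp add: G_eq mink_sym)

lemma G_nonneg: "G p v v >= 0"
 using mink_tangent_nonneg(1)[OF X_in[of p]] by (simp add: G_eq)

lemma G_zero: "G p v v = 0 ==> v = 0"
 using mink_tangent_nonneg(2)[OF X_in[of p], of "X' p v"] X'_inj[of p v 0]
 by (simp add: G_eq linear_0[OF X'_linear])

lemmas G_simps = G_eq X'_simps mink_simps

lemma G_Cauchy_Schwarz: "\<bar>G p v w\<bar> <= sqrt (G p v v) * sqrt (G p w w)"
 using mink_tangent_Cauchy_Schwarz[OF X_in[of p], of "X' p v" "X' p w"] by (simp add: G_eq)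

lemma sharpI: "(!!y. G p z y = \<phi> y) ==> sharp G p \<phi> = z"
proof -
 assume a: "!!y. G p z y = \<phi> y"
 show ?thesis unfolding sharp_def
 proof (rule the_equality)
  show "\<forall>y. G p z y = \<phi> y" using a by simp
  fix z' assume "\<forall>y. G p z' y = \<phi> y"
  then have "G p (z' - z) (z' - z) = 0" using a by (simp add: G_simps)
  then show "z' = z" using G_zero by fastforce
 qed
qed

lemma G_has_derivative:
 "((%p. G p v w) has_derivative (%h. mink (X' p v) (X'' p h w) + mink (X'' p h v) (X' p w))) (at p)"
 unfolding G_eq by (rule mink.FDERIV[OF X'_deriv X'_deriv])

text \<open>Gauss formula: the hyperboloid is umbilic with the position vector as normal, so
  \<open>X''\<close> splits into the Christoffel vector and a multiple of \<open>X p\<close>. The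
  covector in the Koszul formula reduces to the product with \<open>X'' p v w\<close>.\<close>

lemma X'_christoffel: "X' p (christoffel G p v w) = X'' p v w - G p v w *R X p"
proof -
 define e where "e = X'' p v w - G p v w *R X p"
 have e: "mink (X p) e = 0" by (simp add: e_def mink_simps mink_X_X'')
 have "christoffel G p v w = Xi' (X p) e"
  unfolding christoffel_def
 proof (rule sharpI)
  fix y
  have "(dderiv (%p. G p w y) p v + dderiv (%p. G p v y) p w - dderiv (%p. G p v w) p y) / 2
    = mink (X'' p v w) (X' p y)"
   unfolding dderivI[OF G_has_derivative] X''_sym[of p w v] X''_sym[of p y]
   using mink_sym[of "X' p w"] mink_sym[of "X' p v"] by simp
  also have "... = G p (Xi' (X p) e) y"
   unfolding G_eq X'_Xi'[OF e] by (simp add: e_def mink_simps)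
  finally show "G p (Xi' (X p) e) y = (dderiv (%p. G p w y) p v + dderiv (%p. G p v y) p w
    - dderiv (%p. G p v w) p y) / 2" by simp
 qed
 then show ?thesis using X'_Xi'[OF e] by (simp add: e_def)
qed

lemma christoffel_eq: "christoffel G p v w = Xi' (X p) (X'' p v w - G p v w *R X p)"
 by (metis X'_christoffel Xi'_X')

lemma christoffel_linear2: "linear (christoffel G p v)"
proof (rule linearI)
 fix a b and r :: real
 have "X' p (christoffel G p v (a + b)) = X' p (christoffel G p v a + christoffel G p v b)"
  by (simp add: X'_christoffel X'_simps linear_add[OF X''_linear2] G_simps algebra_simps)
 then show "christoffel G p v (a + b) = christoffel G p v a + christoffel G p v b" by (simp add: X'_inj)
 have "X' p (christoffel G p v (r *R a)) = X' p (r *R christoffel G p v a)"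
  by (simp add: X'_christoffel X'_simps linear_cmul[OF X''_linear2] G_simps algebra_simps)
 then show "christoffel G p v (r *R a) = r *R christoffel G p v a" by (simp add: X'_inj)
qed

lemma christoffel_sym: "christoffel G p v w = christoffel G p w v"
 by (simp add: christoffel_eq X''_sym[of p v w] G_sym[of p v w])

end

text \<open>Product rule for a family of linear maps along a curve. Expanding the argument in the
  basis reduces it to \<open>p\<close> against \<open>A p b\<close> for fixed \<open>b\<close>,
  which is the form of differentiability that the chart provides.\<close>

lemma has_vector_derivative_apply:
 fixes A :: "'a::real_normed_vector => 'b::euclidean_space => 'c::real_normed_vector"
 assumes lin: "!!r. r \<in> S ==> linear (A (c r))"
  and der: "!!b. b \<in> Basis ==> ((%p. A p b) has_derivative (%h. A' h b)) (at (c s))"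
  and g: "(c has_vector_derivative v) (at s within S)"
  and V: "(V has_vector_derivative W) (at s within S)" and s: "s \<in> S"
 shows "((%r. A (c r) (V r)) has_vector_derivative
      (\<Sum>b\<in>Basis. (V s \<bullet> b) *R A' v b) + A (c s) W) (at s within S)"
proof -
 have exp: "A (c r) w = (\<Sum>b\<in>Basis. (w \<bullet> b) *R A (c r) b)" if "r \<in> S" for r w
 proof -
  have "A (c r) w = A (c r) (\<Sum>b\<in>Basis. (w \<bullet> b) *R b)" by (simp add: euclidean_representation)
  also have "... = (\<Sum>b\<in>Basis. (w \<bullet> b) *R A (c r) b)"
   by (simp add: linear_sum[OF lin[OF that]] linear_cmul[OF lin[OF that]])
  finally show ?thesis .
 qed
 have d: "((%r. (V r \<bullet> b) *R A (c r) b) has_vector_derivative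
   (V s \<bullet> b) *R A' v b + (W \<bullet> b) *R A (c s) b) (at s within S)" if b: "b \<in> Basis" for b
 proof -
  have 1: "((%r. A (c r) b) has_vector_derivative A' v b) (at s within S)"
   using has_derivative_compose[OF g[unfolded has_vector_derivative_def] der[OF b]]
   unfolding has_vector_derivative_def
   using linear_cmul[OF has_derivative_linear[OF der[OF b]]] by simp
  have 2: "((%r. V r \<bullet> b) has_real_derivative W \<bullet> b) (at s within S)"
   using bounded_linear.has_vector_derivative[OF bounded_linear_inner_left V, of b]
   by (simp add: has_real_derivative_iff_has_vector_derivative)
  show ?thesis using has_vector_derivative_scaleR[OF 2 1] by simp
 qed
 have "((%r. \<Sum>b\<in>Basis. (V r \<bullet> b) *R A (c r) b) has_vector_derivative
   (\<Sum>b\<in>Basis. (V s \<bullet> b) *R A' v b + (W \<bullet> b) *R A (c s) b)) (at s within S)"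
  by (intro has_vector_derivative_sum d)
 then have "((%r. A (c r) (V r)) has_vector_derivative
   (\<Sum>b\<in>Basis. (V s \<bullet> b) *R A' v b + (W \<bullet> b) *R A (c s) b)) (at s within S)"
  by (rule has_vector_derivative_transform[OF s, rotated]) (simp add: exp[symmetric])
 then show ?thesis using exp[OF s, of W] by (simp add: sum.distrib)
qed

abbreviation dd2 :: "('b::euclidean_space => real) => 'b => 'b => 'b => real" where
 "dd2 u v p w \<equiv> dderiv (%p. dderiv u p v) p w"

section \<open>Geodesics and parallel transport\<close>

lemma sinh_ge_self: "x <= sinh x" if "x >= 0" for x :: real
proof -
 have "sinh 0 - 0 <= sinh x - x"
  by (rule DERIV_nonneg_imp_nondecreasing[OF that])
    (auto intro!: exI derivative_eq_intros simp: cosh_real_ge_1)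
 then show ?thesis by simp
qed

text \<open>The system b' = a, a' = l^2 b is diagonal in a + l b and a - l b; each of these times
  the matching exponential is constant. Derivatives are taken within [0,1] because geodesics and
  parallel fields are only given there.\<close>

lemma hyperbolic_ode:
 fixes a b :: "real => real"
 assumes l: "l > 0"
  and b: "!!s. s \<in> {0..1} ==> (b has_real_derivative a s) (at s within {0..1})"
  and a: "!!s. s \<in> {0..1} ==> (a has_real_derivative l\<^sup>2 * b s) (at s within {0..1})"
  and s: "s \<in> {0..1}"
 shows "b s = b 0 * cosh (l * s) + a 0 / l * sinh (l * s)"
  and "a s = a 0 * cosh (l * s) + l * b 0 * sinh (l * s)"
proof -
 have cst: "f s = f 0" if "!!s. s \<in> {0..1} ==> (f has_real_derivative 0) (at s within {0..1})" for f :: "real => real"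
  using has_field_derivative_zero_constant[of "{0..1}" f] that s by auto
 have 1: "(a s + l * b s) * exp (- (l * s)) = (a 0 + l * b 0) * exp (- (l * 0))"
  by (rule cst) (auto intro!: derivative_eq_intros a b simp: algebra_simps power2_eq_square)
 have 2: "(a s - l * b s) * exp (l * s) = (a 0 - l * b 0) * exp (l * 0)"
  by (rule cst) (auto intro!: derivative_eq_intros a b simp: algebra_simps power2_eq_square)
 have e1: "a s + l * b s = (a 0 + l * b 0) * exp (l * s)"
  using arg_cong[OF 1, of "%x. x * exp (l * s)"] by (simp add: mult.assoc exp_minus)
 have e2: "a s - l * b s = (a 0 - l * b 0) * exp (- (l * s))"
  using arg_cong[OF 2, of "%x. x * exp (- (l * s))"] by (simp add: mult.assoc exp_minus)
 have "2 * a s = (a 0 + l * b 0) * exp (l * s) + (a 0 - l * b 0) * exp (- (l * s))"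
  using e1 e2 by linarith
 then show "a s = a 0 * cosh (l * s) + l * b 0 * sinh (l * s)"
  by (simp add: cosh_field_def sinh_field_def field_simps)
 have "2 * (l * b s) = (a 0 + l * b 0) * exp (l * s) - (a 0 - l * b 0) * exp (- (l * s))"
  using e1 e2 by linarith
 then have "l * b s = l * b 0 * cosh (l * s) + a 0 * sinh (l * s)"
  by (simp add: cosh_field_def sinh_field_def field_simps)
 then show "b s = b 0 * cosh (l * s) + a 0 / l * sinh (l * s)"
  using l by (simp add: field_simps)
qed

lemma geodesic_velocity:
 assumes "geodesic G c" "s \<in> {0..1}"
 shows "(c has_vector_derivative velocity c s) (at s within {0..1})"
 using assms unfolding geodesic_def differentiable_on_def by (metis vector_derivative_works)

context hyperbolic_chart
begin

text \<open>The hyperbolic cosine of the distance. It is smooth across the diagonal, where the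
  distance is not, so kernels and estimates are written in terms of \<open>Z\<close>.\<close>

definition Z :: "'w => 'w => real" where "Z p q = - mink (X p) (X q)"

lemma Z_ge1: "Z p q >= 1" and Z_eq1: "Z p q = 1 \<longleftrightarrow> p = q" and Z_sym: "Z p q = Z q p"
proof -
 show "Z p q >= 1" unfolding Z_def by (rule mink_hyperboloid_ge1[OF X_in X_in])
 show "Z p q = 1 \<longleftrightarrow> p = q"
  using mink_hyperboloid_eq[OF X_in X_in, of p q] X_inj[of p q] by (auto simp: Z_def)
 show "Z p q = Z q p" by (simp add: Z_def mink_sym)
qed

definition hdist :: "'w => 'w => real" where "hdist p q = arcosh (Z p q)"

lemma cosh_hdist [simp]: "cosh (hdist p q) = Z p q" and hdist_nonneg [simp]: "hdist p q >= 0"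
 and hdist_sym: "hdist p q = hdist q p" and hdist_eq_0: "hdist p q = 0 \<longleftrightarrow> p = q"
 using Z_ge1[of p q] Z_sym[of p q] Z_eq1[of p q] by (auto simp: hdist_def)

lemma hdist_self [simp]: "hdist p p = 0" by (simp add: hdist_eq_0)

text \<open>From cosh d - 1 = 2 sinh(d/2)^2 and sinh x >= x. It converts Hoelder bounds in the
  distance into the variable of the Gaussian kernel.\<close>

lemma hdist_sq_le: "(hdist p q)\<^sup>2 <= 2 * (Z p q - 1)"
proof -
 have "sinh (hdist p q / 2) >= hdist p q / 2" using sinh_ge_self[of "hdist p q / 2"] by simp
 then have "(hdist p q / 2)\<^sup>2 <= (sinh (hdist p q / 2))\<^sup>2" by (intro power_mono) auto
 also have "... = (Z p q - 1) / 2"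
  using cosh_double_cosh[of "hdist p q / 2"] by (simp add: sinh_square_eq field_simps)
 finally show ?thesis by (simp add: field_simps power2_eq_square)
qed

lemma curve_ambient:
 assumes "(c has_vector_derivative v) (at s within S)"
 shows "((%s. X (c s)) has_vector_derivative X' (c s) v) (at s within S)"
 using has_derivative_compose[OF assms[unfolded has_vector_derivative_def] X_deriv]
 by (simp add: has_vector_derivative_def X'_simps)

lemma X''_expand: "(\<Sum>b\<in>Basis. (w \<bullet> b) *R X'' p v b) = X'' p v w"
proof -
 have "X'' p v w = X'' p v (\<Sum>b\<in>Basis. (w \<bullet> b) *R b)" by (simp add: euclidean_representation)
 then show ?thesis by (simp add: linear_sum[OF X''_linear2] linear_cmul[OF X''_linear2])
qed

lemma field_ambient:
 assumes "(c has_vector_derivative v) (at s within S)"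
  and "(V has_vector_derivative W) (at s within S)" "s \<in> S"
 shows "((%s. X' (c s) (V s)) has_vector_derivative X'' (c s) v (V s) + X' (c s) W) (at s within S)"
 using has_vector_derivative_apply[where A=X' and A'="X'' (c s)", OF X'_linear X'_deriv assms]
 by (simp add: X''_expand)

text \<open>By the Gauss formula the tangential part of the derivative of a parallel field cancels
  and only the normal part remains.\<close>

lemma parallel_ambient:
 assumes "parallel_along G c V" "s \<in> {0..1}"
  and "(c has_vector_derivative velocity c s) (at s within {0..1})"
 shows "((%s. X' (c s) (V s)) has_vector_derivative G (c s) (velocity c s) (V s) *R X (c s)) (at s within {0..1})"
proof -
 have "(V has_vector_derivative - christoffel G (c s) (velocity c s) (V s)) (at s within {0..1})"
  using assms(1,2) by (simp add: parallel_along_def)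
 from field_ambient[OF assms(3) this assms(2)] show ?thesis
  unfolding linear_neg[OF X'_linear] X'_christoffel by simp
qed

text \<open>Converse of \<open>parallel_ambient\<close>: a tangent ambient field with normal
  derivative comes from a parallel field. Explicit ambient fields thus replace an existence theorem
  for differential equations.\<close>

lemma parallel_from_ambient:
 assumes g: "!!s. s \<in> {0..1} ==> (c has_vector_derivative velocity c s) (at s within {0..1})"
  and Y: "!!s. s \<in> {0..1} ==>
   (Y has_vector_derivative mink (X' (c s) (velocity c s)) (Y s) *R X (c s)) (at s within {0..1})"
  and tan: "!!s. s \<in> {0..1} ==> mink (X (c s)) (Y s) = 0"
 shows "parallel_along G c (%s. Xi' (X (c s)) (Y s))"
  and "!!s. s \<in> {0..1} ==> X' (c s) (Xi' (X (c s)) (Y s)) = Y s"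
proof -
 let ?V = "%s. Xi' (X (c s)) (Y s)"
 show X'V: "X' (c s) (?V s) = Y s" if "s \<in> {0..1}" for s
  using X'_Xi'[OF tan[OF that]] .
 show "parallel_along G c ?V" unfolding parallel_along_def
 proof
  fix s :: real assume s: "s \<in> {0..1}"
  \<comment> \<open>The chain rule through \<open>Xi'\<close> shows that some derivative exists. Its
    value is read off afterwards by mapping to the ambient space with \<open>X'\<close> and using
    uniqueness of derivatives.\<close>
  obtain W where W: "(?V has_vector_derivative W) (at s within {0..1})"
   using has_vector_derivative_apply[where A=Xi' and A'="Xi'' (X (c s))" and c="%s. X (c s)",
     OF Xi'_linear[OF X_in] Xi'_deriv[OF X_in] curve_ambient[OF g[OF s]] Y[OF s] s] by blast
  have "((%s. X' (c s) (?V s)) has_vector_derivative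
    X'' (c s) (velocity c s) (?V s) + X' (c s) W) (at s within {0..1})"
   by (rule field_ambient[OF g[OF s] W s])
  then have "(Y has_vector_derivative X'' (c s) (velocity c s) (?V s) + X' (c s) W) (at s within {0..1})"
   by (rule has_vector_derivative_transform[OF s, rotated]) (simp add: X'V)
  from vector_derivative_unique_within[OF _ this Y[OF s]] s
  have "X'' (c s) (velocity c s) (?V s) + X' (c s) W
    = mink (X' (c s) (velocity c s)) (X' (c s) (?V s)) *R X (c s)"
   using X'V[OF s] trivial_limit_within[of s "{0..1::real}"] islimpt_Icc[of 0 1 s] by auto
  then have "X' (c s) W = X' (c s) (- christoffel G (c s) (velocity c s) (?V s))"
   unfolding linear_neg[OF X'_linear] X'_christoffel G_eq by (simp add: algebra_simps eq_diff_eq)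
  then show "(?V has_vector_derivative - christoffel G (c s) (velocity c s) (?V s)) (at s within {0..1})"
   using W X'_inj by metis
 qed
qed

definition speed :: "(real => 'w) => real" where
 "speed c = sqrt (G (c 0) (velocity c 0) (velocity c 0))"

lemma parallel_inner_const:
 assumes g: "!!s. s \<in> {0..1} ==> (c has_vector_derivative velocity c s) (at s within {0..1})"
  and V: "parallel_along G c V" and W: "parallel_along G c W" and s: "s \<in> {0..1}"
 shows "G (c s) (V s) (W s) = G (c 0) (V 0) (W 0)"
proof -
 have "((%s. G (c s) (V s) (W s)) has_real_derivative 0) (at s within {0..1})" if s: "s \<in> {0..1}" for s
  using mink.has_vector_derivative[OF parallel_ambient[OF V s g[OF s]] parallel_ambient[OF W s g[OF s]]]
  by (simp add: G_eq mink_simps has_real_derivative_iff_has_vector_derivative)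
 from has_field_derivative_zero_constant[OF _ this] s show ?thesis by fastforce
qed

lemma speed_nonneg: "speed c >= 0"
 by (simp add: speed_def G_nonneg)

lemma geodesic_speed:
 assumes "geodesic G c" "s \<in> {0..1}"
 shows "G (c s) (velocity c s) (velocity c s) = (speed c)\<^sup>2"
 using parallel_inner_const[OF geodesic_velocity[OF assms(1)], of "velocity c" "velocity c" s] assms
 by (simp add: geodesic_def speed_def G_nonneg)

lemma geodesic_speed_pos:
 assumes "geodesic G c" "c 0 ~= c 1"
 shows "speed c > 0"
proof (rule ccontr)
 assume "\<not> ?thesis"
 then have "speed c = 0" using speed_nonneg[of c] by simp
 then have "velocity c s = 0" if "s \<in> {0..1}" for s
  using geodesic_speed[OF assms(1) that] by (intro G_zero) simp
 then have "(c has_derivative (%h. 0)) (at s within {0..1})" if "s \<in> {0..1}" for s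
  using geodesic_velocity[OF assms(1) that] that by (simp add: has_vector_derivative_def)
 from has_derivative_zero_constant[OF _ this] have "c 0 = c 1" by fastforce
 then show False using assms(2) by simp
qed

lemma geodesic_ambient2:
 assumes "geodesic G c" "s \<in> {0..1}"
 shows "((%s. X' (c s) (velocity c s)) has_vector_derivative (speed c)\<^sup>2 *R X (c s)) (at s within {0..1})"
 using parallel_ambient[OF _ assms(2) geodesic_velocity[OF assms], of "velocity c"] assms
  geodesic_speed[OF assms] by (simp add: geodesic_def)

text \<open>The product of \<open>X (c 0)\<close> with the moving point solves b'' = l^2 b with b(0)
  = -1 and b'(0) = 0, so \<open>Z\<close> equals cosh (l s) along the geodesic.\<close>

lemma geodesic_hdist:
 assumes g: "geodesic G c" and ne: "c 0 ~= c 1" and s: "s \<in> {0..1}"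
 shows "hdist (c 0) (c s) = speed c * s"
proof -
 note l = geodesic_speed_pos[OF g ne]
 let ?b = "%s. mink (X (c 0)) (X (c s))" and ?a = "%s. mink (X (c 0)) (X' (c s) (velocity c s))"
 have "(?b has_real_derivative ?a s) (at s within {0..1})" if s: "s \<in> {0..1}" for s
  using mink.has_vector_derivative[OF has_vector_derivative_const[of "X (c 0)"] curve_ambient[OF geodesic_velocity[OF g s]]]
  by (simp add: mink_simps has_real_derivative_iff_has_vector_derivative)
 moreover have "(?a has_real_derivative (speed c)\<^sup>2 * ?b s) (at s within {0..1})" if s: "s \<in> {0..1}" for s
  using mink.has_vector_derivative[OF has_vector_derivative_const[of "X (c 0)"] geodesic_ambient2[OF g s]]
  by (simp add: mink_simps has_real_derivative_iff_has_vector_derivative)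
 ultimately have "?b s = ?b 0 * cosh (speed c * s) + ?a 0 / speed c * sinh (speed c * s)"
  by (rule hyperbolic_ode(1)[OF l _ _ s])
 then have "Z (c 0) (c s) = cosh (speed c * s)" by (simp add: Z_def)
 then show ?thesis using l s by (simp add: hdist_def arcosh_cosh_real)
qed

text \<open>The ambient velocity \<open>c1\<close> of a geodesic satisfies c1' = l^2 X, so a field
  with derivative k X is obtained by adding k / l^2 times \<open>c1\<close>. That it stays tangent
  and that k stays its product with the velocity is expressed by \<open>b\<close> and
  \<open>a\<close>, which solve a linear system with zero initial data.\<close>

lemma parallel_exists:
 assumes g: "geodesic G c" and ne: "c 0 ~= c 1"
 obtains V where "parallel_along G c V" "V 0 = v"
proof -
 note l = geodesic_speed_pos[OF g ne]
 define y0 where "y0 = X' (c 0) v"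
 define c1 where "c1 s = X' (c s) (velocity c s)" for s
 define k where "k = mink (c1 0) y0"
 define Y where "Y s = y0 + (k / (speed c)\<^sup>2) *R (c1 s - c1 0)" for s
 have Y': "(Y has_vector_derivative k *R X (c s)) (at s within {0..1})" if s: "s \<in> {0..1}" for s
 proof -
  have "(Y has_vector_derivative (k / (speed c)\<^sup>2) *R ((speed c)\<^sup>2 *R X (c s))) (at s within {0..1})"
   unfolding Y_def c1_def
   by (auto intro!: derivative_eq_intros geodesic_ambient2[OF g s])
  then show ?thesis using l by simp
 qed
 have c1': "(c1 has_vector_derivative (speed c)\<^sup>2 *R X (c s)) (at s within {0..1})" if s: "s \<in> {0..1}" for s
  unfolding c1_def by (rule geodesic_ambient2[OF g s])
 have mc: "mink (c1 s) (X (c s)) = 0" for s by (simp add: c1_def)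
 define b where "b s = mink (X (c s)) (Y s)" for s
 define a where "a s = mink (c1 s) (Y s) - k" for s
 have db: "(b has_real_derivative a s) (at s within {0..1})" if s: "s \<in> {0..1}" for s
  using mink.has_vector_derivative[OF curve_ambient[OF geodesic_velocity[OF g s]] Y'[OF s]]
  by (simp add: b_def[abs_def] a_def mink_simps has_real_derivative_iff_has_vector_derivative c1_def)
 have da: "(a has_real_derivative (speed c)\<^sup>2 * b s) (at s within {0..1})" if s: "s \<in> {0..1}" for s
 proof -
  have "((%s. mink (c1 s) (Y s)) has_vector_derivative (speed c)\<^sup>2 * b s) (at s within {0..1})"
   using mink.has_vector_derivative[OF c1'[OF s] Y'[OF s]] mc by (simp add: b_def mink_simps)
  then show ?thesis unfolding a_def[abs_def] has_real_derivative_iff_has_vector_derivative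
   by (auto intro!: derivative_eq_intros)
 qed
 have 0: "a 0 = 0" "b 0 = 0" by (auto simp: a_def b_def Y_def k_def y0_def)
 have z: "a s = 0" "b s = 0" if s: "s \<in> {0..1}" for s
  using hyperbolic_ode[OF l db da s] 0 by auto
 have pa: "parallel_along G c (%s. Xi' (X (c s)) (Y s))"
 proof (rule parallel_from_ambient(1))
  show "(c has_vector_derivative velocity c s) (at s within {0..1})" if "s \<in> {0..1}" for s
   using geodesic_velocity[OF g that] .
  show "(Y has_vector_derivative mink (X' (c s) (velocity c s)) (Y s) *R X (c s)) (at s within {0..1})"
   if "s \<in> {0..1}" for s using Y'[OF that] z(1)[OF that] by (simp add: a_def c1_def)
  show "mink (X (c s)) (Y s) = 0" if "s \<in> {0..1}" for s using z(2)[OF that] by (simp add: b_def)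
 qed
 then show thesis
  by (rule that) (simp add: Y_def y0_def Xi'_X')
qed

text \<open>The geodesic is cut out of the hyperboloid by the plane through \<open>X p\<close> and
  \<open>X q\<close>, parametrised as in spherical interpolation with sinh in place of sin. It
  solves c'' = d^2 c, so the derivative of its velocity is normal.\<close>

lemma geodesic_exists:
 assumes ne: "p ~= q"
 obtains k where "geodesic G k" "k 0 = p" "k 1 = q" "speed k = hdist p q" "k C1_differentiable_on {0..1}"
  "!!s. s \<in> {0..1} ==> hdist p (k s) = hdist p q * s"
proof -
 define d where "d = hdist p q"
 have d: "d > 0" using ne hdist_eq_0[of p q] hdist_nonneg[of p q] unfolding d_def by linarith
 then have sd: "sinh d > 0" by simp
 define c where "c s = (sinh ((1 - s) * d) / sinh d) *R X p + (sinh (s * d) / sinh d) *R X q" for s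
 define c1 where "c1 s = (- d * cosh ((1 - s) * d) / sinh d) *R X p + (d * cosh (s * d) / sinh d) *R X q" for s
 have mm: "mink (X p) (X q) = - cosh d" "mink (X q) (X p) = - cosh d"
  using cosh_hdist[of p q] mink_sym[of "X p" "X q"] by (auto simp: d_def Z_def)
 \<comment> \<open>With a + b = d these identities give \<open>mink (c s) (c s)\<close> = -1 and
   \<open>mink (c1 s) (c1 s)\<close> = d^2.\<close>
 have id: "(sinh a)\<^sup>2 + (sinh b)\<^sup>2 + 2 * sinh a * sinh b * cosh (a + b) = (sinh (a + b))\<^sup>2"
  "(cosh a)\<^sup>2 + (cosh b)\<^sup>2 - 2 * cosh a * cosh b * cosh (a + b) = - (sinh (a + b))\<^sup>2"
  for a b :: real
 proof -
  have ca: "(cosh a)\<^sup>2 = 1 + (sinh a)\<^sup>2" "(cosh b)\<^sup>2 = 1 + (sinh b)\<^sup>2" by (auto simp: cosh_square_eq)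
  show "(sinh a)\<^sup>2 + (sinh b)\<^sup>2 + 2 * sinh a * sinh b * cosh (a + b) = (sinh (a + b))\<^sup>2"
   unfolding cosh_add sinh_add using ca by algebra
  show "(cosh a)\<^sup>2 + (cosh b)\<^sup>2 - 2 * cosh a * cosh b * cosh (a + b) = - (sinh (a + b))\<^sup>2"
   unfolding cosh_add sinh_add using ca by algebra
 qed
 have ab: "(1 - s) * d + s * d = d" for s by (simp add: algebra_simps)
 have mc: "mink (c s) (c s) = -1" for s
 proof -
  have "mink (c s) (c s) = - ((sinh ((1-s)*d))\<^sup>2 + (sinh (s*d))\<^sup>2 + 2 * sinh ((1-s)*d) * sinh (s*d) * cosh d) / (sinh d)\<^sup>2"
   using sd unfolding c_def mink_simps mm mink_XX by (simp add: field_simps power2_eq_square)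
  also have "... = -1" using id(1)[of "(1-s)*d" "s*d"] sd unfolding ab by simp
  finally show ?thesis .
 qed
 have cin: "c s \<in> hyperboloid" if "s \<in> {0..1}" for s
 proof -
  have "fst (c s) ~= 0"
  proof
   assume "fst (c s) = 0" then show False using mc[of s] by (simp add: mink_self) (smt (verit) zero_le_power2)
  qed
  moreover have "fst (c s) >= 0"
   using that d sd fst_hyperboloid_ge1[OF X_in[of p]] fst_hyperboloid_ge1[OF X_in[of q]]
   by (auto simp: c_def intro!: add_nonneg_nonneg mult_nonneg_nonneg divide_nonneg_pos)
  ultimately show ?thesis using mc by (simp add: hyperboloid_def)
 qed
 have d0: "d ~= 0" using d by simp
 have cd: "(c has_vector_derivative c1 s) (at s within S)" for s S
  unfolding c_def c1_def using d0
  by (auto intro!: derivative_eq_intros simp: has_real_derivative_iff_has_vector_derivative[symmetric] field_simps)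
 have c1d: "(c1 has_vector_derivative d\<^sup>2 *R c s) (at s within S)" for s S
  unfolding c_def c1_def using d0
  by (auto intro!: derivative_eq_intros simp: has_real_derivative_iff_has_vector_derivative[symmetric]
    field_simps power2_eq_square scaleR_add_right)
 have mc1: "mink (c1 s) (c1 s) = d\<^sup>2" for s
 proof -
  have "mink (c1 s) (c1 s) = - d\<^sup>2 * ((cosh ((1-s)*d))\<^sup>2 + (cosh (s*d))\<^sup>2 - 2 * cosh ((1-s)*d) * cosh (s*d) * cosh d) / (sinh d)\<^sup>2"
   using sd unfolding c1_def mink_simps mm mink_XX by (simp add: field_simps power2_eq_square)
  also have "... = d\<^sup>2" using id(2)[of "(1-s)*d" "s*d"] sd unfolding ab by simp
  finally show ?thesis .
 qed
 define k where "k s = Xi (c s)" for s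
 have Xk: "X (k s) = c s" if "s \<in> {0..1}" for s using X_Xi[OF cin[OF that]] by (simp add: k_def)
 have kd: "(k has_vector_derivative Xi' (c s) (c1 s)) (at s within S)" if "s \<in> {0..1}" for s S
  using has_derivative_compose[OF cd[unfolded has_vector_derivative_def] Xi_deriv[OF cin[OF that]]]
  unfolding k_def has_vector_derivative_def by (simp add: linear_cmul[OF Xi'_linear[OF cin[OF that]]])
 have v: "velocity k s = Xi' (c s) (c1 s)" if "s \<in> {0..1}" for s
  using vector_derivative_within_closed_interval[OF _ that kd[OF that]] by simp
 have kv: "(k has_vector_derivative velocity k s) (at s within {0..1})" if "s \<in> {0..1}" for s
  using kd[OF that] v[OF that] by simp
 have X'v: "X' (k s) (velocity k s) = c1 s" if s: "s \<in> {0..1}" for s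
 proof -
  have "((%s. X (k s)) has_vector_derivative X' (k s) (velocity k s)) (at s within {0..1})"
   by (rule curve_ambient[OF kv[OF s]])
  then have "(c has_vector_derivative X' (k s) (velocity k s)) (at s within {0..1})"
   by (rule has_vector_derivative_transform[OF s, rotated]) (simp add: Xk)
  from vector_derivative_unique_within[OF _ this cd] s
  show ?thesis using trivial_limit_within[of s "{0..1::real}"] islimpt_Icc[of 0 1 s] by auto
 qed
 have tan: "mink (X (k s)) (c1 s) = 0" if "s \<in> {0..1}" for s
  using X'v[OF that] by (metis mink_X_X'(1))
 have "parallel_along G k (%s. Xi' (X (k s)) (c1 s))"
  by (rule parallel_from_ambient(1)[OF kv _ tan]) (simp_all add: X'v mc1 Xk c1d)
 moreover have "Xi' (X (k s)) (c1 s) = velocity k s" if "s \<in> {0..1}" for s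
  using X'v[OF that] by (metis Xi'_X')
 ultimately have pv: "parallel_along G k (velocity k)"
  unfolding parallel_along_def
  by (auto intro!: has_vector_derivative_transform[of _ "{0..1}" "velocity k" "%s. Xi' (X (k s)) (c1 s)"])
 have geo: "geodesic G k"
  unfolding geodesic_def differentiable_on_def
  using kv pv differentiableI_vector by blast
 have e: "k 0 = p" "k 1 = q" using sd by (auto simp: k_def c_def Xi_X)
 have sp: "speed k = d" using d unfolding speed_def by (simp add: G_eq X'v mc1)
 have C1: "k C1_differentiable_on {0..1}"
  unfolding C1_differentiable_on_def
 proof (intro exI[of _ "velocity k"] conjI ballI)
  show "(k has_vector_derivative velocity k s) (at s)" if "s \<in> {0..1}" for s using kd[OF that] v[OF that] by simp
  show "continuous_on {0..1} (velocity k)"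
   using pv has_vector_derivative_continuous
   unfolding parallel_along_def continuous_on_eq_continuous_within by blast
 qed
 show thesis
 proof (rule that[OF geo e _ C1])
  show "speed k = hdist p q" using sp by (simp add: d_def)
  show "hdist p (k s) = hdist p q * s" if "s \<in> {0..1}" for s
   using geodesic_hdist[OF geo _ that] e ne sp by (simp add: d_def)
 qed
qed

end

section \<open>Calculus of C^2 functions\<close>

lemma mvt01:
 fixes f :: "real => real"
 assumes "!!s. s \<in> {0..1} ==> (f has_real_derivative f' s) (at s within {0..1})"
  and "!!s. s \<in> {0..1} ==> \<bar>f' s\<bar> <= B"
 shows "\<bar>f 1 - f 0\<bar> <= B"
 using field_differentiable_bound[of "{0..1}" f f' B 1 0] assms by auto

lemma Ck2D:
 assumes "Ck 2 u"
 shows "(u has_derivative dderiv u p) (at p)"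
  and "((%p. dderiv u p v) has_derivative dd2 u v p) (at p)"
  and "continuous_on UNIV (%p. dd2 u v p w)"
 using assms by (auto simp: numeral_2_eq_2 frechet_derivative_works)

text \<open>Working form of the definition of \<open>Ck\<close>: candidates for both derivatives
  give the regularity and the values of \<open>dderiv\<close> and \<open>dd2\<close> at
  once.\<close>

lemma Ck2I:
 assumes u: "!!p. (u has_derivative u' p) (at p)"
  and u': "!!p v. ((%p. u' p v) has_derivative u'' p v) (at p)"
  and c: "!!v w. continuous_on UNIV (%p. u'' p v w)"
 shows "Ck 2 u" and "dderiv u p v = u' p v" and "dd2 u v p w = u'' p v w"
proof -
 have 1: "dderiv u p v = u' p v" for p v by (rule dderivI[OF u])
 have 2: "dderiv (%p. u' p v) p w = u'' p v w" for p v w by (rule dderivI[OF u'])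
 show "dderiv u p v = u' p v" "dd2 u v p w = u'' p v w" using 1 2 by simp_all
 show "Ck 2 u"
  using u u' c by (auto simp: numeral_2_eq_2 1 2 differentiable_def)
qed

lemma Ck2_linear1: "Ck 2 u ==> linear (dderiv u p)"
 using Ck2D(1) has_derivative_linear by blast

lemma Ck2_dd_linear1: "Ck 2 u ==> linear (%v. dd2 u w p v)"
 using Ck2D(2) has_derivative_linear by blast

lemma Ck2_dd_linear2:
 assumes "Ck 2 u" shows "linear (%w. dd2 u w p v)"
proof (rule linearI)
 fix a b :: 'a and r :: real
 have "((%p. dderiv u p (a + b)) has_derivative
   (%h. dd2 u a p h + dd2 u b p h)) (at p)"
  using has_derivative_add[OF Ck2D(2)[OF assms, of a p] Ck2D(2)[OF assms, of b p]]
  by (simp add: linear_add[OF Ck2_linear1[OF assms]])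
 then show "dd2 u (a + b) p v = dd2 u a p v + dd2 u b p v"
  by (rule dderivI)
 have "((%p. dderiv u p (r *R a)) has_derivative
   (%h. r *R dd2 u a p h)) (at p)"
  using has_derivative_scaleR_right[OF Ck2D(2)[OF assms, of a p]]
  by (simp add: linear_cmul[OF Ck2_linear1[OF assms]])
 then show "dd2 u (r *R a) p v = r *R dd2 u a p v"
  by (rule dderivI)
qed

lemma Ck2_continuous: "Ck 2 u ==> continuous_on UNIV u"
 by (intro continuous_at_imp_continuous_on ballI has_derivative_continuous[OF Ck2D(1)])

lemma Ck2_continuous1: "Ck 2 u ==> continuous_on UNIV (%p. dderiv u p v)"
 by (intro continuous_at_imp_continuous_on ballI has_derivative_continuous[OF Ck2D(2)])

lemma Ck2_mult:
 assumes u: "Ck 2 u" and w: "Ck 2 w"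
 shows "Ck 2 (%p. u p * w p)"
  and "dderiv (%p. u p * w p) p v = u p * dderiv w p v + dderiv u p v * w p"
  and "dd2 (%p. u p * w p) v p a =
    u p * dd2 w v p a + dderiv u p a * dderiv w p v
    + (dderiv u p v * dderiv w p a + dd2 u v p a * w p)"
proof -
 have 1: "((%p. u p * w p) has_derivative (%v. u p * dderiv w p v + dderiv u p v * w p)) (at p)" for p
  by (rule has_derivative_mult[OF Ck2D(1)[OF u] Ck2D(1)[OF w]])
 have 2: "((%p. u p * dderiv w p v + dderiv u p v * w p) has_derivative
   (%a. u p * dd2 w v p a + dderiv u p a * dderiv w p v
    + (dderiv u p v * dderiv w p a + dd2 u v p a * w p))) (at p)" for p v
  by (intro has_derivative_add has_derivative_mult Ck2D u w)
 have 3: "continuous_on UNIV (%p. u p * dd2 w v p a + dderiv u p a * dderiv w p v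
    + (dderiv u p v * dderiv w p a + dd2 u v p a * w p))" for v a
  by (intro continuous_intros Ck2_continuous Ck2_continuous1 Ck2D(3) u w)
 show "Ck 2 (%p. u p * w p)"
  and "dderiv (%p. u p * w p) p v = u p * dderiv w p v + dderiv u p v * w p"
  and "dd2 (%p. u p * w p) v p a =
    u p * dd2 w v p a + dderiv u p a * dderiv w p v
    + (dderiv u p v * dderiv w p a + dd2 u v p a * w p)"
  by (rule Ck2I(1)[OF 1 2 3], rule Ck2I(2)[OF 1 2 3], rule Ck2I(3)[OF 1 2 3])
qed

lemma Ck2_add:
 assumes u: "Ck 2 u" and w: "Ck 2 w"
 shows "Ck 2 (%p. u p + w p)"
  and "dderiv (%p. u p + w p) p v = dderiv u p v + dderiv w p v"
  and "dd2 (%p. u p + w p) v p a =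
    dd2 u v p a + dd2 w v p a"
proof -
 have 1: "((%p. u p + w p) has_derivative (%v. dderiv u p v + dderiv w p v)) (at p)" for p
  by (rule has_derivative_add[OF Ck2D(1)[OF u] Ck2D(1)[OF w]])
 have 2: "((%p. dderiv u p v + dderiv w p v) has_derivative
   (%a. dd2 u v p a + dd2 w v p a)) (at p)" for p v
  by (intro has_derivative_add Ck2D u w)
 have 3: "continuous_on UNIV (%p. dd2 u v p a + dd2 w v p a)" for v a
  by (intro continuous_intros Ck2D(3) u w)
 show "Ck 2 (%p. u p + w p)"
  and "dderiv (%p. u p + w p) p v = dderiv u p v + dderiv w p v"
  and "dd2 (%p. u p + w p) v p a =
    dd2 u v p a + dd2 w v p a"
  by (rule Ck2I(1)[OF 1 2 3], rule Ck2I(2)[OF 1 2 3], rule Ck2I(3)[OF 1 2 3])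
qed

lemma Ck2_const: "Ck 2 (%p::'a::euclidean_space. c)" and Ck2_const_dderiv [simp]: "dderiv (%p. c) p v = 0"
proof -
 have 1: "((%p. c) has_derivative (%v. 0)) (at p)" for p :: 'b by simp
 show "Ck 2 (%p::'a. c)"
  by (rule Ck2I(1)[where u'="%_ _. 0" and u''="%_ _ _. 0"]) auto
 show "dderiv (%p. c) p v = 0" by (rule dderivI[OF 1])
qed

lemma Ck2_cmult:
 assumes u: "Ck 2 u"
 shows "Ck 2 (%p. c * u p)"
  and "dderiv (%p. c * u p) p v = c * dderiv u p v"
  and "dd2 (%p. c * u p) v p a = c * dd2 u v p a"
 using Ck2_mult[OF Ck2_const u, of c] by simp_all

lemma Ck2_compose:
 fixes \<phi> :: "real => real"
 assumes u: "Ck 2 u"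
  and f: "!!p. (\<phi> has_real_derivative \<phi>' (u p)) (at (u p))"
  and f': "!!p. (\<phi>' has_real_derivative \<phi>'' (u p)) (at (u p))"
  and c: "continuous_on UNIV (%p. \<phi>'' (u p))"
 shows "Ck 2 (%p. \<phi> (u p))"
  and "dderiv (%p. \<phi> (u p)) p v = \<phi>' (u p) * dderiv u p v"
  and "dderiv (%p. dderiv (%p. \<phi> (u p)) p v) p a =
    \<phi>' (u p) * dd2 u v p a + \<phi>'' (u p) * dderiv u p a * dderiv u p v"
proof -
 have 1: "((%p. \<phi> (u p)) has_derivative (%v. \<phi>' (u p) * dderiv u p v)) (at p)" for p
  using has_derivative_compose[OF Ck2D(1)[OF u] f[unfolded has_field_derivative_def]] .
 have d1: "((%p. \<phi>' (u p)) has_derivative (%v. \<phi>'' (u p) * dderiv u p v)) (at p)" for p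
  using has_derivative_compose[OF Ck2D(1)[OF u] f'[unfolded has_field_derivative_def]] .
 have 2: "((%p. \<phi>' (u p) * dderiv u p v) has_derivative
   (%a. \<phi>' (u p) * dd2 u v p a + \<phi>'' (u p) * dderiv u p a * dderiv u p v)) (at p)" for p v
  by (rule has_derivative_mult[OF d1 Ck2D(2)[OF u]])
 have c': "continuous_on UNIV (%p. \<phi>' (u p))"
  by (intro continuous_at_imp_continuous_on ballI has_derivative_continuous[OF d1])
 have 3: "continuous_on UNIV (%p. \<phi>' (u p) * dd2 u v p a + \<phi>'' (u p) * dderiv u p a * dderiv u p v)" for v a
  by (intro continuous_intros Ck2_continuous1 Ck2D(3) u c c')
 show "Ck 2 (%p. \<phi> (u p))"
  and "dderiv (%p. \<phi> (u p)) p v = \<phi>' (u p) * dderiv u p v"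
  and "dderiv (%p. dderiv (%p. \<phi> (u p)) p v) p a =
    \<phi>' (u p) * dd2 u v p a + \<phi>'' (u p) * dderiv u p a * dderiv u p v"
  by (rule Ck2I(1)[OF 1 2 3], rule Ck2I(2)[OF 1 2 3], rule Ck2I(3)[OF 1 2 3])
qed

section \<open>Riemannian distance, orthonormal frames and Hessians\<close>

abbreviation hess :: "'b::euclidean_space metric => ('b => real) => 'b => 'b => 'b => real" where
 "hess G u p v w \<equiv> covd G u 2 p [v, w]"

lemma hess_eq: "hess G u p v w = dd2 u w p v - dderiv u p (christoffel G p v w)"
 by (simp add: numeral_2_eq_2)

context hyperbolic_chart
begin

text \<open>Along the curve, f = Z p (c s) satisfies |f'| <= speed * sqrt (f^2 - 1), so arcosh f
  grows at most by the length.\<close>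

lemma rdist_le:
 assumes "c C1_differentiable_on {0..1}" "c 0 = p" "c 1 = q"
 shows "hdist p q <= curve_length G c"
proof -
 obtain D where D: "!!s. s \<in> {0..1} ==> (c has_vector_derivative D s) (at s)" and Dc: "continuous_on {0..1} D"
  using assms(1) unfolding C1_differentiable_on_def by blast
 have Dw: "(c has_vector_derivative D s) (at s within {0..1})" if "s \<in> {0..1}" for s
  using D[OF that] has_vector_derivative_at_within by blast
 have v: "velocity c s = D s" if "s \<in> {0..1}" for s
  using vector_derivative_within_closed_interval[OF _ that Dw[OF that]] by simp
 define N where "N s = sqrt (G (c s) (D s) (D s))" for s
 have cg: "continuous_on {0..1} c"
  using Dw has_vector_derivative_continuous continuous_on_eq_continuous_within by blast
 have cX: "continuous_on {0..1} (%s. X' (c s) (D s))"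
 proof -
  have "X' (c s) (D s) = (\<Sum>b\<in>Basis. (D s \<bullet> b) *R X' (c s) b)" for s
  proof -
   have "X' (c s) (D s) = X' (c s) (\<Sum>b\<in>Basis. (D s \<bullet> b) *R b)" by (simp add: euclidean_representation)
   then show ?thesis by (simp add: X'_simps)
  qed
  moreover have "continuous_on {0..1} (%s. \<Sum>b\<in>Basis. (D s \<bullet> b) *R X' (c s) b)"
   by (intro continuous_intros Dc continuous_on_compose2[OF continuous_on_X'[of UNIV] cg]) auto
  ultimately show ?thesis by simp
 qed
 have cN: "continuous_on {0..1} N"
  unfolding N_def G_eq by (intro continuous_on_real_sqrt mink.continuous_on cX)
 have len: "curve_length G c = integral {0..1} N"
  unfolding curve_length_def by (rule integral_cong) (simp add: v N_def)
 have Ni: "N integrable_on {0..1}" by (rule integrable_continuous_interval[OF cN])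
 define f where "f s = Z p (c s)" for s
 define f' where "f' s = - mink (X p) (X' (c s) (D s))" for s
 have fd: "(f has_real_derivative f' s) (at s within {0..1})" if s: "s \<in> {0..1}" for s
  unfolding f_def Z_def f'_def has_real_derivative_iff_has_vector_derivative
  using mink.has_vector_derivative[OF has_vector_derivative_const[of "X p"] curve_ambient[OF Dw[OF s]]]
  by (auto intro!: has_vector_derivative_minus simp: mink_simps)
 have f1: "f s >= 1" for s by (simp add: f_def Z_ge1)
 have f'b: "\<bar>f' s\<bar> <= N s * sqrt ((f s)\<^sup>2 - 1)" for s
  using mink_tangent_bound[OF X_in X_in mink_X_X'(1), of "c s" "D s" p]
  by (simp add: f'_def f_def N_def Z_def G_eq mink_sym[of "X p"])
 \<comment> \<open>arcosh is not differentiable at 1, the value of f at the start of the curve.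
   Adding \<open>e\<close> under the root removes the singularity and keeps the inequality;
   afterwards \<open>e\<close> tends to 0.\<close>
 have main: "ln (f 1 + sqrt ((f 1)\<^sup>2 - 1 + e)) - ln (f 0 + sqrt ((f 0)\<^sup>2 - 1 + e)) <= integral {0..1} N"
  if e: "e > 0" for e :: real
 proof -
  define g where "g s = sqrt ((f s)\<^sup>2 - 1 + e)" for s
  have fsq: "(f s)\<^sup>2 - 1 >= 0" for s using f1[of s] by (simp add: abs_le_square_iff[of 1, simplified])
  have gp: "g s > 0" for s using fsq[of s] e by (simp add: g_def)
  have pos: "f s + g s > 0" for s using gp[of s] f1[of s] by simp
  have gd: "(g has_real_derivative f s * f' s / g s) (at s within {0..1})" if s: "s \<in> {0..1}" for s
  proof -
   have "((%s. (f s)\<^sup>2 - 1 + e) has_real_derivative 2 * f s * f' s) (at s within {0..1})"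
    by (auto intro!: derivative_eq_intros fd[OF s])
   moreover have "(f s)\<^sup>2 - 1 + e > 0" using fsq[of s] e by linarith
   ultimately have "((%s. sqrt ((f s)\<^sup>2 - 1 + e)) has_real_derivative
     inverse (sqrt ((f s)\<^sup>2 - 1 + e)) / 2 * (2 * f s * f' s)) (at s within {0..1})"
    by (intro DERIV_chain2[where f=sqrt] DERIV_real_sqrt)
   then show ?thesis by (simp add: g_def[abs_def] field_simps)
  qed
  have "((%s. ln (f s + g s)) has_vector_derivative f' s / g s) (at s within {0..1})" if s: "s \<in> {0..1}" for s
  proof -
   have "((%s. ln (f s + g s)) has_real_derivative (f' s + f s * f' s / g s) / (f s + g s)) (at s within {0..1})"
    using pos[of s] by (auto intro!: derivative_eq_intros fd[OF s] gd[OF s] simp: divide_inverse)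
   moreover have "(f' s + f s * f' s / g s) / (f s + g s) = f' s / g s"
   proof -
    have "f' s + f s * f' s / g s = f' s * (f s + g s) / g s"
     using gp[of s] by (simp add: field_simps)
    then show ?thesis using pos[of s] by simp
   qed
   ultimately show ?thesis by (simp add: has_real_derivative_iff_has_vector_derivative)
  qed
  from fundamental_theorem_of_calculus[OF _ this]
  have i1: "((%s. f' s / g s) has_integral (ln (f 1 + g 1) - ln (f 0 + g 0))) {0..1}" by simp
  have "f' s / g s <= N s" for s
  proof -
   have "f' s <= N s * sqrt ((f s)\<^sup>2 - 1)" using f'b[of s] by simp
   also have "... <= N s * g s"
    using e by (intro mult_left_mono) (auto simp: g_def N_def G_nonneg)
   finally show ?thesis using gp[of s] by (simp add: field_simps)
  qed
  then show ?thesis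
   using has_integral_le[OF i1 integrable_integral[OF Ni]] by (simp add: g_def)
 qed
 have f0: "f 0 = 1" using Z_eq1[of p p] assms(2) by (simp add: f_def)
 have "((%e. ln (f 1 + sqrt ((f 1)\<^sup>2 - 1 + e)) - ln (f 0 + sqrt ((f 0)\<^sup>2 - 1 + e))) --->
   ln (f 1 + sqrt ((f 1)\<^sup>2 - 1 + 0)) - ln (f 0 + sqrt ((f 0)\<^sup>2 - 1 + 0))) (at_right 0)"
 proof (intro tendsto_intros)
  have "0 <= sqrt ((f 1)\<^sup>2 - 1)" using f1[of 1] abs_le_square_iff[of 1 "f 1"] by simp
  then show "f 1 + sqrt ((f 1)\<^sup>2 - 1 + 0) ~= 0" using f1[of 1] by (smt (verit))
  show "f 0 + sqrt ((f 0)\<^sup>2 - 1 + 0) ~= 0" using f0 by simp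
 qed
 then have "ln (f 1 + sqrt ((f 1)\<^sup>2 - 1 + 0)) - ln (f 0 + sqrt ((f 0)\<^sup>2 - 1 + 0)) <= integral {0..1} N"
  by (rule tendsto_upperbound) (auto simp: eventually_at_right_field intro!: exI[of _ 1] main)
 then have "ln (f 1 + sqrt ((f 1)\<^sup>2 - 1)) <= integral {0..1} N" using f0 by simp
 moreover have "hdist p q = ln (f 1 + sqrt ((f 1)\<^sup>2 - 1))"
  unfolding hdist_def f_def using Z_ge1[of p q] assms(3) by (simp add: arcosh_real_def)
 ultimately show ?thesis using len by simp
qed

text \<open>The infimum is attained, by the explicit geodesic or by the constant curve, so no
  approximating curves are needed.\<close>

lemma rdist_eq: "rdist G p q = hdist p q"
proof -
 let ?S = "curve_length G ` {c. c C1_differentiable_on {0..1} \<and> c 0 = p \<and> c 1 = q}"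
 have lb: "hdist p q <= x" if "x \<in> ?S" for x using that rdist_le by auto
 have "hdist p q \<in> ?S"
 proof (cases "p = q")
  case True
  have "curve_length G (%s. p) = 0"
  proof -
   have "velocity (%s. p) s = 0" if "s \<in> {0..1}" for s
    using vector_derivative_within_closed_interval[OF _ that has_vector_derivative_const] by simp
   then have "curve_length G (%s. p) = integral {0..1::real} (%s. 0)"
    unfolding curve_length_def by (intro integral_cong) (simp add: G_eq X'_simps mink_simps)
   then show ?thesis by simp
  qed
  then show ?thesis using True by (intro image_eqI[of _ _ "%s. p"]) auto
 next
  case False
  then obtain c where g: "geodesic G c" "c 0 = p" "c 1 = q" "speed c = hdist p q" "c C1_differentiable_on {0..1}"
   using geodesic_exists by metis
  have "curve_length G c = integral {0..1::real} (%s. hdist p q)"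
   unfolding curve_length_def by (rule integral_cong) (simp add: geodesic_speed[OF g(1)] g(4))
  then show ?thesis using g by (intro image_eqI[of _ _ c]) auto
 qed
 then show ?thesis unfolding rdist_def
  by (intro cInf_eq_minimum) (use lb in auto)
qed

text \<open>The Lorentz boost that takes (1, 0) to \<open>X p\<close>, restricted to spatial
  vectors. It supplies an explicit orthonormal frame of each tangent space.\<close>

definition boost :: "'w => 'w => real * 'w" where
 "boost p v = (snd (X p) \<bullet> v, v + (snd (X p) \<bullet> v / (1 + fst (X p))) *R snd (X p))"

lemma boost_mink: "mink (boost p v) (boost p w) = v \<bullet> w" "mink (X p) (boost p v) = 0"
proof -
 have sq: "snd (X p) \<bullet> snd (X p) = (fst (X p))\<^sup>2 - 1"
  using mink_XX[of p] by (simp add: mink_def power2_eq_square)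
 have pos: "1 + fst (X p) ~= 0" using fst_hyperboloid_ge1[OF X_in[of p]] by simp
 define y0 where "y0 = fst (X p)"
 define y where "y = snd (X p)"
 have yy: "y \<bullet> y = (y0 - 1) * (y0 + 1)" using sq by (simp add: y0_def y_def power2_eq_square algebra_simps)
 have y0: "1 + y0 ~= 0" using pos by (simp add: y0_def)
 define k where "k = 1 / (1 + y0)"
 have k: "k * (1 + y0) = 1" using y0 by (simp add: k_def)
 have b: "boost p v = (y \<bullet> v, v + (k * (y \<bullet> v)) *R y)" for v by (simp add: boost_def y_def y0_def k_def)
 have "mink (boost p v) (boost p w) = v \<bullet> w + (y \<bullet> v) * (y \<bullet> w) * (2 * k + k * k * (y \<bullet> y) - 1)"
  by (simp add: mink_def b inner_add_left inner_add_right inner_commute[of v y]) (simp add: algebra_simps)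
 also have "2 * k + k * k * (y \<bullet> y) - 1 = 0"
  unfolding yy using k by algebra
 finally show "mink (boost p v) (boost p w) = v \<bullet> w" by simp
 have "mink (X p) (boost p v) = (y \<bullet> v) * (1 + k * (y \<bullet> y) - y0)"
  by (simp add: mink_def b inner_add_right y_def[symmetric] y0_def[symmetric]) (simp add: algebra_simps)
 also have "1 + k * (y \<bullet> y) - y0 = 0" unfolding yy using k by algebra
 finally show "mink (X p) (boost p v) = 0" by simp
qed

definition frame :: "'w => 'w => 'w" where "frame p b = Xi' (X p) (boost p b)"

definition orthonormal :: "'w => ('w => 'w) => bool" where
 "orthonormal p E \<longleftrightarrow> (\<forall>b\<in>Basis. \<forall>c\<in>Basis. G p (E b) (E c) = (if b = c then 1 else 0))"

lemma orthonormal_frame: "orthonormal p (frame p)"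
 by (auto simp: orthonormal_def frame_def G_eq X'_Xi' boost_mink inner_Basis)

text \<open>The linear map from coordinates to combinations of the frame is injective, because
  products with the frame recover the coordinates; equal dimensions make it surjective.\<close>

lemma orthonormal_expand:
 assumes "orthonormal p E"
 shows "v = (\<Sum>b\<in>Basis. G p v (E b) *R E b)"
proof -
 define L where "L w = (\<Sum>b\<in>Basis. (w \<bullet> b) *R E b)" for w
 have lin: "linear L"
  by (rule linearI) (simp_all add: L_def inner_add_left scaleR_add_left sum.distrib scaleR_sum_right)
 have GL: "G p (L w) (E b) = w \<bullet> b" if b: "b \<in> Basis" for w b
 proof -
  have "G p (L w) (E b) = (\<Sum>c\<in>Basis. (w \<bullet> c) * G p (E c) (E b))"
   by (simp add: L_def G_eq X'_simps mink.sum_left mink_simps)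
  also have "... = (\<Sum>c\<in>Basis. (w \<bullet> c) * (if c = b then 1 else 0))"
   using assms b by (intro sum.cong) (auto simp: orthonormal_def)
  also have "... = w \<bullet> b" using b by (simp add: if_distrib cong: if_cong)
  finally show ?thesis .
 qed
 have "inj L"
 proof (rule injI)
  fix a b assume "L a = L b"
  then have "a \<bullet> c = b \<bullet> c" if "c \<in> Basis" for c using GL[OF that] by metis
  then show "a = b" by (rule euclidean_eqI)
 qed
 then have "surj L" using linear_injective_imp_surjective[OF lin] by blast
 then obtain w where w: "v = L w" by blast
 then show ?thesis using GL by (simp add: L_def)
qed

lemma orthonormal_G_expand:
 assumes "orthonormal p E"
 shows "G p v w = (\<Sum>b\<in>Basis. G p v (E b) * G p w (E b))"
proof -
 have "G p v w = G p (\<Sum>b\<in>Basis. G p v (E b) *R E b) w"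
  using orthonormal_expand[OF assms, of v] by simp
 also have "... = (\<Sum>b\<in>Basis. G p v (E b) * G p (E b) w)"
  unfolding G_eq[of p _ w] by (simp add: X'_simps mink.sum_left mink_simps)
 finally show ?thesis by (simp add: G_sym[of p w])
qed

lemma linear_hess1: "Ck 2 u ==> linear (%v. hess G u p v w)"
 unfolding hess_eq christoffel_sym[of p _ w]
 by (intro linear_compose_sub Ck2_dd_linear1 linear_compose[OF christoffel_linear2 Ck2_linear1, unfolded o_def])

lemma linear_hess2: "Ck 2 u ==> linear (%w. hess G u p v w)"
 unfolding hess_eq
 by (intro linear_compose_sub Ck2_dd_linear2 linear_compose[OF christoffel_linear2 Ck2_linear1, unfolded o_def])

text \<open>The definition takes the trace in coordinates. Here it becomes the trace in an arbitrary
  orthonormal frame, so the boost frame or a frame parallel along a geodesic may be used.\<close>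

lemma laplace_eq:
 assumes u: "Ck 2 u" and E: "orthonormal p E"
 shows "laplace G u p = (\<Sum>e\<in>Basis. hess G u p (E e) (E e))"
proof -
 have sh: "sharp G p (%y. b \<bullet> y) = (\<Sum>e\<in>Basis. (b \<bullet> E e) *R E e)" for b
 proof (rule sharpI)
  fix y
  have "G p (\<Sum>e\<in>Basis. (b \<bullet> E e) *R E e) y = (\<Sum>e\<in>Basis. (b \<bullet> E e) * G p y (E e))"
   unfolding G_eq by (simp add: X'_simps mink.sum_left mink_simps mink_sym[of "X' p y"])
  also have "... = b \<bullet> (\<Sum>e\<in>Basis. G p y (E e) *R E e)" by (simp add: inner_sum_right mult.commute)
  also have "... = b \<bullet> y" using orthonormal_expand[OF E, of y] by simp
  finally show "G p (\<Sum>e\<in>Basis. (b \<bullet> E e) *R E e) y = b \<bullet> y" .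
 qed
 note l1 = linear_hess1[OF u, of p] and l2 = linear_hess2[OF u, of p]
 have "laplace G u p = (\<Sum>b\<in>Basis. \<Sum>e\<in>Basis. (b \<bullet> E e) * hess G u p b (E e))"
  unfolding laplace_def sh by (simp add: linear_sum[OF l2] linear_cmul[OF l2])
 also have "... = (\<Sum>e\<in>Basis. \<Sum>b\<in>Basis. (b \<bullet> E e) * hess G u p b (E e))" by (rule sum.swap)
 also have "... = (\<Sum>e\<in>Basis. hess G u p (E e) (E e))"
 proof (rule sum.cong)
  fix e assume "e \<in> (Basis :: 'w set)"
  have "hess G u p (E e) (E e) = hess G u p (\<Sum>b\<in>Basis. (E e \<bullet> b) *R b) (E e)"
   by (simp add: euclidean_representation)
  also have "... = (\<Sum>b\<in>Basis. (b \<bullet> E e) * hess G u p b (E e))"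
   by (simp add: linear_sum[OF l1] linear_cmul[OF l1] inner_commute)
  finally show "(\<Sum>b\<in>Basis. (b \<bullet> E e) * hess G u p b (E e)) = hess G u p (E e) (E e)" by simp
 qed simp
 finally show ?thesis .
qed

text \<open>For the restriction of an ambient linear function only the normal part of
  \<open>X''\<close> survives in the Hessian. The Laplacians of \<open>fst\<close>,
  \<open>zq\<close> and the barriers all rest on this identity.\<close>

lemma Ck2_minkX:
 shows "Ck 2 (%p. mink (X p) Y)"
  and "dderiv (%p. mink (X p) Y) p v = mink (X' p v) Y"
  and "hess G (%p. mink (X p) Y) p v w = G p v w * mink (X p) Y"
proof -
 have 1: "((%p. mink (X p) Y) has_derivative (%v. mink (X' p v) Y)) (at p)" for p
  using mink.FDERIV[OF X_deriv has_derivative_const[of Y]] by (simp add: mink_simps)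
 have 2: "((%p. mink (X' p v) Y) has_derivative (%w. mink (X'' p w v) Y)) (at p)" for p v
  using mink.FDERIV[OF X'_deriv has_derivative_const[of Y]] by (simp add: mink_simps)
 have 3: "continuous_on UNIV (%p. mink (X'' p w v) Y)" for v w
  by (intro mink.continuous_on X''_cont continuous_on_const)
 show "Ck 2 (%p. mink (X p) Y)" by (rule Ck2I(1)[OF 1 2 3])
 show d: "dderiv (%p. mink (X p) Y) p v = mink (X' p v) Y" for v by (rule Ck2I(2)[OF 1 2 3])
 show "hess G (%p. mink (X p) Y) p v w = G p v w * mink (X p) Y"
  unfolding hess_eq Ck2I(3)[OF 1 2 3] d X'_christoffel by (simp add: mink_simps)
qed

lemma hess_mult:
 assumes "Ck 2 u" "Ck 2 w"
 shows "hess G (%p. u p * w p) p a b = u p * hess G w p a b + w p * hess G u p a b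
   + dderiv u p a * dderiv w p b + dderiv u p b * dderiv w p a"
 unfolding hess_eq Ck2_mult(3)[OF assms] unfolding Ck2_mult(2)[OF assms] by (simp add: algebra_simps)

lemma hess_add:
 assumes "Ck 2 u" "Ck 2 w"
 shows "hess G (%p. u p + w p) p a b = hess G u p a b + hess G w p a b"
 unfolding hess_eq Ck2_add(3)[OF assms] unfolding Ck2_add(2)[OF assms] by (simp add: algebra_simps)

lemma hess_cmult:
 assumes "Ck 2 u"
 shows "hess G (%p. c * u p) p a b = c * hess G u p a b"
 unfolding hess_eq Ck2_cmult(3)[OF assms] unfolding Ck2_cmult(2)[OF assms] by (simp add: algebra_simps)

lemma hess_compose:
 fixes \<phi> :: "real => real"
 assumes "Ck 2 u"
  and "!!p. (\<phi> has_real_derivative \<phi>' (u p)) (at (u p))"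
  and "!!p. (\<phi>' has_real_derivative \<phi>'' (u p)) (at (u p))"
  and "continuous_on UNIV (%p. \<phi>'' (u p))"
 shows "hess G (%p. \<phi> (u p)) p a b = \<phi>' (u p) * hess G u p a b + \<phi>'' (u p) * dderiv u p a * dderiv u p b"
 unfolding hess_eq Ck2_compose(3)[OF assms] unfolding Ck2_compose(2)[OF assms] by (simp add: algebra_simps)

text \<open>The Christoffel term in the derivative of the parallel field is the one that turns the
  coordinate second derivative into the Hessian.\<close>

lemma dderiv_parallel:
 assumes u: "Ck 2 u" and V: "parallel_along G c V" and s: "s \<in> {0..1}"
  and g: "(c has_vector_derivative velocity c s) (at s within {0..1})"
 shows "((%s. dderiv u (c s) (V s)) has_real_derivative hess G u (c s) (velocity c s) (V s)) (at s within {0..1})"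
proof -
 let ?D = "%w. dd2 u w (c s) (velocity c s)"
 have V': "(V has_vector_derivative - christoffel G (c s) (velocity c s) (V s)) (at s within {0..1})"
  using V s by (simp add: parallel_along_def)
 have e: "(\<Sum>b\<in>Basis. (V s \<bullet> b) *R ?D b) = ?D (V s)"
 proof -
  have "?D (V s) = ?D (\<Sum>b\<in>Basis. (V s \<bullet> b) *R b)" by (simp add: euclidean_representation)
  then show ?thesis by (simp only: linear_sum[OF Ck2_dd_linear2[OF u]] linear_cmul[OF Ck2_dd_linear2[OF u]])
 qed
 show ?thesis
  using has_vector_derivative_apply[where A="dderiv u" and A'="%h b. dd2 u b (c s) h",
    OF Ck2_linear1[OF u] Ck2D(2)[OF u] g V' s]
  unfolding e hess_eq has_real_derivative_iff_has_vector_derivative linear_neg[OF Ck2_linear1[OF u]] by simp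
qed

lemma curve_deriv:
 assumes u: "u differentiable (at (c s))"
  and g: "(c has_vector_derivative v) (at s within S)"
 shows "((%s. u (c s)) has_real_derivative dderiv u (c s) v) (at s within S)"
proof -
 have d: "(u has_derivative dderiv u (c s)) (at (c s))" using u by (simp add: frechet_derivative_works)
 show ?thesis
  using has_derivative_compose[OF g[unfolded has_vector_derivative_def] d]
  by (simp add: has_field_derivative_def linear_cmul[OF has_derivative_linear[OF d]] mult_commute_abs)
qed

definition nrm :: "'w => 'w => real" where "nrm p v = sqrt (G p v v)"

lemma nrm_nonneg [simp]: "nrm p v >= 0" by (simp add: nrm_def G_nonneg)

lemma nrm_unit:
 assumes "v ~= 0" shows "nrm p v > 0" "G p (v /\<^sub>R nrm p v) (v /\<^sub>R nrm p v) = 1" "v = nrm p v *R (v /\<^sub>R nrm p v)"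
proof -
 show pos: "nrm p v > 0" using assms G_zero[of p v] G_nonneg[of p v] unfolding nrm_def real_sqrt_gt_0_iff by linarith
 then have "nrm p v * nrm p v = G p v v" by (simp add: nrm_def G_nonneg)
 then show "G p (v /\<^sub>R nrm p v) (v /\<^sub>R nrm p v) = 1"
 proof -
  assume e: "nrm p v * nrm p v = G p v v"
  have "G p (v /\<^sub>R nrm p v) (v /\<^sub>R nrm p v) = inverse (nrm p v) * inverse (nrm p v) * G p v v"
   by (simp add: G_eq X'_simps mink_simps)
  then show ?thesis unfolding e[symmetric] using pos by (simp add: field_simps)
 qed
 show "v = nrm p v *R (v /\<^sub>R nrm p v)" using pos by simp
qed

definition grad_bound :: "('w => real) => real => bool" where
 "grad_bound u C \<longleftrightarrow> (\<forall>p. u differentiable (at p)) \<and> (\<forall>p v. \<bar>dderiv u p v\<bar> <= C * nrm p v)"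

definition hess_bound :: "('w => real) => real => bool" where
 "hess_bound u C \<longleftrightarrow> (\<forall>p v w. \<bar>hess G u p v w\<bar> <= C * nrm p v * nrm p w)"

lemma grad_bound_unitI:
 assumes d: "!!p. u differentiable (at p)" and b: "!!p v. G p v v = 1 ==> \<bar>dderiv u p v\<bar> <= C"
 shows "grad_bound u C"
 unfolding grad_bound_def
proof (intro conjI allI d)
 fix p v
 note l = dderiv_linear[OF d[of p]]
 show "\<bar>dderiv u p v\<bar> <= C * nrm p v"
 proof (cases "v = 0")
  case True then show ?thesis by (simp add: linear_0[OF l] nrm_def G_eq X'_simps mink_simps)
 next
  case False
  note n = nrm_unit[OF False, of p]
  have "dderiv u p v = nrm p v * dderiv u p (v /\<^sub>R nrm p v)"
   by (subst n(3)) (simp only: linear_cmul[OF l] real_scaleR_def)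
  then show ?thesis using b[OF n(2)] n(1) by (simp add: abs_mult mult.commute)
 qed
qed

lemma hess_bound_unitI:
 assumes u: "Ck 2 u" and b: "!!p v w. G p v v = 1 ==> G p w w = 1 ==> \<bar>hess G u p v w\<bar> <= C"
 shows "hess_bound u C"
 unfolding hess_bound_def
proof (intro allI)
 fix p v w
 show "\<bar>hess G u p v w\<bar> <= C * nrm p v * nrm p w"
 proof (cases "v = 0 \<or> w = 0")
  case True then show ?thesis
   by (auto simp: linear_0[OF linear_hess1[OF u]] linear_0[OF linear_hess2[OF u]] nrm_def G_eq X'_simps mink_simps)
 next
  case False
  then have ne: "v ~= 0" "w ~= 0" by auto
  note n = nrm_unit[OF ne(1), of p] and m = nrm_unit[OF ne(2), of p]
  have "hess G u p v w = nrm p v * (nrm p w * hess G u p (v /\<^sub>R nrm p v) (w /\<^sub>R nrm p w))"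
   using n(1) m(1) by (simp add: linear_cmul[OF linear_hess1[OF u]] linear_cmul[OF linear_hess2[OF u]] field_simps)
  then show ?thesis using b[OF n(2) m(2)] n(1) m(1) by (simp add: abs_mult mult.commute mult.left_commute)
 qed
qed

lemma grad_bound_nonneg: "grad_bound u C ==> C >= 0"
proof -
 assume "grad_bound u C"
 then have "\<bar>dderiv u p v\<bar> <= C * nrm p v" for p v by (simp add: grad_bound_def)
 moreover obtain b :: 'w where "b \<in> Basis" by (meson nonempty_Basis ex_in_conv)
 ultimately show "C >= 0" using nrm_unit(1)[of b undefined]
  by (metis abs_ge_zero nonzero_Basis order_trans zero_le_mult_iff less_le_not_le)
qed

text \<open>Mean value theorem along the geodesic from \<open>p\<close> to \<open>q\<close>, whose
  constant speed is the distance.\<close>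

lemma grad_bound_Lipschitz:
 assumes "grad_bound u C"
 shows "\<bar>u p - u q\<bar> <= C * hdist p q"
proof (cases "p = q")
 case False
 then obtain c where g: "geodesic G c" "c 0 = p" "c 1 = q" "speed c = hdist p q"
  using geodesic_exists by metis
 have "\<bar>u (c 1) - u (c 0)\<bar> <= C * hdist p q"
 proof (rule mvt01)
  fix s :: real assume s: "s \<in> {0..1}"
  show "((%s. u (c s)) has_real_derivative dderiv u (c s) (velocity c s)) (at s within {0..1})"
   using assms by (intro curve_deriv geodesic_velocity[OF g(1) s]) (simp add: grad_bound_def)
  have "\<bar>dderiv u (c s) (velocity c s)\<bar> <= C * nrm (c s) (velocity c s)"
   using assms by (simp add: grad_bound_def)
  then show "\<bar>dderiv u (c s) (velocity c s)\<bar> <= C * hdist p q"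
   using geodesic_speed[OF g(1) s] speed_nonneg[of c] by (simp add: nrm_def g(4))
 qed
 then show ?thesis using g by (simp add: abs_minus_commute)
qed simp

end

section \<open>Hoelder bounds and their equivalence with the norms of the statement\<close>

context hyperbolic_chart
begin

text \<open>Real bounds in place of extended-real norms. \<open>hb\<close> admits all pairs of
  points, which costs a constant factor against pairs in unit balls and makes sums, products and
  limits direct. \<open>hb2\<close> compares Hessians only at distance below 1, the range in which
  the kernel estimates are made.\<close>

definition hb :: "real => ('w => real) => real => bool" where
 "hb \<alpha> g M \<longleftrightarrow> (\<forall>p. \<bar>g p\<bar> <= M) \<and> (\<forall>p q. \<bar>g p - g q\<bar> <= M * hdist p q powr \<alpha>)"

definition hb2 :: "real => ('w => real) => real => bool" where
 "hb2 \<alpha> u M \<longleftrightarrow> Ck 2 u \<and> (\<forall>p. \<bar>u p\<bar> <= M) \<and> grad_bound u M \<and> hess_bound u M \<and>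
   (\<forall>c V W. geodesic G c --> c 0 ~= c 1 --> hdist (c 0) (c 1) < 1 -->
    parallel_along G c V --> parallel_along G c W -->
    G (c 0) (V 0) (V 0) = 1 --> G (c 0) (W 0) (W 0) = 1 -->
    \<bar>hess G u (c 1) (V 1) (W 1) - hess G u (c 0) (V 0) (W 0)\<bar> <= M * hdist (c 0) (c 1) powr \<alpha>)"

lemma hb_nonneg: "hb \<alpha> g M ==> M >= 0"
 unfolding hb_def by (meson abs_ge_zero order_trans)

lemma hb2_nonneg: "hb2 \<alpha> g M ==> M >= 0"
 unfolding hb2_def by (meson abs_ge_zero order_trans)

lemma hb2_D:
 assumes "hb2 \<alpha> u M"
 shows "Ck 2 u" "\<bar>u p\<bar> <= M" "grad_bound u M" "hess_bound u M"
  and "geodesic G c ==> c 0 ~= c 1 ==> hdist (c 0) (c 1) < 1 ==>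
    parallel_along G c V ==> parallel_along G c W ==>
    G (c 0) (V 0) (V 0) = 1 ==> G (c 0) (W 0) (W 0) = 1 ==>
    \<bar>hess G u (c 1) (V 1) (W 1) - hess G u (c 0) (V 0) (W 0)\<bar> <= M * hdist (c 0) (c 1) powr \<alpha>"
 using assms unfolding hb2_def by blast+

lemma continuous_on_hdist: "continuous_on UNIV (%q. hdist p q)"
 unfolding hdist_def Z_def
 by (rule continuous_on_compose2[OF continuous_on_arcosh[OF order_refl]
    continuous_on_minus[OF mink.continuous_on[OF continuous_on_const continuous_on_X]]])
   (use mink_hyperboloid_ge1[OF X_in X_in] in auto)

lemma hb_continuous:
 assumes "\<alpha> > 0" "hb \<alpha> g M"
 shows "continuous_on UNIV g"
 unfolding continuous_on_eq_continuous_at[OF open_UNIV]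
proof
 fix p
 have "((%q. hdist p q) ---> hdist p p) (at p)"
  using continuous_on_hdist[of p, unfolded continuous_on_eq_continuous_at[OF open_UNIV]] by (simp only: isCont_def) blast
 then have "((%q. hdist p q powr \<alpha>) ---> 0) (at p)"
  using assms(1) by (intro tendsto_zero_powrI[where b=\<alpha>]) auto
 then have "((%q. M * hdist p q powr \<alpha>) ---> 0) (at p)"
  by (auto intro: tendsto_mult_right_zero)
 then have "((%q. g q - g p) ---> 0) (at p)"
  by (rule Lim_null_comparison[rotated])
    (intro always_eventually allI, metis assms(2) abs_minus_commute hb_def real_norm_def)
 then show "isCont g p" by (simp add: isCont_def LIM_zero_iff)
qed

lemma nrm_1 [simp]: "G p v v = 1 ==> nrm p v = 1" by (simp add: nrm_def)

lemma unit_lists_2: "vs \<in> unit_lists G 2 p \<longleftrightarrow> (\<exists>v w. vs = [v, w] \<and> G p v v = 1 \<and> G p w w = 1)"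
 by (auto simp: unit_lists_def numeral_2_eq_2 length_Suc_conv)

lemma unit_lists_1: "vs \<in> unit_lists G (Suc 0) p \<longleftrightarrow> (\<exists>v. vs = [v] \<and> G p v v = 1)"
 by (auto simp: unit_lists_def length_Suc_conv)

lemma unit_lists_0: "vs \<in> unit_lists G 0 p \<longleftrightarrow> vs = []"
 by (auto simp: unit_lists_def)

lemma sup_covd_le:
 assumes "!!p vs. p \<in> B ==> vs \<in> unit_lists G k p ==> \<bar>covd G u k p vs\<bar> <= M"
 shows "sup_covd G u k B <= ennreal M"
 unfolding sup_covd_def using assms by (intro SUP_least ennreal_leI) auto

lemma sup_covd_ge:
 assumes "p \<in> B" "vs \<in> unit_lists G k p" "sup_covd G u k B <= ennreal M" "0 <= M"
 shows "\<bar>covd G u k p vs\<bar> <= M"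
proof -
 have "ennreal \<bar>covd G u k p vs\<bar> <= sup_covd G u k B"
  unfolding sup_covd_def using assms(1,2) by (intro SUP_upper2[OF assms(1)] SUP_upper2[OF assms(2)]) auto
 also note assms(3)
 finally show ?thesis using assms(4) by (simp add: ennreal_le_iff)
qed

lemma holder_seminorm_ge:
 assumes "geodesic G c" "c ` {0..1} \<subseteq> B" "c 0 ~= c 1" "\<forall>V\<in>set Vs. parallel_along G c V"
  "map (%V. V 0) Vs \<in> unit_lists G k (c 0)" "holder_seminorm G u k \<alpha> B <= ennreal M" "0 <= M"
 shows "\<bar>covd G u k (c 1) (map (%V. V 1) Vs) - covd G u k (c 0) (map (%V. V 0) Vs)\<bar>
     <= M * hdist (c 0) (c 1) powr \<alpha>"
proof -
 let ?q = "\<bar>covd G u k (c 1) (map (%V. V 1) Vs) - covd G u k (c 0) (map (%V. V 0) Vs)\<bar>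
     / hdist (c 0) (c 1) powr \<alpha>"
 have "ennreal ?q <= holder_seminorm G u k \<alpha> B"
  unfolding holder_seminorm_def rdist_eq using assms(1-5) by (intro SUP_upper2[of "(c, Vs)"]) auto
 also note assms(6)
 finally have "?q <= M" using assms(7) by (simp add: ennreal_le_iff)
 moreover have "hdist (c 0) (c 1) > 0"
  using assms(3) hdist_eq_0[of "c 0" "c 1"] hdist_nonneg[of "c 0" "c 1"] by linarith
 ultimately show ?thesis by (simp add: field_simps)
qed

lemma holder_norm_parts:
 assumes "holder_enorm G k \<alpha> u <= ennreal M"
 shows "j <= k ==> sup_covd G u j (rball G p 1) <= ennreal M"
  and "holder_seminorm G u k \<alpha> (rball G p 1) <= ennreal M"
proof -
 have "holder_norm_on G k \<alpha> (rball G p 1) u <= holder_enorm G k \<alpha> u"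
  unfolding holder_enorm_def by (rule SUP_upper) simp
 then have le: "holder_norm_on G k \<alpha> (rball G p 1) u <= ennreal M" using assms by (rule order_trans)
 have "holder_seminorm G u k \<alpha> (rball G p 1) <= holder_norm_on G k \<alpha> (rball G p 1) u"
  unfolding holder_norm_on_def by (rule add_increasing) simp_all
 then show "holder_seminorm G u k \<alpha> (rball G p 1) <= ennreal M" using le by (rule order_trans)
 assume j: "j <= k"
 have "sup_covd G u j (rball G p 1) <= (\<Sum>j\<le>k. sup_covd G u j (rball G p 1))"
  using j by (intro member_le_sum) auto
 also have "... <= holder_norm_on G k \<alpha> (rball G p 1) u"
  unfolding holder_norm_on_def by (simp add: add_increasing2)
 also note le
 finally show "sup_covd G u j (rball G p 1) <= ennreal M" .
qed

lemma in_rball: "q \<in> rball G p 1 \<longleftrightarrow> hdist p q < 1"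
 by (simp add: rball_def rdist_eq)

lemma powr_ge_1_of_ge_1: "x >= 1 ==> \<alpha> >= 0 ==> x powr \<alpha> >= (1::real)"
 using powr_mono2[of \<alpha> 1 x] by simp

text \<open>At distance at least 1 the power of the distance is at least 1 and the sup bound
  suffices, hence the factor 2.\<close>

lemma hbI_local:
 assumes "\<alpha> > 0" and b: "!!p. \<bar>g p\<bar> <= M"
  and h: "!!p q. hdist p q < 1 ==> p ~= q ==> \<bar>g p - g q\<bar> <= M * hdist p q powr \<alpha>"
 shows "hb \<alpha> g (2 * M)"
 unfolding hb_def
proof (intro conjI allI)
 have M: "M >= 0" using b[of undefined] by linarith
 show "\<bar>g p\<bar> <= 2 * M" for p using b[of p] by linarith
 fix p q
 show "\<bar>g p - g q\<bar> <= 2 * M * hdist p q powr \<alpha>"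
 proof (cases "p = q \<or> hdist p q < 1")
  case True
  then show ?thesis using h[of p q] M by (cases "p = q") (auto intro: order_trans)
 next
  case False
  then have "hdist p q powr \<alpha> >= 1" using assms(1) by (intro powr_ge_1_of_ge_1) auto
  then have "2 * M * 1 <= 2 * M * hdist p q powr \<alpha>" using M by (intro mult_left_mono) auto
  then show ?thesis using b[of p] b[of q] by linarith
 qed
qed

lemma hb_LipschitzI:
 assumes "0 < \<alpha>" "\<alpha> <= 1" and b: "!!p. \<bar>g p\<bar> <= M"
  and h: "!!p q. \<bar>g p - g q\<bar> <= M * hdist p q"
 shows "hb \<alpha> g (2 * M)"
proof (rule hbI_local[OF assms(1) b])
 fix p q assume d: "hdist p q < 1" "p ~= q"
 have M: "M >= 0" using b[of undefined] by linarith
 have "hdist p q > 0" using d(2) hdist_eq_0[of p q] hdist_nonneg[of p q] by linarith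
 then have "hdist p q powr 1 <= hdist p q powr \<alpha>" using d assms(2) by (intro powr_mono') auto
 then have "hdist p q <= hdist p q powr \<alpha>" by simp
 then show "\<bar>g p - g q\<bar> <= M * hdist p q powr \<alpha>"
  using h[of p q] M by (meson mult_left_mono order_trans)
qed

lemma hb_imp_holder:
 assumes a: "\<alpha> > 0" and h: "hb \<alpha> g M"
 shows "Ck 0 g" "holder_enorm G 0 \<alpha> g <= ennreal (2 * M)"
proof -
 show "Ck 0 g" using hb_continuous[OF a h] by simp
 have M: "M >= 0" using hb_nonneg[OF h] .
 show "holder_enorm G 0 \<alpha> g <= ennreal (2 * M)"
  unfolding holder_enorm_def
 proof (rule SUP_least)
  fix p
  have "sup_covd G g 0 (rball G p 1) <= ennreal M"
   by (rule sup_covd_le) (use h in "simp add: hb_def")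
  moreover have "holder_seminorm G g 0 \<alpha> (rball G p 1) <= ennreal M"
   unfolding holder_seminorm_def
  proof (rule SUP_least, clarify)
   fix c :: "real => 'w" and Vs assume ne: "c 0 ~= c 1"
   have "hdist (c 0) (c 1) > 0"
    using ne hdist_eq_0[of "c 0" "c 1"] hdist_nonneg[of "c 0" "c 1"] by linarith
   moreover have "\<bar>g (c 1) - g (c 0)\<bar> <= M * hdist (c 0) (c 1) powr \<alpha>"
    using h by (simp add: hb_def hdist_sym[of "c 0" "c 1"])
   ultimately show "ennreal (\<bar>covd G g 0 (c 1) (map (%V. V 1) Vs) - covd G g 0 (c 0) (map (%V. V 0) Vs)\<bar>
     / rdist G (c 0) (c 1) powr \<alpha>) <= ennreal M"
    by (intro ennreal_leI) (simp add: rdist_eq field_simps)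
  qed
  ultimately have "holder_norm_on G 0 \<alpha> (rball G p 1) g <= ennreal M + ennreal M"
   unfolding holder_norm_on_def by (simp add: add_mono)
  then show "holder_norm_on G 0 \<alpha> (rball G p 1) g <= ennreal (2 * M)"
   using M by (simp add: ennreal_plus[symmetric] del: ennreal_plus)
 qed
qed

lemma holder_imp_hb:
 assumes a: "\<alpha> > 0" and e: "holder_enorm G 0 \<alpha> g <= ennreal M" and M: "0 <= M"
 shows "hb \<alpha> g (2 * M)"
proof (rule hbI_local[OF a])
 show "\<bar>g p\<bar> <= M" for p
  using sup_covd_ge[OF _ _ holder_norm_parts(1)[OF e, of 0 p] M, of p "[]"]
  by (simp add: unit_lists_0 in_rball)
 fix p q assume d: "hdist p q < 1" "p ~= q"
 then obtain c where g: "geodesic G c" "c 0 = p" "c 1 = q"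
  "!!s. s \<in> {0..1} ==> hdist p (c s) = hdist p q * s"
  using geodesic_exists by metis
 have "c ` {0..1} \<subseteq> rball G p 1"
  using g(4) d(1) mult_left_le[of _ "hdist p q"] by (fastforce simp: in_rball)
 from holder_seminorm_ge[OF g(1) this _ _ _ holder_norm_parts(2)[OF e] M, of "[]"]
 show "\<bar>g p - g q\<bar> <= M * hdist p q powr \<alpha>"
  using g d by (simp add: unit_lists_0 abs_minus_commute)
qed

lemma hb2_imp_holder:
 assumes a: "\<alpha> > 0" and h: "hb2 \<alpha> u M"
 shows "holder_enorm G 2 \<alpha> u <= ennreal (5 * M)"
proof -
 note D = hb2_D[OF h]
 have M: "M >= 0" using hb2_nonneg[OF h] .
 have hs: "\<bar>hess G u p v w\<bar> <= M" if "G p v v = 1" "G p w w = 1" for p v w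
  using D(4) that unfolding hess_bound_def by (metis mult_1_right nrm_1)
 show ?thesis unfolding holder_enorm_def
 proof (rule SUP_least)
  fix p
  have 0: "sup_covd G u 0 (rball G p 1) <= ennreal M"
   by (rule sup_covd_le) (use D(2) in simp)
  have 1: "sup_covd G u (Suc 0) (rball G p 1) <= ennreal M"
  proof (rule sup_covd_le)
   fix p vs assume "vs \<in> unit_lists G (Suc 0) p"
   then obtain v where v: "vs = [v]" "G p v v = 1" by (auto simp: unit_lists_1)
   have "\<bar>dderiv u p v\<bar> <= M * nrm p v" using D(3) by (simp add: grad_bound_def)
   then show "\<bar>covd G u (Suc 0) p vs\<bar> <= M" using v by simp
  qed
  have 2: "sup_covd G u 2 (rball G p 1) <= ennreal M"
   by (rule sup_covd_le) (use hs unit_lists_2 in auto)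
  \<comment> \<open>Points of a unit ball may be at distance 1 or more, where \<open>hb2\<close>
    says nothing about differences; there the two Hessians are bounded separately, which gives the
    factor 2.\<close>
  have 3: "holder_seminorm G u 2 \<alpha> (rball G p 1) <= ennreal (2 * M)"
   unfolding holder_seminorm_def
  proof (rule SUP_least, clarify)
   fix c :: "real => 'w" and Vs
   assume g: "geodesic G c" and ne: "c 0 ~= c 1" and par: "\<forall>V\<in>set Vs. parallel_along G c V"
    and ul: "map (%V. V 0) Vs \<in> unit_lists G 2 (c 0)"
   from ul have "length Vs = 2" by (simp add: unit_lists_def)
   then obtain V W where Vs: "Vs = [V, W]" by (auto simp: numeral_2_eq_2 length_Suc_conv)
   have V: "parallel_along G c V" "G (c 0) (V 0) (V 0) = 1"
    and W: "parallel_along G c W" "G (c 0) (W 0) (W 0) = 1"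
    using par ul by (auto simp: Vs unit_lists_2)
   have pos: "hdist (c 0) (c 1) > 0"
    using ne hdist_eq_0[of "c 0" "c 1"] hdist_nonneg[of "c 0" "c 1"] by linarith
   have "\<bar>hess G u (c 1) (V 1) (W 1) - hess G u (c 0) (V 0) (W 0)\<bar> <= 2 * M * hdist (c 0) (c 1) powr \<alpha>"
   proof (cases "hdist (c 0) (c 1) < 1")
    case True
    have "M * hdist (c 0) (c 1) powr \<alpha> <= 2 * M * hdist (c 0) (c 1) powr \<alpha>"
     using M by (intro mult_right_mono) auto
    then show ?thesis using D(5)[OF g ne True V(1) W(1) V(2) W(2)] by linarith
   next
    case False
    then have "hdist (c 0) (c 1) powr \<alpha> >= 1" using a by (intro powr_ge_1_of_ge_1) auto
    then have le: "2 * M * 1 <= 2 * M * hdist (c 0) (c 1) powr \<alpha>" using M by (intro mult_left_mono) auto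
    have "G (c 1) (V 1) (V 1) = 1" "G (c 1) (W 1) (W 1) = 1"
     using parallel_inner_const[OF geodesic_velocity[OF g] V(1) V(1), of 1]
      parallel_inner_const[OF geodesic_velocity[OF g] W(1) W(1), of 1] V(2) W(2) by auto
    then show ?thesis using hs[of "c 1" "V 1" "W 1"] hs[OF V(2) W(2)] le by linarith
   qed
   then show "ennreal (\<bar>covd G u 2 (c 1) (map (%V. V 1) Vs) - covd G u 2 (c 0) (map (%V. V 0) Vs)\<bar>
     / rdist G (c 0) (c 1) powr \<alpha>) <= ennreal (2 * M)"
    using pos unfolding Vs rdist_eq by (intro ennreal_leI) (simp add: field_simps)
  qed
  have "holder_norm_on G 2 \<alpha> (rball G p 1) u <= ennreal M + ennreal M + ennreal M + ennreal (2 * M)"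
   unfolding holder_norm_on_def
   using add_mono[OF add_mono[OF add_mono[OF 0 1] 2[unfolded numeral_2_eq_2]] 3]
   by (simp add: numeral_2_eq_2)
  then show "holder_norm_on G 2 \<alpha> (rball G p 1) u <= ennreal (5 * M)"
   using M by (simp add: ennreal_plus[symmetric] del: ennreal_plus)
 qed
qed

lemma holder_imp_hb2:
 assumes u: "Ck 2 u" and e: "holder_enorm G 2 \<alpha> u <= ennreal M" and M: "0 <= M"
 shows "hb2 \<alpha> u M"
 unfolding hb2_def
proof (intro conjI allI impI u)
 have self: "p \<in> rball G p 1" for p by (simp add: in_rball)
 show "\<bar>u p\<bar> <= M" for p
  using sup_covd_ge[OF self _ holder_norm_parts(1)[OF e, of 0 p] M, of "[]"] by (simp add: unit_lists_0)
 show "grad_bound u M"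
 proof (rule grad_bound_unitI)
  show "u differentiable (at p)" for p using Ck2D(1)[OF u] differentiable_def by blast
  show "\<bar>dderiv u p v\<bar> <= M" if "G p v v = 1" for p v
   using sup_covd_ge[OF self _ holder_norm_parts(1)[OF e, of "Suc 0" p] M, of "[v]"] that
   by (simp add: unit_lists_1)
 qed
 show "hess_bound u M"
 proof (rule hess_bound_unitI[OF u])
  show "\<bar>hess G u p v w\<bar> <= M" if "G p v v = 1" "G p w w = 1" for p v w
   by (rule sup_covd_ge[OF self _ holder_norm_parts(1)[OF e, of 2 p] M]) (use that unit_lists_2 in auto)
 qed
 fix c V W
 assume g: "geodesic G c" and ne: "c 0 ~= c 1" and d: "hdist (c 0) (c 1) < 1"
  and V: "parallel_along G c V" and W: "parallel_along G c W"
  and un: "G (c 0) (V 0) (V 0) = 1" "G (c 0) (W 0) (W 0) = 1"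
 \<comment> \<open>The distance from the starting point grows linearly along a geodesic, so the
   whole curve lies in the unit ball centred at \<open>c 0\<close>.\<close>
 have "c ` {0..1} \<subseteq> rball G (c 0) 1"
 proof (clarify, unfold in_rball)
  fix s :: real assume s: "s \<in> {0..1}"
  have "hdist (c 0) (c s) = hdist (c 0) (c 1) * s"
   using geodesic_hdist[OF g ne s] geodesic_hdist[OF g ne, of 1] by simp
  also have "... <= hdist (c 0) (c 1)" using s by (intro mult_left_le) auto
  finally show "hdist (c 0) (c s) < 1" using d by simp
 qed
 from holder_seminorm_ge[OF g this ne _ _ holder_norm_parts(2)[OF e] M, of "[V, W]"]
 show "\<bar>hess G u (c 1) (V 1) (W 1) - hess G u (c 0) (V 0) (W 0)\<bar> <= M * hdist (c 0) (c 1) powr \<alpha>"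
  using V W un by (simp add: unit_lists_2)
qed

lemma hb_add: "hb \<alpha> f A ==> hb \<alpha> g B ==> hb \<alpha> (%p. f p + g p) (A + B)"
proof -
 assume f: "hb \<alpha> f A" and g: "hb \<alpha> g B"
 show ?thesis unfolding hb_def
 proof (intro conjI allI)
  show "\<bar>f p + g p\<bar> <= A + B" for p
   using f g abs_triangle_ineq[of "f p" "g p"] unfolding hb_def by (meson add_mono order_trans)
  fix p q
  have "\<bar>f p - f q\<bar> <= A * hdist p q powr \<alpha>" "\<bar>g p - g q\<bar> <= B * hdist p q powr \<alpha>"
   using f g by (auto simp: hb_def)
  then show "\<bar>f p + g p - (f q + g q)\<bar> <= (A + B) * hdist p q powr \<alpha>"
   by (simp add: distrib_right)
 qed
qed

lemma hb_mono: "hb \<alpha> f A ==> A <= B ==> hb \<alpha> f B"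
 unfolding hb_def by (meson mult_right_mono order_trans powr_ge_zero)

lemma hb_mult:
 assumes f: "hb \<alpha> f A" and g: "hb \<alpha> g B"
 shows "hb \<alpha> (%p. f p * g p) (2 * A * B)"
 unfolding hb_def
proof (intro conjI allI)
 have AB: "A >= 0" "B >= 0" using f g hb_nonneg by blast+
 have ab: "\<bar>f p\<bar> <= A" "\<bar>g p\<bar> <= B" for p using f g by (auto simp: hb_def)
 have "\<bar>f p * g p\<bar> <= A * B" for p using ab[of p] AB by (simp add: abs_mult mult_mono)
 moreover have "A * B <= 2 * A * B" using AB by simp
 ultimately show "\<bar>f p * g p\<bar> <= 2 * A * B" for p by (meson order_trans)
 fix p q
 have d: "\<bar>f p - f q\<bar> <= A * hdist p q powr \<alpha>" "\<bar>g p - g q\<bar> <= B * hdist p q powr \<alpha>"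
  using f g by (auto simp: hb_def)
 have "f p * g p - f q * g q = (f p - f q) * g p + f q * (g p - g q)" by (simp add: algebra_simps)
 then have "\<bar>f p * g p - f q * g q\<bar> <= \<bar>f p - f q\<bar> * \<bar>g p\<bar> + \<bar>f q\<bar> * \<bar>g p - g q\<bar>"
  by (metis abs_mult abs_triangle_ineq)
 also have "... <= (A * hdist p q powr \<alpha>) * B + A * (B * hdist p q powr \<alpha>)"
  by (intro add_mono mult_mono d ab) (use AB in auto)
 finally show "\<bar>f p * g p - f q * g q\<bar> <= 2 * A * B * hdist p q powr \<alpha>" by (simp add: algebra_simps)
qed

lemma hb_const: "hb \<alpha> (%p. c) \<bar>c\<bar>"
 by (simp add: hb_def)

lemma hb_cmult: "hb \<alpha> f A ==> hb \<alpha> (%p. c * f p) (\<bar>c\<bar> * A)"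
 by (auto simp: hb_def abs_mult mult_left_mono mult.assoc right_diff_distrib[symmetric])

section \<open>The Laplacian and products of gradients\<close>

lemma parallel_frame:
 assumes g: "geodesic G c" and ne: "c 0 ~= c 1"
 obtains E where "!!b. b \<in> Basis ==> parallel_along G c (E b)"
  "!!s. s \<in> {0..1} ==> orthonormal (c s) (%b. E b s)"
proof -
 have "\<forall>b. \<exists>V. parallel_along G c V \<and> V 0 = frame (c 0) b"
  using parallel_exists[OF g ne] by metis
 then obtain E where E: "!!b. parallel_along G c (E b)" "!!b. E b 0 = frame (c 0) b" by metis
 show thesis
 proof (rule that[of E])
  fix s :: real assume s: "s \<in> {0..1}"
  show "orthonormal (c s) (%b. E b s)"
   using orthonormal_frame[of "c 0"] parallel_inner_const[OF geodesic_velocity[OF g] E(1) E(1) s] E(2)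
   by (auto simp: orthonormal_def)
 qed (use E in auto)
qed

lemma orthonormal_unit: "orthonormal p E ==> b \<in> Basis ==> G p (E b) (E b) = 1"
 by (simp add: orthonormal_def)

text \<open>In a frame that is parallel along the geodesic the difference of the two traces is a sum
  of Hessian differences of the kind controlled by \<open>hb2\<close>.\<close>

lemma laplace_hb:
 assumes a: "\<alpha> > 0" and h: "hb2 \<alpha> u M"
 shows "hb \<alpha> (laplace G u) (2 * (real DIM('w) * M))"
proof (rule hbI_local[OF a])
 note D = hb2_D[OF h]
 have hs: "\<bar>hess G u p v w\<bar> <= M" if "G p v v = 1" "G p w w = 1" for p v w
  using D(4) that unfolding hess_bound_def by (metis mult_1_right nrm_1)
 show "\<bar>laplace G u p\<bar> <= real DIM('w) * M" for p
  unfolding laplace_eq[OF D(1) orthonormal_frame]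
  using sum_norm_bound[of "Basis :: 'w set" "%e. hess G u p (frame p e) (frame p e)" M]
   hs orthonormal_unit[OF orthonormal_frame] by simp
 fix p q assume d: "hdist p q < 1" "p ~= q"
 then obtain c where g: "geodesic G c" "c 0 = p" "c 1 = q" using geodesic_exists by metis
 then have ne: "c 0 ~= c 1" using d by simp
 obtain E where E: "!!b. b \<in> Basis ==> parallel_along G c (E b)"
  "!!s. s \<in> {0..1} ==> orthonormal (c s) (%b. E b s)"
  using parallel_frame[OF g(1) ne] by metis
 have "laplace G u q - laplace G u p =
   (\<Sum>e\<in>Basis. hess G u (c 1) (E e 1) (E e 1) - hess G u (c 0) (E e 0) (E e 0))"
  using laplace_eq[OF D(1) E(2)[of 1]] laplace_eq[OF D(1) E(2)[of 0]] g by (simp add: sum_subtractf)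
 also have "\<bar>...\<bar> <= real DIM('w) * (M * hdist p q powr \<alpha>)"
 proof -
  have "\<bar>hess G u (c 1) (E e 1) (E e 1) - hess G u (c 0) (E e 0) (E e 0)\<bar> <= M * hdist p q powr \<alpha>"
   if "e \<in> Basis" for e
   using D(5)[OF g(1) ne _ E(1)[OF that] E(1)[OF that]] orthonormal_unit[OF E(2) that, of 0] d g by simp
  then show ?thesis using sum_norm_bound[of "Basis :: 'w set" "%e. hess G u (c 1) (E e 1) (E e 1) - hess G u (c 0) (E e 0) (E e 0)"] by simp
 qed
 finally show "\<bar>laplace G u p - laplace G u q\<bar> <= real DIM('w) * M * hdist p q powr \<alpha>"
  by (simp add: abs_minus_commute mult.assoc)
qed

text \<open>The inner product of the gradients, which appears in the product rule for the Laplacian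
  and hence in the conjugated operator. The frame is irrelevant by \<open>gdot_eq\<close>.\<close>

definition gdot :: "('w => real) => ('w => real) => 'w => real" where
 "gdot u w p = (\<Sum>b\<in>Basis. dderiv u p (frame p b) * dderiv w p (frame p b))"

lemma gdot_eq:
 assumes E: "orthonormal p E" and u: "u differentiable (at p)" and w: "w differentiable (at p)"
 shows "gdot u w p = (\<Sum>b\<in>Basis. dderiv u p (E b) * dderiv w p (E b))"
proof -
 note lu = dderiv_linear[OF u] and lw = dderiv_linear[OF w]
 let ?F = "frame p"
 have "(\<Sum>b\<in>Basis. dderiv u p (E b) * dderiv w p (E b))
   = (\<Sum>b\<in>Basis. dderiv u p (E b) * (\<Sum>c\<in>Basis. G p (E b) (?F c) * dderiv w p (?F c)))"
 proof (rule sum.cong[OF refl])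
  fix b assume "b \<in> (Basis :: 'w set)"
  have "dderiv w p (E b) = dderiv w p (\<Sum>c\<in>Basis. G p (E b) (?F c) *R ?F c)"
   using orthonormal_expand[OF orthonormal_frame, of "E b" p] by simp
  then show "dderiv u p (E b) * dderiv w p (E b) = dderiv u p (E b) * (\<Sum>c\<in>Basis. G p (E b) (?F c) * dderiv w p (?F c))"
   by (simp add: linear_sum[OF lw] linear_cmul[OF lw])
 qed
 also have "... = (\<Sum>c\<in>Basis. (\<Sum>b\<in>Basis. G p (?F c) (E b) * dderiv u p (E b)) * dderiv w p (?F c))"
  unfolding sum_distrib_left sum_distrib_right
  by (subst sum.swap) (simp add: mult.assoc mult.left_commute G_sym)
 also have "... = (\<Sum>c\<in>Basis. dderiv u p (?F c) * dderiv w p (?F c))"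
 proof (rule sum.cong[OF refl])
  fix c assume "c \<in> (Basis :: 'w set)"
  have "dderiv u p (?F c) = dderiv u p (\<Sum>b\<in>Basis. G p (?F c) (E b) *R E b)"
   using orthonormal_expand[OF E, of "?F c"] by simp
  then show "(\<Sum>b\<in>Basis. G p (?F c) (E b) * dderiv u p (E b)) * dderiv w p (?F c) = dderiv u p (?F c) * dderiv w p (?F c)"
   by (simp add: linear_sum[OF lu] linear_cmul[OF lu])
 qed
 finally show ?thesis by (simp add: gdot_def)
qed

lemma gdot_bound:
 assumes "grad_bound u A" "grad_bound w B"
 shows "\<bar>gdot u w p\<bar> <= real DIM('w) * (A * B)"
proof -
 have "\<bar>dderiv u p (frame p b) * dderiv w p (frame p b)\<bar> <= A * B" if "b \<in> Basis" for b
 proof -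
  have "nrm p (frame p b) = 1" using orthonormal_unit[OF orthonormal_frame that] by simp
  then have "\<bar>dderiv u p (frame p b)\<bar> <= A" "\<bar>dderiv w p (frame p b)\<bar> <= B"
   using assms unfolding grad_bound_def by (metis mult_1_right)+
  then show ?thesis using grad_bound_nonneg[OF assms(1)] by (simp add: abs_mult mult_mono)
 qed
 then show ?thesis unfolding gdot_def
  using sum_norm_bound[of "Basis :: 'w set" "%b. dderiv u p (frame p b) * dderiv w p (frame p b)" "A * B"] by simp
qed

lemma Ck2_differentiable: "Ck 2 u ==> u differentiable (at p)"
 using Ck2D(1) differentiable_def by blast

text \<open>In a parallel frame the components of the gradients have Hessian entries as derivatives,
  so the mean value theorem applies to each product of components.\<close>

lemma gdot_Lipschitz:
 assumes u: "Ck 2 u" "grad_bound u A" "hess_bound u A" and w: "Ck 2 w" "grad_bound w B" "hess_bound w B"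
 shows "\<bar>gdot u w p - gdot u w q\<bar> <= 2 * real DIM('w) * A * B * hdist p q"
proof (cases "p = q")
 case False
 obtain c where g: "geodesic G c" "c 0 = p" "c 1 = q" "speed c = hdist p q" using geodesic_exists[OF False] by metis
 then have ne: "c 0 ~= c 1" using False by simp
 obtain E where E: "!!b. b \<in> Basis ==> parallel_along G c (E b)"
  "!!s. s \<in> {0..1} ==> orthonormal (c s) (%b. E b s)"
  using parallel_frame[OF g(1) ne] by metis
 have AB: "A >= 0" "B >= 0" using u w grad_bound_nonneg by blast+
 have each: "\<bar>dderiv u (c 1) (E b 1) * dderiv w (c 1) (E b 1) - dderiv u (c 0) (E b 0) * dderiv w (c 0) (E b 0)\<bar>
   <= 2 * A * B * hdist p q" if b: "b \<in> Basis" for b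
 proof (rule mvt01)
  fix s :: real assume s: "s \<in> {0..1}"
  note gv = geodesic_velocity[OF g(1) s]
  show "((%s. dderiv u (c s) (E b s) * dderiv w (c s) (E b s)) has_real_derivative
    hess G u (c s) (velocity c s) (E b s) * dderiv w (c s) (E b s)
    + hess G w (c s) (velocity c s) (E b s) * dderiv u (c s) (E b s)) (at s within {0..1})"
   by (rule DERIV_mult[OF dderiv_parallel[OF u(1) E(1)[OF b] s gv] dderiv_parallel[OF w(1) E(1)[OF b] s gv]])
  have n1: "nrm (c s) (E b s) = 1" using orthonormal_unit[OF E(2)[OF s] b] by simp
  have nv: "nrm (c s) (velocity c s) = hdist p q"
   using geodesic_speed[OF g(1) s] speed_nonneg[of c] g(4) by (simp add: nrm_def)
  have b1: "\<bar>dderiv u (c s) (E b s)\<bar> <= A" "\<bar>dderiv w (c s) (E b s)\<bar> <= B"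
   using u(2) w(2) n1 unfolding grad_bound_def by (metis mult_1_right)+
  have b2: "\<bar>hess G u (c s) (velocity c s) (E b s)\<bar> <= A * hdist p q" "\<bar>hess G w (c s) (velocity c s) (E b s)\<bar> <= B * hdist p q"
   using u(3) w(3) n1 nv unfolding hess_bound_def by (metis mult_1_right)+
  have "\<bar>hess G u (c s) (velocity c s) (E b s) * dderiv w (c s) (E b s)
    + hess G w (c s) (velocity c s) (E b s) * dderiv u (c s) (E b s)\<bar>
   <= (A * hdist p q) * B + (B * hdist p q) * A"
   by (intro order_trans[OF abs_triangle_ineq] add_mono) (unfold abs_mult, (intro mult_mono b1 b2; use AB in auto)+)
  then show "\<bar>hess G u (c s) (velocity c s) (E b s) * dderiv w (c s) (E b s)
    + hess G w (c s) (velocity c s) (E b s) * dderiv u (c s) (E b s)\<bar> <= 2 * A * B * hdist p q"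
   by (simp add: algebra_simps)
 qed
 have "gdot u w q - gdot u w p = (\<Sum>b\<in>Basis. dderiv u (c 1) (E b 1) * dderiv w (c 1) (E b 1) - dderiv u (c 0) (E b 0) * dderiv w (c 0) (E b 0))"
  using gdot_eq[OF E(2)[of 1] Ck2_differentiable[OF u(1)] Ck2_differentiable[OF w(1)]]
   gdot_eq[OF E(2)[of 0] Ck2_differentiable[OF u(1)] Ck2_differentiable[OF w(1)]] g
  by (simp add: sum_subtractf)
 moreover have "\<bar>...\<bar> <= real DIM('w) * (2 * A * B * hdist p q)"
  using sum_norm_bound[of "Basis :: 'w set" "%b. dderiv u (c 1) (E b 1) * dderiv w (c 1) (E b 1) - dderiv u (c 0) (E b 0) * dderiv w (c 0) (E b 0)"] each by simp
 ultimately show ?thesis by (simp add: abs_minus_commute algebra_simps)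
qed simp

lemma laplace_mult:
 assumes "Ck 2 u" "Ck 2 w"
 shows "laplace G (%p. u p * w p) p = u p * laplace G w p + w p * laplace G u p + 2 * gdot u w p"
 unfolding laplace_eq[OF Ck2_mult(1)[OF assms] orthonormal_frame] hess_mult[OF assms]
  laplace_eq[OF assms(1) orthonormal_frame] laplace_eq[OF assms(2) orthonormal_frame] gdot_def
 by (simp add: sum.distrib sum_distrib_left algebra_simps)

lemma laplace_add:
 assumes "Ck 2 u" "Ck 2 w"
 shows "laplace G (%p. u p + w p) p = laplace G u p + laplace G w p"
 unfolding laplace_eq[OF Ck2_add(1)[OF assms] orthonormal_frame] hess_add[OF assms]
  laplace_eq[OF assms(1) orthonormal_frame] laplace_eq[OF assms(2) orthonormal_frame]
 by (simp add: sum.distrib)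

lemma laplace_cmult:
 assumes "Ck 2 u"
 shows "laplace G (%p. c * u p) p = c * laplace G u p"
 unfolding laplace_eq[OF Ck2_cmult(1)[OF assms] orthonormal_frame] hess_cmult[OF assms]
  laplace_eq[OF assms(1) orthonormal_frame] by (simp add: sum_distrib_left)

lemma laplace_compose:
 fixes \<phi> :: "real => real"
 assumes "Ck 2 u"
  and "!!p. (\<phi> has_real_derivative \<phi>' (u p)) (at (u p))"
  and "!!p. (\<phi>' has_real_derivative \<phi>'' (u p)) (at (u p))"
  and "continuous_on UNIV (%p. \<phi>'' (u p))"
 shows "laplace G (%p. \<phi> (u p)) p = \<phi>' (u p) * laplace G u p + \<phi>'' (u p) * gdot u u p"
 unfolding laplace_eq[OF Ck2_compose(1)[OF assms] orthonormal_frame] hess_compose[OF assms]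
  laplace_eq[OF assms(1) orthonormal_frame] gdot_def by (simp add: sum.distrib sum_distrib_left mult.assoc)

lemma sum_G_frame: "orthonormal p E ==> (\<Sum>e\<in>Basis. G p (E e) (E e)) = real DIM('w)"
 by (simp add: orthonormal_def)

lemma laplace_minkX: "laplace G (%p. mink (X p) Y) p = real DIM('w) * mink (X p) Y"
 unfolding laplace_eq[OF Ck2_minkX(1) orthonormal_frame] Ck2_minkX(3)
 by (simp add: sum_distrib_right[symmetric] sum_G_frame[OF orthonormal_frame])

text \<open>\<open>T\<close> projects orthogonally to the tangent space, so this is Parseval's
  identity for the tangential parts of two ambient vectors.\<close>

lemma sum_mink_frame:
 assumes E: "orthonormal p E"
 shows "(\<Sum>b\<in>Basis. mink (X' p (E b)) Y * mink (X' p (E b)) Y') = mink Y Y' + mink (X p) Y * mink (X p) Y'"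
proof -
 define T where "T Y = Y + mink (X p) Y *R X p" for Y
 have tan: "mink (X p) (T Y) = 0" for Y by (simp add: T_def mink_simps)
 have eq: "mink (X' p v) Y = G p (Xi' (X p) (T Y)) v" for v Y
  unfolding G_eq X'_Xi'[OF tan] by (simp add: T_def mink_simps mink_sym[of Y])
 have "(\<Sum>b\<in>Basis. mink (X' p (E b)) Y * mink (X' p (E b)) Y') = G p (Xi' (X p) (T Y)) (Xi' (X p) (T Y'))"
  unfolding eq by (rule orthonormal_G_expand[OF E, symmetric])
 also have "... = mink Y Y' + mink (X p) Y * mink (X p) Y'"
  unfolding G_eq X'_Xi'[OF tan] by (simp add: T_def mink_simps mink_sym[of Y] algebra_simps)
 finally show ?thesis .
qed

lemma gdot_minkX: "gdot (%p. mink (X p) Y) (%p. mink (X p) Y') p = mink Y Y' + mink (X p) Y * mink (X p) Y'"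
 unfolding gdot_def Ck2_minkX(2) by (rule sum_mink_frame[OF orthonormal_frame])

lemma gdot_compose:
 fixes \<phi> \<psi> :: "real => real"
 assumes "u differentiable (at p)" "w differentiable (at p)"
  and "(\<phi> has_real_derivative a) (at (u p))" "(\<psi> has_real_derivative b) (at (w p))"
 shows "gdot (%p. \<phi> (u p)) (%p. \<psi> (w p)) p = a * b * gdot u w p"
proof -
 have "dderiv (%p. \<phi> (u p)) p v = a * dderiv u p v" for v
  by (rule dderivI) (rule has_derivative_compose[OF assms(1)[unfolded frechet_derivative_works] assms(3)[unfolded has_field_derivative_def]])
 moreover have "dderiv (%p. \<psi> (w p)) p v = b * dderiv w p v" for v
  by (rule dderivI) (rule has_derivative_compose[OF assms(2)[unfolded frechet_derivative_works] assms(4)[unfolded has_field_derivative_def]])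
 ultimately show ?thesis by (simp add: gdot_def sum_distrib_left algebra_simps)
qed

end

section \<open>The hyperboloid chart and the Fermi chart\<close>

abbreviation jp :: "'a::euclidean_space => real" where "jp x \<equiv> sqrt (1 + x \<bullet> x)"

lemma jp_pos: "jp x > 0" "jp x ~= 0" "1 + x \<bullet> x > 0" "jp x * jp x = 1 + x \<bullet> x"
 using inner_ge_zero[of x] by (auto simp: add_pos_nonneg less_imp_neq[symmetric])

lemma jp_has_derivative: "(jp has_derivative (%v. (x \<bullet> v) / jp x)) (at x)"
proof -
 have "((%x. 1 + x \<bullet> x) has_derivative (%v. 2 * (x \<bullet> v))) (at x)"
  by (auto intro!: derivative_eq_intros simp: inner_commute)
 from DERIV_compose_FDERIV[OF DERIV_real_sqrt[OF jp_pos(3)] this]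
 show ?thesis by (simp add: field_simps)
qed

lemma jp_has_derivative2:
 "((%x. (x \<bullet> v) / jp x) has_derivative (%w. (w \<bullet> v) / jp x - (x \<bullet> v) * (x \<bullet> w) / jp x ^ 3)) (at x)"
proof -
 have "((%x. (x \<bullet> v) / jp x) has_derivative
   (%w. ((w \<bullet> v) * jp x - (x \<bullet> v) * ((x \<bullet> w) / jp x)) / (jp x * jp x))) (at x)"
  by (rule has_derivative_divide'[OF _ jp_has_derivative jp_pos(2)]) (auto intro!: derivative_eq_intros)
 moreover have "((w \<bullet> v) * jp x - (x \<bullet> v) * ((x \<bullet> w) / jp x)) / (jp x * jp x)
   = (w \<bullet> v) / jp x - (x \<bullet> v) * (x \<bullet> w) / jp x ^ 3" for w
  using jp_pos(2)[of x] by (simp add: field_simps power3_eq_cube del: real_sqrt_mult_self)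
 ultimately show ?thesis by simp
qed

definition HX :: "'a::euclidean_space => real * 'a" where "HX x = (jp x, x)"
definition HX' :: "'a::euclidean_space => 'a => real * 'a" where "HX' x v = (x \<bullet> v / jp x, v)"
definition HX'' :: "'a::euclidean_space => 'a => 'a => real * 'a" where
 "HX'' x w v = ((w \<bullet> v) / jp x - (x \<bullet> v) * (x \<bullet> w) / jp x ^ 3, 0)"

interpretation hyp: hyperbolic_chart "ghyp :: 'a::euclidean_space metric" HX HX' HX'' snd "%_. snd" "%_ _ _. 0"
proof
 fix p v w :: 'a and Y e :: "real * 'a"
 show "(HX has_derivative HX' p) (at p)"
  unfolding HX_def[abs_def] HX'_def by (intro has_derivative_Pair jp_has_derivative has_derivative_ident)
 show "((%p. HX' p v) has_derivative (%h. HX'' p h v)) (at p)"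
  unfolding HX'_def HX''_def by (intro has_derivative_Pair jp_has_derivative2 has_derivative_const)
 show "continuous_on UNIV (%p. HX'' p v w)"
  unfolding HX''_def using jp_pos(2) by (intro continuous_intros) auto
 show "HX'' p v w = HX'' p w v" by (simp add: HX''_def inner_commute mult.commute)
 show "HX p \<in> hyperboloid" by (simp add: HX_def hyperboloid_iff power2_norm_eq_inner)
 show "ghyp p v w = mink (HX' p v) (HX' p w)"
  using jp_pos(4)[of p] by (simp add: ghyp_def mink_def HX'_def)
 show "snd (HX p) = p" by (simp add: HX_def)
 show "HX (snd Y) = Y" if "Y \<in> hyperboloid"
  using that by (simp add: HX_def hyperboloid_iff power2_norm_eq_inner prod_eq_iff)
 show "(snd has_derivative snd) (at Y)" by (rule bounded_linear_imp_has_derivative[OF bounded_linear_snd])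
 show "((%Y. snd e) has_derivative (%h. 0)) (at Y)" by simp
qed

text \<open>cosh t times the hyperboloid point over x plus sinh t times the unit normal of the
  hyperplane t = 0. The normal direction is the middle component of the ambient triple.\<close>

definition FX :: "real * 'a::euclidean_space => real * real * 'a" where
 "FX p = (cosh (fst p) * jp (snd p), sinh (fst p), cosh (fst p) *R snd p)"

definition FX' :: "real * 'a::euclidean_space => real * 'a => real * real * 'a" where
 "FX' p v = (cosh (fst p) * (snd p \<bullet> snd v / jp (snd p)) + fst v * sinh (fst p) * jp (snd p),
   fst v * cosh (fst p), cosh (fst p) *R snd v + (fst v * sinh (fst p)) *R snd p)"

definition FX'' :: "real * 'a::euclidean_space => real * 'a => real * 'a => real * real * 'a" where
 "FX'' p w v = (cosh (fst p) * ((snd w \<bullet> snd v) / jp (snd p) - (snd p \<bullet> snd v) * (snd p \<bullet> snd w) / jp (snd p) ^ 3)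
   + fst w * sinh (fst p) * (snd p \<bullet> snd v / jp (snd p))
   + fst v * sinh (fst p) * (snd p \<bullet> snd w / jp (snd p)) + fst v * fst w * cosh (fst p) * jp (snd p),
   fst v * fst w * sinh (fst p),
   (fst w * sinh (fst p)) *R snd v + (fst v * sinh (fst p)) *R snd w + (fst v * fst w * cosh (fst p)) *R snd p)"

definition FXi :: "real * real * 'a::euclidean_space => real * 'a" where
 "FXi Y = (arsinh (fst (snd Y)), (1 / jp (fst (snd Y))) *R snd (snd Y))"

definition FXi' :: "real * real * 'a::euclidean_space => real * real * 'a => real * 'a" where
 "FXi' Y e = (fst (snd e) / jp (fst (snd Y)),
   (1 / jp (fst (snd Y))) *R snd (snd e) - (fst (snd Y) * fst (snd e) / jp (fst (snd Y)) ^ 3) *R snd (snd Y))"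

text \<open>Only the existence of this derivative enters, in \<open>parallel_from_ambient\<close>,
  so it is not computed.\<close>

definition FXi'' :: "real * real * 'a::euclidean_space => real * real * 'a => real * real * 'a => real * 'a" where
 "FXi'' Y h e = frechet_derivative (%Y. FXi' Y e) (at Y) h"

lemma jp_snd_has_derivative:
 "((%p. jp (snd p)) has_derivative (%v. (snd p \<bullet> snd v) / jp (snd p))) (at p)"
 by (rule has_derivative_compose[OF has_derivative_snd[OF has_derivative_ident] jp_has_derivative])

lemma jp_snd_has_derivative2:
 "((%p. (snd p \<bullet> snd v) / jp (snd p)) has_derivative
   (%w. (snd w \<bullet> snd v) / jp (snd p) - (snd p \<bullet> snd v) * (snd p \<bullet> snd w) / jp (snd p) ^ 3)) (at p)"
 by (rule has_derivative_compose[OF has_derivative_snd[OF has_derivative_ident] jp_has_derivative2])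

lemma cosh_fst_has_derivative: "((%p. cosh (fst p)) has_derivative (%v. fst v * sinh (fst p))) (at p)"
 and sinh_fst_has_derivative: "((%p. sinh (fst p)) has_derivative (%v. fst v * cosh (fst p))) (at p)"
 for p :: "real * 'a::euclidean_space"
proof -
 have "((%p. fst p) has_derivative (%v. fst v)) (at p)" by (auto intro: derivative_intros)
 then have d: "(fst has_derivative fst) (at p)" by simp
 have "(cosh has_real_derivative sinh (fst p)) (at (fst p))" "(sinh has_real_derivative cosh (fst p)) (at (fst p))"
  by (auto intro!: derivative_eq_intros)
 from DERIV_compose_FDERIV[OF this(1) d] DERIV_compose_FDERIV[OF this(2) d]
 show "((%p. cosh (fst p)) has_derivative (%v. fst v * sinh (fst p))) (at p)"
  "((%p. sinh (fst p)) has_derivative (%v. fst v * cosh (fst p))) (at p)" by auto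
qed

lemma snd_has_derivative: "(snd has_derivative snd) (at p)" by (rule bounded_linear_imp_has_derivative[OF bounded_linear_snd])

lemma FXi'_has_derivative: "((%Y. FXi' Y e) has_derivative (%h. FXi'' Y h e)) (at Y)"
proof -
 have d1: "((%Y. fst (snd Y)) has_derivative (%h. fst (snd h))) (at Y)"
  and d2: "((%Y. snd (snd Y)) has_derivative (%h. snd (snd h))) (at Y)"
  by (auto intro!: derivative_eq_intros)
 have j: "(%Y. jp (fst (snd Y))) differentiable (at Y)"
  using has_derivative_compose[OF d1 jp_has_derivative] differentiable_def by blast
 have "(%Y. FXi' Y e) differentiable (at Y)"
  unfolding FXi'_def using jp_pos(2)[of "fst (snd Y)"] d1 d2 j
  by (intro differentiable_Pair differentiable_diff differentiable_scaleR differentiable_divide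
    differentiable_mult differentiable_power differentiable_const) (auto simp: differentiable_def)
 then show ?thesis unfolding FXi''_def by (simp add: frechet_derivative_works)
qed

lemma jp_fst_snd_has_derivative:
 "((%Y. 1 / jp (fst (snd Y))) has_derivative (%h. - (fst (snd Y) * fst (snd h) / jp (fst (snd Y)) ^ 3))) (at Y)"
proof -
 have d1: "((%Y. fst (snd Y)) has_derivative (%h. fst (snd h))) (at Y)" by (auto intro!: derivative_eq_intros)
 let ?j = "jp (fst (snd Y))"
 have "((%Y. 1 / jp (fst (snd Y))) has_derivative
   (%h. (0 * ?j - 1 * (fst (snd Y) \<bullet> fst (snd h) / ?j)) / (?j * ?j))) (at Y)"
  by (rule has_derivative_divide'[OF has_derivative_const has_derivative_compose[OF d1 jp_has_derivative] jp_pos(2)])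
 then show ?thesis
  by (rule has_derivative_eq_rhs) (simp only: fun_eq_iff power3_eq_cube mult.assoc inner_real_def
    divide_divide_eq_left mult_zero_left mult_1 diff_0 minus_divide_left, simp add: mult.assoc)
qed

interpretation fm: hyperbolic_chart "gfermi :: (real * 'a::euclidean_space) metric" FX FX' FX'' FXi FXi' FXi''
proof
 fix p v w :: "real * 'a" and Y e :: "real * real * 'a"
 have ch: "cosh (fst p) * cosh (fst p) = 1 + sinh (fst p) * sinh (fst p)"
  using cosh_square_eq[of "fst p"] by (simp add: power2_eq_square)
 note jj = jp_pos(4)[of "snd p"] and j0 = jp_pos(2)[of "snd p"]
 show "(FX has_derivative FX' p) (at p)"
  unfolding FX_def[abs_def] FX'_def
  by (intro has_derivative_Pair has_derivative_mult has_derivative_scaleR cosh_fst_has_derivative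
    sinh_fst_has_derivative jp_snd_has_derivative snd_has_derivative)
 show "((%p. FX' p v) has_derivative (%h. FX'' p h v)) (at p)"
  unfolding FX'_def FX''_def
 proof (intro has_derivative_Pair)
  let ?k = "%p. snd p \<bullet> snd v / jp (snd p)"
  show "((%p. cosh (fst p) * ?k p + fst v * sinh (fst p) * jp (snd p)) has_derivative
   (%w. cosh (fst p) * ((snd w \<bullet> snd v) / jp (snd p) - (snd p \<bullet> snd v) * (snd p \<bullet> snd w) / jp (snd p) ^ 3)
   + fst w * sinh (fst p) * ?k p + fst v * sinh (fst p) * (snd p \<bullet> snd w / jp (snd p)) + fst v * fst w * cosh (fst p) * jp (snd p))) (at p)"
   by (rule has_derivative_eq_rhs[OF has_derivative_add[OF
      has_derivative_mult[OF cosh_fst_has_derivative jp_snd_has_derivative2]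
      has_derivative_mult[OF has_derivative_mult_right[OF sinh_fst_has_derivative] jp_snd_has_derivative]]])
     (simp add: fun_eq_iff algebra_simps)
  show "((%p. fst v * cosh (fst p)) has_derivative (%h. fst v * fst h * sinh (fst p))) (at p)"
   by (rule has_derivative_eq_rhs[OF has_derivative_mult_right[OF cosh_fst_has_derivative]]) (simp add: fun_eq_iff)
  show "((%p. cosh (fst p) *R snd v + (fst v * sinh (fst p)) *R snd p) has_derivative
   (%w. (fst w * sinh (fst p)) *R snd v + (fst v * sinh (fst p)) *R snd w + (fst v * fst w * cosh (fst p)) *R snd p)) (at p)"
   by (rule has_derivative_eq_rhs[OF has_derivative_add[OF
      has_derivative_scaleR_left[OF cosh_fst_has_derivative]
      has_derivative_scaleR[OF has_derivative_mult_right[OF sinh_fst_has_derivative] snd_has_derivative]]])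
     (simp add: fun_eq_iff algebra_simps)
 qed
 show "continuous_on UNIV (%p. FX'' p v w)"
  unfolding FX''_def using jp_pos(2) by (intro continuous_intros) auto
 show "FX'' p v w = FX'' p w v" by (simp add: FX''_def inner_commute algebra_simps)
 have "fst (FX p) = cosh (fst p) * jp (snd p)" "fst (FX p) > 0" using jp_pos(1)[of "snd p"] by (auto simp: FX_def)
 moreover have "mink (FX p) (FX p) = -1"
 proof -
  have "mink (FX p) (FX p) = sinh (fst p) * sinh (fst p) + cosh (fst p) * cosh (fst p) * (snd p \<bullet> snd p)
    - cosh (fst p) * cosh (fst p) * (jp (snd p) * jp (snd p))"
   by (simp add: mink_def FX_def inner_prod_def algebra_simps del: real_sqrt_mult_self)
  then show ?thesis unfolding jj ch by (simp add: algebra_simps)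
 qed
 ultimately show "FX p \<in> hyperboloid" by (simp add: hyperboloid_def)
 show "gfermi p v w = mink (FX' p v) (FX' p w)"
 proof -
  define j where "j = jp (snd p)"
  define a b where "a = snd p \<bullet> snd v" and "b = snd p \<bullet> snd w"
  define s c where "s = sinh (fst p)" and "c = cosh (fst p)"
  have j: "j * j = 1 + snd p \<bullet> snd p" "j ~= 0" using jj j0 by (auto simp: j_def)
  define i where "i = 1 / j"
  have i: "i * j = 1" using j by (simp add: i_def)
  have cs: "c * c = 1 + s * s" using ch by (simp add: c_def s_def)
  have "mink (FX' p v) (FX' p w) = fst v * c * (fst w * c)
    + (c * c * (snd v \<bullet> snd w) + c * (fst w * s) * a + fst v * s * c * b + fst v * s * (fst w * s) * (snd p \<bullet> snd p))
    - (c * (a * i) + fst v * s * j) * (c * (b * i) + fst w * s * j)"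
  proof -
   have F: "FX' p v = (c * (a * i) + fst v * s * j, fst v * c, c *R snd v + (fst v * s) *R snd p)"
    "FX' p w = (c * (b * i) + fst w * s * j, fst w * c, c *R snd w + (fst w * s) *R snd p)"
    by (simp_all add: FX'_def a_def b_def s_def c_def i_def j_def)
   have ab: "snd v \<bullet> snd p = a" "snd p \<bullet> snd w = b" by (simp_all add: a_def b_def inner_commute)
   show ?thesis unfolding F mink_def
    by (simp add: inner_prod_def inner_add_left inner_add_right ab) (simp add: algebra_simps)
  qed
  \<comment> \<open>Sorted so that the last three terms carry factors that vanish by cosh^2 = 1 +
    sinh^2, by i j = 1 and by j^2 = 1 + |x|^2.\<close>
  also have "... = fst v * fst w + c * c * (snd v \<bullet> snd w - a * b * (i * i))
    + fst v * fst w * (c * c - (1 + s * s)) + c * s * (fst w * a + fst v * b) * (1 - i * j)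
    + fst v * fst w * s * s * (1 + snd p \<bullet> snd p - j * j)"
   by (simp add: algebra_simps)
  also have "... = fst v * fst w + c * c * (snd v \<bullet> snd w - a * b * (i * i))"
   unfolding i j(1) cs by simp
  also have "... = gfermi p v w"
   by (cases p; cases v; cases w)
    (simp add: gfermi_def ghyp_def a_def b_def c_def i_def power2_eq_square, simp add: j(1)[symmetric] j_def)
  finally show ?thesis by simp
 qed
 show "FXi (FX p) = p"
 proof -
  have "jp (sinh (fst p)) = cosh (fst p)"
   using ch by (metis abs_of_pos cosh_real_pos inner_real_def real_sqrt_abs2)
  then show ?thesis by (simp add: FXi_def FX_def prod_eq_iff arsinh_sinh_real)
 qed
 show "FX (FXi Y) = Y" if Y: "Y \<in> hyperboloid"
 proof -
  let ?s = "fst (snd Y)" and ?y = "snd (snd Y)"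
  have c: "cosh (arsinh ?s) = jp ?s" by (simp add: cosh_arsinh_real power2_eq_square add.commute)
  note q = jp_pos[of ?s]
  have "jp ?s * jp ((1 / jp ?s) *R ?y) = sqrt ((1 + ?s \<bullet> ?s) * (1 + (?y \<bullet> ?y) / (1 + ?s \<bullet> ?s)))"
   by (simp add: real_sqrt_mult)
  also have "(1 + ?s \<bullet> ?s) * (1 + (?y \<bullet> ?y) / (1 + ?s \<bullet> ?s)) = 1 + ?s \<bullet> ?s + ?y \<bullet> ?y"
   using q(3) by (simp add: field_simps)
  also have "sqrt ... = fst Y" using Y by (simp add: hyperboloid_iff power2_norm_eq_inner inner_prod_def add.assoc)
  finally show ?thesis using q(2) by (simp add: FXi_def FX_def c prod_eq_iff)
 qed
 show "(FXi has_derivative FXi' Y) (at Y)"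
  unfolding FXi_def[abs_def] FXi'_def
 proof (intro has_derivative_Pair)
  have d1: "((%Y. fst (snd Y)) has_derivative (%h. fst (snd h))) (at Y)"
   and d2: "((%Y. snd (snd Y)) has_derivative (%h. snd (snd h))) (at Y)"
   by (auto intro!: derivative_eq_intros)
  have "(arsinh has_real_derivative 1 / jp (fst (snd Y))) (at (fst (snd Y)))"
   by (rule DERIV_cong[OF arsinh_real_has_field_derivative]) (simp add: power2_eq_square add.commute)
  from DERIV_compose_FDERIV[OF this d1]
  show "((%Y. arsinh (fst (snd Y))) has_derivative (%e. fst (snd e) / jp (fst (snd Y)))) (at Y)" by simp
  show "((%Y. (1 / jp (fst (snd Y))) *R snd (snd Y)) has_derivative
    (%e. (1 / jp (fst (snd Y))) *R snd (snd e) - (fst (snd Y) * fst (snd e) / jp (fst (snd Y)) ^ 3) *R snd (snd Y))) (at Y)"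
   by (rule has_derivative_eq_rhs[OF has_derivative_scaleR[OF jp_fst_snd_has_derivative d2]]) (simp add: fun_eq_iff)
 qed
 show "((%Y. FXi' Y e) has_derivative (%h. FXi'' Y h e)) (at Y)" by (rule FXi'_has_derivative)
qed

section \<open>Signed distance, distance to the base point, and barriers\<close>

lemma Ck2_fst:
 fixes p :: "real * 'a::euclidean_space"
 shows "Ck 2 (fst :: real * 'a => real)" and "dderiv fst p v = fst v"
proof -
 have 1: "(fst has_derivative fst) (at p)" for p :: "real * 'a"
  by (rule bounded_linear_imp_has_derivative[OF bounded_linear_fst])
 show "Ck 2 (fst :: real * 'a => real)"
  by (rule Ck2I(1)[where u'="%_. fst" and u''="%_ _ _. 0"]) (auto intro: 1)
 show "dderiv fst p v = fst v" by (rule dderivI[OF 1])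
qed

lemma fst_diff: "(fst :: real * 'a::euclidean_space => real) differentiable (at p)"
 by (rule fm.Ck2_differentiable[OF Ck2_fst(1)])

lemma sinh_cosh_DERIV:
 "(sinh has_real_derivative cosh t) (at t)" "(cosh has_real_derivative sinh t) (at (t::real))"
 by (auto intro!: derivative_eq_intros)

lemma mink_e1: "mink (FX p) (0, 1, 0) = sinh (fst p)" "mink (FX' p v) (0, 1, 0) = fst v * cosh (fst p)"
 by (simp_all add: mink_def FX_def FX'_def inner_prod_def)

lemma sinh_fst_eq: "(%p. mink (FX p) (0, 1, 0)) = (%p. sinh (fst p))"
 by (simp add: mink_e1)

text \<open>\<open>sinh (fst p)\<close> is an ambient linear function with known Hessian; the chain
  rule is then solved for the Hessian of \<open>fst\<close>. Gradient and Laplacian of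
  \<open>fst\<close> are found in the same way.\<close>

lemma hess_fst: "hess gfermi fst p v w = tanh (fst p) * (gfermi p v w - fst v * fst w)"
proof -
 have "hess gfermi (%p. sinh (fst p)) p v w = gfermi p v w * sinh (fst p)"
  using fm.Ck2_minkX(3)[of "(0,1,0)"] by (simp add: mink_e1)
 moreover have "hess gfermi (%p. sinh (fst p)) p v w
   = cosh (fst p) * hess gfermi fst p v w + sinh (fst p) * fst v * fst w"
  using fm.hess_compose[OF Ck2_fst(1), of sinh cosh sinh p v w] sinh_cosh_DERIV
  by (simp add: Ck2_fst(2) continuous_intros)
 ultimately have "cosh (fst p) * hess gfermi fst p v w = sinh (fst p) * (gfermi p v w - fst v * fst w)"
  by (simp add: algebra_simps)
 then show ?thesis by (simp add: tanh_def field_simps)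
qed

lemma gdot_fst: "fm.gdot fst fst p = 1"
proof -
 have "fm.gdot (%p. sinh (fst p)) (%p. sinh (fst p)) p = cosh (fst p) * cosh (fst p) * fm.gdot fst fst p"
  by (rule fm.gdot_compose[OF fst_diff fst_diff sinh_cosh_DERIV(1) sinh_cosh_DERIV(1)])
 moreover have "fm.gdot (%p. sinh (fst p)) (%p. sinh (fst p)) p = 1 + sinh (fst p) * sinh (fst p)"
  using fm.gdot_minkX[of "(0,1,0)" "(0,1,0)" p] by (simp add: mink_e1) (simp add: mink_def inner_prod_def)
 moreover have "cosh (fst p) * cosh (fst p) = 1 + sinh (fst p) * sinh (fst p)"
  using cosh_square_eq[of "fst p"] by (simp add: power2_eq_square)
 ultimately show ?thesis by (metis mult_cancel_left1 cosh_real_nonzero mult_eq_0_iff)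
qed

lemma laplace_fst: "laplace gfermi fst (p :: real * 'a::euclidean_space) = real DIM('a) * tanh (fst p)"
proof -
 have "laplace gfermi (%p. sinh (fst p)) p = (real DIM('a) + 1) * sinh (fst p)"
  using fm.laplace_minkX[of "(0,1,0)" p] by (simp add: mink_e1)
 moreover have "laplace gfermi (%p. sinh (fst p)) p = cosh (fst p) * laplace gfermi fst p + sinh (fst p)"
  using fm.laplace_compose[OF Ck2_fst(1), of sinh cosh sinh p] sinh_cosh_DERIV
  by (simp add: gdot_fst continuous_intros)
 ultimately have "cosh (fst p) * laplace gfermi fst p = real DIM('a) * sinh (fst p)" by (simp add: algebra_simps)
 then show ?thesis by (simp add: tanh_def field_simps)
qed

text \<open>The hyperbolic cosine of the distance from (0, q). By \<open>zq_eq\<close> it equals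
  cosh t cosh r, so sech r becomes \<open>cosh (fst p) / zq q p\<close>, built from two functions
  with explicit Hessians. The factor \<open>- 1 *\<close> fits the rules for constant
  multiples.\<close>

definition zq :: "'a::euclidean_space => real * 'a => real" where
 "zq q p = - 1 * mink (FX p) (FX (0, q))"

lemma zq_Z: "zq q p = fm.Z p (0, q)" by (simp add: zq_def fm.Z_def)

lemma zq_ge1: "zq q p >= 1" by (simp add: zq_Z fm.Z_ge1)

lemma zq_eq: "zq q p = cosh (fst p) * hyp.Z q (snd p)"
 by (simp add: zq_def hyp.Z_def FX_def HX_def mink_def inner_prod_def inner_commute algebra_simps)

lemma Ck2_zq:
 "Ck 2 (zq q)" "dderiv (zq q) p v = - mink (FX' p v) (FX (0, q))"
 "hess gfermi (zq q) p v w = gfermi p v w * zq q p"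
proof -
 show "Ck 2 (zq q)" unfolding zq_def[abs_def] by (rule Ck2_cmult(1)[OF fm.Ck2_minkX(1)])
 show "dderiv (zq q) p v = - mink (FX' p v) (FX (0, q))"
  unfolding zq_def[abs_def] Ck2_cmult(2)[OF fm.Ck2_minkX(1)] fm.Ck2_minkX(2) by simp
 show "hess gfermi (zq q) p v w = gfermi p v w * zq q p"
  unfolding zq_def[abs_def] fm.hess_cmult[OF fm.Ck2_minkX(1)] fm.Ck2_minkX(3) by simp
qed

lemma zq_diff: "zq q differentiable (at p)"
 by (rule fm.Ck2_differentiable[OF Ck2_zq(1)])

lemma laplace_zq: "laplace gfermi (zq q) (p :: real * 'a::euclidean_space) = (real DIM('a) + 1) * zq q p"
 unfolding zq_def[abs_def] fm.laplace_cmult[OF fm.Ck2_minkX(1)] fm.laplace_minkX by simp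

lemma gdot_zq: "fm.gdot (zq q) (zq q) p = (zq q p)\<^sup>2 - 1"
proof -
 have "fm.gdot (zq q) (zq q) p = (-1) * (-1) * fm.gdot (%p. mink (FX p) (FX (0, q))) (%p. mink (FX p) (FX (0, q))) p"
  unfolding zq_def[abs_def]
  by (rule fm.gdot_compose) (auto intro!: fm.Ck2_differentiable fm.Ck2_minkX(1) derivative_eq_intros)
 then show ?thesis by (simp add: fm.gdot_minkX zq_def power2_eq_square)
qed

lemma gdot_fst_zq: "fm.gdot fst (zq q) p = tanh (fst p) * zq q p"
proof -
 have "fm.gdot (%p. sinh (fst p)) (zq q) p = cosh (fst p) * 1 * fm.gdot fst (zq q) p"
  by (rule fm.gdot_compose[OF fst_diff zq_diff sinh_cosh_DERIV(1) DERIV_ident])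
 moreover have "fm.gdot (%p. sinh (fst p)) (zq q) p
   = 1 * (-1) * fm.gdot (%p. mink (FX p) (0, 1, 0)) (%p. mink (FX p) (FX (0, q))) p"
  unfolding zq_def[abs_def] sinh_fst_eq[symmetric]
  by (rule fm.gdot_compose[where \<phi>="%x. x" and \<psi>="%x. - 1 * x"])
    (rule fm.Ck2_differentiable[OF fm.Ck2_minkX(1)] | rule DERIV_ident | rule DERIV_cmult_Id)+
 moreover have "fm.gdot (%p. mink (FX p) (0, 1, 0)) (%p. mink (FX p) (FX (0, q))) p = - sinh (fst p) * zq q p"
 proof -
  have "mink (0, 1, 0) (FX (0, q)) = 0" by (simp add: mink_def FX_def inner_prod_def)
  then show ?thesis unfolding fm.gdot_minkX unfolding mink_e1 zq_def by simp
 qed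
 ultimately have "cosh (fst p) * fm.gdot fst (zq q) p = sinh (fst p) * zq q p" by simp
 then show ?thesis by (simp add: tanh_def field_simps)
qed

lemma weight_eq: "weight q \<mu> \<delta> p = sech (\<mu> * fst p) * (cosh (fst p) / zq q p) powr \<delta>"
proof -
 have "sech (rdist ghyp q (snd p)) = cosh (fst p) / zq q p"
  unfolding hyp.rdist_eq sech_def zq_eq using hyp.Z_ge1[of q "snd p"] by simp
 then show ?thesis by (simp add: weight_def case_prod_beta)
qed

definition barrier :: "'a::euclidean_space => real => (real => real) => real * 'a => real" where
 "barrier q \<delta> \<phi> p = \<phi> (fst p) * (cosh (fst p) / zq q p) powr \<delta>"

text \<open>Regrouped as F(t) P(z) with F = \<phi> cosh^\<delta> and P(z) = z^(-\<delta>), so that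
  only Laplacians and gradient products of t and z enter. In the result the factor next to \<phi> is
  sech^2 t times the quotient of the Laplacian of (sech r)^\<delta> by that function.\<close>

lemma barrier_calculus:
 fixes \<phi> \<phi>' \<phi>'' :: "real => real" and p :: "real * 'a::euclidean_space"
 assumes d1: "!!t. (\<phi> has_real_derivative \<phi>' t) (at t)" and d2: "!!t. (\<phi>' has_real_derivative \<phi>'' t) (at t)"
  and c: "continuous_on UNIV \<phi>''"
 shows "Ck 2 (barrier q \<delta> \<phi>)"
  and "laplace gfermi (barrier q \<delta> \<phi>) p =
   (\<phi>'' (fst p) + real DIM('a) * tanh (fst p) * \<phi>' (fst p)
    + \<phi> (fst p) * ((1 - (tanh (fst p))\<^sup>2) * (\<delta>\<^sup>2 - (real DIM('a) - 1) * \<delta>) - \<delta> * (\<delta> + 1) / (zq q p)\<^sup>2))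
   * (cosh (fst p) / zq q p) powr \<delta>"
proof -
 define F where "F t = \<phi> t * cosh t powr \<delta>" for t
 define F' where "F' t = (\<phi>' t + \<delta> * tanh t * \<phi> t) * cosh t powr \<delta>" for t
 define F'' where "F'' t = (\<phi>'' t + 2 * \<delta> * tanh t * \<phi>' t
   + (\<delta>\<^sup>2 * (tanh t)\<^sup>2 + \<delta> * (1 - (tanh t)\<^sup>2)) * \<phi> t) * cosh t powr \<delta>" for t
 define P where "P z = z powr (- \<delta>)" for z :: real
 define P' where "P' z = - \<delta> * z powr (- \<delta> - 1)" for z :: real
 define P'' where "P'' z = \<delta> * (\<delta> + 1) * z powr (- \<delta> - 2)" for z :: real
 have cd: "((%t. cosh t powr \<delta>) has_real_derivative \<delta> * tanh t * cosh t powr \<delta>) (at t)" for t :: real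
  by (rule DERIV_cong[OF DERIV_chain2[OF has_real_derivative_powr[OF cosh_real_pos] sinh_cosh_DERIV(2)]])
    (simp add: powr_diff tanh_def)
 have td: "(tanh has_real_derivative 1 - (tanh t)\<^sup>2) (at t)" for t :: real
  by (auto intro!: derivative_eq_intros)
 have Fd: "(F has_real_derivative F' t) (at t)" for t
  unfolding F_def[abs_def] F'_def
  by (rule DERIV_cong[OF DERIV_mult[OF d1 cd]]) (simp add: algebra_simps)
 have Fd': "(F' has_real_derivative F'' t) (at t)" for t
  unfolding F'_def[abs_def] F''_def
  by (rule DERIV_cong[OF DERIV_mult[OF DERIV_add[OF d2 DERIV_mult[OF DERIV_cmult[OF td] d1]] cd]])
    (simp add: algebra_simps power2_eq_square)
 have cont: "continuous_on UNIV \<phi>" "continuous_on UNIV \<phi>'" "continuous_on UNIV (tanh :: real => real)"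
  using d1 d2 td by (auto intro!: DERIV_continuous_on)
 have Fc: "continuous_on UNIV F''"
  unfolding F''_def using c cont by (intro continuous_intros) auto
 have Fc': "continuous_on UNIV (%p :: real * 'a. F'' (fst p))"
  by (rule continuous_on_compose2[OF Fc]) (auto intro: continuous_intros)
 have Pd: "(P has_real_derivative P' z) (at z)" if "z > 0" for z
  unfolding P_def[abs_def] P'_def using that by (auto intro!: derivative_eq_intros simp: powr_diff)
 have Pd': "(P' has_real_derivative P'' z) (at z)" if "z > 0" for z
  unfolding P'_def[abs_def] P''_def
  by (rule DERIV_cong[OF DERIV_cmult[OF has_real_derivative_powr[OF that]]]) (simp add: algebra_simps)
 have zp: "zq q p > 0" for p using zq_ge1[of q p] by linarith
 have zc: "continuous_on UNIV (zq q)" using Ck2_continuous[OF Ck2_zq(1)] .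
 have Pc: "continuous_on UNIV (%p. P'' (zq q p))"
  unfolding P''_def using zp by (intro continuous_intros zc) (auto simp: less_imp_neq[symmetric])
 have eq: "barrier q \<delta> \<phi> = (%p. F (fst p) * P (zq q p))"
  using zp by (auto simp: barrier_def F_def P_def fun_eq_iff powr_divide powr_minus field_simps less_imp_le)
 note CF = Ck2_compose[OF Ck2_fst(1), of F F' F'', OF Fd Fd' Fc']
 note CP = Ck2_compose[OF Ck2_zq(1)[of q], where \<phi>=P and \<phi>'=P' and \<phi>''=P'', OF Pd[OF zp] Pd'[OF zp] Pc]
 show "Ck 2 (barrier q \<delta> \<phi>)" unfolding eq by (rule Ck2_mult(1)[OF CF(1) CP(1)])
 have lF: "laplace gfermi (%p. F (fst p)) p = F' (fst p) * (real DIM('a) * tanh (fst p)) + F'' (fst p)"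
  using fm.laplace_compose[OF Ck2_fst(1), of F F' F'' p, OF Fd Fd' Fc'] by (simp add: laplace_fst gdot_fst)
 have lP: "laplace gfermi (%p. P (zq q p)) p = P' (zq q p) * ((real DIM('a) + 1) * zq q p) + P'' (zq q p) * ((zq q p)\<^sup>2 - 1)"
  using fm.laplace_compose[OF Ck2_zq(1)[of q], where \<phi>=P and \<phi>'=P' and \<phi>''=P'' and p=p, OF Pd[OF zp] Pd'[OF zp] Pc] by (simp add: laplace_zq gdot_zq)
 have gFP: "fm.gdot (%p. F (fst p)) (%p. P (zq q p)) p = F' (fst p) * P' (zq q p) * (tanh (fst p) * zq q p)"
  using fm.gdot_compose[OF fst_diff zq_diff Fd Pd[OF zp]] by (simp only: gdot_fst_zq)
 define z where "z = zq q p"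
 define T where "T = tanh (fst p)"
 define C where "C = cosh (fst p) powr \<delta>"
 define W where "W = z powr (- \<delta>)"
 have z: "z > 0" "z ~= 0" using zp[of p] by (auto simp: z_def)
 have PW: "P z = W" "P' z * z = - \<delta> * W" "P'' z * (z\<^sup>2 - 1) = \<delta> * (\<delta> + 1) * (1 - 1 / z\<^sup>2) * W"
  using z by (auto simp: P_def P'_def P''_def W_def powr_diff field_simps)
 have CW: "(cosh (fst p) / zq q p) powr \<delta> = C * W"
  using z by (simp add: C_def W_def powr_divide powr_minus z_def[symmetric] field_simps)
 have "laplace gfermi (barrier q \<delta> \<phi>) p =
   F (fst p) * (P' z * z * (real DIM('a) + 1) + P'' z * (z\<^sup>2 - 1)) + P z * (F' (fst p) * (real DIM('a) * T) + F'' (fst p))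
   + 2 * (F' (fst p) * T * (P' z * z))"
  unfolding eq fm.laplace_mult[OF CF(1) CP(1)] lF lP gFP by (simp add: z_def T_def algebra_simps)
 also have "... = (\<phi>'' (fst p) + real DIM('a) * T * \<phi>' (fst p)
    + \<phi> (fst p) * ((1 - T\<^sup>2) * (\<delta>\<^sup>2 - (real DIM('a) - 1) * \<delta>) - \<delta> * (\<delta> + 1) * (1 / z\<^sup>2))) * (C * W)"
  unfolding PW F_def F'_def F''_def C_def[symmetric] T_def[symmetric]
  by (simp add: algebra_simps power2_eq_square)
 finally show "laplace gfermi (barrier q \<delta> \<phi>) p =
   (\<phi>'' (fst p) + real DIM('a) * tanh (fst p) * \<phi>' (fst p)
    + \<phi> (fst p) * ((1 - (tanh (fst p))\<^sup>2) * (\<delta>\<^sup>2 - (real DIM('a) - 1) * \<delta>) - \<delta> * (\<delta> + 1) / (zq q p)\<^sup>2))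
   * (cosh (fst p) / zq q p) powr \<delta>"
  by (simp add: CW T_def z_def)
qed

section \<open>Bounded derivatives of the logarithm of the weight\<close>

context hyperbolic_chart
begin

lemma grad_boundI: "(!!p. u differentiable (at p)) ==> (!!p v. \<bar>dderiv u p v\<bar> <= C * nrm p v) ==> grad_bound u C"
 by (simp add: grad_bound_def)

lemma grad_bound_add:
 assumes "Ck 2 u" "Ck 2 w" "grad_bound u A" "grad_bound w B"
 shows "grad_bound (%p. u p + w p) (A + B)"
proof (rule grad_boundI[OF Ck2_differentiable[OF Ck2_add(1)[OF assms(1,2)]]])
 fix p v
 have "\<bar>dderiv u p v\<bar> <= A * nrm p v" "\<bar>dderiv w p v\<bar> <= B * nrm p v"
  using assms(3,4) by (auto simp: grad_bound_def)
 then show "\<bar>dderiv (%p. u p + w p) p v\<bar> <= (A + B) * nrm p v"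
  unfolding Ck2_add(2)[OF assms(1,2)] distrib_right by linarith
qed

lemma hess_bound_add:
 assumes "Ck 2 u" "Ck 2 w" "hess_bound u A" "hess_bound w B"
 shows "hess_bound (%p. u p + w p) (A + B)"
 unfolding hess_bound_def
proof (intro allI)
 fix p v a
 have "\<bar>hess G u p v a\<bar> <= A * nrm p v * nrm p a" "\<bar>hess G w p v a\<bar> <= B * nrm p v * nrm p a"
  using assms(3,4) by (auto simp: hess_bound_def)
 then show "\<bar>hess G (%p. u p + w p) p v a\<bar> <= (A + B) * nrm p v * nrm p a"
  unfolding hess_add[OF assms(1,2)] distrib_right by linarith
qed

lemma grad_bound_cmult:
 assumes "Ck 2 u" "grad_bound u A"
 shows "grad_bound (%p. c * u p) (\<bar>c\<bar> * A)"
proof (rule grad_boundI[OF Ck2_differentiable[OF Ck2_cmult(1)[OF assms(1)]]])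
 fix p v
 have "\<bar>dderiv u p v\<bar> <= A * nrm p v" using assms(2) by (auto simp: grad_bound_def)
 then show "\<bar>dderiv (%p. c * u p) p v\<bar> <= \<bar>c\<bar> * A * nrm p v"
  unfolding Ck2_cmult(2)[OF assms(1)] abs_mult mult.assoc by (intro mult_left_mono) auto
qed

lemma hess_bound_cmult:
 assumes "Ck 2 u" "hess_bound u A"
 shows "hess_bound (%p. c * u p) (\<bar>c\<bar> * A)"
 unfolding hess_bound_def
proof (intro allI)
 fix p v a
 have "\<bar>hess G u p v a\<bar> <= A * nrm p v * nrm p a" using assms(2) by (auto simp: hess_bound_def)
 then show "\<bar>hess G (%p. c * u p) p v a\<bar> <= \<bar>c\<bar> * A * nrm p v * nrm p a"
  unfolding hess_cmult[OF assms(1)] abs_mult mult.assoc by (intro mult_left_mono) auto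
qed

lemma bounds_compose:
 fixes \<phi> :: "real => real"
 assumes u: "Ck 2 u" and g: "grad_bound u g" and h: "hess_bound u h"
  and d: "!!p. (\<phi> has_real_derivative \<phi>' (u p)) (at (u p))"
   "!!p. (\<phi>' has_real_derivative \<phi>'' (u p)) (at (u p))" "continuous_on UNIV (%p. \<phi>'' (u p))"
  and b: "!!p. \<bar>\<phi>' (u p)\<bar> <= a" "!!p. \<bar>\<phi>'' (u p)\<bar> <= b"
 shows "grad_bound (%p. \<phi> (u p)) (a * g)" "hess_bound (%p. \<phi> (u p)) (a * h + b * g\<^sup>2)"
proof -
 note C = Ck2_compose[OF u d]
 have gb: "\<bar>dderiv u p v\<bar> <= g * nrm p v" for p v using g by (simp add: grad_bound_def)
 have hb: "\<bar>hess G u p v w\<bar> <= h * nrm p v * nrm p w" for p v w using h by (simp add: hess_bound_def)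
 have a0: "a >= 0" "b >= 0" using b[of undefined] by linarith+
 have g0: "g >= 0" using grad_bound_nonneg[OF g] .
 show "grad_bound (%p. \<phi> (u p)) (a * g)"
 proof (rule grad_boundI[OF Ck2_differentiable[OF C(1)]])
  fix p v show "\<bar>dderiv (%p. \<phi> (u p)) p v\<bar> <= a * g * nrm p v"
   unfolding C(2) abs_mult mult.assoc by (intro mult_mono b gb) (use a0 in auto)
 qed
 show "hess_bound (%p. \<phi> (u p)) (a * h + b * g\<^sup>2)"
  unfolding hess_bound_def
 proof (intro allI)
  fix p v w
  have 1: "\<bar>\<phi>' (u p) * hess G u p v w\<bar> <= a * (h * nrm p v * nrm p w)"
   unfolding abs_mult by (intro mult_mono b hb) (use a0 in auto)
  have 2: "\<bar>\<phi>'' (u p) * dderiv u p v * dderiv u p w\<bar> <= b * (g * nrm p v) * (g * nrm p w)"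
   unfolding abs_mult by (intro mult_mono b gb) (use a0 g0 in auto)
  show "\<bar>hess G (%p. \<phi> (u p)) p v w\<bar> <= (a * h + b * g\<^sup>2) * nrm p v * nrm p w"
   unfolding hess_compose[OF u d] using 1 2
   by (simp add: algebra_simps power2_eq_square)
 qed
qed

lemma G_bound: "\<bar>G p v w\<bar> <= nrm p v * nrm p w"
 using G_Cauchy_Schwarz[of p v w] by (simp add: nrm_def)

lemma dderiv_Z_bound: "\<bar>mink (X' p v) (X q)\<bar> <= nrm p v * sqrt ((Z p q)\<^sup>2 - 1)"
 using mink_tangent_bound[OF X_in X_in mink_X_X'(1), of p v q] by (simp add: nrm_def G_eq Z_def)

lemma hb2_hb:
 assumes "0 < \<alpha>" "\<alpha> <= 1" "hb2 \<alpha> w M"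
 shows "hb \<alpha> w (2 * M)"
 using hb_LipschitzI[OF assms(1,2), of w M] hb2_D[OF assms(3)] grad_bound_Lipschitz by blast

lemma gdot_hb:
 assumes a: "0 < \<alpha>" "\<alpha> <= 1" and u: "Ck 2 u" "grad_bound u A" "hess_bound u A"
  and w: "Ck 2 w" "grad_bound w B" "hess_bound w B"
 shows "hb \<alpha> (gdot u w) (4 * real DIM('w) * A * B)"
proof -
 have AB: "A >= 0" "B >= 0" using u w grad_bound_nonneg by blast+
 have "hb \<alpha> (gdot u w) (2 * (2 * real DIM('w) * A * B))"
 proof (rule hb_LipschitzI[OF a])
  show "\<bar>gdot u w p\<bar> <= 2 * real DIM('w) * A * B" for p
  proof -
   have "\<bar>gdot u w p\<bar> <= real DIM('w) * (A * B)" by (rule gdot_bound[OF u(2) w(2)])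
   also have "... <= 2 * (real DIM('w) * (A * B))" using AB by simp
   finally show ?thesis by (simp add: mult.assoc)
  qed
  show "\<bar>gdot u w p - gdot u w q\<bar> <= 2 * real DIM('w) * A * B * hdist p q" for p q
   by (rule gdot_Lipschitz[OF u w])
 qed
 then show ?thesis by (simp add: mult.assoc)
qed

end

lemma fst_bound: "\<bar>fst v\<bar> <= fm.nrm p v"
proof -
 have "gfermi p v v = (fst v)\<^sup>2 + (cosh (fst p))\<^sup>2 * ghyp (snd p) (snd v) (snd v)"
  by (cases p; cases v) (simp add: gfermi_def power2_eq_square)
 then have "(fst v)\<^sup>2 <= gfermi p v v" using hyp.G_nonneg[of "snd p" "snd v"] by simp
 then have "sqrt ((fst v)\<^sup>2) <= sqrt (gfermi p v v)" by (rule real_sqrt_le_mono)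
 then show ?thesis by (simp add: fm.nrm_def)
qed

lemma abs_tanh_le: "\<bar>tanh t\<bar> <= (1::real)"
 using tanh_real_lt_1[of t] tanh_real_gt_neg1[of t] by (simp add: abs_le_iff)

lemma tanh_sq_le: "(tanh t)\<^sup>2 <= (1::real)"
 using abs_tanh_le[of t] by (simp add: abs_square_le_1)

lemma fst_bounds:
 shows "fm.grad_bound (fst :: real * 'a::euclidean_space => real) 1"
  and "fm.hess_bound (fst :: real * 'a => real) 2"
proof -
 show "fm.grad_bound (fst :: real * 'a => real) 1"
  by (rule fm.grad_boundI[OF fst_diff]) (use fst_bound in "auto simp: Ck2_fst(2)")
 show "fm.hess_bound (fst :: real * 'a => real) 2"
  unfolding fm.hess_bound_def
 proof (intro allI)
  fix p v w :: "real * 'a"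
  have "\<bar>gfermi p v w - fst v * fst w\<bar> <= \<bar>gfermi p v w\<bar> + \<bar>fst v\<bar> * \<bar>fst w\<bar>"
   using abs_triangle_ineq4[of "gfermi p v w" "fst v * fst w"] by (simp add: abs_mult)
  also have "... <= fm.nrm p v * fm.nrm p w + fm.nrm p v * fm.nrm p w"
   by (intro add_mono fm.G_bound mult_mono fst_bound) auto
  finally have "\<bar>tanh (fst p)\<bar> * \<bar>gfermi p v w - fst v * fst w\<bar> <= 1 * (2 * (fm.nrm p v * fm.nrm p w))"
   by (intro mult_mono abs_tanh_le) auto
  then show "\<bar>hess gfermi fst p v w\<bar> <= 2 * fm.nrm p v * fm.nrm p w"
   unfolding hess_fst by (simp add: abs_mult)
 qed
qed

text \<open>The gradient of z has length at most sqrt (z^2 - 1) <= z and its Hessian is z times the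
  metric, so division by z leaves bounded quantities.\<close>

lemma ln_zq_bounds:
 fixes q :: "'a::euclidean_space"
 shows "Ck 2 (%p. ln (zq q p))" "fm.grad_bound (%p. ln (zq q p)) 1" "fm.hess_bound (%p. ln (zq q p)) 2"
proof -
 have zp: "zq q p > 0" for p using zq_ge1[of q p] by linarith
 have zc: "continuous_on UNIV (zq q)" using Ck2_continuous[OF Ck2_zq(1)] .
 have d1: "(ln has_real_derivative 1 / zq q p) (at (zq q p))" for p using zp[of p] by (auto intro!: derivative_eq_intros)
 have d2: "((%z. 1 / z) has_real_derivative - (1 / (zq q p)\<^sup>2)) (at (zq q p))" for p
  using zp[of p] by (auto intro!: derivative_eq_intros simp: power2_eq_square)
 have c: "continuous_on UNIV (%p. - (1 / (zq q p)\<^sup>2))"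
  using less_imp_neq[OF zp] by (intro continuous_intros zc ballI) (metis power_eq_0_iff)
 note C = Ck2_compose[where \<phi>=ln and \<phi>'="%z. 1 / z" and \<phi>''="%z. - (1 / z\<^sup>2)", OF Ck2_zq(1)[of q] d1 d2 c]
 show "Ck 2 (%p. ln (zq q p))" by (rule C(1))
 have gz: "\<bar>dderiv (zq q) p v\<bar> / zq q p <= fm.nrm p v" for p v
 proof -
  have "\<bar>dderiv (zq q) p v\<bar> <= fm.nrm p v * sqrt ((zq q p)\<^sup>2 - 1)"
   unfolding Ck2_zq(2) zq_Z using fm.dderiv_Z_bound[of p v "(0, q)"] by simp
  also have "... <= fm.nrm p v * zq q p"
   using zp[of p] by (intro mult_left_mono real_le_lsqrt) auto
  finally show ?thesis using zp[of p] by (simp add: field_simps)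
 qed
 show "fm.grad_bound (%p. ln (zq q p)) 1"
  by (rule fm.grad_boundI[OF fm.Ck2_differentiable[OF C(1)]])
    (unfold C(2), use gz zp less_imp_le in "metis abs_divide abs_of_pos mult_1 times_divide_eq_left")
 show "fm.hess_bound (%p. ln (zq q p)) 2"
  unfolding fm.hess_bound_def
 proof (intro allI)
  fix p v w :: "real * 'a"
  have "hess gfermi (%p. ln (zq q p)) p v w = gfermi p v w - (dderiv (zq q) p v / zq q p) * (dderiv (zq q) p w / zq q p)"
   using fm.hess_compose[where \<phi>=ln and \<phi>'="%z. 1 / z" and \<phi>''="%z. - (1 / z\<^sup>2)", OF Ck2_zq(1)[of q] d1 d2 c] zp[of p]
   by (simp add: Ck2_zq(3) power2_eq_square less_imp_neq[symmetric])
  also have "\<bar>...\<bar> <= \<bar>gfermi p v w\<bar> + \<bar>dderiv (zq q) p v / zq q p\<bar> * \<bar>dderiv (zq q) p w / zq q p\<bar>"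
   using abs_triangle_ineq4 by (metis abs_mult)
  also have "... <= fm.nrm p v * fm.nrm p w + fm.nrm p v * fm.nrm p w"
   using gz[of p] zp[of p] by (intro add_mono fm.G_bound mult_mono) auto
  finally show "\<bar>hess gfermi (%p. ln (zq q p)) p v w\<bar> <= 2 * fm.nrm p v * fm.nrm p w" by simp
 qed
qed

lemma ln_cosh_bounds:
 fixes a :: real
 shows "Ck 2 (%p :: real * 'a::euclidean_space. ln (cosh (a * fst p)))"
  "fm.grad_bound (%p :: real * 'a. ln (cosh (a * fst p))) \<bar>a\<bar>"
  "fm.hess_bound (%p :: real * 'a. ln (cosh (a * fst p))) (2 * \<bar>a\<bar> + a\<^sup>2)"
proof -
 have d1: "((%t. ln (cosh (a * t))) has_real_derivative a * tanh (a * t)) (at t)" for t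
  by (auto intro!: derivative_eq_intros simp: tanh_def)
 have d2: "((%t. a * tanh (a * t)) has_real_derivative a\<^sup>2 * (1 - (tanh (a * t))\<^sup>2)) (at t)" for t
  by (auto intro!: derivative_eq_intros simp: power2_eq_square)
 have c: "continuous_on UNIV (%p :: real * 'a. a\<^sup>2 * (1 - (tanh (a * fst p))\<^sup>2))"
  by (intro continuous_intros) auto
 have b1: "\<bar>a * tanh (a * t)\<bar> <= \<bar>a\<bar>" for t using abs_tanh_le[of "a * t"] by (simp add: abs_mult mult_left_le)
 have b2: "\<bar>a\<^sup>2 * (1 - (tanh (a * t))\<^sup>2)\<bar> <= a\<^sup>2" for t
  using tanh_sq_le[of "a * t"] by (simp add: abs_mult mult_left_le)
 note D = Ck2_compose[where \<phi>="%t. ln (cosh (a * t))" and \<phi>'="%t. a * tanh (a * t)" and \<phi>''="%t. a\<^sup>2 * (1 - (tanh (a * t))\<^sup>2)", OF Ck2_fst(1) d1 d2 c]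
 note B = fm.bounds_compose[where \<phi>="%t. ln (cosh (a * t))" and \<phi>'="%t. a * tanh (a * t)" and \<phi>''="%t. a\<^sup>2 * (1 - (tanh (a * t))\<^sup>2)", OF Ck2_fst(1) fst_bounds d1 d2 c b1 b2]
 show "Ck 2 (%p :: real * 'a. ln (cosh (a * fst p)))" by (rule D(1))
 show "fm.grad_bound (%p :: real * 'a. ln (cosh (a * fst p))) \<bar>a\<bar>" using B(1) by simp
 show "fm.hess_bound (%p :: real * 'a. ln (cosh (a * fst p))) (2 * \<bar>a\<bar> + a\<^sup>2)" using B(2) by (simp add: mult.commute)
qed

text \<open>The logarithm of the weight. Its gradient is the drift of the conjugated operator, and
  unlike the weight itself it controls relative sizes: both derivatives are bounded on the whole
  space. Constant factors are explicit to fit the rules for sums and multiples.\<close>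

definition omega :: "'a::euclidean_space => real => real => real * 'a => real" where
 "omega q \<mu> \<delta> p = - 1 * ln (cosh (\<mu> * fst p)) + (\<delta> * ln (cosh (1 * fst p)) + (- \<delta>) * ln (zq q p))"

lemma omega_bounds:
 fixes q :: "'a::euclidean_space"
 shows "Ck 2 (omega q \<mu> \<delta>)" and "\<exists>C. fm.grad_bound (omega q \<mu> \<delta>) C \<and> fm.hess_bound (omega q \<mu> \<delta>) C"
proof -
 note l1 = ln_cosh_bounds[of \<mu>] and l2 = ln_cosh_bounds[of 1] and l3 = ln_zq_bounds[of q]
 note c1 = Ck2_cmult(1)[OF l1(1), of "-1"] and c2 = Ck2_cmult(1)[OF l2(1), of \<delta>] and c3 = Ck2_cmult(1)[OF l3(1), of "-\<delta>"]
 note a = Ck2_add(1)[OF c2 c3]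
 show "Ck 2 (omega q \<mu> \<delta>)" unfolding omega_def[abs_def] by (rule Ck2_add(1)[OF c1 a])
 have "\<exists>C. fm.grad_bound (omega q \<mu> \<delta>) C" unfolding omega_def[abs_def]
  using fm.grad_bound_add[OF c1 a fm.grad_bound_cmult[OF l1(1,2)] fm.grad_bound_add[OF c2 c3
     fm.grad_bound_cmult[OF l2(1,2)] fm.grad_bound_cmult[OF l3(1,2)]]] by blast
 then obtain A where A: "fm.grad_bound (omega q \<mu> \<delta>) A" by blast
 have "\<exists>C. fm.hess_bound (omega q \<mu> \<delta>) C" unfolding omega_def[abs_def]
  using fm.hess_bound_add[OF c1 a fm.hess_bound_cmult[OF l1(1,3)] fm.hess_bound_add[OF c2 c3
     fm.hess_bound_cmult[OF l2(1,3)] fm.hess_bound_cmult[OF l3(1,3)]]] by blast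
 then obtain B where B: "fm.hess_bound (omega q \<mu> \<delta>) B" by blast
 have "fm.grad_bound (omega q \<mu> \<delta>) (max A B)"
  using A unfolding fm.grad_bound_def by (meson max.cobounded1 mult_right_mono order_trans fm.nrm_nonneg)
 moreover have "fm.hess_bound (omega q \<mu> \<delta>) (max A B)"
  using B unfolding fm.hess_bound_def
  by (meson max.cobounded2 mult_right_mono order_trans fm.nrm_nonneg)
 ultimately show "\<exists>C. fm.grad_bound (omega q \<mu> \<delta>) C \<and> fm.hess_bound (omega q \<mu> \<delta>) C" by blast
qed

section \<open>The operator conjugated by the weight\<close>

lemma weight_pos: "weight q \<mu> \<delta> p > 0"
proof -
 have "cosh (fst p) / zq q p > 0" using zq_ge1[of q p] by (intro divide_pos_pos) auto
 then show ?thesis unfolding weight_eq sech_def by (intro mult_pos_pos) auto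
qed

lemma weight_exp: "weight q \<mu> \<delta> p = exp (omega q \<mu> \<delta> p)"
proof -
 have z: "zq q p > 0" using zq_ge1[of q p] by linarith
 then show ?thesis
  unfolding weight_eq omega_def sech_def powr_def
  by (simp add: exp_add exp_diff exp_minus ln_div field_simps)
qed

text \<open>The Laplacian of the weight divided by the weight, minus the potential \<open>V\<close>;
  see \<open>weight_calculus\<close>.\<close>

definition cc :: "'a::euclidean_space => real => real => (real => real) => real * 'a => real" where
 "cc q \<mu> \<delta> V p = \<mu>\<^sup>2 * (2 * (tanh (\<mu> * fst p))\<^sup>2 - 1) - real DIM('a) * \<mu> * tanh (fst p) * tanh (\<mu> * fst p)
   + (1 - (tanh (fst p))\<^sup>2) * (\<delta>\<^sup>2 - (real DIM('a) - 1) * \<delta>) - \<delta> * (\<delta> + 1) / (zq q p)\<^sup>2 - V (fst p)"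

definition Lt :: "'a::euclidean_space => real => real => (real => real) => (real * 'a => real) => real * 'a => real" where
 "Lt q \<mu> \<delta> V w p = laplace gfermi w p + 2 * fm.gdot (omega q \<mu> \<delta>) w p + cc q \<mu> \<delta> V p * w p"

lemma sech_DERIV:
 "((%t. sech (\<mu> * t)) has_real_derivative - \<mu> * tanh (\<mu> * t) * sech (\<mu> * t)) (at t)"
 "((%t. - \<mu> * tanh (\<mu> * t) * sech (\<mu> * t)) has_real_derivative
   \<mu>\<^sup>2 * (2 * (tanh (\<mu> * t))\<^sup>2 - 1) * sech (\<mu> * t)) (at t)"
proof -
 show d: "((%t. sech (\<mu> * t)) has_real_derivative - \<mu> * tanh (\<mu> * t) * sech (\<mu> * t)) (at t)" for t
  unfolding sech_def by (auto intro!: derivative_eq_intros simp: tanh_def field_simps)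
 have t: "((%t. - \<mu> * tanh (\<mu> * t)) has_real_derivative - (\<mu>\<^sup>2) * (1 - (tanh (\<mu> * t))\<^sup>2)) (at t)"
  by (auto intro!: derivative_eq_intros simp: power2_eq_square)
 show "((%t. - \<mu> * tanh (\<mu> * t) * sech (\<mu> * t)) has_real_derivative
   \<mu>\<^sup>2 * (2 * (tanh (\<mu> * t))\<^sup>2 - 1) * sech (\<mu> * t)) (at t)"
  by (rule DERIV_cong[OF DERIV_mult[OF t d]]) (simp add: algebra_simps power2_eq_square)
qed

lemma weight_calculus:
 fixes q :: "'a::euclidean_space"
 shows "Ck 2 (weight q \<mu> \<delta>)" and "laplace gfermi (weight q \<mu> \<delta>) p = (cc q \<mu> \<delta> V p + V (fst p)) * weight q \<mu> \<delta> p"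
  and "w differentiable (at p) ==> fm.gdot (weight q \<mu> \<delta>) w p = weight q \<mu> \<delta> p * fm.gdot (omega q \<mu> \<delta>) w p"
proof -
 have e: "weight q \<mu> \<delta> = barrier q \<delta> (%t. sech (\<mu> * t))"
  by (simp add: weight_eq barrier_def fun_eq_iff)
 have c: "continuous_on UNIV (%t. \<mu>\<^sup>2 * (2 * (tanh (\<mu> * t))\<^sup>2 - 1) * sech (\<mu> * t))"
  unfolding sech_def by (intro continuous_intros) auto
 note B = barrier_calculus[OF sech_DERIV(1)[of \<mu>] sech_DERIV(2)[of \<mu>] c, of q \<delta>]
 show "Ck 2 (weight q \<mu> \<delta>)" unfolding e by (rule B(1))
 show "laplace gfermi (weight q \<mu> \<delta>) p = (cc q \<mu> \<delta> V p + V (fst p)) * weight q \<mu> \<delta> p"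
  unfolding e B(2) cc_def barrier_def by (simp add: algebra_simps)
 assume w: "w differentiable (at p)"
 have "fm.gdot (%p. exp (omega q \<mu> \<delta> p)) w p = exp (omega q \<mu> \<delta> p) * 1 * fm.gdot (omega q \<mu> \<delta>) w p"
  by (rule fm.gdot_compose[OF fm.Ck2_differentiable[OF omega_bounds(1)] w DERIV_exp DERIV_ident])
 then show "fm.gdot (weight q \<mu> \<delta>) w p = weight q \<mu> \<delta> p * fm.gdot (omega q \<mu> \<delta>) w p"
  by (simp add: weight_exp[abs_def])
qed

lemma L0_weight:
 assumes w: "Ck 2 w"
 shows "L0 F U (%z. weight q \<mu> \<delta> z * w z) p = weight q \<mu> \<delta> p * Lt q \<mu> \<delta> (%t. deriv (deriv F) (U t)) w p"
proof -
 have "L0 F U (%z. weight q \<mu> \<delta> z * w z) p =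
  laplace gfermi (%z. weight q \<mu> \<delta> z * w z) p - deriv (deriv F) (U (fst p)) * (weight q \<mu> \<delta> p * w p)"
  by (cases p) (simp add: L0_def)
 also have "... = weight q \<mu> \<delta> p * Lt q \<mu> \<delta> (%t. deriv (deriv F) (U t)) w p"
  unfolding fm.laplace_mult[OF weight_calculus(1) w] weight_calculus(2)[where V="%t. deriv (deriv F) (U t)"]
   weight_calculus(3)[OF fm.Ck2_differentiable[OF w]] Lt_def
  by (simp add: algebra_simps)
 finally show ?thesis .
qed

lemma Lt_linear:
 assumes "Ck 2 u" "Ck 2 w"
 shows "Lt q \<mu> \<delta> V (%p. a * u p + b * w p) p = a * Lt q \<mu> \<delta> V u p + b * Lt q \<mu> \<delta> V w p"
proof -
 note cu = Ck2_cmult(1)[OF assms(1), of a] and cw = Ck2_cmult(1)[OF assms(2), of b]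
 have g: "fm.gdot (omega q \<mu> \<delta>) (%p. a * u p + b * w p) p = a * fm.gdot (omega q \<mu> \<delta>) u p + b * fm.gdot (omega q \<mu> \<delta>) w p"
  unfolding fm.gdot_def Ck2_add(2)[OF cu cw] Ck2_cmult(2)[OF assms(1)] Ck2_cmult(2)[OF assms(2)]
  by (simp add: sum.distrib sum_distrib_left algebra_simps)
 show ?thesis
  unfolding Lt_def fm.laplace_add[OF cu cw] fm.laplace_cmult[OF assms(1)] fm.laplace_cmult[OF assms(2)] g
  by (simp add: algebra_simps)
qed

lemma hb_fst_compose:
 assumes a: "0 < \<alpha>" "\<alpha> <= 1" and b: "!!t. \<bar>g t\<bar> <= M" and l: "!!s t. \<bar>g s - g t\<bar> <= M * \<bar>s - t\<bar>"
 shows "fm.hb \<alpha> (%p. g (fst p)) (2 * M)"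
proof (rule fm.hb_LipschitzI[OF a b])
 fix p q :: "real * 'a"
 have M: "M >= 0" using b[of 0] by linarith
 have "\<bar>fst p - fst q\<bar> <= fm.hdist p q" using fm.grad_bound_Lipschitz[OF fst_bounds(1), of p q] by simp
 then show "\<bar>g (fst p) - g (fst q)\<bar> <= M * fm.hdist p q"
  using l[of "fst p" "fst q"] M by (meson mult_left_mono order_trans)
qed

lemma DERIV_Lipschitz:
 fixes g :: "real => real"
 assumes "!!t. (g has_real_derivative g' t) (at t)" "!!t. \<bar>g' t\<bar> <= M"
 shows "\<bar>g s - g t\<bar> <= M * \<bar>s - t\<bar>"
 using field_differentiable_bound[of UNIV g g' M s t] assms by simp

lemma hb_tanh:
 assumes a: "0 < \<alpha>" "\<alpha> <= 1"
 shows "fm.hb \<alpha> (%p. tanh (c * fst p)) (2 * (1 + \<bar>c\<bar>))"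
proof (rule hb_fst_compose[OF a])
 show "\<bar>tanh (c * t)\<bar> <= 1 + \<bar>c\<bar>" for t using abs_tanh_le[of "c * t"] by linarith
 show "\<bar>tanh (c * s) - tanh (c * t)\<bar> <= (1 + \<bar>c\<bar>) * \<bar>s - t\<bar>" for s t
 proof (rule DERIV_Lipschitz)
  show "((%t. tanh (c * t)) has_real_derivative c * (1 - (tanh (c * t))\<^sup>2)) (at t)" for t
   by (auto intro!: derivative_eq_intros)
  have "\<bar>c\<bar> * \<bar>1 - (tanh (c * t))\<^sup>2\<bar> <= \<bar>c\<bar> * 1" for t
   using tanh_sq_le[of "c * t"] by (intro mult_left_mono) auto
  from order_trans[OF this[unfolded mult_1_right] add_increasing[OF zero_le_one order_refl]]
  show "\<bar>c * (1 - (tanh (c * t))\<^sup>2)\<bar> <= 1 + \<bar>c\<bar>" for t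
   unfolding abs_mult .
 qed
qed

text \<open>1/z = exp (- ln z), and exp (- x) is 1-Lipschitz for x >= 0, so the gradient bound of ln
  z carries over.\<close>

lemma hb_zq:
 assumes a: "0 < \<alpha>" "\<alpha> <= 1"
 shows "fm.hb \<alpha> (%p. 1 / zq q p) (2 * 1)"
proof (rule fm.hb_LipschitzI[OF a])
 show "\<bar>1 / zq q p\<bar> <= 1" for p using zq_ge1[of q p] by simp
 fix p p'
 have z: "zq q p > 0" for p using zq_ge1[of q p] by linarith
 have "1 / zq q p = exp (- ln (zq q p))" for p using z[of p] by (simp add: exp_minus inverse_eq_divide)
 moreover have "\<bar>exp (- a) - exp (- b)\<bar> <= \<bar>a - b\<bar>" if "a >= 0" "b >= 0" for a b :: real
 proof -
  have "\<bar>exp (- a) - exp (- b)\<bar> <= 1 * \<bar>a - b\<bar>"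
  proof (rule field_differentiable_bound[of "{0..}" "%x. exp (- x)" "%x. - exp (- x)" 1 a b, unfolded real_norm_def])
   show "((%x. exp (- x)) has_real_derivative - exp (- z)) (at z within {0..})" if "z \<in> {0..}" for z :: real
    by (auto intro!: derivative_eq_intros)
  qed (use that in auto)
  then show ?thesis by simp
 qed
 moreover have "ln (zq q p) >= 0" for p using zq_ge1[of q p] by simp
 ultimately have "\<bar>1 / zq q p - 1 / zq q p'\<bar> <= \<bar>ln (zq q p) - ln (zq q p')\<bar>" by metis
 also have "... <= 1 * fm.hdist p p'" by (rule fm.grad_bound_Lipschitz[OF ln_zq_bounds(2)])
 finally show "\<bar>1 / zq q p - 1 / zq q p'\<bar> <= 1 * fm.hdist p p'" .
qed

lemma hb_cc:
 assumes a: "0 < \<alpha>" "\<alpha> <= 1" and V: "!!t. \<bar>V t\<bar> <= M" "!!s t. \<bar>V s - V t\<bar> <= M * \<bar>s - t\<bar>"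
 shows "\<exists>C. fm.hb \<alpha> (cc (q :: 'a::euclidean_space) \<mu> \<delta> V) C"
proof -
 define H where "H f \<longleftrightarrow> (\<exists>C. fm.hb \<alpha> f C)" for f :: "real * 'a => real"
 have Hadd: "H (%p. f p + g p)" if "H f" "H g" for f g using that fm.hb_add unfolding H_def by blast
 have Hmult: "H (%p. f p * g p)" if "H f" "H g" for f g using that fm.hb_mult unfolding H_def by blast
 have Hc: "H (%p. c)" for c using fm.hb_const unfolding H_def by blast
 have Ht: "H (%p. tanh (c * fst p))" for c using hb_tanh[OF a] unfolding H_def by blast
 have Hz: "H (%p. 1 / zq q p)" using hb_zq[OF a] unfolding H_def by blast
 have HV: "H (%p. V (fst p))" using hb_fst_compose[OF a V] unfolding H_def by blast
 \<comment> \<open>The coefficient is rewritten with sums and products alone, so that the closure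
   rules for \<open>H\<close> apply.\<close>
 have "H (%p. \<mu>\<^sup>2 * (2 * (tanh (\<mu> * fst p) * tanh (\<mu> * fst p)) + (-1))
   + ((- (real DIM('a) * \<mu>)) * (tanh (1 * fst p) * tanh (\<mu> * fst p))
   + ((1 + (-1) * (tanh (1 * fst p) * tanh (1 * fst p))) * (\<delta>\<^sup>2 - (real DIM('a) - 1) * \<delta>)
   + ((- (\<delta> * (\<delta> + 1))) * (1 / zq q p * (1 / zq q p)) + (-1) * V (fst p)))))"
  by (intro Hadd Hmult Hc Ht Hz HV)
 moreover have "(%p. \<mu>\<^sup>2 * (2 * (tanh (\<mu> * fst p) * tanh (\<mu> * fst p)) + (-1))
   + ((- (real DIM('a) * \<mu>)) * (tanh (1 * fst p) * tanh (\<mu> * fst p))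
   + ((1 + (-1) * (tanh (1 * fst p) * tanh (1 * fst p))) * (\<delta>\<^sup>2 - (real DIM('a) - 1) * \<delta>)
   + ((- (\<delta> * (\<delta> + 1))) * (1 / zq q p * (1 / zq q p)) + (-1) * V (fst p))))) = cc q \<mu> \<delta> V"
  by (simp add: fun_eq_iff cc_def power2_eq_square mult.assoc)
 ultimately show ?thesis unfolding H_def by metis
qed

lemma Lt_hb:
 assumes a: "0 < \<alpha>" "\<alpha> <= 1" and V: "!!t. \<bar>V t\<bar> <= B" "!!s t. \<bar>V s - V t\<bar> <= B * \<bar>s - t\<bar>"
 obtains C where "C >= 0" "!!w M. fm.hb2 \<alpha> w M ==> fm.hb \<alpha> (Lt (q :: 'a::euclidean_space) \<mu> \<delta> V w) (C * M)"
proof -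
 obtain A where A: "fm.grad_bound (omega q \<mu> \<delta>) A" "fm.hess_bound (omega q \<mu> \<delta>) A" using omega_bounds(2)[of q \<mu> \<delta>] by (elim exE conjE)
 obtain D where D: "fm.hb \<alpha> (cc q \<mu> \<delta> V) D" using hb_cc[OF a V] by blast
 define N where "N = real DIM(real * 'a)"
 have "fm.hb \<alpha> (Lt q \<mu> \<delta> V w) ((2 * N + 2 * (4 * N * A) + 2 * D * 2) * M)" if w: "fm.hb2 \<alpha> w M" for w M
 proof -
  note W = fm.hb2_D[OF w]
  have "fm.hb \<alpha> (%p. laplace gfermi w p + 2 * fm.gdot (omega q \<mu> \<delta>) w p + cc q \<mu> \<delta> V p * w p)
    (2 * (N * M) + \<bar>2\<bar> * (4 * N * A * M) + 2 * D * (2 * M))"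
   unfolding N_def
   by (intro fm.hb_add fm.hb_cmult fm.hb_mult fm.laplace_hb[OF a(1) w] fm.gdot_hb[OF a omega_bounds(1) A W(1,3,4)]
      D fm.hb2_hb[OF a w])
  then show ?thesis unfolding Lt_def[abs_def] by (rule fm.hb_mono) (simp add: algebra_simps)
 qed
 moreover have "0 <= 2 * N + 2 * (4 * N * A) + 2 * D * 2"
  using fm.grad_bound_nonneg[OF A(1)] fm.hb_nonneg[OF D] by (simp add: N_def)
 ultimately show thesis using that by blast
qed

section \<open>The one-dimensional profile is strictly increasing\<close>

lemma dderiv_real: "u differentiable (at x) ==> dderiv u x v = v * deriv u x" for u :: "real => real"
proof -
 assume "u differentiable (at x)"
 then have "(u has_real_derivative deriv u x) (at x)"
  by (simp add: DERIV_deriv_iff_real_differentiable)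
 then show ?thesis by (intro dderivI) (simp add: has_field_derivative_def mult.commute mult_commute_abs)
qed

lemma Ck_Suc_real:
 fixes u :: "real => real"
 assumes "Ck (Suc k) u"
 shows "(u has_real_derivative deriv u x) (at x)" "Ck k (deriv u)"
proof -
 have d: "u differentiable (at x)" for x using assms by simp
 then show "(u has_real_derivative deriv u x) (at x)" by (simp add: DERIV_deriv_iff_real_differentiable)
 have "Ck k (%x. dderiv u x 1)" using assms by simp
 then show "Ck k (deriv u)" using dderiv_real[OF d, of _ 1] by simp
qed

lemma Ck_real_continuous: "(!!k. Ck k u) ==> continuous_on UNIV u"
 by (metis Ck.simps(1))

text \<open>On the half line the energy \<open>U'\<^sup>2/2 - F(U)\<close> is nonincreasing and tends to \<open>0\<close>, so it is nonnegative.\<close>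

lemma energy_half_line:
 fixes U U' U'' F f :: "real => real"
 assumes U: "!!t. (U has_real_derivative U' t) (at t)" and U': "!!t. (U' has_real_derivative U'' t) (at t)"
  and eq: "!!t. U'' t = f (U t) - m * tanh t * U' t" and m: "m > 0"
  and F: "!!s. (F has_real_derivative f s) (at s)" "!!s. F s >= 0" "F l = 0"
  and lim: "(U ---> l) at_top"
 shows "(U' ---> 0) at_top" and "!!t0 t. t0 >= 0 ==> U' t0 = 0 ==> t >= t0 ==> U t = l"
proof -
 define E where "E t = (U' t)\<^sup>2 / 2 - F (U t)" for t
 have Ed: "(E has_real_derivative - m * tanh t * (U' t)\<^sup>2) (at t)" for t
 proof -
  have "((%t. (U' t)\<^sup>2 / 2) has_real_derivative U' t * U'' t) (at t)"
   by (auto intro!: derivative_eq_intros U')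
  from DERIV_diff[OF this DERIV_chain2[OF F(1) U]] show ?thesis
   unfolding E_def[abs_def] by (rule DERIV_cong) (simp add: eq algebra_simps power2_eq_square)
 qed
 have dec: "E t <= E s" if "0 <= s" "s <= t" for s t
 proof (rule DERIV_nonpos_imp_nonincreasing[OF that(2)])
  fix x assume x: "s <= x" "x <= t"
  then have "- m * tanh x * (U' x)\<^sup>2 <= 0" using that m by simp
  then show "\<exists>y. (E has_real_derivative y) (at x) \<and> y <= 0" using Ed by blast
 qed
 \<comment> \<open>Some slope on (k, k+1) equals U(k+1) - U(k), which tends to 0. Along these points
   the energy tends to 0, and monotonicity carries this over to the full limit.\<close>
 have "\<exists>s. real k < s \<and> s < real k + 1 \<and> U (real k + 1) - U (real k) = (real k + 1 - real k) * U' s" for k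
  using MVT2[of "real k" "real k + 1" U U'] U by auto
 then obtain s where s: "!!k. real k < s k" "!!k. s k < real k + 1" "!!k. U (real k + 1) - U (real k) = U' (s k)"
  by (metis add_diff_cancel_left' mult_1)
 have sinf: "filterlim s at_top sequentially"
  by (rule filterlim_at_top_mono[OF filterlim_real_sequentially]) (use s(1) less_imp_le in "auto intro!: always_eventually")
 have "(%k. U (real k + 1) - U (real k)) -----> l - l"
  by (intro tendsto_diff filterlim_compose[OF lim] filterlim_real_sequentially)
    (rule filterlim_tendsto_add_at_top[OF tendsto_const filterlim_real_sequentially, of 1, unfolded add.commute[of 1]])
 then have U's: "(%k. U' (s k)) -----> 0" by (simp add: s(3))
 have Fc: "isCont F x" for x using F(1) DERIV_isCont by blast
 have FU: "((%t. F (U t)) ---> 0) at_top"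
  using isCont_tendsto_compose[OF Fc lim] F(3) by simp
 have Es: "(%k. E (s k)) -----> 0"
  unfolding E_def
  using tendsto_diff[OF tendsto_divide[OF tendsto_power[OF U's, of 2] tendsto_const[of 2]] filterlim_compose[OF FU sinf]]
  by simp
 have E0: "E t >= 0" if "t >= 0" for t
 proof (rule tendsto_upperbound[OF Es])
  show "\<forall>\<^sub>F k in sequentially. E (s k) <= E t"
   using filterlim_at_top[THEN iffD1, OF sinf, rule_format, of t]
   by (rule eventually_mono) (use dec that in auto)
 qed simp
 have El: "(E ---> 0) at_top"
 proof (rule tendstoI)
  fix e :: real assume e: "e > 0"
  have "\<forall>\<^sub>F k in sequentially. dist (E (s k)) 0 < e" using Es e by (rule tendstoD)
  then obtain k where k: "\<bar>E (s k)\<bar> < e" by (auto simp: eventually_sequentially)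
  have sk: "s k >= 0" using s(1)[of k] by (meson less_imp_le of_nat_0_le_iff order_trans)
  show "\<forall>\<^sub>F t in at_top. dist (E t) 0 < e"
   using eventually_ge_at_top[of "s k"]
  proof eventually_elim
   case (elim t)
   then show ?case using dec[OF sk elim] E0[of t] sk k by simp
  qed
 qed
 have "((%t. 2 * (E t + F (U t))) ---> 0) at_top"
  using tendsto_mult[OF tendsto_const[of 2] tendsto_add[OF El FU]] by simp
 then have "((%t. (U' t)\<^sup>2) ---> 0) at_top" by (simp add: E_def)
 from tendsto_real_sqrt[OF this] show "(U' ---> 0) at_top" by (simp add: tendsto_rabs_zero_iff)
 \<comment> \<open>If U' vanishes at t0, the energy there is -F <= 0; being nonnegative and
   nonincreasing it is 0 from t0 on. Its derivative then vanishes too, which forces U' = 0 and U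
   constant.\<close>
 fix t0 t assume t0: "t0 >= 0" "U' t0 = 0" and t: "t >= t0"
 have "E t0 <= 0" using t0 F(2) by (simp add: E_def)
 then have Ez: "E r = 0" if "r >= t0" for r using E0[of r] dec[OF t0(1) that] t0(1) that by simp
 have "U' r = 0" if r: "r > t0" for r
 proof -
  have "\<forall>\<^sub>F x in nhds r. x \<in> {t0<..}" using r by (intro eventually_nhds_in_open) auto
  then have "\<forall>\<^sub>F x in nhds r. E x = 0" by (rule eventually_mono) (use Ez in auto)
  then have "((%x. 0) has_real_derivative - m * tanh r * (U' r)\<^sup>2) (at r)"
   using DERIV_cong_ev[OF refl _ refl, of E "%x. 0" r] Ed[of r] by simp
  then have "- m * tanh r * (U' r)\<^sup>2 = 0" using DERIV_unique DERIV_const by blast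
  then show ?thesis using m r t0 by simp
 qed
 then have z: "U' r = 0" if "r >= t0" for r using t0 that by (cases "r = t0") auto
 have cst: "U r = U t" if "r >= t0" for r
 proof -
  have "\<bar>U r - U t\<bar> <= 0 * \<bar>r - t\<bar>"
   unfolding real_norm_def[symmetric]
  proof (rule field_differentiable_bound[of "{t0..}" U U'])
   show "(U has_real_derivative U' x) (at x within {t0..})" for x by (rule has_field_derivative_at_within[OF U])
  qed (use z that t in auto)
  then show ?thesis by simp
 qed
 have "(U ---> U t) at_top"
  by (rule tendsto_eventually, rule eventually_mono[OF eventually_ge_at_top[of t0]]) (rule cst)
 then show "U t = l" using lim tendsto_unique trivial_limit_at_top_linorder by blast
qed

text \<open>Gronwall argument backwards in time: \<open>w\<close> times exp (C t) is nondecreasing,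
  so \<open>w\<close> = 0 at t0 forces \<open>w\<close> = 0 earlier. \<open>C\<close> adds up the
  bounds 1, |L| and 2 m for the three terms of w'.\<close>

lemma backward_uniqueness:
 fixes U U' U'' f f' :: "real => real"
 assumes U: "!!t. (U has_real_derivative U' t) (at t)" and U': "!!t. (U' has_real_derivative U'' t) (at t)"
  and eq: "!!t. U'' t = f (U t) - m * tanh t * U' t" and m: "m > 0"
  and L: "!!t. \<bar>f (U t)\<bar> <= L * \<bar>U t - l\<bar>"
  and z: "U t0 = l" "U' t0 = 0" and t: "t <= t0"
 shows "U t = l"
proof -
 define w where "w t = (U t - l)\<^sup>2 + (U' t)\<^sup>2" for t
 define C where "C = 1 + \<bar>L\<bar> + 2 * m"
 define D where "D t = (2 * (U t - l) * U' t + 2 * U' t * U'' t + C * w t) * exp (C * t)" for t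
 have wd: "((%t. w t * exp (C * t)) has_real_derivative D t) (at t)" for t
  unfolding w_def[abs_def] D_def
  by (rule derivative_eq_intros U U' refl)+ (simp add: w_def algebra_simps)
 have Dn: "D t >= 0" for t
 proof -
  let ?a = "\<bar>U t - l\<bar>" and ?b = "\<bar>U' t\<bar>"
  have ab: "2 * ?a * ?b <= w t" using sum_squares_bound[of ?a ?b] by (simp add: w_def)
  have w0: "w t >= 0" "?b * ?b <= w t" by (simp_all add: w_def power2_eq_square)
  have "\<bar>2 * (U t - l) * U' t\<bar> <= w t" using ab by (simp only: abs_mult abs_numeral)
  moreover have "\<bar>2 * U' t * f (U t)\<bar> <= \<bar>L\<bar> * w t"
  proof -
   have "\<bar>f (U t)\<bar> <= \<bar>L\<bar> * ?a" using L[of t] by (meson abs_ge_self abs_ge_zero mult_right_mono order_trans)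
   then have "2 * ?b * \<bar>f (U t)\<bar> <= 2 * ?b * (\<bar>L\<bar> * ?a)" by (intro mult_left_mono) auto
   also have "... = \<bar>L\<bar> * (2 * ?a * ?b)" by simp
   also have "... <= \<bar>L\<bar> * w t" by (intro mult_left_mono ab) auto
   finally show ?thesis by (simp add: abs_mult)
  qed
  moreover have "\<bar>2 * U' t * (m * tanh t * U' t)\<bar> <= 2 * m * w t"
  proof -
   have "\<bar>2 * U' t * (m * tanh t * U' t)\<bar> = 2 * m * (\<bar>tanh t\<bar> * (?b * ?b))" using m by (simp add: abs_mult)
   also have "... <= 2 * m * (1 * w t)" using m w0 abs_tanh_le by (intro mult_left_mono mult_mono) auto
   finally show ?thesis by simp
  qed
  ultimately have "0 <= 2 * (U t - l) * U' t + 2 * U' t * f (U t) - 2 * U' t * (m * tanh t * U' t) + (w t + \<bar>L\<bar> * w t + 2 * m * w t)"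
   by linarith
  also have "... = 2 * (U t - l) * U' t + 2 * U' t * U'' t + C * w t"
   by (simp add: eq C_def algebra_simps)
  finally show ?thesis unfolding D_def by simp
 qed
 have "w t * exp (C * t) <= w t0 * exp (C * t0)"
  by (rule DERIV_nonneg_imp_nondecreasing[OF t]) (use wd Dn in blast)
 also have "w t0 = 0" using z by (simp add: w_def)
 finally have "w t <= 0" by (simp add: mult_le_0_iff)
 then have "(U t - l)\<^sup>2 <= 0" unfolding w_def using zero_le_power2[of "U' t"] by linarith
 then show ?thesis by simp
qed

lemma bounded_of_limits:
 fixes U :: "real => real"
 assumes c: "continuous_on UNIV U" and l: "(U ---> a) at_top" "(U ---> b) at_bot"
 shows "\<exists>R. \<forall>t. \<bar>U t\<bar> <= R"
proof -
 obtain S where S: "!!t. t >= S ==> \<bar>U t - a\<bar> < 1"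
  using tendstoD[OF l(1), of 1] by (auto simp: eventually_at_top_linorder dist_real_def)
 obtain T where T: "!!t. t <= T ==> \<bar>U t - b\<bar> < 1"
  using tendstoD[OF l(2), of 1] by (auto simp: eventually_at_bot_linorder dist_real_def)
 have "bounded (U ` {T..S})"
  by (rule compact_imp_bounded[OF compact_continuous_image[OF continuous_on_subset[OF c] compact_Icc]]) simp
 then obtain B where "\<forall>t\<in>{T..S}. \<bar>U t\<bar> <= B" by (auto simp: bounded_iff)
 then have B: "!!t. t \<in> {T..S} ==> \<bar>U t\<bar> <= B" by blast
 have "\<bar>U t\<bar> <= max B (max (\<bar>a\<bar> + 1) (\<bar>b\<bar> + 1))" for t
  using S[of t] T[of t] B[of t] by (cases "t >= S"; cases "t <= T") auto
 then show ?thesis by blast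
qed

lemma range_bound:
 fixes g U :: "real => real"
 assumes "continuous_on UNIV g" "!!t. \<bar>U t\<bar> <= R"
 shows "\<exists>L. \<forall>s\<in>{-R..R}. \<bar>g s\<bar> <= L"
proof -
 have "bounded (g ` {-R..R})"
  by (rule compact_imp_bounded[OF compact_continuous_image[OF continuous_on_subset[OF assms(1)] compact_Icc]]) simp
 then show ?thesis by (auto simp: bounded_iff)
qed

text \<open>The profile as a problem on ordinary differential equations, detached from the chart; m
  stands for n - 1, and \<open>f\<close>, \<open>f1\<close>, \<open>f2\<close> for the successive
  derivatives of \<open>F\<close>.\<close>

locale heteroclinic =
 fixes U U' U'' F f f1 f2 :: "real => real" and m :: real
 assumes U: "!!t. (U has_real_derivative U' t) (at t)" and U': "!!t. (U' has_real_derivative U'' t) (at t)"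
  and ode: "!!t. U'' t = f (U t) - m * tanh t * U' t" and m: "m > 0"
  and F: "!!s. (F has_real_derivative f s) (at s)" and f: "!!s. (f has_real_derivative f1 s) (at s)"
  and f1: "!!s. (f1 has_real_derivative f2 s) (at s)" and f2: "continuous_on UNIV f2"
  and F0: "!!s. F s >= 0" "F 1 = 0" "F (-1) = 0"
  and lim: "(U ---> 1) at_top" "(U ---> -1) at_bot"
  and gam: "f1 1 > 0" "f1 (-1) > 0"
begin

lemma cont: "continuous_on S U" "continuous_on S U'" "continuous_on S f" "continuous_on S f1" "continuous_on S U''"
proof -
 show c: "continuous_on S U" "continuous_on S U'" "continuous_on S f" "continuous_on S f1" for S
  by (rule DERIV_continuous_on, rule has_field_derivative_at_within,
    (rule U | rule U' | rule f | rule f1))+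
 show "continuous_on S U''"
  unfolding ode by (intro continuous_intros continuous_on_compose2[OF c(3)[of UNIV] c(1)] c(2)) auto
qed

lemma f_zero: "f 1 = 0" "f (-1) = 0"
proof -
 show "f 1 = 0" by (rule DERIV_local_min[OF F, of 1 1]) (use F0 in auto)
 show "f (-1) = 0" by (rule DERIV_local_min[OF F, of 1 "-1"]) (use F0 in auto)
qed

lemma bounded_U: obtains R where "!!t. \<bar>U t\<bar> <= R" "R >= 1"
proof -
 obtain R where R: "!!t. \<bar>U t\<bar> <= R" using bounded_of_limits[OF cont(1) lim] by blast
 show thesis by (rule that[of "max R 1"]) (use R in "auto simp: le_max_iff_disj")
qed

lemma f_Lipschitz:
 obtains L where "!!t. \<bar>f (U t)\<bar> <= L * \<bar>U t - 1\<bar>" "!!t. \<bar>f (U t)\<bar> <= L * \<bar>U t - (-1)\<bar>"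
proof -
 obtain R where R: "!!t. \<bar>U t\<bar> <= R" "R >= 1" using bounded_U by metis
 obtain L where L: "!!s. s \<in> {-R..R} ==> \<bar>f1 s\<bar> <= L" using range_bound[OF cont(4) R(1)] by blast
 have lip: "\<bar>f (U t) - f s\<bar> <= L * \<bar>U t - s\<bar>" if "s \<in> {-R..R}" for t s
  unfolding real_norm_def[symmetric]
 proof (rule field_differentiable_bound[of "{-R..R}" f f1])
  show "(f has_real_derivative f1 z) (at z within {-R..R})" for z by (rule has_field_derivative_at_within[OF f])
 qed (use L R(1)[of t] that in auto)
 show thesis
  by (rule that[of L]) (use lip[of 1] lip[of "-1"] f_zero R(2) in auto)
qed

lemma not_const: "\<exists>t. U t ~= 1" "\<exists>t. U t ~= -1"
proof -
 show "\<exists>t. U t ~= 1"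
 proof (rule ccontr)
  assume "\<not> ?thesis" then have "U = (%t. 1)" by auto
  then have "(-1::real) = 1" using lim(2) tendsto_const_iff[of "at_bot :: real filter" "1::real" "-1", OF trivial_limit_at_bot_linorder] by simp
  then show False by simp
 qed
 show "\<exists>t. U t ~= -1"
 proof (rule ccontr)
  assume "\<not> ?thesis" then have "U = (%t. -1)" by auto
  then have "(-1::real) = 1" using lim(1) tendsto_const_iff[of "at_top :: real filter" "-1::real" "1", OF trivial_limit_at_top_linorder] by simp
  then show False by simp
 qed
qed

text \<open>The symmetry t to -t, U to -U, F(s) to F(-s) exchanges the two ends, so results on the
  positive half line also serve at minus infinity.\<close>

lemma reflect:
 shows "!!t. ((%t. - U (- t)) has_real_derivative U' (- t)) (at t)"
  and "!!t. ((%t. U' (- t)) has_real_derivative - U'' (- t)) (at t)"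
  and "!!t. - U'' (- t) = - f (- (- U (- t))) - m * tanh t * U' (- t)"
  and "!!s. ((%s. F (- s)) has_real_derivative - f (- s)) (at s)"
  and "((%t. - U (- t)) ---> 1) at_top"
proof -
 have n: "(uminus has_real_derivative -1) (at t)" for t :: real
  by (auto intro!: derivative_eq_intros)
 show "((%t. - U (- t)) has_real_derivative U' (- t)) (at t)" for t
  using DERIV_minus[OF DERIV_chain2[OF U n]] by simp
 show "((%t. U' (- t)) has_real_derivative - U'' (- t)) (at t)" for t
  using DERIV_chain2[OF U' n] by simp
 show "- U'' (- t) = - f (- (- U (- t))) - m * tanh t * U' (- t)" for t by (simp add: ode)
 show "((%s. F (- s)) has_real_derivative - f (- s)) (at s)" for s
  using DERIV_chain2[OF F n] by simp
 show "((%t. - U (- t)) ---> 1) at_top"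
  using tendsto_minus[OF filterlim_compose[OF lim(2) filterlim_uminus_at_bot_at_top]] by simp
qed

text \<open>A critical point at t >= 0 makes U equal to its limit from there on by the energy
  argument, and equal to it everywhere by backward uniqueness, against the limit at the other end.
  For t < 0 the reflected solution is used.\<close>

lemma U'_nonzero: "U' t ~= 0"
proof
 assume z: "U' t = 0"
 obtain L where L: "!!t. \<bar>f (U t)\<bar> <= L * \<bar>U t - 1\<bar>" "!!t. \<bar>f (U t)\<bar> <= L * \<bar>U t - (-1)\<bar>"
  using f_Lipschitz by metis
 show False
 proof (cases "t >= 0")
  case True
  have e: "U s = 1" if "s >= t" for s
   by (rule energy_half_line(2)[OF U U' ode m F F0(1,2) lim(1) True z that])
  have "U s = 1" for s
   using e backward_uniqueness[OF U U' ode m L(1) e[OF order_refl] z, of s] by (cases "s >= t") auto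
  then show False using not_const(1) by blast
 next
  case False
  have e: "- U (- s) = 1" if "s >= - t" for s
   by (rule energy_half_line(2)[OF reflect(1-3) m reflect(4) _ _ reflect(5), of "- t" s])
     (use False z that F0 in auto)
  have "- U (- s) = 1" for s
  proof (cases "s >= - t")
   case False
   show ?thesis
   proof (rule backward_uniqueness[OF reflect(1-3) m, of L 1 "- t" s])
    show "\<bar>- f (- (- U (- t)))\<bar> <= L * \<bar>- U (- t) - 1\<bar>" for t using L(2)[of "- t"] by (simp add: abs_minus_commute add.commute)
   qed (use False e[of "- t"] z in auto)
  qed (rule e)
  then have "U s = -1" for s by (metis minus_minus)
  then show False using not_const(2) by blast
 qed
qed

text \<open>Without zeros U' has one sign, and a decreasing U cannot go from -1 to 1.\<close>

lemma U'_pos: "U' t > 0"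
proof (rule ccontr)
 assume "\<not> ?thesis"
 then have neg: "U' t < 0" using U'_nonzero[of t] by simp
 have neg': "U' s < 0" for s
 proof (rule ccontr)
  assume "\<not> U' s < 0"
  then have pos: "U' s > 0" using U'_nonzero[of s] by linarith
  have "\<exists>x. U' x = 0"
  proof (cases "s <= t")
   case True
   then show ?thesis using IVT2'[of U' t 0 s] neg pos cont(2) by auto
  next
   case False
   then show ?thesis using IVT'[of U' t 0 s] neg pos cont(2) by auto
  qed
  then show False using U'_nonzero by blast
 qed
 have dec: "U b <= U a" if "a <= b" for a b
  by (rule DERIV_nonpos_imp_nonincreasing[OF that]) (use U neg' less_imp_le in blast)
 have "U 0 >= 1"
  by (rule tendsto_upperbound[OF lim(1)]) (rule eventually_mono[OF eventually_ge_at_top[of 0]], use dec in auto)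
 moreover have "-1 >= U 0"
  by (rule tendsto_lowerbound[OF lim(2)]) (rule eventually_mono[OF eventually_le_at_bot[of 0]], use dec in auto)
 ultimately show False by simp
qed

lemma U'_lim: "(U' ---> 0) at_top" "(U' ---> 0) at_bot"
proof -
 show "(U' ---> 0) at_top" by (rule energy_half_line(1)[OF U U' ode m F F0(1,2) lim(1)])
 have "((%t. U' (- t)) ---> 0) at_top"
  by (rule energy_half_line(1)[OF reflect(1-3) m reflect(4) _ _ reflect(5)]) (use F0 in auto)
 then show "(U' ---> 0) at_bot"
  using filterlim_at_bot_mirror[of U' "nhds 0"] by simp
qed

end

section \<open>One-dimensional barriers\<close>

lemma global_min_real:
 fixes w :: "real => real"
 assumes c: "continuous_on UNIV w" and l: "(w ---> 0) at_top" "(w ---> 0) at_bot" and neg: "w t1 < 0"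
 obtains t where "!!s. w t <= w s"
proof -
 obtain S where S: "!!t. t >= S ==> \<bar>w t\<bar> < - w t1"
  using tendstoD[OF l(1), of "- w t1"] neg by (auto simp: eventually_at_top_linorder dist_real_def)
 obtain T where T: "!!t. t <= T ==> \<bar>w t\<bar> < - w t1"
  using tendstoD[OF l(2), of "- w t1"] neg by (auto simp: eventually_at_bot_linorder dist_real_def)
 define J where "J = {min T t1..max S t1}"
 have "compact J" "J ~= {}" "continuous_on J w" "t1 \<in> J" using c continuous_on_subset by (auto simp: J_def)
 then obtain t where t: "t \<in> J" "!!s. s \<in> J ==> w t <= w s"
  using continuous_attains_inf[of J w] by blast
 have "w t <= w s" for s
 proof (cases "s \<in> J")
  case False
  then have "s >= S \<or> s <= T" by (auto simp: J_def)
  then have "\<bar>w s\<bar> < - w t1" using S T by blast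
  then show ?thesis using t(2)[OF \<open>t1 \<in> J\<close>] by linarith
 qed (use t in auto)
 then show thesis by (rule that)
qed

lemma second_derivative_min:
 fixes w :: "real => real"
 assumes w: "!!t. (w has_real_derivative w' t) (at t)" and w': "(w' has_real_derivative d) (at t)"
  and mn: "!!s. w t <= w s"
 shows "w' t = 0" "d >= 0"
proof -
 show z: "w' t = 0" by (rule DERIV_local_min[OF w, of 1 t]) (use mn in auto)
 show "d >= 0"
 proof (rule ccontr)
  assume "\<not> ?thesis"
  then have "d < 0" by simp
  from DERIV_neg_dec_right[OF w' this] obtain e where e: "e > 0" "!!h. 0 < h ==> h < e ==> w' (t + h) < w' t" by blast
  have "\<exists>z. t < z \<and> z < t + e / 2 \<and> w (t + e / 2) - w t = (t + e / 2 - t) * w' z"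
   by (rule MVT2) (use e w in auto)
  then obtain z where z': "t < z" "z < t + e / 2" "w (t + e / 2) - w t = (e / 2) * w' z" by auto
  have "w' z < 0" using e(2)[of "z - t"] z' z e(1) by simp
  then have "w (t + e / 2) < w t" using z'(3) e(1) mult_pos_neg[of "e / 2" "w' z"] by linarith
  then show False using mn[of "t + e / 2"] by simp
 qed
qed

lemma tanh_mu_lim: "((%t::real. tanh (\<mu> * t)) ---> 1) at_top" "((%t::real. tanh (\<mu> * t)) ---> -1) at_bot" if "\<mu> > 0"
proof -
 show "((%t::real. tanh (\<mu> * t)) ---> 1) at_top"
  by (rule filterlim_compose[OF tanh_real_at_top filterlim_tendsto_pos_mult_at_top[OF tendsto_const that filterlim_ident]])
 show "((%t::real. tanh (\<mu> * t)) ---> -1) at_bot"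
  by (rule filterlim_compose[OF tanh_real_at_bot filterlim_tendsto_pos_mult_at_bot[OF tendsto_const that filterlim_ident]])
qed

lemma sech_pos [simp]: "sech t > 0" and sech_le_1: "sech t <= 1"
 by (auto simp: sech_def cosh_real_ge_1)

lemma sech_lim: "(sech ---> 0) at_top" "(sech ---> 0) at_bot"
 unfolding sech_def[abs_def]
 by (rule tendsto_divide_0[OF tendsto_const filterlim_at_top_imp_at_infinity[OF cosh_real_at_top]],
   rule tendsto_divide_0[OF tendsto_const filterlim_at_top_imp_at_infinity[OF cosh_real_at_bot]])

lemma sech_mu_lim: "((%t. sech (\<mu> * t)) ---> 0) at_top" "((%t. sech (\<mu> * t)) ---> 0) at_bot" if "\<mu> > 0"
proof -
 show "((%t. sech (\<mu> * t)) ---> 0) at_top"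
  by (rule filterlim_compose[OF sech_lim(1) filterlim_tendsto_pos_mult_at_top[OF tendsto_const that filterlim_ident]])
 show "((%t. sech (\<mu> * t)) ---> 0) at_bot"
  by (rule filterlim_compose[OF sech_lim(2) filterlim_tendsto_pos_mult_at_bot[OF tendsto_const that filterlim_ident]])
qed

lemma sech_sq: "1 - (tanh t)\<^sup>2 = (sech t)\<^sup>2" for t :: real
proof -
 have "1 - (tanh t)\<^sup>2 = ((cosh t)\<^sup>2 - (sinh t)\<^sup>2) / (cosh t)\<^sup>2"
  by (simp add: tanh_def power_divide diff_divide_distrib)
 also have "(cosh t)\<^sup>2 - (sinh t)\<^sup>2 = 1" by (simp add: cosh_square_eq)
 finally show ?thesis by (simp add: sech_def power_divide)
qed

context heteroclinic
begin

text \<open>\<open>L0\<close> on functions of t alone. The derivatives are passed as arguments,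
  which lets barriers be handled with explicit formulas.\<close>

definition L1 :: "(real => real) => (real => real) => (real => real) => real => real" where
 "L1 g g' g'' t = g'' t + m * tanh t * g' t - f1 (U t) * g t"

definition S' where "S' \<mu> t = - \<mu> * tanh (\<mu> * t) * sech (\<mu> * t)"
definition S'' where "S'' \<mu> t = \<mu>\<^sup>2 * (2 * (tanh (\<mu> * t))\<^sup>2 - 1) * sech (\<mu> * t)"
definition U3 where "U3 t = f1 (U t) * U' t - (m * (sech t)\<^sup>2 * U' t + m * tanh t * U'' t)"

lemma U3: "(U'' has_real_derivative U3 t) (at t)"
proof -
 have t: "(tanh has_real_derivative (sech t)\<^sup>2) (at t)"
  by (rule DERIV_cong[of _ "1 - (tanh t)\<^sup>2"]) (auto intro!: derivative_eq_intros simp: sech_sq)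
 have "((%t. f (U t) - m * tanh t * U' t) has_real_derivative
   f1 (U t) * U' t - (m * (sech t)\<^sup>2 * U' t + U'' t * (m * tanh t))) (at t)"
  by (rule DERIV_diff[OF DERIV_chain2[OF f U] DERIV_mult[OF DERIV_cmult[OF t] U']])
 moreover have "(%t. f (U t) - m * tanh t * U' t) = U''" by (auto simp: ode)
 ultimately show ?thesis by (simp add: U3_def mult.commute mult.left_commute)
qed

text \<open>The equation for U differentiated: besides the linearised terms only the derivative of
  tanh contributes, with a favourable sign. In the Euclidean problem U' would lie in the
  kernel.\<close>

lemma L1_U': "L1 U' U'' U3 t = - m * (sech t)\<^sup>2 * U' t"
 by (simp add: L1_def U3_def)

lemma S_DERIV: "((%t. sech (\<mu> * t)) has_real_derivative S' \<mu> t) (at t)" "(S' \<mu> has_real_derivative S'' \<mu> t) (at t)"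
 using sech_DERIV[of \<mu> t] by (simp_all add: S'_def[abs_def] S''_def)

lemma L1_sech: "L1 (%t. sech (\<mu> * t)) (S' \<mu>) (S'' \<mu>) t =
  (\<mu>\<^sup>2 * (2 * (tanh (\<mu> * t))\<^sup>2 - 1) - m * \<mu> * tanh t * tanh (\<mu> * t) - f1 (U t)) * sech (\<mu> * t)"
 by (simp add: L1_def S'_def S''_def algebra_simps)

text \<open>The larger root of x^2 - m x - g = 0, that is, \<open>indicial\<close> with m = n -
  1.\<close>

definition ind :: "real => real" where "ind g = m / 2 + sqrt (m\<^sup>2 / 4 + g)"

lemma ind_neg:
 assumes "0 < \<mu>" "\<mu> < ind g" "g > 0"
 shows "\<mu>\<^sup>2 - m * \<mu> - g < 0"
proof (cases "\<mu> <= m / 2")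
 case True
 then have "\<mu> * \<mu> <= m / 2 * \<mu>" using assms(1) by (intro mult_right_mono) auto
 also have "m / 2 * \<mu> <= m * \<mu>" using m assms(1) by simp
 finally show ?thesis using assms(3) by (simp add: power2_eq_square)
next
 case False
 then have "\<mu> - m / 2 < sqrt (m\<^sup>2 / 4 + g)" "0 <= \<mu> - m / 2" using assms(2) by (auto simp: ind_def)
 then have "(\<mu> - m / 2)\<^sup>2 < (sqrt (m\<^sup>2 / 4 + g))\<^sup>2" by (intro power_strict_mono) auto
 also have "... = m\<^sup>2 / 4 + g" using assms(3) by simp
 finally have "(\<mu> - m / 2)\<^sup>2 < m\<^sup>2 / 4 + g" .
 then show ?thesis by (simp add: power2_eq_square algebra_simps)
qed

lemma f1U_lim: "((%t. f1 (U t)) ---> f1 1) at_top" "((%t. f1 (U t)) ---> f1 (-1)) at_bot"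
 using isCont_tendsto_compose[OF DERIV_isCont[OF f1] lim(1)] isCont_tendsto_compose[OF DERIV_isCont[OF f1] lim(2)] by auto

lemma coefficient_lim:
 assumes "\<mu> > 0"
 shows "((%t. \<mu>\<^sup>2 * (2 * (tanh (\<mu> * t))\<^sup>2 - 1) - m * \<mu> * tanh t * tanh (\<mu> * t) - f1 (U t)) ---> \<mu>\<^sup>2 - m * \<mu> - f1 1) at_top"
  and "((%t. \<mu>\<^sup>2 * (2 * (tanh (\<mu> * t))\<^sup>2 - 1) - m * \<mu> * tanh t * tanh (\<mu> * t) - f1 (U t)) ---> \<mu>\<^sup>2 - m * \<mu> - f1 (-1)) at_bot"
proof -
 have "((%t. \<mu>\<^sup>2 * (2 * (tanh (\<mu> * t))\<^sup>2 - 1) - m * \<mu> * tanh t * tanh (\<mu> * t) - f1 (U t)) ---> \<mu>\<^sup>2 * (2 * 1\<^sup>2 - 1) - m * \<mu> * 1 * 1 - f1 1) at_top"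
  by (intro tendsto_intros tanh_mu_lim assms f1U_lim tanh_real_at_top)
 then show "((%t. \<mu>\<^sup>2 * (2 * (tanh (\<mu> * t))\<^sup>2 - 1) - m * \<mu> * tanh t * tanh (\<mu> * t) - f1 (U t)) ---> \<mu>\<^sup>2 - m * \<mu> - f1 1) at_top" by simp
 have "((%t. \<mu>\<^sup>2 * (2 * (tanh (\<mu> * t))\<^sup>2 - 1) - m * \<mu> * tanh t * tanh (\<mu> * t) - f1 (U t)) ---> \<mu>\<^sup>2 * (2 * (-1)\<^sup>2 - 1) - m * \<mu> * (-1) * (-1) - f1 (-1)) at_bot"
  by (intro tendsto_intros tanh_mu_lim assms f1U_lim tanh_real_at_bot)
 then show "((%t. \<mu>\<^sup>2 * (2 * (tanh (\<mu> * t))\<^sup>2 - 1) - m * \<mu> * tanh t * tanh (\<mu> * t) - f1 (U t)) ---> \<mu>\<^sup>2 - m * \<mu> - f1 (-1)) at_bot" by simp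
qed

text \<open>The coefficient of \<open>L1\<close> on sech (\<mu> t) tends to \<mu>^2 - m \<mu> -
  f'(1) and \<mu>^2 - m \<mu> - f'(-1) at the two ends, both negative below the indicial roots;
  \<open>c\<close> is half the smaller gap. The last two inequalities serve the comparison in
  \<open>U'_decay\<close>.\<close>

lemma far_field:
 assumes mu: "0 < \<mu>" "\<mu> < ind (f1 1)" "\<mu> < ind (f1 (-1))"
 obtains T c where "T > 0" "c > 0" "!!t. \<bar>t\<bar> >= T ==> L1 (%t. sech (\<mu> * t)) (S' \<mu>) (S'' \<mu>) t <= - c * sech (\<mu> * t)"
  "!!t. \<bar>t\<bar> >= T ==> m * (sech t)\<^sup>2 <= c" "!!t. \<bar>t\<bar> >= T ==> m * (sech t)\<^sup>2 - f1 (U t) < 0"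
proof -
 let ?k = "%t. \<mu>\<^sup>2 * (2 * (tanh (\<mu> * t))\<^sup>2 - 1) - m * \<mu> * tanh t * tanh (\<mu> * t) - f1 (U t)"
 define c where "c = min (- (\<mu>\<^sup>2 - m * \<mu> - f1 1)) (- (\<mu>\<^sup>2 - m * \<mu> - f1 (-1))) / 2"
 have cpos: "c > 0" using ind_neg[OF mu(1,2) gam(1)] ind_neg[OF mu(1,3) gam(2)] by (simp add: c_def)
 have c1: "\<mu>\<^sup>2 - m * \<mu> - f1 1 < - c" "\<mu>\<^sup>2 - m * \<mu> - f1 (-1) < - c" 
 proof -
  have "c <= - (\<mu>\<^sup>2 - m * \<mu> - f1 1) / 2" "c <= - (\<mu>\<^sup>2 - m * \<mu> - f1 (-1)) / 2" by (auto simp: c_def)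
  then show "\<mu>\<^sup>2 - m * \<mu> - f1 1 < - c" and "\<mu>\<^sup>2 - m * \<mu> - f1 (-1) < - c"
   using cpos by simp_all
 qed
 have ms: "((%t. m * (sech t)\<^sup>2) ---> 0) at_top" "((%t. m * (sech t)\<^sup>2) ---> 0) at_bot"
  using tendsto_mult[OF tendsto_const[of m] tendsto_power[OF sech_lim(1), of 2]]
   tendsto_mult[OF tendsto_const[of m] tendsto_power[OF sech_lim(2), of 2]] by simp_all
 have d: "((%t. m * (sech t)\<^sup>2 - f1 (U t)) ---> 0 - f1 1) at_top" "((%t. m * (sech t)\<^sup>2 - f1 (U t)) ---> 0 - f1 (-1)) at_bot"
  by (rule tendsto_diff[OF ms(1) f1U_lim(1)], rule tendsto_diff[OF ms(2) f1U_lim(2)])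
 have "\<forall>\<^sub>F t in at_top. ?k t < - c \<and> m * (sech t)\<^sup>2 < c \<and> m * (sech t)\<^sup>2 - f1 (U t) < 0"
  using gam by (intro eventually_conj order_tendstoD(2)[OF coefficient_lim(1)[OF mu(1)] c1(1)]
   order_tendstoD(2)[OF ms(1) cpos] order_tendstoD(2)[OF d(1)]) auto
 then obtain A where A: "!!t. t >= A ==> ?k t < - c \<and> m * (sech t)\<^sup>2 < c \<and> m * (sech t)\<^sup>2 - f1 (U t) < 0"
  unfolding eventually_at_top_linorder by blast
 have "\<forall>\<^sub>F t in at_bot. ?k t < - c \<and> m * (sech t)\<^sup>2 < c \<and> m * (sech t)\<^sup>2 - f1 (U t) < 0"
  using gam by (intro eventually_conj order_tendstoD(2)[OF coefficient_lim(2)[OF mu(1)] c1(2)]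
   order_tendstoD(2)[OF ms(2) cpos] order_tendstoD(2)[OF d(2)]) auto
 then obtain B where B: "!!t. t <= B ==> ?k t < - c \<and> m * (sech t)\<^sup>2 < c \<and> m * (sech t)\<^sup>2 - f1 (U t) < 0"
  unfolding eventually_at_bot_linorder by blast
 define T where "T = max 1 (max A (- B))"
 have T: "?k t < - c \<and> m * (sech t)\<^sup>2 < c \<and> m * (sech t)\<^sup>2 - f1 (U t) < 0" if "\<bar>t\<bar> >= T" for t
  using that A[of t] B[of t] by (cases "t >= 0") (auto simp: T_def)
 show thesis
 proof (rule that[of T c])
  show "L1 (%t. sech (\<mu> * t)) (S' \<mu>) (S'' \<mu>) t <= - c * sech (\<mu> * t)" if "\<bar>t\<bar> >= T" for t
   unfolding L1_sech using T[OF that] by (intro mult_right_mono) (auto simp: less_imp_le)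
  show "m * (sech t)\<^sup>2 <= c" "m * (sech t)\<^sup>2 - f1 (U t) < 0" if "\<bar>t\<bar> >= T" for t
   using T[OF that] by auto
 qed (use cpos in "auto simp: T_def")
qed

lemma compact_bounds:
 fixes g :: "real => real"
 assumes "continuous_on UNIV g"
 obtains B where "B >= 0" "!!t. \<bar>t\<bar> <= T ==> \<bar>g t\<bar> <= B"
proof -
 have "bounded (g ` {-T..T})"
  by (rule compact_imp_bounded[OF compact_continuous_image[OF continuous_on_subset[OF assms] compact_Icc]]) simp
 then obtain B where B: "\<forall>t\<in>{-T..T}. \<bar>g t\<bar> <= B" by (auto simp: bounded_iff)
 show thesis by (rule that[of "max B 0"]) (use B in "auto simp: abs_le_iff le_max_iff_disj")
qed

text \<open>Comparison of M sech (\<mu> t) with U', which solves (L1 + m sech^2) U' = 0. For |t| >=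
  T this operator has a negative zeroth-order coefficient and sech (\<mu> t) is still a
  supersolution of it; for |t| <= T the choice of M decides. A negative minimum of the difference
  would be attained because both functions vanish at infinity.\<close>

lemma U'_decay:
 assumes mu: "0 < \<mu>" "\<mu> < ind (f1 1)" "\<mu> < ind (f1 (-1))"
 obtains M where "M > 0" "!!t. U' t <= M * sech (\<mu> * t)"
proof -
 obtain T c where T: "T > 0" "c > 0" "!!t. \<bar>t\<bar> >= T ==> L1 (%t. sech (\<mu> * t)) (S' \<mu>) (S'' \<mu>) t <= - c * sech (\<mu> * t)"
  "!!t. \<bar>t\<bar> >= T ==> m * (sech t)\<^sup>2 <= c" "!!t. \<bar>t\<bar> >= T ==> m * (sech t)\<^sup>2 - f1 (U t) < 0"
  using far_field[OF mu] by metis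
 obtain B where B: "B >= 0" "!!t. \<bar>t\<bar> <= T ==> \<bar>U' t * cosh (\<mu> * t)\<bar> <= B"
 proof -
  have "continuous_on UNIV (%t. U' t * cosh (\<mu> * t))" by (intro continuous_intros cont)
  from compact_bounds[OF this, of T] that show ?thesis by blast
 qed
 define M where "M = B + 1"
 define w where "w t = M * sech (\<mu> * t) - U' t" for t
 define w' where "w' t = M * S' \<mu> t - U'' t" for t
 have wd: "(w has_real_derivative w' t) (at t)" for t
  unfolding w_def[abs_def] w'_def by (intro DERIV_diff DERIV_cmult S_DERIV U')
 have w'd: "(w' has_real_derivative M * S'' \<mu> t - U3 t) (at t)" for t
  unfolding w'_def[abs_def] by (intro DERIV_diff DERIV_cmult S_DERIV U3)
 have wc: "continuous_on UNIV w" using wd by (auto intro!: DERIV_continuous_on intro: has_field_derivative_at_within)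
 have wl: "(w ---> 0) at_top" "(w ---> 0) at_bot"
  unfolding w_def[abs_def]
  using tendsto_diff[OF tendsto_mult[OF tendsto_const[of M] sech_mu_lim(1)[OF mu(1)]] U'_lim(1)]
   tendsto_diff[OF tendsto_mult[OF tendsto_const[of M] sech_mu_lim(2)[OF mu(1)]] U'_lim(2)] by simp_all
 have "w s >= 0" for s
 proof (rule ccontr)
  assume "\<not> ?thesis"
  then have "w s < 0" by simp
  from global_min_real[OF wc wl this] obtain t where t: "!!s. w t <= w s" by blast
  have wt: "w t < 0" using t[of s] \<open>w s < 0\<close> by linarith
  note mn = second_derivative_min[OF wd w'd t]
  have far: "\<bar>t\<bar> >= T"
  proof (rule ccontr)
   assume "\<not> ?thesis"
   then have "\<bar>U' t * cosh (\<mu> * t)\<bar> <= B" using B(2) by simp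
   then have "U' t * cosh (\<mu> * t) <= M" by (simp add: M_def)
   then have "w t >= 0" by (simp add: w_def sech_def field_simps)
   then show False using wt by simp
  qed
  have "0 < (M * S'' \<mu> t - U3 t) + (m * (sech t)\<^sup>2 - f1 (U t)) * w t"
   using mn(2) mult_neg_neg[OF T(5)[OF far] wt] by linarith
  also have "... = M * S'' \<mu> t - U3 t + m * tanh t * w' t + (m * (sech t)\<^sup>2 - f1 (U t)) * w t" using mn(1) by simp
  also have "... = M * (L1 (%t. sech (\<mu> * t)) (S' \<mu>) (S'' \<mu>) t + m * (sech t)\<^sup>2 * sech (\<mu> * t))
    - (L1 U' U'' U3 t + m * (sech t)\<^sup>2 * U' t)"
   unfolding L1_def w_def w'_def by (simp add: algebra_simps)
  also have "... = M * (L1 (%t. sech (\<mu> * t)) (S' \<mu>) (S'' \<mu>) t + m * (sech t)\<^sup>2 * sech (\<mu> * t))"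
   unfolding L1_U' by simp
  also have "... <= M * 0"
  proof (rule mult_left_mono)
   have "m * (sech t)\<^sup>2 * sech (\<mu> * t) <= c * sech (\<mu> * t)"
    using T(4)[OF far] by (intro mult_right_mono) (auto simp: less_imp_le)
   then show "L1 (%t. sech (\<mu> * t)) (S' \<mu>) (S'' \<mu>) t + m * (sech t)\<^sup>2 * sech (\<mu> * t) <= 0"
    using T(3)[OF far] by linarith
  qed (use B in "simp add: M_def")
  finally show False by simp
 qed
 then show thesis
  using that[of M] B(1) by (auto simp: w_def M_def)
qed

text \<open>Since \<open>U'\<close> is a positive supersolution, strict near \<open>t = 0\<close>, and \<open>sech (\<mu> t)\<close> is a strict
 supersolution for large \<open>t\<close>, the sum of the first and a small multiple of the second is strict everywhere.\<close>

lemma barrier_exists: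
 assumes mu: "0 < \<mu>" "\<mu> < ind (f1 1)" "\<mu> < ind (f1 (-1))"
 obtains g g' g'' a b c0 where "a > 0" "c0 > 0"
  "!!t. (g has_real_derivative g' t) (at t)" "!!t. (g' has_real_derivative g'' t) (at t)" "continuous_on UNIV g''"
  "!!t. a * sech (\<mu> * t) <= g t" "!!t. g t <= b * sech (\<mu> * t)" "!!t. L1 g g' g'' t <= - c0 * g t"
proof -
 obtain T c where T: "T > 0" "c > 0" "!!t. \<bar>t\<bar> >= T ==> L1 (%t. sech (\<mu> * t)) (S' \<mu>) (S'' \<mu>) t <= - c * sech (\<mu> * t)"
  using far_field[OF mu] by metis
 obtain M where M: "M > 0" "!!t. U' t <= M * sech (\<mu> * t)" using U'_decay[OF mu] by metis
 have eS: "L1 (%t. sech (\<mu> * t)) (S' \<mu>) (S'' \<mu>) = (%t. (\<mu>\<^sup>2 * (2 * (tanh (\<mu> * t))\<^sup>2 - 1) - m * \<mu> * tanh t * tanh (\<mu> * t) - f1 (U t)) * sech (\<mu> * t))"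
  by (rule ext) (rule L1_sech)
 have cS: "continuous_on UNIV (L1 (%t. sech (\<mu> * t)) (S' \<mu>) (S'' \<mu>))"
  unfolding eS unfolding sech_def by (intro continuous_intros continuous_on_compose2[OF cont(4)[of UNIV] cont(1)]) auto
 obtain B where B: "B >= 0" "!!t. \<bar>t\<bar> <= T ==> \<bar>L1 (%t. sech (\<mu> * t)) (S' \<mu>) (S'' \<mu>) t\<bar> <= B"
  using compact_bounds[OF cS, of T] by metis
 have c2: "continuous_on UNIV (%t. 1 / (m * (sech t)\<^sup>2 * U' t))"
  unfolding sech_def using m U'_pos by (intro continuous_intros cont) (auto simp: less_imp_neq[symmetric])
 obtain D where D: "D >= 0" "!!t. \<bar>t\<bar> <= T ==> \<bar>1 / (m * (sech t)\<^sup>2 * U' t)\<bar> <= D"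
  using compact_bounds[OF c2, of T] by metis
 define k where "k = 1 / (D + 1)"
 have kpos: "k > 0" using D(1) by (simp add: k_def)
 have near: "m * (sech t)\<^sup>2 * U' t >= k" if "\<bar>t\<bar> <= T" for t
 proof -
  have p: "m * (sech t)\<^sup>2 * U' t > 0" using m U'_pos by (intro mult_pos_pos zero_less_power) auto
  have "1 / (m * (sech t)\<^sup>2 * U' t) <= D + 1"
   using order_trans[OF abs_ge_self D(2)[OF that]] by linarith
  then show ?thesis using p D(1) by (simp add: k_def field_simps)
 qed
 \<comment> \<open>For |t| <= T the sech term may contribute with the wrong sign, but by at most e B
   <= k/2, half of the strict negativity that U' provides there.\<close>
 define e where "e = k / (2 * (B + 1))"
 have e: "e > 0" using kpos B(1) by (simp add: e_def)
 have eB: "e * B <= k / 2"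
 proof -
  have "e * B <= e * (B + 1)" using e by simp
  also have "... = k / 2" using B(1) by (simp add: e_def field_simps)
  finally show ?thesis .
 qed
 define g where "g t = U' t + e * sech (\<mu> * t)" for t
 define g' where "g' t = U'' t + e * S' \<mu> t" for t
 define g'' where "g'' t = U3 t + e * S'' \<mu> t" for t
 define b where "b = M + e"
 \<comment> \<open>The rates of the outer and of the inner region, expressed through
   \<open>g\<close> by means of g <= b sech (\<mu> t) <= b.\<close>
 define c0 where "c0 = min (e * c / b) (k / (2 * b))"
 have bpos: "b > 0" using M e by (simp add: b_def)
 have c0: "c0 > 0" using e T(2) bpos kpos by (simp add: c0_def)
 have gu: "g t <= b * sech (\<mu> * t)" for t using M(2)[of t] by (simp add: g_def b_def algebra_simps)
 have L: "L1 g g' g'' t = - (m * (sech t)\<^sup>2 * U' t) + e * L1 (%t. sech (\<mu> * t)) (S' \<mu>) (S'' \<mu>) t" for t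
 proof -
  have "L1 g g' g'' t = L1 U' U'' U3 t + e * L1 (%t. sech (\<mu> * t)) (S' \<mu>) (S'' \<mu>) t"
   by (simp add: L1_def g_def g'_def g''_def algebra_simps)
  then show ?thesis by (simp add: L1_U')
 qed
 show thesis
 proof (rule that[of e c0 g g' g'' b])
  show "(g has_real_derivative g' t) (at t)" for t
   unfolding g_def[abs_def] g'_def by (intro DERIV_add DERIV_cmult S_DERIV U')
  show "(g' has_real_derivative g'' t) (at t)" for t
   unfolding g'_def[abs_def] g''_def by (intro DERIV_add DERIV_cmult S_DERIV U3)
  show "continuous_on UNIV g''"
   unfolding g''_def U3_def S''_def sech_def
   by (intro continuous_intros continuous_on_compose2[OF cont(4)[of UNIV] cont(1)] cont) auto
  show "e * sech (\<mu> * t) <= g t" for t using U'_pos[of t] by (simp add: g_def)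
  show "g t <= b * sech (\<mu> * t)" for t by (rule gu)
  show "L1 g g' g'' t <= - c0 * g t" for t
  proof (cases "\<bar>t\<bar> >= T")
   case True
   have "m * (sech t)\<^sup>2 * U' t >= 0" using m U'_pos[of t] by simp
   then have "L1 g g' g'' t <= e * (- c * sech (\<mu> * t))"
    unfolding L using mult_left_mono[OF T(3)[OF True], of e] e by linarith
   also have "... = - (e * c / b) * (b * sech (\<mu> * t))" using bpos by simp
   also have "... <= - (e * c / b) * g t"
    using e T(2) bpos gu[of t] by (intro mult_left_mono_neg) auto
   also have "... <= - c0 * g t"
    using U'_pos[of t] e by (intro mult_right_mono) (auto simp: c0_def g_def less_imp_le intro!: add_nonneg_nonneg)
   finally show ?thesis .
  next
   case False
   then have t: "\<bar>t\<bar> <= T" by simp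
   have "e * L1 (%t. sech (\<mu> * t)) (S' \<mu>) (S'' \<mu>) t <= e * B" using B(2)[OF t] e by (intro mult_left_mono) auto
   then have "L1 g g' g'' t <= - (k / 2)" unfolding L using near[OF t] eB by linarith
   also have "... = - (k / (2 * b)) * b" using bpos by simp
   also have "... <= - (k / (2 * b)) * g t"
   proof (rule mult_left_mono_neg)
    show "g t <= b" using gu[of t] sech_le_1[of "\<mu> * t"] bpos by (meson less_imp_le mult_left_le order_trans)
   qed (use kpos bpos in auto)
   also have "... <= - c0 * g t"
    using U'_pos[of t] e by (intro mult_right_mono) (auto simp: c0_def g_def less_imp_le intro!: add_nonneg_nonneg)
   finally show ?thesis .
  qed
 qed (use e c0 in auto)
qed

end

section \<open>Maximum principle and weighted sup estimate\<close>

text \<open>At a minimum the gradient vanishes, so the Christoffel part of the Hessian drops out and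
  second derivatives along straight coordinate lines decide.\<close>

lemma (in hyperbolic_chart) laplace_min:
 assumes u: "Ck 2 u" and mn: "!!p. u p0 <= u p"
 shows "laplace G u p0 >= 0"
proof -
 have d0: "dderiv u p0 v = 0" for v
 proof -
  have "(%v. dderiv u p0 v) = (%v. 0)"
   by (rule differential_zero_maxmin[of p0 UNIV u]) (use mn Ck2D(1)[OF u] in auto)
  then show ?thesis by metis
 qed
 have "hess G u p0 e e >= 0" for e
 proof -
  let ?w = "%s::real. u (p0 + s *R e)" and ?w' = "%s::real. dderiv u (p0 + s *R e) e"
  have l: "((%s::real. p0 + s *R e) has_derivative (%h. h *R e)) (at s)" for s
   by (auto intro!: derivative_eq_intros)
  have 1: "(?w has_real_derivative ?w' s) (at s)" for s
   using has_derivative_compose[OF l Ck2D(1)[OF u]]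
   by (simp add: has_field_derivative_def linear_cmul[OF Ck2_linear1[OF u]] mult_commute_abs)
  have 2: "(?w' has_real_derivative dd2 u e p0 e) (at 0)"
   using has_derivative_compose[OF l Ck2D(2)[OF u, of e], of 0]
   by (simp add: has_field_derivative_def linear_cmul[OF Ck2_dd_linear1[OF u]] mult_commute_abs)
  have "dd2 u e p0 e >= 0"
   by (rule second_derivative_min(2)[OF 1 2]) (use mn in simp)
  then show ?thesis by (simp only: hess_eq d0)
 qed
 then show ?thesis unfolding laplace_eq[OF u orthonormal_frame] by (intro sum_nonneg) auto
qed

lemma hypZ_lower: "hyp.Z q x >= norm x * (jp q - norm q)"
proof -
 have "q \<bullet> x <= norm q * norm x" by (rule norm_cauchy_schwarz)
 moreover have "jp q * jp x >= jp q * norm x"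
  by (intro mult_left_mono) (auto intro!: real_le_rsqrt simp: power2_norm_eq_inner)
 ultimately show ?thesis by (simp add: hyp.Z_def HX_def mink_def algebra_simps)
qed

lemma jp_gt_norm: "jp q > norm q"
 by (rule real_less_rsqrt) (simp add: power2_norm_eq_inner)

text \<open>Growth of the quotient of the two barriers in \<open>sup_estimate\<close>. A large
  Euclidean norm in the chart forces |t| or |x| to be large, hence one of the two factors, while the
  other one is at least 1.\<close>

lemma ratio_lower:
 fixes q :: "'a::euclidean_space"
 assumes "\<mu> > 0" "\<delta> > 0"
 obtains S where "!!p :: real * 'a. norm p > S ==> cosh (\<mu> * fst p) * (zq q p / cosh (fst p)) powr \<delta> > R"
proof -
 define R1 where "R1 = max 1 R"
 obtain A where A: "!!t. t >= A ==> cosh (\<mu> * t) > R1"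
 proof -
  have "filterlim (%t. cosh (\<mu> * t)) at_top at_top"
   by (rule filterlim_compose[OF cosh_real_at_top filterlim_tendsto_pos_mult_at_top[OF tendsto_const assms(1) filterlim_ident]])
  then have "\<forall>\<^sub>F t in at_top. cosh (\<mu> * t) > R1" unfolding filterlim_at_top_dense by blast
  then show thesis using that unfolding eventually_at_top_linorder by blast
 qed
 define B where "B = ((R1 + 1) powr (1 / \<delta>)) / (jp q - norm q)"
 have jn: "jp q - norm q > 0" using jp_gt_norm[of q] by simp
 have main: "cosh (\<mu> * fst p) * (zq q p / cosh (fst p)) powr \<delta> > R"
  if n: "norm p > max A 1 + max B 1" for p :: "real * 'a"
 proof -
  have z: "zq q p / cosh (fst p) = hyp.Z q (snd p)" by (simp add: zq_eq)
  have "norm p <= norm (fst p) + norm (snd p)" by (cases p) (simp only: fst_conv snd_conv norm_Pair_le)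
  then have "\<bar>fst p\<bar> > max A 1 \<or> norm (snd p) > max B 1" using n by (simp only: real_norm_def) linarith
  then show ?thesis
  proof
   assume "\<bar>fst p\<bar> > max A 1"
   then have "cosh (\<mu> * \<bar>fst p\<bar>) > R1" using A by simp
   moreover have "cosh (\<mu> * \<bar>fst p\<bar>) = cosh (\<mu> * fst p)" by (cases "fst p >= 0") auto
   moreover have "hyp.Z q (snd p) powr \<delta> >= 1" using hyp.Z_ge1 assms(2) by (intro fm.powr_ge_1_of_ge_1) auto
   ultimately have "cosh (\<mu> * fst p) * hyp.Z q (snd p) powr \<delta> > R1 * 1"
    by (intro mult_less_le_imp_less) (auto simp: R1_def)
   then show ?thesis unfolding z by (simp add: R1_def)
  next
   assume "norm (snd p) > max B 1"
   then have "norm (snd p) > B" by simp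
   then have "norm (snd p) * (jp q - norm q) > (R1 + 1) powr (1 / \<delta>)" using jn by (simp add: B_def field_simps)
   then have "hyp.Z q (snd p) > (R1 + 1) powr (1 / \<delta>)" using hypZ_lower[of "snd p" q] by linarith
   then have "hyp.Z q (snd p) powr \<delta> > ((R1 + 1) powr (1 / \<delta>)) powr \<delta>" using assms(2) by (intro powr_less_mono2) auto
   also have "((R1 + 1) powr (1 / \<delta>)) powr \<delta> = R1 + 1" using assms(2) by (simp add: powr_powr R1_def)
   finally have "1 * R1 < cosh (\<mu> * fst p) * hyp.Z q (snd p) powr \<delta>"
    by (intro mult_le_less_imp_less) (auto simp: cosh_real_ge_1 R1_def)
   then show ?thesis unfolding z by (simp add: R1_def)
  qed
 qed
 then show thesis by (rule that)
qed

context heteroclinic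
begin

text \<open>What \<open>barrier_calculus\<close> adds to the one-dimensional operator is
  nonpositive, because \<delta>^2 <= (m - 1) \<delta> and the remaining term is subtracted.\<close>

lemma barrier_supersolution:
 fixes q :: "'a::euclidean_space" and p :: "real * 'a"
 assumes m: "m = real DIM('a)" and d: "0 < \<delta>" "\<delta> <= m - 1"
  and g: "!!t. (g has_real_derivative g' t) (at t)" "!!t. (g' has_real_derivative g'' t) (at t)" "continuous_on UNIV g''"
  and pos: "!!t. g t >= 0" and L: "!!t. L1 g g' g'' t <= - c0 * g t"
 shows "laplace gfermi (barrier q \<delta> g) p - f1 (U (fst p)) * barrier q \<delta> g p <= - c0 * barrier q \<delta> g p"
proof -
 define W where "W = (cosh (fst p) / zq q p) powr \<delta>"
 define t where "t = fst p"
 have W: "W >= 0" by (simp add: W_def)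
 have "\<delta>\<^sup>2 - (m - 1) * \<delta> <= 0" using mult_right_mono[OF d(2), of \<delta>] d(1) by (simp add: power2_eq_square)
 then have "(1 - (tanh t)\<^sup>2) * (\<delta>\<^sup>2 - (m - 1) * \<delta>) <= 0"
  using tanh_sq_le[of t] by (intro mult_nonneg_nonpos) auto
 moreover have "\<delta> * (\<delta> + 1) / (zq q p)\<^sup>2 >= 0" using d(1) by simp
 ultimately have "g t * ((1 - (tanh t)\<^sup>2) * (\<delta>\<^sup>2 - (m - 1) * \<delta>) - \<delta> * (\<delta> + 1) / (zq q p)\<^sup>2) <= 0"
  using pos by (intro mult_nonneg_nonpos) auto
 then have "g'' t + m * tanh t * g' t + g t * ((1 - (tanh t)\<^sup>2) * (\<delta>\<^sup>2 - (m - 1) * \<delta>) - \<delta> * (\<delta> + 1) / (zq q p)\<^sup>2) - f1 (U t) * g t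
   <= - c0 * g t" using L[of t] unfolding L1_def by linarith
 then have "(g'' t + m * tanh t * g' t + g t * ((1 - (tanh t)\<^sup>2) * (\<delta>\<^sup>2 - (m - 1) * \<delta>) - \<delta> * (\<delta> + 1) / (zq q p)\<^sup>2) - f1 (U t) * g t) * W
   <= - c0 * g t * W" using W by (rule mult_right_mono)
 then show ?thesis
  unfolding barrier_calculus(2)[OF g] barrier_def unfolding W_def[symmetric] unfolding t_def[symmetric] m[symmetric]
  by (simp add: algebra_simps)
qed

text \<open>The barrier with exponents \<open>\<mu>/2\<close>, \<open>\<delta>/2\<close> dominates the one with \<open>\<mu>\<close>, \<open>\<delta>\<close> at infinity. A small
 multiple of it is added to force the quotient to attain its minimum.\<close>

lemma sup_estimate:
 fixes q :: "'a::euclidean_space"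
 assumes m: "m = real DIM('a)" and d: "0 < \<delta>" "\<delta> <= m - 1"
  and mu: "0 < \<mu>" "\<mu> < ind (f1 1)" "\<mu> < ind (f1 (-1))"
 obtains h :: "real => real" and c0 a b :: real where "c0 > 0" "a > 0" "!!t. a <= h t" "!!t. h t <= b"
  "!!K M w p. K >= 0 ==> M >= 0 ==> Ck 2 w ==> (\<exists>B. \<forall>p. \<bar>w p\<bar> <= B) ==>
   (!!p :: real * 'a. \<bar>K * w p - Lt q \<mu> \<delta> (%t. f1 (U t)) w p\<bar> <= M * h (fst p)) ==>
   \<bar>w p\<bar> <= M / (K + c0) * h (fst p)"
proof -
 obtain g g' g'' a b c0 where g: "a > 0" "c0 > 0"
  "!!t. (g has_real_derivative g' t) (at t)" "!!t. (g' has_real_derivative g'' t) (at t)" "continuous_on UNIV g''"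
  "!!t. a * sech (\<mu> * t) <= g t" "!!t. g t <= b * sech (\<mu> * t)" "!!t. L1 g g' g'' t <= - c0 * g t"
  using barrier_exists[OF mu] by metis
 have mu2: "0 < \<mu> / 2" "\<mu> / 2 < ind (f1 1)" "\<mu> / 2 < ind (f1 (-1))" using mu by auto
 obtain k k' k'' a2 b2 c2 where k: "a2 > 0" "c2 > 0"
  "!!t. (k has_real_derivative k' t) (at t)" "!!t. (k' has_real_derivative k'' t) (at t)" "continuous_on UNIV k''"
  "!!t. a2 * sech (\<mu> / 2 * t) <= k t" "!!t. k t <= b2 * sech (\<mu> / 2 * t)" "!!t. L1 k k' k'' t <= - c2 * k t"
  using barrier_exists[OF mu2] by metis
 have sp: "sech (\<mu> * t) > 0" "sech (\<mu> / 2 * t) > 0" for t by auto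
 have gp: "g t > 0" for t using g(6)[of t] mult_pos_pos[OF g(1) sp(1)[of t]] by linarith
 have kp: "k t > 0" for t using k(6)[of t] mult_pos_pos[OF k(1) sp(2)[of t]] by linarith
 define P where "P = barrier q \<delta> g"
 define Q where "Q = barrier q (\<delta> / 2) k"
 define V where "V t = f1 (U t)" for t
 have Pc: "Ck 2 P" and Qc: "Ck 2 Q" unfolding P_def Q_def using barrier_calculus(1)[OF g(3-5)] barrier_calculus(1)[OF k(3-5)] by auto
 have PL: "laplace gfermi P p - V (fst p) * P p <= - c0 * P p" for p
  unfolding P_def V_def by (rule barrier_supersolution[OF m d g(3-5) less_imp_le[OF gp] g(8)])
 have QL: "laplace gfermi Q p - V (fst p) * Q p <= - c2 * Q p" for p
  unfolding Q_def V_def by (rule barrier_supersolution[OF m _ _ k(3-5) less_imp_le[OF kp] k(8)]) (use d in auto)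
 have cz: "cosh (fst p) / zq q p > 0" for p using zq_ge1[of q p] by (intro divide_pos_pos) auto
 have Pp: "P p > 0" and Qp: "Q p > 0" for p
  unfolding P_def Q_def barrier_def
  by (rule mult_pos_pos[OF gp powr_gt_zero[THEN iffD2, OF less_imp_neq[OF cz, symmetric]]],
    rule mult_pos_pos[OF kp powr_gt_zero[THEN iffD2, OF less_imp_neq[OF cz, symmetric]]])
 define h where "h t = g t / sech (\<mu> * t)" for t
 have wh: "weight q \<mu> \<delta> p * h (fst p) = P p" for p
  using less_imp_neq[OF sp(1)[of "fst p"]] by (simp add: weight_eq h_def P_def barrier_def)
 have ha: "a <= h t" "h t <= b" for t using g(6,7)[of t] sp(1)[of t] by (auto simp: h_def field_simps)
 have hp: "h t > 0" for t using ha(1)[of t] g(1) by linarith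
 have one_sided: "w p <= M / (K + c0) * h (fst p)"
  if K: "K >= 0" and M: "M >= 0" and w: "Ck 2 w" and B: "!!p. \<bar>w p\<bar> <= B"
   and e: "!!p. K * w p - Lt q \<mu> \<delta> V w p <= M * h (fst p)" for K M w B p
 proof -
  define M' where "M' = M / (K + c0)"
  have M': "M' >= 0" "M' * (K + c0) = M" using M K g(2) by (auto simp: M'_def)
  define u where "u p = weight q \<mu> \<delta> p * w p" for p
  have uc: "Ck 2 u" unfolding u_def[abs_def] by (rule Ck2_mult(1)[OF weight_calculus(1) w])
  have uL: "K * u p - (laplace gfermi u p - V (fst p) * u p) <= M * P p" for p
  proof -
   have "laplace gfermi u p - V (fst p) * u p = weight q \<mu> \<delta> p * Lt q \<mu> \<delta> V w p"
    unfolding u_def[abs_def] fm.laplace_mult[OF weight_calculus(1) w] weight_calculus(2)[where V=V]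
     weight_calculus(3)[OF fm.Ck2_differentiable[OF w]] Lt_def by (simp add: algebra_simps)
   then have "K * u p - (laplace gfermi u p - V (fst p) * u p) = weight q \<mu> \<delta> p * (K * w p - Lt q \<mu> \<delta> V w p)"
    by (simp add: u_def algebra_simps)
   also have "... <= weight q \<mu> \<delta> p * (M * h (fst p))"
    using weight_pos[of q \<mu> \<delta> p] by (intro mult_left_mono e) auto
   also have "... = M * P p" using wh[of p] by simp
   finally show ?thesis .
  qed
  \<comment> \<open>If the bound fails somewhere, the quotient \<open>r\<close> of the difference by
    \<open>P\<close> is negative there and positive outside a ball, so it has a negative global
    minimum \<open>- s\<close>. Adding s P yields the C^2 function \<open>H\<close> >= 0 with a zero
    at \<open>z\<close>, to which \<open>laplace_min\<close> applies.\<close>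
  have step: "u p <= M' * P p + \<eta> * Q p" if eta: "\<eta> > 0" for \<eta> p
  proof (rule ccontr)
   assume "\<not> ?thesis"
   then have neg: "M' * P p + \<eta> * Q p - u p < 0" by simp
   define v where "v p = (M' * P p + \<eta> * Q p) + (-1) * u p" for p
   define r where "r p = v p / P p" for p
   note c1 = Ck2_cmult(1)[OF Pc, of M'] and c2 = Ck2_cmult(1)[OF Qc, of \<eta>]
   have vc: "Ck 2 v" unfolding v_def[abs_def] by (rule Ck2_add(1)[OF Ck2_add(1)[OF c1 c2] Ck2_cmult(1)[OF uc]])
   have rc: "continuous_on UNIV r" unfolding r_def
    using Ck2_continuous[OF vc] Ck2_continuous[OF Pc] less_imp_neq[OF Pp] by (intro continuous_on_divide) auto
   have rp: "r p < 0" using neg Pp[of p] by (simp add: r_def v_def divide_neg_pos)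
   have QP: "Q p / P p >= a2 / b * (cosh (\<mu> / 2 * fst p) * (zq q p / cosh (fst p)) powr (\<delta> / 2))" for p
   proof -
    define y where "y = zq q p / cosh (fst p)"
    have y: "y > 0" "cosh (fst p) / zq q p = 1 / y" using cz[of p] zq_ge1[of q p] by (auto simp: y_def)
    have bpos: "b > 0" using ha[of 0] g(1) by linarith
    \<comment> \<open>From the doubling formula; through it the slower decay of \<open>k\<close>
      gains the factor cosh (\<mu> t / 2) over \<open>g\<close>.\<close>
    have ch: "(cosh (\<mu> / 2 * fst p))\<^sup>2 <= cosh (\<mu> * fst p)"
     using cosh_double_cosh[of "\<mu> / 2 * fst p"] cosh_real_ge_1[of "\<mu> / 2 * fst p"]
      one_le_power[of "cosh (\<mu> / 2 * fst p)" 2] by (simp add: mult.assoc)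
    have "a2 / b * cosh (\<mu> / 2 * fst p) <= a2 / b * (cosh (\<mu> * fst p) / cosh (\<mu> / 2 * fst p))"
     using ch k(1) bpos by (intro mult_left_mono) (auto simp: field_simps power2_eq_square)
    also have "... = (a2 * sech (\<mu> / 2 * fst p)) / (b * sech (\<mu> * fst p))" by (simp add: sech_def)
    also have "... <= k (fst p) / g (fst p)"
     using k(6) g(7) gp kp k(1) by (intro frac_le) (auto simp: less_imp_le)
    finally have 1: "a2 / b * cosh (\<mu> / 2 * fst p) <= k (fst p) / g (fst p)" .
    have "Q p / P p = k (fst p) / g (fst p) * ((1 / y) powr (\<delta> / 2) / (1 / y) powr \<delta>)"
     by (simp add: Q_def P_def barrier_def y(2))
    also have "(1 / y) powr (\<delta> / 2) / (1 / y) powr \<delta> = (1 / y) powr (\<delta> / 2 - \<delta>)" using y(1) by (simp only: powr_diff)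
    also have "... = y powr (\<delta> / 2)" using y(1) by (simp add: powr_divide powr_minus field_simps)
    finally have "Q p / P p = k (fst p) / g (fst p) * y powr (\<delta> / 2)" .
    moreover have "a2 / b * cosh (\<mu> / 2 * fst p) * y powr (\<delta> / 2) <= k (fst p) / g (fst p) * y powr (\<delta> / 2)"
     by (intro mult_right_mono 1) auto
    ultimately show ?thesis unfolding y_def[symmetric] by (simp add: mult.assoc)
   qed
   have bpos: "b > 0" using ha[of 0] g(1) by linarith
   obtain S where S: "!!p :: real * 'a. norm p > S ==>
     cosh (\<mu> / 2 * fst p) * (zq q p / cosh (fst p)) powr (\<delta> / 2) > B / a * b / (a2 * \<eta>)"
    using ratio_lower[where \<mu>="\<mu> / 2" and \<delta>="\<delta> / 2" and q=q and R="B / a * b / (a2 * \<eta>)"] mu d by auto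
   have far: "r p > 0" if "norm p > S" for p
   proof -
    have "w p / h (fst p) <= B / a"
     using B[of p] ha(1)[of "fst p"] g(1) by (intro frac_le) auto
    moreover have "u p / P p = w p / h (fst p)"
     using wh[of p] hp[of "fst p"] weight_pos[of q \<mu> \<delta> p] by (simp add: u_def flip: wh)
    moreover have "\<eta> * (Q p / P p) > B / a"
    proof -
     have "B / a = \<eta> * (a2 / b * (B / a * b / (a2 * \<eta>)))" using eta k(1) bpos by simp
     also have "... < \<eta> * (a2 / b * (cosh (\<mu> / 2 * fst p) * (zq q p / cosh (fst p)) powr (\<delta> / 2)))"
      using S[OF that] eta k(1) bpos by (intro mult_strict_left_mono) auto
     also have "... <= \<eta> * (Q p / P p)" using QP[of p] eta by (intro mult_left_mono) auto
     finally show ?thesis .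
    qed
    moreover have "r p = M' + \<eta> * (Q p / P p) - u p / P p"
     using Pp[of p] by (simp add: r_def v_def field_simps)
    ultimately show ?thesis using M'(1) by linarith
   qed
   have "\<exists>z\<in>cball 0 (max S (norm p)). \<forall>y\<in>cball 0 (max S (norm p)). r z <= r y"
    by (rule continuous_attains_inf[OF compact_cball]) (auto intro: continuous_on_subset[OF rc])
   then obtain z where z: "!!y. norm y <= max S (norm p) ==> r z <= r y"
    unfolding Bex_def Ball_def mem_cball_0 by blast
   have rz: "r z < 0" using z[of p] rp by simp
   have glob: "r z <= r y" for y
   proof (cases "norm y <= max S (norm p)")
    case False
    then have "r y > 0" by (intro far) (simp add: max_def split: if_splits)
    then show ?thesis using rz by linarith
   qed (rule z)
   define s where "s = - r z"
   have s: "s > 0" using rz by (simp add: s_def)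
   define H where "H p = v p + s * P p" for p
   have Hc: "Ck 2 H" unfolding H_def[abs_def] by (rule Ck2_add(1)[OF vc Ck2_cmult(1)[OF Pc]])
   have Hr: "H p = (r p + s) * P p" for p using Pp[of p] by (simp add: H_def r_def field_simps)
   have H0: "H z = 0" by (simp add: Hr s_def)
   have "H y >= 0" for y unfolding Hr using glob[of y] Pp[of y] by (intro mult_nonneg_nonneg) (auto simp: s_def)
   then have lap: "laplace gfermi H z >= 0" using fm.laplace_min[OF Hc, of z] H0 by simp
   have lH: "laplace gfermi H z = M' * laplace gfermi P z + \<eta> * laplace gfermi Q z - laplace gfermi u z + s * laplace gfermi P z"
    unfolding H_def[abs_def] fm.laplace_add[OF vc Ck2_cmult(1)[OF Pc]] unfolding v_def[abs_def]
     fm.laplace_add[OF Ck2_add(1)[OF c1 c2] Ck2_cmult(1)[OF uc]] fm.laplace_add[OF c1 c2]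
     fm.laplace_cmult[OF Pc] fm.laplace_cmult[OF Qc] fm.laplace_cmult[OF uc] by simp
   have H0': "(M' + s) * P z + \<eta> * Q z - u z = 0" using H0 by (simp add: H_def v_def algebra_simps)
   have "(M' + s) * (laplace gfermi P z - V (fst z) * P z) <= (M' + s) * (- c0 * P z)"
    using M'(1) s by (intro mult_left_mono PL) auto
   moreover have "\<eta> * (laplace gfermi Q z - V (fst z) * Q z) <= \<eta> * (- c2 * Q z)"
    using eta by (intro mult_left_mono QL) auto
   moreover have "\<eta> * (- c2 * Q z) <= 0" using eta k(2) Qp[of z] by (simp add: mult_pos_pos less_imp_le)
   moreover have "K * ((M' + s) * P z + \<eta> * Q z - u z) = 0" using H0' by simp
   moreover have "V (fst z) * ((M' + s) * P z + \<eta> * Q z - u z) = 0" using H0' by simp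
   moreover have "K * (\<eta> * Q z) >= 0" using K eta Qp[of z] by simp
   moreover note uL[of z] lap lH
   \<comment> \<open>The value of \<open>u\<close> at \<open>z\<close> is eliminated by
     \<open>H\<close> = 0. What remains is absurd, since M' (K + c0) = M and s > 0.\<close>
   ultimately have "(M' + s) * (K + c0) * P z <= M * P z" by (simp add: algebra_simps)
   moreover have "(M' + s) * (K + c0) * P z = M' * (K + c0) * P z + s * (K + c0) * P z" by (simp add: algebra_simps)
   ultimately have "s * (K + c0) * P z <= 0" unfolding M'(2) by linarith
   moreover have "s * (K + c0) * P z > 0" using s K g(2) Pp[of z] by simp
   ultimately show False by simp
  qed
  have "((%\<eta>. M' * P p + \<eta> * Q p) ---> M' * P p + 0 * Q p) (at_right 0)" by (intro tendsto_intros)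
  then have "u p <= M' * P p + 0 * Q p"
   by (rule tendsto_lowerbound) (auto simp: eventually_at_right_field intro!: exI[of _ 1] step)
  then have "weight q \<mu> \<delta> p * w p <= weight q \<mu> \<delta> p * (M' * h (fst p))" using wh[of p] by (simp add: u_def mult.left_commute)
  then show ?thesis unfolding mult_le_cancel_left_pos[OF weight_pos] M'_def .
 qed
 show thesis
 proof (rule that[of c0 a h b])
  fix K M w p
  assume K: "K >= 0" "M >= (0::real)" and w: "Ck 2 w" "\<exists>B. \<forall>p. \<bar>w p\<bar> <= B"
   and e: "!!p :: real * 'a. \<bar>K * w p - Lt q \<mu> \<delta> (%t. f1 (U t)) w p\<bar> <= M * h (fst p)"
  obtain B where B: "!!p. \<bar>w p\<bar> <= B" using w(2) by blast
  have e': "\<bar>K * w p - Lt q \<mu> \<delta> V w p\<bar> <= M * h (fst p)" for p using e[of p] by (simp add: V_def[abs_def])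
  have 1: "w p <= M / (K + c0) * h (fst p)"
   by (rule one_sided[OF K w(1) B]) (use e' in "simp add: abs_le_iff")
  have lin: "Lt q \<mu> \<delta> V (%p. (-1) * w p + 0 * w p) p = (-1) * Lt q \<mu> \<delta> V w p + 0 * Lt q \<mu> \<delta> V w p" for p
   by (rule Lt_linear[OF w(1) w(1)])
  have "(-1) * w p <= M / (K + c0) * h (fst p)"
  proof (rule one_sided[OF K Ck2_cmult(1)[OF w(1)]])
   show "\<bar>(-1) * w p\<bar> <= B" for p using B[of p] by simp
   show "K * ((-1) * w p) - Lt q \<mu> \<delta> V (%p. (-1) * w p) p <= M * h (fst p)" for p
    using lin[of p] e'[of p] by (simp add: abs_le_iff)
  qed
  then show "\<bar>w p\<bar> <= M / (K + c0) * h (fst p)" using 1 by (simp add: abs_le_iff)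
 qed (use g ha in auto)
qed

end

section \<open>Hyperbolic volume and Gaussian integrals\<close>

text \<open>Upper half-space coordinates \<open>(\<xi>, e\<^sup>\<tau>)\<close> on the hyperboloid. Translations and dilations act on them
 affinely, so the invariance of the hyperbolic volume \<open>e\<^bsup>-m\<tau>\<^esup> d\<xi> d\<tau>\<close> follows from that of Lebesgue measure.\<close>

definition hsY :: "'a::euclidean_space \<times> real => real * real * 'a" where
 "hsY w = ((exp (snd w) + exp (- snd w) * (1 + fst w \<bullet> fst w)) / 2,
   (exp (snd w) + exp (- snd w) * (fst w \<bullet> fst w - 1)) / 2, exp (- snd w) *R fst w)"

definition hsN :: "('a::euclidean_space \<times> real) measure" where
 "hsN = density lborel (%w. ennreal (exp (- (real DIM('a) * snd w))))"

text \<open>Fermi coordinates are kept for the point of evaluation and half-space coordinates for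
  the integration variable; the ambient product couples the two without a change of charts.\<close>

definition ZZ :: "real * 'a::euclidean_space => 'a \<times> real => real" where
 "ZZ p w = - mink (FX p) (hsY w)"

text \<open>The half-space formula cosh d = 1 + (|\<xi> - \<xi>'|^2 + (y - y')^2) / (2 y y') with y
  = e^\<tau>.\<close>

lemma hsY_mink: "- mink (hsY v) (hsY w) =
  cosh (snd v - snd w) + (fst v - fst w) \<bullet> (fst v - fst w) * exp (- snd v - snd w) / 2"
proof -
 have e: "exp (- snd v - snd w) = exp (- snd v) * exp (- snd w)" "exp (snd v - snd w) = exp (snd v) * exp (- snd w)"
  "exp (snd w - snd v) = exp (snd w) * exp (- snd v)"
  by (simp_all flip: exp_add)
 define E e F f a b c where d: "E = exp (snd v)" "e = exp (- snd v)" "F = exp (snd w)" "f = exp (- snd w)"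
  "a = fst v \<bullet> fst v" "b = fst w \<bullet> fst w" "c = fst v \<bullet> fst w"
 have "(E + e * (1 + a)) * (F + f * (1 + b)) - (E + e * (a - 1)) * (F + f * (b - 1)) = 2 * (E * f + F * e) + 2 * (e * f * (a + b))"
  by (simp add: algebra_simps)
 then have "- mink (hsY v) (hsY w) = (2 * (E * f + F * e) + 2 * (e * f * (a + b))) / 4 - e * f * c"
  by (simp add: hsY_def mink_def inner_prod_def d diff_divide_distrib)
 also have "... = (E * f + F * e) / 2 + (a + b - 2 * c) * (e * f) / 2" by (simp add: field_simps)
 also have "... = cosh (snd v - snd w) + (fst v - fst w) \<bullet> (fst v - fst w) * exp (- snd v - snd w) / 2"
  unfolding e d cosh_field_def using e by (simp add: inner_diff_left inner_diff_right inner_commute[of "fst w" "fst v"])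
 finally show ?thesis .
qed

lemma hsY_in: "hsY w \<in> hyperboloid"
proof -
 have "- mink (hsY w) (hsY w) = 1" unfolding hsY_mink by simp
 moreover have "fst (hsY w) > 0" by (simp add: hsY_def add_pos_nonneg)
 ultimately show ?thesis by (simp add: hyperboloid_def)
qed

text \<open>The difference y0 - y1 of the first two coordinates is e^(-\<tau>), and dividing the
  last one by it gives \<xi>. It is positive because y1^2 < y0^2.\<close>

lemma hsY_surj: assumes "Y \<in> hyperboloid" obtains w :: "'a::euclidean_space \<times> real" where "Y = hsY w"
proof -
 obtain y0 y1 and y2 :: 'a where Y: "Y = (y0, y1, y2)" by (metis prod.exhaust)
 have q: "y0 * y0 - y1 * y1 = 1 + y2 \<bullet> y2" and y0: "y0 > 0"
  using assms by (auto simp: hyperboloid_def Y mink_def inner_prod_def algebra_simps)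
 then have "y1 * y1 < y0 * y0" using inner_ge_zero[of y2] by linarith
 then have d: "y0 - y1 > 0" using power2_less_imp_less[of y1 y0] y0 by (simp add: power2_eq_square)
 define w where "w = (y2 /\<^sub>R (y0 - y1), - ln (y0 - y1))"
 have e: "exp (- snd w) = y0 - y1" "exp (snd w) = 1 / (y0 - y1)"
  using d by (simp_all add: w_def exp_minus inverse_eq_divide)
 have i: "(y0 - y1) * (fst w \<bullet> fst w) = (y2 \<bullet> y2) / (y0 - y1)"
 proof -
  have "(y0 - y1) * (fst w \<bullet> fst w) = ((y0 - y1) * inverse (y0 - y1)) * (inverse (y0 - y1) * (y2 \<bullet> y2))"
   by (simp add: w_def)
  also have "(y0 - y1) * inverse (y0 - y1) = 1" using d by simp
  finally show ?thesis by (simp add: inverse_eq_divide)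
 qed
 have s: "1 / (y0 - y1) + (y2 \<bullet> y2) / (y0 - y1) = y0 + y1"
  using d q by (simp add: field_simps)
 have "Y = hsY w"
 proof -
  have v: "(y0 - y1) *R fst w = y2" using d by (simp add: w_def)
  have "(1 / (y0 - y1) + (y0 - y1) * (1 + fst w \<bullet> fst w)) / 2 = y0"
   "(1 / (y0 - y1) + (y0 - y1) * (fst w \<bullet> fst w - 1)) / 2 = y1"
   unfolding distrib_left right_diff_distrib i using s by simp_all
  then show ?thesis unfolding hsY_def e Y v by simp
 qed
 then show thesis by (rule that)
qed

lemma hsY_continuous: "continuous_on UNIV hsY"
 unfolding hsY_def by (intro continuous_intros) auto

lemma hsY_measurable [measurable]: "hsY \<in> borel_measurable borel"
 by (rule borel_measurable_continuous_onI[OF hsY_continuous])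

lemma sets_hsN [measurable_cong]: "sets hsN = sets borel" by (simp add: hsN_def)
lemma space_hsN [simp]: "space hsN = UNIV" by (simp add: hsN_def)

lemma ZZ_ge1: "ZZ p w >= 1"
 unfolding ZZ_def by (rule mink_hyperboloid_ge1[OF fm.X_in hsY_in])

lemma ZZ_continuous: "continuous_on UNIV (ZZ p)"
 unfolding ZZ_def[abs_def] by (intro continuous_intros mink.continuous_on hsY_continuous)

lemma ZZ_measurable [measurable]: "ZZ p \<in> borel_measurable borel"
 by (rule borel_measurable_continuous_onI[OF ZZ_continuous])

lemma fst_snd_measurable [measurable]:
 "(fst :: 'a::euclidean_space \<times> real => _) \<in> borel_measurable borel"
 "(snd :: 'a \<times> real => _) \<in> borel_measurable borel"
 by (intro borel_measurable_continuous_onI continuous_intros)+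

lemma cosh_measurable [measurable]: "(cosh :: real => real) \<in> borel_measurable borel"
 by (intro borel_measurable_continuous_onI continuous_intros)

lemma nn_integral_hsN:
 assumes [measurable]: "F \<in> borel_measurable borel"
 shows "(\<integral>\<^sup>+w. F w \<partial>(hsN :: ('a::euclidean_space \<times> real) measure))
  = (\<integral>\<^sup>+t. \<integral>\<^sup>+x. ennreal (exp (- (real DIM('a) * t))) * F (x, t) \<partial>lborel \<partial>lborel)"
proof -
 have "(\<integral>\<^sup>+w. F w \<partial>(hsN :: ('a \<times> real) measure)) = (\<integral>\<^sup>+w. ennreal (exp (- (real DIM('a) * snd w))) * F w \<partial>lborel)"
  unfolding hsN_def by (rule nn_integral_density) simp_all
 also have "... = (\<integral>\<^sup>+w. ennreal (exp (- (real DIM('a) * snd w))) * F w \<partial>(lborel \<Otimes>\<^sub>M lborel))"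
  by (simp add: lborel_prod)
 also have "... = (\<integral>\<^sup>+t. \<integral>\<^sup>+x. ennreal (exp (- (real DIM('a) * snd (x, t)))) * F (x, t) \<partial>lborel \<partial>lborel)"
  by (rule lborel_pair.nn_integral_snd[symmetric]) (simp add: lborel_prod)
 finally show ?thesis by simp
qed

lemma nn_integral_lborel_affine:
 fixes f :: "'a::euclidean_space => ennreal"
 assumes [measurable]: "f \<in> borel_measurable borel" and c: "c > 0"
 shows "(\<integral>\<^sup>+x. f x \<partial>lborel) = ennreal (c ^ DIM('a)) * (\<integral>\<^sup>+x. f (t + c *R x) \<partial>lborel)"
proof -
 have "(\<integral>\<^sup>+x. f x \<partial>lborel) = (\<integral>\<^sup>+x. f x \<partial>density (distr lborel borel (%x. t + c *R x)) (%_. ennreal (\<bar>c\<bar>^DIM('a))))"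
  using lborel_affine[of c t] c by simp
 also have "... = ennreal (c ^ DIM('a)) * (\<integral>\<^sup>+x. f (t + c *R x) \<partial>lborel)"
  using c by (simp add: nn_integral_density nn_integral_distr nn_integral_cmult)
 finally show ?thesis .
qed

text \<open>The integral of a radial function centred at the base point \<xi> = 0, \<tau> = 0;
  \<open>hs_invariance\<close> moves any centre there.\<close>

definition hsI :: "'a::euclidean_space itself => (real => ennreal) => ennreal" where
 "hsI T k = (\<integral>\<^sup>+t. \<integral>\<^sup>+x. ennreal (exp (- (real DIM('a) * t))) * k (cosh t + (x :: 'a) \<bullet> x * exp (- t) / 2) \<partial>lborel \<partial>lborel)"

text \<open>The substitution x to fst v + exp (snd v) x and the shift of t by snd v carry the centre
  to the base point. The Jacobian exp (m snd v) turns the density exp (-m t) into exp (-m (t - snd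
  v)).\<close>

lemma hs_invariance:
 fixes p :: "real * 'a::euclidean_space"
 assumes [measurable]: "k \<in> borel_measurable borel"
 shows "(\<integral>\<^sup>+w. k (ZZ p w) \<partial>hsN) = hsI TYPE('a) k"
proof -
 obtain v :: "'a \<times> real" where v: "FX p = hsY v" using hsY_surj[OF fm.X_in[of p]] by blast
 let ?m = "real DIM('a)"
 have "(\<integral>\<^sup>+w. k (ZZ p w) \<partial>hsN) = (\<integral>\<^sup>+t. \<integral>\<^sup>+x. ennreal (exp (- (?m * t))) * k (ZZ p (x, t)) \<partial>lborel \<partial>lborel)"
  by (rule nn_integral_hsN) simp
 also have "... = (\<integral>\<^sup>+t. \<integral>\<^sup>+x. ennreal (exp (- (?m * t))) * k (cosh (snd v - t) + (fst v - x) \<bullet> (fst v - x) * exp (- snd v - t) / 2) \<partial>lborel \<partial>lborel)"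
  unfolding ZZ_def v hsY_mink by simp
 also have "... = (\<integral>\<^sup>+t. ennreal (exp (- (?m * (t - snd v)))) * (\<integral>\<^sup>+x. k (cosh (t - snd v) + (x :: 'a) \<bullet> x * exp (- (t - snd v)) / 2) \<partial>lborel) \<partial>lborel)"
 proof (rule nn_integral_cong)
  fix t :: real
  have "(\<integral>\<^sup>+x. ennreal (exp (- (?m * t))) * k (cosh (snd v - t) + (fst v - x) \<bullet> (fst v - x) * exp (- snd v - t) / 2) \<partial>lborel)
   = ennreal (exp (- (?m * t))) * (\<integral>\<^sup>+x. k (cosh (snd v - t) + (fst v - x) \<bullet> (fst v - x) * exp (- snd v - t) / 2) \<partial>lborel)"
   by (rule nn_integral_cmult) simp
  also have "(\<integral>\<^sup>+x. k (cosh (snd v - t) + (fst v - x) \<bullet> (fst v - x) * exp (- snd v - t) / 2) \<partial>lborel)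
   = ennreal (exp (snd v) ^ DIM('a)) * (\<integral>\<^sup>+x. k (cosh (snd v - t) + (fst v - (fst v + exp (snd v) *R x)) \<bullet> (fst v - (fst v + exp (snd v) *R x)) * exp (- snd v - t) / 2) \<partial>lborel)"
   by (rule nn_integral_lborel_affine) simp_all
  also have "(%x. k (cosh (snd v - t) + (fst v - (fst v + exp (snd v) *R x)) \<bullet> (fst v - (fst v + exp (snd v) *R x)) * exp (- snd v - t) / 2))
   = (%x. k (cosh (t - snd v) + x \<bullet> x * exp (- (t - snd v)) / 2))"
  proof
   fix x :: 'a
   have "(fst v - (fst v + exp (snd v) *R x)) \<bullet> (fst v - (fst v + exp (snd v) *R x)) = exp (snd v) * exp (snd v) * (x \<bullet> x)" by simp
   then have "(fst v - (fst v + exp (snd v) *R x)) \<bullet> (fst v - (fst v + exp (snd v) *R x)) * exp (- snd v - t)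
     = x \<bullet> x * (exp (snd v) * exp (snd v) * exp (- snd v - t))" by (simp only: mult_ac)
   also have "exp (snd v) * exp (snd v) * exp (- snd v - t) = exp (- (t - snd v))" by (simp flip: exp_add)
   finally have "(fst v - (fst v + exp (snd v) *R x)) \<bullet> (fst v - (fst v + exp (snd v) *R x)) * exp (- snd v - t) = x \<bullet> x * exp (- (t - snd v))" .
   moreover have "cosh (snd v - t) = cosh (t - snd v)" using cosh_minus[of "t - snd v"] by simp
   ultimately show "k (cosh (snd v - t) + (fst v - (fst v + exp (snd v) *R x)) \<bullet> (fst v - (fst v + exp (snd v) *R x)) * exp (- snd v - t) / 2)
    = k (cosh (t - snd v) + x \<bullet> x * exp (- (t - snd v)) / 2)" by (simp only:)
  qed
  also have "ennreal (exp (- (?m * t))) * (ennreal (exp (snd v) ^ DIM('a)) * (\<integral>\<^sup>+x. k (cosh (t - snd v) + (x :: 'a) \<bullet> x * exp (- (t - snd v)) / 2) \<partial>lborel))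
   = ennreal (exp (- (?m * (t - snd v)))) * (\<integral>\<^sup>+x. k (cosh (t - snd v) + (x :: 'a) \<bullet> x * exp (- (t - snd v)) / 2) \<partial>lborel)"
   unfolding mult.assoc[symmetric]
   by (simp add: ennreal_mult[symmetric] exp_of_nat_mult[symmetric] exp_add[symmetric] algebra_simps)
  finally show "(\<integral>\<^sup>+x. ennreal (exp (- (?m * t))) * k (cosh (snd v - t) + (fst v - x) \<bullet> (fst v - x) * exp (- snd v - t) / 2) \<partial>lborel)
   = ennreal (exp (- (?m * (t - snd v)))) * (\<integral>\<^sup>+x. k (cosh (t - snd v) + (x :: 'a) \<bullet> x * exp (- (t - snd v)) / 2) \<partial>lborel)" .
 qed
 also have "... = ennreal \<bar>1\<bar> * (\<integral>\<^sup>+t. ennreal (exp (- (?m * (snd v + 1 * t - snd v)))) * (\<integral>\<^sup>+x. k (cosh (snd v + 1 * t - snd v) + (x :: 'a) \<bullet> x * exp (- (snd v + 1 * t - snd v)) / 2) \<partial>lborel) \<partial>lborel)"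
  by (rule nn_integral_real_affine) simp_all
 also have "... = hsI TYPE('a) k"
  unfolding hsI_def by (simp add: nn_integral_cmult)
 finally show ?thesis .
qed

lemma nn_integral_gauss:
 assumes "\<sigma> > 0"
 shows "(\<integral>\<^sup>+y. ennreal (exp (- (y\<^sup>2 / (2 * \<sigma>\<^sup>2)))) \<partial>lborel) = ennreal (sqrt (2 * pi * \<sigma>\<^sup>2))"
proof -
 have c: "sqrt (2 * pi * \<sigma>\<^sup>2) > 0" using assms by simp
 have "(\<integral>\<^sup>+y. ennreal (exp (- (y\<^sup>2 / (2 * \<sigma>\<^sup>2)))) \<partial>lborel)
   = (\<integral>\<^sup>+y. ennreal (sqrt (2 * pi * \<sigma>\<^sup>2)) * ennreal (normal_density 0 \<sigma> y) \<partial>lborel)"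
  using c assms by (intro nn_integral_cong) (simp add: normal_density_def ennreal_mult[symmetric])
 also have "... = ennreal (sqrt (2 * pi * \<sigma>\<^sup>2)) * (\<integral>\<^sup>+y. ennreal (normal_density 0 \<sigma> y) \<partial>lborel)"
  by (rule nn_integral_cmult) simp
 also have "(\<integral>\<^sup>+y. ennreal (normal_density 0 \<sigma> y) \<partial>lborel) = 1"
  using assms by (subst nn_integral_eq_integral) (auto simp: integral_normal_density)
 finally show ?thesis by simp
qed

lemma nn_integral_gauss_euclidean:
 "(\<integral>\<^sup>+x. ennreal (exp (- ((x::'a::euclidean_space) \<bullet> x / 4))) \<partial>lborel) = ennreal (sqrt (4 * pi) ^ DIM('a))"
proof -
 have "exp (- (x \<bullet> x / 4)) = (\<Prod>b\<in>Basis. exp (- ((x \<bullet> b)\<^sup>2 / 4)))" for x :: 'a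
  by (simp add: exp_sum[symmetric] sum_negf sum_divide_distrib[symmetric] euclidean_inner[of x x] power2_eq_square)
 then have "(\<integral>\<^sup>+x. ennreal (exp (- ((x::'a) \<bullet> x / 4))) \<partial>lborel)
   = (\<integral>\<^sup>+x. (\<Prod>b\<in>Basis. ennreal (exp (- (((x::'a) \<bullet> b)\<^sup>2 / 4)))) \<partial>lborel)"
  by (simp add: prod_ennreal)
 also have "... = (\<Prod>b\<in>(Basis :: 'a set). (\<integral>\<^sup>+y. ennreal (exp (- (y\<^sup>2 / 4))) \<partial>lborel))"
  by (rule nn_integral_lborel_prod) simp_all
 also have "(\<integral>\<^sup>+y. ennreal (exp (- (y\<^sup>2 / 4))) \<partial>lborel) = ennreal (sqrt (4 * pi))"
  using nn_integral_gauss[of "sqrt 2"] by (simp add: mult.commute)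
 finally show ?thesis by (simp add: ennreal_power)
qed

text \<open>What remains of a radial Gaussian after the \<xi>-integration, in the rescaled variable
  t = r y, where r^2 plays the role of time. The factor exp (-m t / 2) is the density exp (-m t)
  combined with exp (m t / 2) from the \<xi>-integral.\<close>

definition Jm :: "real => real => ennreal" where
 "Jm m r = (\<integral>\<^sup>+y. ennreal (exp (- (m / 2 * (r * y)) - (cosh (r * y) - 1) / (2 * r\<^sup>2))) \<partial>lborel)"

lemma hsI_gauss:
 assumes r: "r > 0"
 shows "hsI TYPE('a::euclidean_space) (%z. ennreal (exp (- ((z - 1) / (2 * r\<^sup>2)))))
  = ennreal (r ^ (DIM('a) + 1) * sqrt (4 * pi) ^ DIM('a)) * Jm (real DIM('a)) r"
proof -
 let ?m = "real DIM('a)"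
 have inner: "(\<integral>\<^sup>+x. ennreal (exp (- (?m * t))) * ennreal (exp (- ((cosh t + (x :: 'a) \<bullet> x * exp (- t) / 2 - 1) / (2 * r\<^sup>2)))) \<partial>lborel)
   = ennreal (r ^ DIM('a) * sqrt (4 * pi) ^ DIM('a)) * ennreal (exp (- (?m / 2 * t) - (cosh t - 1) / (2 * r\<^sup>2)))" for t
 proof -
  \<comment> \<open>The scale at which the Gaussian in x becomes exp (-|x|^2 / 4).\<close>
  define c where "c = r * exp (t / 2)"
  have c: "c > 0" using r by (simp add: c_def)
  have "(\<integral>\<^sup>+x. ennreal (exp (- (?m * t))) * ennreal (exp (- ((cosh t + (x :: 'a) \<bullet> x * exp (- t) / 2 - 1) / (2 * r\<^sup>2)))) \<partial>lborel)
   = (\<integral>\<^sup>+x. ennreal (exp (- (?m * t) - (cosh t - 1) / (2 * r\<^sup>2))) * ennreal (exp (- ((x :: 'a) \<bullet> x * exp (- t) / (4 * r\<^sup>2)))) \<partial>lborel)"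
   using r by (intro nn_integral_cong) (simp add: ennreal_mult[symmetric] exp_add[symmetric] field_simps)
  also have "... = ennreal (exp (- (?m * t) - (cosh t - 1) / (2 * r\<^sup>2))) * (\<integral>\<^sup>+x. ennreal (exp (- ((x :: 'a) \<bullet> x * exp (- t) / (4 * r\<^sup>2)))) \<partial>lborel)"
   by (rule nn_integral_cmult) simp
  also have "(\<integral>\<^sup>+x. ennreal (exp (- ((x :: 'a) \<bullet> x * exp (- t) / (4 * r\<^sup>2)))) \<partial>lborel)
   = ennreal (c ^ DIM('a)) * (\<integral>\<^sup>+x. ennreal (exp (- ((0 + c *R x :: 'a) \<bullet> (0 + c *R x) * exp (- t) / (4 * r\<^sup>2)))) \<partial>lborel)"
   by (rule nn_integral_lborel_affine[OF _ c]) simp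
  also have "(%x :: 'a. ennreal (exp (- ((0 + c *R x) \<bullet> (0 + c *R x) * exp (- t) / (4 * r\<^sup>2))))) = (%x. ennreal (exp (- (x \<bullet> x / 4))))"
  proof
   fix x :: 'a
   have "c * c * exp (- t) = r\<^sup>2"
    by (simp add: c_def power2_eq_square mult.assoc mult.left_commute flip: exp_add)
   moreover have "(0 + c *R x) \<bullet> (0 + c *R x) * exp (- t) = (c * c * exp (- t)) * (x \<bullet> x)" by simp
   ultimately have "(0 + c *R x) \<bullet> (0 + c *R x) * exp (- t) = r\<^sup>2 * (x \<bullet> x)" by (simp only:)
   then show "ennreal (exp (- ((0 + c *R x) \<bullet> (0 + c *R x) * exp (- t) / (4 * r\<^sup>2)))) = ennreal (exp (- (x \<bullet> x / 4)))"
    using r by (simp only:) simp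
  qed
  also have "ennreal (exp (- (?m * t) - (cosh t - 1) / (2 * r\<^sup>2))) * (ennreal (c ^ DIM('a)) * (\<integral>\<^sup>+x. ennreal (exp (- ((x :: 'a) \<bullet> x / 4))) \<partial>lborel))
   = ennreal (r ^ DIM('a) * sqrt (4 * pi) ^ DIM('a)) * ennreal (exp (- (?m / 2 * t) - (cosh t - 1) / (2 * r\<^sup>2)))"
  proof -
   have "exp (- (?m * t) - (cosh t - 1) / (2 * r\<^sup>2)) * c ^ DIM('a) = r ^ DIM('a) * exp (- (?m / 2 * t) - (cosh t - 1) / (2 * r\<^sup>2))"
    by (simp add: c_def power_mult_distrib exp_of_nat_mult[symmetric] mult.left_commute flip: exp_add)
   then have "ennreal (exp (- (?m * t) - (cosh t - 1) / (2 * r\<^sup>2)) * c ^ DIM('a) * sqrt (4 * pi) ^ DIM('a))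
     = ennreal (r ^ DIM('a) * exp (- (?m / 2 * t) - (cosh t - 1) / (2 * r\<^sup>2)) * sqrt (4 * pi) ^ DIM('a))" by (simp only:)
   then show ?thesis unfolding nn_integral_gauss_euclidean
    using r c by (simp only: ennreal_mult zero_le_power less_imp_le exp_ge_zero real_sqrt_ge_0_iff
      mult_nonneg_nonneg pi_ge_zero zero_le_numeral mult_ac)
  qed
  finally show ?thesis .
 qed
 have "hsI TYPE('a) (%z. ennreal (exp (- ((z - 1) / (2 * r\<^sup>2)))))
   = (\<integral>\<^sup>+t. ennreal (r ^ DIM('a) * sqrt (4 * pi) ^ DIM('a)) * ennreal (exp (- (?m / 2 * t) - (cosh t - 1) / (2 * r\<^sup>2))) \<partial>lborel)"
  unfolding hsI_def inner ..
 also have "... = ennreal (r ^ DIM('a) * sqrt (4 * pi) ^ DIM('a)) * (\<integral>\<^sup>+t. ennreal (exp (- (?m / 2 * t) - (cosh t - 1) / (2 * r\<^sup>2))) \<partial>lborel)"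
  by (rule nn_integral_cmult) simp
 also have "(\<integral>\<^sup>+t. ennreal (exp (- (?m / 2 * t) - (cosh t - 1) / (2 * r\<^sup>2))) \<partial>lborel)
   = ennreal \<bar>r\<bar> * (\<integral>\<^sup>+y. ennreal (exp (- (?m / 2 * (0 + r * y)) - (cosh (0 + r * y) - 1) / (2 * r\<^sup>2))) \<partial>lborel)"
  using r by (intro nn_integral_real_affine) auto
 also have "... = ennreal r * Jm ?m r" using r by (simp add: Jm_def)
 also have "ennreal (r ^ DIM('a) * sqrt (4 * pi) ^ DIM('a)) * (ennreal r * Jm ?m r) = ennreal (r ^ (DIM('a) + 1) * sqrt (4 * pi) ^ DIM('a)) * Jm ?m r"
  using r by (simp add: ennreal_mult[symmetric] mult.assoc[symmetric]) (simp add: mult_ac)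
 finally show ?thesis .
qed

lemma cosh_double_sinh: "cosh (2 * x) = 1 + 2 * (sinh x)\<^sup>2" for x :: real
 by (simp add: cosh_double_cosh cosh_square_eq)

lemma cosh_ge_sq: "cosh x >= 1 + x\<^sup>2 / 2" for x :: real
proof -
 have "\<bar>x / 2\<bar> <= sinh \<bar>x / 2\<bar>" by (rule sinh_ge_self) simp
 then have "\<bar>x / 2\<bar>\<^sup>2 <= (sinh \<bar>x / 2\<bar>)\<^sup>2" by (intro power_mono) auto
 also have "(sinh \<bar>x / 2\<bar>)\<^sup>2 = (sinh (x / 2))\<^sup>2" by (cases "x >= 0") (auto simp: abs_if)
 finally show ?thesis using cosh_double_sinh[of "x / 2"] by (simp add: power_divide)
qed

text \<open>A Gaussian majorant uniform in r <= R. By cosh x >= 1 + x^2/2 the exponent is at least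
  y^2/4, and half of it pays for the linear term, on expanding the square of |y| - 2 m R.\<close>

lemma Jm_integrand_bound:
 fixes m r R y :: real
 assumes "m >= 0" "0 < r" "r <= R"
 shows "exp (- (m / 2 * (r * y)) - (cosh (r * y) - 1) / (2 * r\<^sup>2)) <= exp (m\<^sup>2 * R\<^sup>2 / 2) * exp (- (y\<^sup>2 / (2 * 2\<^sup>2)))"
proof -
 have "(r * y)\<^sup>2 / 2 / (2 * r\<^sup>2) <= (cosh (r * y) - 1) / (2 * r\<^sup>2)"
  using cosh_ge_sq[of "r * y"] by (intro divide_right_mono) auto
 then have 1: "y\<^sup>2 / 4 <= (cosh (r * y) - 1) / (2 * r\<^sup>2)" using assms by (simp add: power_mult_distrib)
 have "- (m / 2 * (r * y)) <= m / 2 * (r * \<bar>y\<bar>)"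
  using mult_left_mono[of "- y" "\<bar>y\<bar>" "m / 2 * r"] assms by (simp add: mult.assoc)
 also have "... <= m / 2 * (R * \<bar>y\<bar>)" using assms by (intro mult_left_mono mult_right_mono) auto
 also have "... <= y\<^sup>2 / 8 + m\<^sup>2 * R\<^sup>2 / 2"
  using zero_le_power2[of "\<bar>y\<bar> - 2 * m * R"] by (simp add: power2_diff power_mult_distrib mult.commute mult.left_commute)
 finally have "- (m / 2 * (r * y)) <= y\<^sup>2 / 8 + m\<^sup>2 * R\<^sup>2 / 2" .
 moreover have "y\<^sup>2 / (2 * 2\<^sup>2) = y\<^sup>2 / 8" by simp
 ultimately show ?thesis using 1 unfolding exp_add[symmetric] exp_le_cancel_iff by linarith
qed

lemma Jm_bound:
 assumes "m >= 0" "0 < r" "r <= R"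
 shows "Jm m r <= ennreal (exp (m\<^sup>2 * R\<^sup>2 / 2) * sqrt (8 * pi))"
proof -
 have "Jm m r <= (\<integral>\<^sup>+y. ennreal (exp (m\<^sup>2 * R\<^sup>2 / 2)) * ennreal (exp (- (y\<^sup>2 / (2 * 2\<^sup>2)))) \<partial>lborel)"
  unfolding Jm_def using Jm_integrand_bound[OF assms]
  by (intro nn_integral_mono) (simp add: ennreal_mult[symmetric] ennreal_leI)
 also have "... = ennreal (exp (m\<^sup>2 * R\<^sup>2 / 2)) * (\<integral>\<^sup>+y. ennreal (exp (- (y\<^sup>2 / (2 * 2\<^sup>2)))) \<partial>lborel)"
  by (rule nn_integral_cmult) simp
 also have "(\<integral>\<^sup>+y. ennreal (exp (- (y\<^sup>2 / (2 * 2\<^sup>2)))) \<partial>lborel) = ennreal (sqrt (8 * pi))"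
  using nn_integral_gauss[of 2] by (simp add: mult.commute)
 finally show ?thesis by (simp add: ennreal_mult)
qed

text \<open>Dominated convergence; (cosh (r y) - 1) / (2 r^2) is the square of sinh (r y / 2) / r,
  which tends to y / 2.\<close>

lemma Jm_tendsto:
 assumes m: "m >= 0" and r: "!!i::nat. 0 < r i" and l: "r -----> 0"
 shows "(%i. Jm m (r i)) -----> ennreal (sqrt (4 * pi))"
proof -
 have "Bseq r" using l by (intro convergent_imp_Bseq) (auto simp: convergent_def)
 then obtain R where R: "!!i. norm (r i) <= R" by (auto simp: Bseq_def)
 have rR: "r i <= R" for i using R[of i] by simp
 have "(%i. \<integral>\<^sup>+y. ennreal (exp (- (m / 2 * (r i * y)) - (cosh (r i * y) - 1) / (2 * (r i)\<^sup>2))) \<partial>lborel)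
   -----> (\<integral>\<^sup>+y. ennreal (exp (- (y\<^sup>2 / 4))) \<partial>lborel)"
 proof (rule nn_integral_dominated_convergence[where w="%y. ennreal (exp (m\<^sup>2 * R\<^sup>2 / 2)) * ennreal (exp (- (y\<^sup>2 / (2 * 2\<^sup>2))))"])
  show "AE y in lborel. ennreal (exp (- (m / 2 * (r i * y)) - (cosh (r i * y) - 1) / (2 * (r i)\<^sup>2)))
    <= ennreal (exp (m\<^sup>2 * R\<^sup>2 / 2)) * ennreal (exp (- (y\<^sup>2 / (2 * 2\<^sup>2))))" for i
   using Jm_integrand_bound[OF m r rR] by (simp add: ennreal_mult[symmetric] ennreal_leI)
  have "(\<integral>\<^sup>+y. ennreal (exp (m\<^sup>2 * R\<^sup>2 / 2)) * ennreal (exp (- (y\<^sup>2 / (2 * 2\<^sup>2)))) \<partial>lborel)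
    = ennreal (exp (m\<^sup>2 * R\<^sup>2 / 2)) * (\<integral>\<^sup>+y. ennreal (exp (- (y\<^sup>2 / (2 * 2\<^sup>2)))) \<partial>lborel)"
   by (rule nn_integral_cmult) simp
  then show "(\<integral>\<^sup>+y. ennreal (exp (m\<^sup>2 * R\<^sup>2 / 2)) * ennreal (exp (- (y\<^sup>2 / (2 * 2\<^sup>2)))) \<partial>lborel) < \<infinity>"
   using nn_integral_gauss[of 2] by (simp add: ennreal_mult_less_top)
  have "(%i. exp (- (m / 2 * (r i * y)) - (cosh (r i * y) - 1) / (2 * (r i)\<^sup>2))) -----> exp (- (m / 2 * (0 * y)) - (y / 2)\<^sup>2)" for y
  proof (intro tendsto_intros l)
   have "((%h. sinh (h * (y / 2))) has_real_derivative y / 2) (at 0)"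
    by (auto intro!: derivative_eq_intros)
   then have "((%h. sinh (h * (y / 2)) / h) ---> y / 2) (at 0)" by (simp add: DERIV_def)
   then have "(%i. sinh (r i * (y / 2)) / r i) -----> y / 2"
    by (rule filterlim_compose) (use l r in "auto simp: filterlim_at less_imp_neq[symmetric]")
   then have "(%i. (sinh (r i * (y / 2)) / r i)\<^sup>2) -----> (y / 2)\<^sup>2" by (rule tendsto_power)
   moreover have "(sinh (r i * (y / 2)) / r i)\<^sup>2 = (cosh (r i * y) - 1) / (2 * (r i)\<^sup>2)" for i
    using cosh_double_sinh[of "r i * (y / 2)"] r[of i] by (simp add: power_divide field_simps)
   ultimately show "(%i. (cosh (r i * y) - 1) / (2 * (r i)\<^sup>2)) -----> (y / 2)\<^sup>2" by simp
  qed
  then show "AE y in lborel. (%i. ennreal (exp (- (m / 2 * (r i * y)) - (cosh (r i * y) - 1) / (2 * (r i)\<^sup>2)))) -----> ennreal (exp (- (y\<^sup>2 / 4)))"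
   by (intro AE_I2 tendsto_ennrealI) (simp add: power_divide)
 qed simp_all
 moreover have "(\<integral>\<^sup>+y. ennreal (exp (- (y\<^sup>2 / 4))) \<partial>lborel) = ennreal (sqrt (4 * pi))"
  using nn_integral_gauss[of "sqrt 2"] by (simp add: mult.commute)
 ultimately show ?thesis by (simp add: Jm_def)
qed

section \<open>Differentiation under the integral and the Gaussian kernel\<close>

text \<open>Dominated convergence for the remainder quotients along sequences; by the mean value
  inequality on the ball these are at most 2 \<open>B\<close>.\<close>

lemma has_derivative_integral_dominated:
 fixes f :: "'p::euclidean_space => 'x => real" and f' :: "'p => 'x => 'p => real"
 assumes r: "r > 0"
  and der: "!!p x. p \<in> ball p0 r ==> x \<in> space M ==> ((%p. f p x) has_derivative f' p x) (at p)"
  and bnd: "!!p x h. p \<in> ball p0 r ==> x \<in> space M ==> \<bar>f' p x h\<bar> <= B x * norm h"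
  and int: "!!p. p \<in> ball p0 r ==> integrable M (f p)" and B: "integrable M B"
  and meas: "!!h. (%x. f' p0 x h) \<in> borel_measurable M"
 shows "((%p. LINT x|M. f p x) has_derivative (%h. LINT x|M. f' p0 x h)) (at p0)"
proof -
 have p0: "p0 \<in> ball p0 r" using r by simp
 have i': "integrable M (%x. f' p0 x h)" for h
  by (rule Bochner_Integration.integrable_bound[OF integrable_mult_left[OF B, of "norm h"] meas])
    (use bnd[OF p0] in "auto intro!: AE_I2 order_trans[OF _ abs_ge_self]")
 have lin: "linear (f' p0 x)" if "x \<in> space M" for x using der[OF p0 that] has_derivative_linear by blast
 have bl: "bounded_linear (%h. LINT x|M. f' p0 x h)"
 proof (rule bounded_linear_intro[where K="LINT x|M. B x"])
  fix a b and c :: real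
  have "(LINT x|M. f' p0 x (a + b)) = (LINT x|M. f' p0 x a + f' p0 x b)"
   by (rule Bochner_Integration.integral_cong) (auto simp: linear_add[OF lin])
  then show "(LINT x|M. f' p0 x (a + b)) = (LINT x|M. f' p0 x a) + (LINT x|M. f' p0 x b)"
   by (simp add: Bochner_Integration.integral_add[OF i' i'])
  have "(LINT x|M. f' p0 x (c *R a)) = (LINT x|M. c * f' p0 x a)"
   by (rule Bochner_Integration.integral_cong) (auto simp: linear_cmul[OF lin])
  then show "(LINT x|M. f' p0 x (c *R a)) = c *R (LINT x|M. f' p0 x a)" by simp
  have "norm (LINT x|M. f' p0 x a) <= (LINT x|M. norm (f' p0 x a))" by (rule integral_norm_bound)
  also have "... <= (LINT x|M. B x * norm a)"
   by (rule Bochner_Integration.integral_mono) (use i' B bnd[OF p0] in auto)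
  finally have "norm (LINT x|M. f' p0 x a) <= (LINT x|M. B x * norm a)" .
  then show "norm (LINT x|M. f' p0 x a) <= norm a * (LINT x|M. B x)" by (simp add: mult.commute)
 qed
 let ?q = "%p x. (f p x - f p0 x - f' p0 x (p - p0)) / norm (p - p0)"
 have "((%p. (1 / norm (p - p0)) *R ((LINT x|M. f p x) - ((LINT x|M. f p0 x) + (LINT x|M. f' p0 x (p - p0))))) ---> 0) (at p0)"
  unfolding tendsto_at_iff_sequentially comp_def
 proof (intro allI impI)
  fix P :: "nat => 'p" assume P: "\<forall>i. P i \<in> UNIV - {p0}" "P -----> p0"
  obtain N where N: "!!i. i >= N ==> P i \<in> ball p0 r"
   using tendstoD[OF P(2) r] by (auto simp: eventually_sequentially dist_commute)
  have eq: "(1 / norm (P i - p0)) *R ((LINT x|M. f (P i) x) - ((LINT x|M. f p0 x) + (LINT x|M. f' p0 x (P i - p0))))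
    = (LINT x|M. ?q (P i) x)" if "i >= N" for i
   using int[OF N[OF that]] int[OF p0] i' by (simp add: divide_inverse algebra_simps)
  have "(%i. LINT x|M. ?q (P (i + N)) x) -----> (LINT x|M. 0)"
  proof (rule integral_dominated_convergence[where w="%x. 2 * B x"])
   show "(%x. ?q (P (i + N)) x) \<in> borel_measurable M" for i
    using int[OF N[of "i + N"]] int[OF p0] meas by (intro borel_measurable_divide borel_measurable_diff) auto
   show "AE x in M. (%i. ?q (P (i + N)) x) -----> 0"
   proof (rule AE_I2)
    fix x assume x: "x \<in> space M"
    have "((%p. (1 / norm (p - p0)) *R (f p x - (f p0 x + f' p0 x (p - p0)))) ---> 0) (at p0)"
     using der[OF p0 x] by (simp add: has_derivative_within)
    then have "(%i. (1 / norm (P i - p0)) *R (f (P i) x - (f p0 x + f' p0 x (P i - p0)))) -----> 0"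
     using P unfolding tendsto_at_iff_sequentially comp_def by blast
    then have "(%i. ?q (P i) x) -----> 0" by (simp add: divide_inverse algebra_simps)
    then show "(%i. ?q (P (i + N)) x) -----> 0" by (rule LIMSEQ_ignore_initial_segment)
   qed
   show "AE x in M. norm (?q (P (i + N)) x) <= 2 * B x" for i
   proof (rule AE_I2)
    fix x assume x: "x \<in> space M"
    let ?p = "P (i + N)"
    have pb: "?p \<in> ball p0 r" by (rule N) simp
    have "norm (f ?p x - f p0 x) <= B x * norm (?p - p0)"
    proof (rule differentiable_bound[of "ball p0 r"])
     fix p assume p: "p \<in> ball p0 r"
     show "((%p. f p x) has_derivative f' p x) (at p within ball p0 r)"
      using der[OF p x] by (rule has_derivative_at_withinI)
     show "onorm (f' p x) <= B x" by (rule onorm_le) (use bnd[OF p x] in auto)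
    qed (use pb p0 in auto)
    moreover have "\<bar>f' p0 x (?p - p0)\<bar> <= B x * norm (?p - p0)" by (rule bnd[OF p0 x])
    moreover have "norm (?p - p0) > 0" using P(1) by auto
    ultimately show "norm (?q ?p x) <= 2 * B x" by (simp add: divide_le_eq)
   qed
  qed (use B in simp_all)
  then have "(%i. LINT x|M. ?q (P (i + N)) x) -----> 0" by simp
  then have "(%i. (1 / norm (P (i + N) - p0)) *R ((LINT x|M. f (P (i + N)) x) - ((LINT x|M. f p0 x) + (LINT x|M. f' p0 x (P (i + N) - p0))))) -----> 0"
   by (simp only: eq[OF le_add2])
  then show "(%i. (1 / norm (P i - p0)) *R ((LINT x|M. f (P i) x) - ((LINT x|M. f p0 x) + (LINT x|M. f' p0 x (P i - p0))))) -----> 0"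
   by (rule LIMSEQ_offset)
 qed
 then show ?thesis using bl by (simp add: has_derivative_within)
qed

text \<open>The Euclidean normalisation (4 pi t)^(-n/2) with n = DIM('a) + 1, under which the mass
  tends to 1 as t goes to 0 (\<open>mass_tendsto\<close>).\<close>

definition nc :: "'a::euclidean_space itself => real => real" where
 "nc T t = 1 / (sqrt (4 * pi * t)) ^ (DIM('a) + 1)"

text \<open>On the hyperboloid a Gaussian in Z - 1, which is about d^2/2. It is defined for every
  ambient \<open>Y\<close>, where it is the exponential of an affine function, so that derivatives
  are products with the linear forms \<open>mm\<close>.\<close>

definition ker :: "real => real * real * 'a::euclidean_space => 'a \<times> real => real" where
 "ker t Y w = nc TYPE('a) t * exp ((mink Y (hsY w) + 1) / (2 * t))"

lemma nc_pos: "t > 0 ==> nc T t > 0" by (simp add: nc_def)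

lemma ker_FX:
 fixes p :: "real * 'a::euclidean_space"
 shows "ker t (FX p) w = nc TYPE('a) t * exp (- ((ZZ p w - 1) / (2 * t)))"
proof -
 have "(mink (FX p) (hsY w) + 1) / (2 * t) = - ((ZZ p w - 1) / (2 * t))"
  unfolding ZZ_def minus_divide_left by (rule arg_cong[where f="%x. x / (2 * t)"]) simp
 then show ?thesis by (simp only: ker_def)
qed

lemma ker_nonneg: "t > 0 ==> ker t Y w >= 0"
 unfolding ker_def by (intro mult_nonneg_nonneg less_imp_le[OF nc_pos]) auto

lemma mink_hsY_continuous: "continuous_on UNIV (%w. mink Y (hsY w))"
 by (intro mink.continuous_on continuous_on_const hsY_continuous)

lemma mink_hsY_measurable [measurable]: "(%w. mink Y (hsY w)) \<in> borel_measurable borel"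
 by (rule borel_measurable_continuous_onI[OF mink_hsY_continuous])

lemma ker_measurable [measurable]: "ker t Y \<in> borel_measurable borel"
 unfolding ker_def[abs_def] by measurable

lemma nn_integral_ker:
 fixes p :: "real * 'a::euclidean_space"
 assumes r: "r > 0"
 shows "(\<integral>\<^sup>+w. ennreal (exp (- ((ZZ p w - 1) / (2 * r\<^sup>2)))) \<partial>hsN)
   = ennreal (r ^ (DIM('a) + 1) * sqrt (4 * pi) ^ DIM('a)) * Jm (real DIM('a)) r"
 using hs_invariance[of "%z. ennreal (exp (- ((z - 1) / (2 * r\<^sup>2))))" p] hsI_gauss[OF r, where 'a='a] by simp

lemma integrable_ker_exp:
 fixes p :: "real * 'a::euclidean_space"
 assumes r: "r > 0"
 shows "integrable hsN (%w. exp (- ((ZZ p w - 1) / (2 * r\<^sup>2))))"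
proof (rule integrableI_nonneg)
 have "Jm (real DIM('a)) r < \<infinity>" using Jm_bound[of "real DIM('a)" r r] r by (simp add: le_less_trans)
 then show "(\<integral>\<^sup>+w. ennreal (exp (- ((ZZ p w - 1) / (2 * r\<^sup>2)))) \<partial>hsN) < \<infinity>"
  unfolding nn_integral_ker[OF r] by (simp add: ennreal_mult_less_top)
qed simp_all

lemma integral_ker_exp_bound:
 fixes p :: "real * 'a::euclidean_space"
 assumes "0 < r" "r <= R"
 shows "(LINT w|hsN. exp (- ((ZZ p w - 1) / (2 * r\<^sup>2))))
   <= r ^ (DIM('a) + 1) * (sqrt (4 * pi) ^ DIM('a) * (exp ((real DIM('a))\<^sup>2 * R\<^sup>2 / 2) * sqrt (8 * pi)))"
proof -
 have "ennreal (LINT w|hsN. exp (- ((ZZ p w - 1) / (2 * r\<^sup>2)))) = (\<integral>\<^sup>+w. ennreal (exp (- ((ZZ p w - 1) / (2 * r\<^sup>2)))) \<partial>hsN)"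
  by (rule nn_integral_eq_integral[symmetric, OF integrable_ker_exp[OF assms(1)]]) simp
 also have "... <= ennreal (r ^ (DIM('a) + 1) * sqrt (4 * pi) ^ DIM('a)) * ennreal (exp ((real DIM('a))\<^sup>2 * R\<^sup>2 / 2) * sqrt (8 * pi))"
  unfolding nn_integral_ker[OF assms(1)] by (intro mult_left_mono Jm_bound assms) auto
 also have "... = ennreal (r ^ (DIM('a) + 1) * (sqrt (4 * pi) ^ DIM('a) * (exp ((real DIM('a))\<^sup>2 * R\<^sup>2 / 2) * sqrt (8 * pi))))"
  using assms(1) by (simp add: ennreal_mult[symmetric] mult.assoc)
 finally show ?thesis using assms(1) by (subst (asm) ennreal_le_iff) auto
qed

text \<open>The exponent 6 covers the powers that occur later; since 24 = 6 * 4, the sixth power of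
  exp (a / 24) is exp (a / 4), half of the Gaussian exponent a / 2.\<close>

lemma power_le_exp: "(1 + a) ^ 6 <= 24 ^ 6 * exp (a / 4)" if "a >= 0" for a :: real
proof -
 have "1 + a <= 24 * (1 + a / 24)" using that by simp
 also have "... <= 24 * exp (a / 24)" by (intro mult_left_mono exp_ge_add_one_self) auto
 finally have "(1 + a) ^ 6 <= (24 * exp (a / 24)) ^ 6" using that by (intro power_mono) auto
 also have "... = 24 ^ 6 * exp (6 * (a / 24))" by (simp add: power_mult_distrib exp_of_nat_mult[of 6 "a / 24", simplified, symmetric])
 finally show ?thesis by simp
qed

text \<open>The squared distance on the scale of the heat flow, roughly d^2 / (2 t).\<close>

definition aa :: "real => real * 'a::euclidean_space => 'a \<times> real => real" where
 "aa t p w = (ZZ p w - 1) / t"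

lemma aa_nonneg: "t > 0 ==> aa t p w >= 0" using ZZ_ge1[of p w] by (simp add: aa_def)

text \<open>Polynomial growth in \<open>aa\<close> costs half of the Gaussian exponent. The integral
  of the rest, a Gaussian of time 2 t, is of order t^(n/2), which \<open>nc\<close> cancels. The
  later kernel estimates are instances of this bound, uniform in the point and in t <= 1.\<close>

lemma ker_moment_bound:
 obtains C where "C > 0" and "!!t (p :: real * 'a::euclidean_space) \<phi> B. 0 < t ==> t <= 1 ==> \<phi> \<in> borel_measurable borel ==>
   (!!w. \<bar>\<phi> w\<bar> <= B * (1 + aa t p w) ^ 6) ==>
   integrable hsN (%w. ker t (FX p) w * \<phi> w) \<and> \<bar>LINT w|hsN. ker t (FX p) w * \<phi> w\<bar> <= C * B"
proof -
 define D where "D = sqrt (4 * pi) ^ DIM('a) * (exp ((real DIM('a))\<^sup>2 * 2\<^sup>2 / 2) * sqrt (8 * pi))"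
 define C where "C = 24 ^ 6 * (sqrt 2 ^ (DIM('a) + 1) / sqrt (4 * pi) ^ (DIM('a) + 1) * D)"
 have Dp: "D > 0" by (simp add: D_def)
 have Cp: "C > 0" using Dp by (simp add: C_def)
 have "integrable hsN (%w. ker t (FX p) w * \<phi> w) \<and> \<bar>LINT w|hsN. ker t (FX p) w * \<phi> w\<bar> <= C * B"
  if t: "0 < t" "t <= 1" and [measurable]: "\<phi> \<in> borel_measurable borel" and b: "!!w. \<bar>\<phi> w\<bar> <= B * (1 + aa t p w) ^ 6"
  for t \<phi> B and p :: "real * 'a"
 proof -
  have B0: "B >= 0"
  proof -
   have "0 <= B * (1 + aa t p undefined) ^ 6" using b[of undefined] by linarith
   moreover have "(1 + aa t p undefined) ^ 6 > 0" using aa_nonneg[OF t(1), of p undefined] by (intro zero_less_power) linarith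
   ultimately show ?thesis by (simp add: zero_le_mult_iff)
  qed
  define r where "r = sqrt (2 * t)"
  have r: "r > 0" "r <= 2" "r\<^sup>2 = 2 * t" using t by (auto simp: r_def intro!: real_le_lsqrt)
  define E where "E w = nc TYPE('a) t * (B * 24 ^ 6) * exp (- ((ZZ p w - 1) / (2 * r\<^sup>2)))" for w
  have Ei: "integrable hsN E" unfolding E_def by (intro integrable_mult_right integrable_ker_exp r)
  have le: "\<bar>ker t (FX p) w * \<phi> w\<bar> <= E w" for w
  proof -
   have "\<bar>ker t (FX p) w * \<phi> w\<bar> <= ker t (FX p) w * (B * (1 + aa t p w) ^ 6)"
    unfolding abs_mult abs_of_nonneg[OF ker_nonneg[OF t(1)]] by (rule mult_left_mono[OF b ker_nonneg[OF t(1)]])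
   also have "... <= ker t (FX p) w * (B * (24 ^ 6 * exp (aa t p w / 4)))"
    by (intro mult_left_mono power_le_exp aa_nonneg ker_nonneg t B0)
   also have "... = nc TYPE('a) t * (B * 24 ^ 6) * (exp (- ((ZZ p w - 1) / (2 * t))) * exp (aa t p w / 4))"
    by (simp add: ker_FX)
   also have "exp (- ((ZZ p w - 1) / (2 * t))) * exp (aa t p w / 4) = exp (- ((ZZ p w - 1) / (2 * r\<^sup>2)))"
    unfolding exp_add[symmetric] r(3) aa_def using t by (simp add: field_simps)
   finally show ?thesis by (simp add: E_def)
  qed
  have int: "integrable hsN (%w. ker t (FX p) w * \<phi> w)"
   by (rule Bochner_Integration.integrable_bound[OF Ei]) (use le in "auto intro!: AE_I2 order_trans[OF le abs_ge_self]")
  have "\<bar>LINT w|hsN. ker t (FX p) w * \<phi> w\<bar> <= (LINT w|hsN. E w)"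
   using Bochner_Integration.integral_norm_bound_integral[OF int Ei] le[unfolded real_norm_def[symmetric]] by simp
  also have "... = nc TYPE('a) t * (B * 24 ^ 6) * (LINT w|hsN. exp (- ((ZZ p w - 1) / (2 * r\<^sup>2))))"
   unfolding E_def by simp
  also have "... <= nc TYPE('a) t * (B * 24 ^ 6) * (r ^ (DIM('a) + 1) * D)"
   using integral_ker_exp_bound[OF r(1,2), of p] B0 nc_pos[OF t(1), of "TYPE('a)"]
   by (intro mult_left_mono) (auto simp: D_def less_imp_le)
  also have "... = C * B"
  proof -
   have "nc TYPE('a) t * r ^ (DIM('a) + 1) = sqrt 2 ^ (DIM('a) + 1) / sqrt (4 * pi) ^ (DIM('a) + 1)"
   proof -
    have "nc TYPE('a) t * r ^ (DIM('a) + 1) = (r / sqrt (4 * pi * t)) ^ (DIM('a) + 1)"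
     by (simp only: nc_def power_divide times_divide_eq_left mult_1)
    also have "r / sqrt (4 * pi * t) = sqrt 2 / sqrt (4 * pi)" using t by (simp add: r_def real_sqrt_mult)
    finally show ?thesis by (simp only: power_divide)
   qed
   moreover have "nc TYPE('a) t * (B * 24 ^ 6) * (r ^ (DIM('a) + 1) * D) = 24 ^ 6 * ((nc TYPE('a) t * r ^ (DIM('a) + 1)) * D) * B"
    by (simp only: mult_ac)
   ultimately show ?thesis by (simp only: C_def)
  qed
  finally show ?thesis using int by simp
 qed
 then show thesis by (rule that[OF Cp])
qed

text \<open>By \<open>hs_invariance\<close> the mass does not see the point. This is what permits
  subtracting constants from the data in \<open>gfermi_heat_shift\<close>.\<close>

lemma mass_const:
 fixes p p' :: "real * 'a::euclidean_space"
 assumes t: "t > 0"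
 shows "(LINT w|hsN. ker t (FX p) w) = (LINT w|hsN. ker t (FX p') w)"
proof -
 have "ennreal (LINT w|hsN. exp (- ((ZZ p w - 1) / (2 * t))))
   = ennreal ((sqrt t) ^ (DIM('a) + 1) * sqrt (4 * pi) ^ DIM('a)) * Jm (real DIM('a)) (sqrt t)" for p :: "real * 'a"
  using nn_integral_eq_integral[OF integrable_ker_exp[of "sqrt t" p]] nn_integral_ker[of "sqrt t" p] t by simp
 then have "ennreal (LINT w|hsN. exp (- ((ZZ p w - 1) / (2 * t)))) = ennreal (LINT w|hsN. exp (- ((ZZ p' w - 1) / (2 * t))))"
  by simp
 then have "(LINT w|hsN. exp (- ((ZZ p w - 1) / (2 * t)))) = (LINT w|hsN. exp (- ((ZZ p' w - 1) / (2 * t))))"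
  by (subst (asm) ennreal_inj) (auto intro!: integral_nonneg_AE)
 then show ?thesis unfolding ker_FX by simp
qed

lemma mass_tendsto:
 fixes p :: "real * 'a::euclidean_space"
 shows "((%t. LINT w|hsN. ker t (FX p) w) ---> 1) (at_right 0)"
 unfolding tendsto_at_iff_sequentially comp_def
proof (intro allI impI)
 fix s :: "nat => real" assume s: "\<forall>i. s i \<in> {0<..} - {0}" "s -----> 0"
 have sp: "s i > 0" for i using s(1) by auto
 have "(%i. sqrt (s i)) -----> 0" using tendsto_real_sqrt[OF s(2)] by simp
 from Jm_tendsto[OF _ _ this, of "real DIM('a)"] sp
 have J: "(%i. Jm (real DIM('a)) (sqrt (s i))) -----> ennreal (sqrt (4 * pi))" by simp
 have eq: "ennreal (LINT w|hsN. ker (s i) (FX p) w) = ennreal (1 / sqrt (4 * pi)) * Jm (real DIM('a)) (sqrt (s i))" for i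
 proof -
  have "ennreal (LINT w|hsN. ker (s i) (FX p) w) = ennreal (nc TYPE('a) (s i)) * ennreal (LINT w|hsN. exp (- ((ZZ p w - 1) / (2 * s i))))"
   unfolding ker_FX using nc_pos[OF sp[of i], of "TYPE('a)"] by (simp add: ennreal_mult'[symmetric] less_imp_le)
  also have "ennreal (LINT w|hsN. exp (- ((ZZ p w - 1) / (2 * s i))))
    = ennreal ((sqrt (s i)) ^ (DIM('a) + 1) * sqrt (4 * pi) ^ DIM('a)) * Jm (real DIM('a)) (sqrt (s i))"
   using nn_integral_eq_integral[OF integrable_ker_exp[of "sqrt (s i)" p]] nn_integral_ker[of "sqrt (s i)" p] sp[of i] by simp
  also have "ennreal (nc TYPE('a) (s i)) * (ennreal ((sqrt (s i)) ^ (DIM('a) + 1) * sqrt (4 * pi) ^ DIM('a)) * Jm (real DIM('a)) (sqrt (s i)))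
    = ennreal (nc TYPE('a) (s i) * ((sqrt (s i)) ^ (DIM('a) + 1) * sqrt (4 * pi) ^ DIM('a))) * Jm (real DIM('a)) (sqrt (s i))"
   using nc_pos[OF sp[of i], of "TYPE('a)"] sp[of i] by (simp add: ennreal_mult mult.assoc less_imp_le)
  also have "nc TYPE('a) (s i) * ((sqrt (s i)) ^ (DIM('a) + 1) * sqrt (4 * pi) ^ DIM('a)) = 1 / sqrt (4 * pi)"
   using sp[of i] by (simp add: nc_def real_sqrt_mult power_mult_distrib field_simps)
  finally show ?thesis .
 qed
 have "(%i. ennreal (1 / sqrt (4 * pi)) * Jm (real DIM('a)) (sqrt (s i))) -----> ennreal (1 / sqrt (4 * pi)) * ennreal (sqrt (4 * pi))"
  by (rule ennreal_tendsto_cmult[OF _ J]) simp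
 also have "ennreal (1 / sqrt (4 * pi)) * ennreal (sqrt (4 * pi)) = ennreal 1" by (simp flip: ennreal_mult)
 finally have "(%i. ennreal (LINT w|hsN. ker (s i) (FX p) w)) -----> ennreal 1" by (simp add: eq)
 moreover have "0 <= (LINT w|hsN. ker (s i) (FX p) w)" for i
  by (intro integral_nonneg_AE AE_I2 ker_nonneg sp)
 ultimately show "(%i. LINT w|hsN. ker (s i) (FX p) w) -----> 1"
  by (subst (asm) tendsto_ennreal_iff) auto
qed

section \<open>Derivatives of kernel integrals\<close>

text \<open>The derivative of the logarithm of the kernel in the ambient direction
  \<open>e\<close>.\<close>

definition mm :: "real => real * real * 'a::euclidean_space => 'a \<times> real => real" where
 "mm t e w = mink e (hsY w) / (2 * t)"

lemma mm_measurable [measurable]: "mm t e \<in> borel_measurable borel"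
 unfolding mm_def[abs_def] by measurable

lemma mm_bl: "bounded_linear (%e. mm t e w)"
proof -
 have "bounded_linear (%e. (1 / (2 * t)) *R mink e (hsY w))"
  by (intro bounded_linear_scaleR_right[THEN bounded_linear_compose] mink.bounded_linear_left)
 then show ?thesis by (simp add: mm_def[abs_def])
qed

lemmas mm_simps = linear_add[OF bounded_linear.linear[OF mm_bl]] linear_cmul[OF bounded_linear.linear[OF mm_bl]]
 linear_0[OF bounded_linear.linear[OF mm_bl]]

lemma ker_eq_mm: "ker t Y w = nc TYPE('a) t * exp (mm t Y w + 1 / (2 * t))"
 for Y :: "real * real * 'a::euclidean_space"
 by (simp add: ker_def mm_def add_divide_distrib)

lemma fst_hsY: "fst (hsY w) = ZZ (0, 0) w"
 by (simp add: ZZ_def FX_def mink_def zero_prod_def[symmetric])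

lemma fst_hsY_ge1: "fst (hsY w) >= 1" by (rule fst_hyperboloid_ge1[OF hsY_in])

lemma mm_bound: "t > 0 ==> \<bar>mm t e w\<bar> <= norm e * fst (hsY w) / t"
proof -
 assume t: "t > 0"
 have y: "norm (snd (hsY w)) <= fst (hsY w)" by (rule less_imp_le[OF norm_snd_less_fst[OF hsY_in]])
 have "\<bar>mink e (hsY w)\<bar> <= \<bar>fst e\<bar> * fst (hsY w) + norm (snd e) * norm (snd (hsY w))"
  using Cauchy_Schwarz_ineq2[of "snd e" "snd (hsY w)"] abs_triangle_ineq4[of "snd e \<bullet> snd (hsY w)" "fst e * fst (hsY w)"] fst_hsY_ge1[of w] by (simp add: mink_def abs_mult)
 also have "... <= norm e * fst (hsY w) + norm e * fst (hsY w)"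
  using norm_fst_le[of "fst e" "snd e"] norm_snd_le[of "snd e" "fst e"] fst_hsY_ge1[of w] y
  by (intro add_mono mult_mono) auto
 finally show ?thesis using t by (simp add: mm_def field_simps)
qed

lemma integrable_exp_fst_hsY:
 assumes "c > 0"
 shows "integrable hsN (%w. exp (- (c * fst (hsY w))))"
proof -
 have 1: "integrable hsN (%w. exp (- c) * exp (- ((ZZ (0, 0) w - 1) / (2 * (sqrt (1 / (2 * c)))\<^sup>2))))"
  by (intro integrable_mult_right integrable_ker_exp) (use assms in simp)
 have 2: "exp (- c) * exp (- ((ZZ (0, 0) w - 1) / (2 * (sqrt (1 / (2 * c)))\<^sup>2))) = exp (- (c * fst (hsY w)))" for w
  using assms by (simp add: exp_add[symmetric] fst_hsY algebra_simps)
 show ?thesis using 1 unfolding 2 .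
qed

text \<open>One family for all integrands: with z = (Y, e, e'), the numbers a, b and zero directions
  select the kernel, its first or its second derivatives. Since \<open>di\<close> is the
  differential in z, a single differentiation under the integral serves all orders.\<close>

definition ti :: "real => real => real => ('a \<times> real => real) =>
  (real * real * 'a) \<times> (real * real * 'a) \<times> (real * real * 'a) => 'a::euclidean_space \<times> real => real" where
 "ti t a b g z w = ker t (fst z) w * ((a + mm t (fst (snd z)) w) * (b + mm t (snd (snd z)) w)) * g w"

definition di :: "real => real => real => ('a \<times> real => real) =>
  (real * real * 'a) \<times> (real * real * 'a) \<times> (real * real * 'a) => 'a::euclidean_space \<times> real =>
  (real * real * 'a) \<times> (real * real * 'a) \<times> (real * real * 'a) => real" where
 "di t a b g z w h = ker t (fst z) w * (mm t (fst h) w * ((a + mm t (fst (snd z)) w) * (b + mm t (snd (snd z)) w))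
   + (mm t (fst (snd h)) w * (b + mm t (snd (snd z)) w) + (a + mm t (fst (snd z)) w) * mm t (snd (snd h)) w)) * g w"

lemma ti_has_derivative: "((%z. ti t a b g z w) has_derivative di t a b g z w) (at z)"
proof -
 have m: "((%z. mm t (L z) w) has_derivative (%h. mm t (L h) w)) (at z)" if "bounded_linear L"
  for L :: "(real * real * 'a) \<times> (real * real * 'a) \<times> (real * real * 'a) => _"
  by (rule bounded_linear_imp_has_derivative[OF bounded_linear_compose[OF mm_bl that]])
 note d = m[OF bounded_linear_fst] m[OF bounded_linear_compose[OF bounded_linear_fst bounded_linear_snd]]
  m[OF bounded_linear_compose[OF bounded_linear_snd bounded_linear_snd]]
 show ?thesis unfolding ti_def[abs_def] di_def[abs_def] ker_eq_mm
  by (rule derivative_eq_intros d | simp)+ (auto simp: fun_eq_iff algebra_simps)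
qed

lemma ti_measurable [measurable]: "g \<in> borel_measurable borel ==> ti t a b g z \<in> borel_measurable borel"
 unfolding ti_def[abs_def] by measurable

lemma di_measurable [measurable]: "g \<in> borel_measurable borel ==> (%w. di t a b g z w h) \<in> borel_measurable borel"
 unfolding di_def[abs_def] by measurable

text \<open>\<open>Y\<close> may be any point of the open forward cone, where the kernel decays
  exponentially in the time coordinate of \<open>hsY w\<close>. At most three linear factors occur,
  so a cube times this exponential is a majorant.\<close>

lemma ti_dominated:
 fixes z0 :: "(real * real * 'a) \<times> (real * real * 'a) \<times> (real * real * 'a::euclidean_space)"
 assumes t: "t > 0" and M: "!!w. \<bar>g w\<bar> <= M" and z0: "norm (snd (fst z0)) < fst (fst z0)"
 obtains r B where "r > 0" "integrable hsN B" "!!z w. z \<in> ball z0 r ==> \<bar>ti t a b g z w\<bar> <= B w"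
  "!!z w h. z \<in> ball z0 r ==> \<bar>di t a b g z w h\<bar> <= B w * norm h"
proof -
 \<comment> \<open>The margin of \<open>z0\<close> inside the cone. A perturbation of size c0/4
   leaves at least c0/2 of it, which gives the rate \<open>c\<close>; half of that rate is given up
   to absorb the cube.\<close>
 define c0 where "c0 = fst (fst z0) - norm (snd (fst z0))"
 define c where "c = c0 / (4 * t)"
 define A where "A = \<bar>a\<bar> + \<bar>b\<bar> + (norm z0 + c0 / 4) / t + 1 / t + 1"
 define N where "N = nc TYPE('a) t * exp (1 / (2 * t))"
 define B where "B w = N * (3 * A ^ 3) * M * (6 / c) ^ 3 * exp (- (c / 2 * fst (hsY w)))" for w :: "'a \<times> real"
 have c0: "c0 > 0" and c: "c > 0" using z0 t by (auto simp: c0_def c_def)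
 have M0: "M >= 0" using M[of undefined] by linarith
 have N0: "N > 0" unfolding N_def by (rule mult_pos_pos[OF nc_pos[OF t] exp_gt_zero])
 have A1: "A >= 1" "A >= 1 / t" using t c0 by (auto simp: A_def)
 have Bi: "integrable hsN B"
  unfolding B_def using c integrable_exp_fst_hsY[of "c / 2"] by (intro integrable_mult_right) auto
 have key: "\<bar>ti t a b g z w\<bar> <= B w \<and> \<bar>di t a b g z w h\<bar> <= B w * norm h" if z: "z \<in> ball z0 (c0 / 4)" for z w h
 proof -
  let ?y = "fst (hsY w)"
  have y1: "?y >= 1" by (rule fst_hsY_ge1)
  have dz: "norm (z - z0) < c0 / 4" using z by (simp add: dist_norm norm_minus_commute)
  have nz: "norm z <= norm z0 + c0 / 4" using norm_triangle_sub[of z z0] dz by simp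
  have n: "norm (fst z) <= norm z" "norm (fst (snd z)) <= norm z" "norm (snd (snd z)) <= norm z"
   for z :: "(real * real * 'a) \<times> (real * real * 'a) \<times> (real * real * 'a)"
   using norm_fst_le[of "fst z" "snd z"] norm_snd_le[of "snd z" "fst z"]
    norm_fst_le[of "fst (snd z)" "snd (snd z)"] norm_snd_le[of "snd (snd z)" "fst (snd z)"] by auto
  have mA: "\<bar>mm t (fst h) w\<bar> <= A * ?y * norm h" "\<bar>mm t (fst (snd h)) w\<bar> <= A * ?y * norm h"
   "\<bar>mm t (snd (snd h)) w\<bar> <= A * ?y * norm h"
  proof -
   have "\<bar>mm t e w\<bar> <= A * ?y * norm h" if "norm e <= norm h" for e
   proof -
    have "\<bar>mm t e w\<bar> <= norm e * ?y / t" by (rule mm_bound[OF t])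
    also have "... = (1 / t) * ?y * norm e" by simp
    also have "... <= A * ?y * norm h" using A1 y1 t that by (intro mult_mono) auto
    finally show ?thesis .
   qed
   then show "\<bar>mm t (fst h) w\<bar> <= A * ?y * norm h" "\<bar>mm t (fst (snd h)) w\<bar> <= A * ?y * norm h"
   "\<bar>mm t (snd (snd h)) w\<bar> <= A * ?y * norm h" using n by auto
  qed
  have aA: "\<bar>a + mm t (fst (snd z)) w\<bar> <= A * ?y" "\<bar>b + mm t (snd (snd z)) w\<bar> <= A * ?y"
  proof -
   have "\<bar>x + mm t e w\<bar> <= A * ?y" if e: "norm e <= norm z" and x: "\<bar>x\<bar> <= \<bar>a\<bar> + \<bar>b\<bar>" for e x
   proof -
    have "\<bar>x + mm t e w\<bar> <= \<bar>x\<bar> + norm e * ?y / t" using mm_bound[OF t, of e w] by linarith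
    also have "... <= (\<bar>a\<bar> + \<bar>b\<bar>) * ?y + (norm z0 + c0 / 4) / t * ?y"
    proof (rule add_mono)
     show "\<bar>x\<bar> <= (\<bar>a\<bar> + \<bar>b\<bar>) * ?y" using mult_left_mono[OF y1, of "\<bar>a\<bar> + \<bar>b\<bar>"] x by simp
     have "norm e * ?y <= (norm z0 + c0 / 4) * ?y" using e nz y1 by (intro mult_right_mono) auto
     then show "norm e * ?y / t <= (norm z0 + c0 / 4) / t * ?y" using t by (simp add: divide_right_mono)
    qed
    also have "... = (\<bar>a\<bar> + \<bar>b\<bar> + (norm z0 + c0 / 4) / t) * ?y" by (simp only: distrib_right)
    also have "... <= A * ?y" using y1 t by (intro mult_right_mono) (auto simp: A_def)
    finally show ?thesis .
   qed
   then show "\<bar>a + mm t (fst (snd z)) w\<bar> <= A * ?y" "\<bar>b + mm t (snd (snd z)) w\<bar> <= A * ?y" using n by auto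
  qed
  have kb: "ker t (fst z) w <= N * exp (- (c * ?y))"
  proof -
   have ys: "norm (snd (hsY w)) <= ?y" by (rule less_imp_le[OF norm_snd_less_fst[OF hsY_in]])
   have 1: "fst (fst z) >= fst (fst z0) - c0 / 4" "norm (snd (fst z)) <= norm (snd (fst z0)) + c0 / 4"
   proof -
    have "norm (fst (fst (z - z0))) <= norm (fst (z - z0))" "norm (snd (fst (z - z0))) <= norm (fst (z - z0))"
     by (metis norm_fst_le prod.collapse, metis norm_snd_le prod.collapse)
    then have "norm (fst (fst (z - z0))) <= norm (z - z0)" "norm (snd (fst (z - z0))) <= norm (z - z0)"
     using n(1)[of "z - z0"] by linarith+
    then show "fst (fst z) >= fst (fst z0) - c0 / 4" "norm (snd (fst z)) <= norm (snd (fst z0)) + c0 / 4"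
     using dz norm_triangle_sub[of "snd (fst z)" "snd (fst z0)"] by auto
   qed
   have "mink (fst z) (hsY w) <= norm (snd (fst z)) * norm (snd (hsY w)) - fst (fst z) * ?y"
    using norm_cauchy_schwarz[of "snd (fst z)" "snd (hsY w)"] by (simp add: mink_def)
   also have "... <= norm (snd (fst z)) * ?y - fst (fst z) * ?y" using ys by (simp add: mult_left_mono)
   also have "... = (norm (snd (fst z)) - fst (fst z)) * ?y" by (simp add: left_diff_distrib)
   also have "... <= (- (c0 / 2)) * ?y" using 1 y1 by (intro mult_right_mono) (auto simp: c0_def field_simps)
   finally have "mm t (fst z) w <= (- (c0 / 2)) * ?y / (2 * t)"
    unfolding mm_def using t by (intro divide_right_mono) auto
   then have "mm t (fst z) w <= - (c * ?y)" by (simp add: c_def)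
   then have "exp (mm t (fst z) w) * exp (1 / (2 * t)) <= exp (- (c * ?y)) * exp (1 / (2 * t))"
    by simp
   from mult_left_mono[OF this less_imp_le[OF nc_pos[OF t, of "TYPE('a)"]]]
   show ?thesis by (simp only: ker_eq_mm N_def exp_add mult_ac)
  qed
  have k0: "ker t (fst z) w >= 0" by (rule ker_nonneg[OF t])
  have Ay: "A * ?y >= 1" using mult_mono[OF A1(1) y1] A1 by simp
  have ex: "exp (- (c * ?y)) * ?y ^ 3 <= (6 / c) ^ 3 * exp (- (c / 2 * ?y))"
  proof -
   have "c / 6 * ?y <= exp (c / 6 * ?y)" using exp_ge_add_one_self[of "c / 6 * ?y"] by linarith
   then have "?y <= 6 / c * exp (c / 6 * ?y)" using c by (simp add: field_simps)
   then have "?y ^ 3 <= (6 / c * exp (c / 6 * ?y)) ^ 3" using y1 by (intro power_mono) auto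
   also have "... = (6 / c) ^ 3 * exp (c / 2 * ?y)"
    unfolding power_mult_distrib exp_of_nat_mult[symmetric] by simp
   finally have "exp (- (c * ?y)) * ?y ^ 3 <= exp (- (c * ?y)) * ((6 / c) ^ 3 * exp (c / 2 * ?y))"
    by (rule mult_left_mono) simp
   also have "... = (6 / c) ^ 3 * (exp (- (c * ?y)) * exp (c / 2 * ?y))" by (simp only: mult_ac)
   also have "exp (- (c * ?y)) * exp (c / 2 * ?y) = exp (- (c / 2 * ?y))" by (simp flip: exp_add)
   finally show ?thesis .
  qed
  have fin: "ker t (fst z) w * x * M <= B w * s" if x: "x <= 3 * (A * ?y) ^ 3 * s" and s: "s >= 0" for x s
  proof -
   have "ker t (fst z) w * x * M <= ker t (fst z) w * (3 * (A * ?y) ^ 3 * s) * M"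
    using x k0 M0 by (intro mult_right_mono mult_left_mono) auto
   also have "... <= (N * exp (- (c * ?y))) * (3 * (A * ?y) ^ 3 * s) * M"
    using kb M0 s y1 A1 by (intro mult_right_mono) auto
   also have "... = (N * (3 * A ^ 3) * M) * (exp (- (c * ?y)) * ?y ^ 3) * s" by (simp add: power_mult_distrib mult_ac)
   also have "... <= (N * (3 * A ^ 3) * M) * ((6 / c) ^ 3 * exp (- (c / 2 * ?y))) * s"
    using ex s N0 A1 M0 by (intro mult_right_mono mult_left_mono) auto
   also have "... = B w * s" by (simp add: B_def mult_ac)
   finally show ?thesis .
  qed
  let ?a = "a + mm t (fst (snd z)) w" and ?b = "b + mm t (snd (snd z)) w"
  have ab: "\<bar>?a\<bar> * \<bar>?b\<bar> <= (A * ?y) * (A * ?y)" using aA Ay by (intro mult_mono) auto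
  have "\<bar>ti t a b g z w\<bar> = ker t (fst z) w * (\<bar>?a\<bar> * \<bar>?b\<bar>) * \<bar>g w\<bar>"
   using k0 by (simp add: ti_def abs_mult)
  also have "... <= ker t (fst z) w * (\<bar>?a\<bar> * \<bar>?b\<bar>) * M" using k0 M by (intro mult_left_mono) auto
  also have "... <= B w * 1"
  proof (rule fin)
   have "(A * ?y) * (A * ?y) * 1 <= (A * ?y) * (A * ?y) * (A * ?y)" using Ay by (intro mult_left_mono) auto
   moreover have "0 <= (A * ?y) * (A * ?y) * (A * ?y)" using Ay by simp
   ultimately show "\<bar>?a\<bar> * \<bar>?b\<bar> <= 3 * (A * ?y) ^ 3 * 1" using ab unfolding power3_eq_cube by linarith
  qed simp
  finally have P: "\<bar>ti t a b g z w\<bar> <= B w" by simp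
  let ?x = "mm t (fst h) w * (?a * ?b) + (mm t (fst (snd h)) w * ?b + ?a * mm t (snd (snd h)) w)"
  have "\<bar>di t a b g z w h\<bar> = ker t (fst z) w * \<bar>?x\<bar> * \<bar>g w\<bar>"
   using k0 by (simp add: di_def abs_mult)
  also have "... <= ker t (fst z) w * \<bar>?x\<bar> * M" using k0 M by (intro mult_left_mono) auto
  also have "... <= B w * norm h"
  proof (rule fin)
   let ?S = "A * ?y"
   have 1: "\<bar>mm t (fst h) w\<bar> * (\<bar>?a\<bar> * \<bar>?b\<bar>) <= (?S * norm h) * (?S * ?S)"
    by (rule mult_mono[OF mA(1) ab]) (use Ay in auto)
   have 2: "\<bar>mm t (fst (snd h)) w\<bar> * \<bar>?b\<bar> <= (?S * norm h) * ?S" "\<bar>?a\<bar> * \<bar>mm t (snd (snd h)) w\<bar> <= ?S * (?S * norm h)"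
    by (rule mult_mono[OF mA(2) aA(2)]; use Ay in simp) (rule mult_mono[OF aA(1) mA(3)]; use Ay in simp)
   have 3: "(?S * ?S * norm h) * 1 <= (?S * ?S * norm h) * ?S" using Ay by (intro mult_left_mono) auto
   have "\<bar>?x\<bar> <= \<bar>mm t (fst h) w\<bar> * (\<bar>?a\<bar> * \<bar>?b\<bar>) + (\<bar>mm t (fst (snd h)) w\<bar> * \<bar>?b\<bar> + \<bar>?a\<bar> * \<bar>mm t (snd (snd h)) w\<bar>)"
    unfolding abs_mult[symmetric] by linarith
   also have "... <= (?S * norm h) * (?S * ?S) + ((?S * norm h) * ?S + ?S * (?S * norm h))"
    using 1 2 by (intro add_mono)
   also have "... <= 3 * ?S ^ 3 * norm h" using 3 by (simp add: power3_eq_cube mult_ac)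
   finally show "\<bar>?x\<bar> <= 3 * ?S ^ 3 * norm h" .
  qed simp
  finally show ?thesis using P by simp
 qed
 show thesis by (rule that[of "c0 / 4" B]) (use c0 Bi key in auto)
qed

lemma di_integrable:
 assumes "t > 0" "g \<in> borel_measurable borel" "!!w. \<bar>g w\<bar> <= M" "norm (snd (fst z)) < fst (fst z)"
 shows "integrable hsN (ti t a b g z)" and "integrable hsN (%w. di t a b g z w h)"
  and "((%z. LINT w|hsN. ti t a b g z w) has_derivative (%h. LINT w|hsN. di t a b g z w h)) (at z)"
proof -
 have [measurable]: "g \<in> borel_measurable borel" by fact
 obtain r B where B: "r > 0" "integrable hsN B" "!!z' w. z' \<in> ball z r ==> \<bar>ti t a b g z' w\<bar> <= B w"
  "!!z' w h. z' \<in> ball z r ==> \<bar>di t a b g z' w h\<bar> <= B w * norm h"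
  by (rule ti_dominated[OF assms(1,3,4), where a=a and b=b]) (rule that)
 have i: "integrable hsN (ti t a b g z')" if "z' \<in> ball z r" for z'
  by (rule Bochner_Integration.integrable_bound[OF B(2)])
    (use B(3)[OF that] in "auto intro!: AE_I2 order_trans[OF _ abs_ge_self]")
 show "integrable hsN (ti t a b g z)" by (rule i) (use B(1) in simp)
 have "\<bar>di t a b g z w h\<bar> <= B w * norm h" for w by (rule B(4)) (use B(1) in simp)
 then show "integrable hsN (%w. di t a b g z w h)"
  by (intro Bochner_Integration.integrable_bound[OF integrable_mult_left[OF B(2), of "norm h"]])
    (auto intro!: AE_I2 order_trans[OF _ abs_ge_self])
 show "((%z. LINT w|hsN. ti t a b g z w) has_derivative (%h. LINT w|hsN. di t a b g z w h)) (at z)"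
  by (rule has_derivative_integral_dominated[OF B(1) _ _ _ B(2)]) (use B(4) i in "auto intro: ti_has_derivative")
qed

lemma FX_cone: "norm (snd (FX p)) < fst (FX p)" by (rule norm_snd_less_fst[OF fm.X_in])

definition hk :: "real => ('a \<times> real => real) => real * 'a::euclidean_space => real" where
 "hk t g p = (LINT w|hsN. ker t (FX p) w * g w)"

abbreviation TI where "TI t a b g z \<equiv> (LINT w|hsN. ti t a b g z w)"

locale heat_data =
 fixes t :: real and g :: "'a::euclidean_space \<times> real => real" and M :: real
 assumes t: "t > 0" and g_meas [measurable]: "g \<in> borel_measurable borel" and g_bound: "!!w. \<bar>g w\<bar> <= M"
begin

lemma ti_integrable: "norm (snd (fst z)) < fst (fst z) ==> integrable hsN (ti t a b g z)"
 by (rule di_integrable(1)[OF t g_meas g_bound])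

lemma TI_linear:
 assumes "norm (snd Y) < fst Y"
 shows "TI t 0 1 g (Y, x *R e + y *R e', 0) = x * TI t 0 1 g (Y, e, 0) + y * TI t 0 1 g (Y, e', 0)"
proof -
 have "ti t 0 1 g (Y, x *R e + y *R e', 0) w = x * ti t 0 1 g (Y, e, 0) w + y * ti t 0 1 g (Y, e', 0) w" for w
  by (simp add: ti_def mm_simps algebra_simps)
 then have "TI t 0 1 g (Y, x *R e + y *R e', 0) = (LINT w|hsN. x * ti t 0 1 g (Y, e, 0) w + y * ti t 0 1 g (Y, e', 0) w)"
  by (simp only:)
 then show ?thesis using assms by (simp add: ti_integrable)
qed

lemma TI_compose:
 assumes "(Z has_derivative Z') (at p within S)" "norm (snd (fst (Z p))) < fst (fst (Z p))"
 shows "((%p. TI t a b g (Z p)) has_derivative (%h. LINT w|hsN. di t a b g (Z p) w (Z' h))) (at p within S)"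
 by (rule has_derivative_compose[OF assms(1) di_integrable(3)[OF t g_meas g_bound assms(2)]])

lemma TI_continuous:
 assumes "continuous_on UNIV Z" "!!p. norm (snd (fst (Z p))) < fst (fst (Z p))"
 shows "continuous_on UNIV (%p. TI t a b g (Z p))"
proof (rule continuous_on_compose2[OF _ assms(1)])
 show "continuous_on (range Z) (%z. TI t a b g z)"
  by (intro continuous_at_imp_continuous_on ballI has_derivative_continuous[OF di_integrable(3)[OF t g_meas g_bound]])
    (use assms(2) in auto)
qed simp

text \<open>In the Hessian the tangential part of \<open>X''\<close> cancels against the Christoffel
  term, and its normal part leaves the metric times the derivative in the radial direction
  \<open>FX p\<close>.\<close>

lemma hk_calculus:
 shows "Ck 2 (hk t g)"
  and "dderiv (hk t g) p v = TI t 0 1 g (FX p, FX' p v, 0)"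
  and "hess gfermi (hk t g) p v v' = TI t 0 0 g (FX p, FX' p v, FX' p v') + gfermi p v v' * TI t 0 1 g (FX p, FX p, 0)"
proof -
 let ?u' = "%p v. TI t 0 1 g (FX p, FX' p v, 0)"
 let ?u'' = "%p v h. TI t 0 0 g (FX p, FX' p h, FX' p v) + TI t 0 1 g (FX p, FX'' p h v, 0)"
 have hk: "hk t g p = TI t 1 1 g (FX p, 0, 0)" for p
  by (simp add: hk_def ti_def mm_simps)
 have 1: "(hk t g has_derivative ?u' p) (at p)" for p
 proof -
  have "((%p. (FX p, 0, 0)) has_derivative (%h. (FX' p h, 0, 0))) (at p)"
   by (intro has_derivative_Pair fm.X_deriv has_derivative_const)
  from TI_compose[OF this, of 1 1] have "((%p. TI t 1 1 g (FX p, 0, 0)) has_derivative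
    (%h. LINT w|hsN. di t 1 1 g (FX p, 0, 0) w (FX' p h, 0, 0))) (at p)" by (simp add: FX_cone)
  moreover have "di t 1 1 g (FX p, 0, 0) w (FX' p h, 0, 0) = ti t 0 1 g (FX p, FX' p h, 0) w" for h w
   by (simp add: di_def ti_def mm_simps)
  ultimately show ?thesis by (simp add: hk[abs_def])
 qed
 have 2: "((%p. ?u' p v) has_derivative ?u'' p v) (at p)" for p v
 proof -
  have "((%p. (FX p, FX' p v, 0)) has_derivative (%h. (FX' p h, FX'' p h v, 0))) (at p)"
   by (intro has_derivative_Pair fm.X_deriv fm.X'_deriv has_derivative_const)
  from TI_compose[OF this, of 0 1] have *: "((%p. TI t 0 1 g (FX p, FX' p v, 0)) has_derivative
    (%h. LINT w|hsN. di t 0 1 g (FX p, FX' p v, 0) w (FX' p h, FX'' p h v, 0))) (at p)" by (simp add: FX_cone)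
  have "di t 0 1 g (FX p, FX' p v, 0) w (FX' p h, FX'' p h v, 0)
    = ti t 0 0 g (FX p, FX' p h, FX' p v) w + ti t 0 1 g (FX p, FX'' p h v, 0) w" for h w
   by (simp add: di_def ti_def mm_simps algebra_simps)
  then have "(LINT w|hsN. di t 0 1 g (FX p, FX' p v, 0) w (FX' p h, FX'' p h v, 0))
    = (LINT w|hsN. ti t 0 0 g (FX p, FX' p h, FX' p v) w + ti t 0 1 g (FX p, FX'' p h v, 0) w)" for h by (simp only:)
  then have "(LINT w|hsN. di t 0 1 g (FX p, FX' p v, 0) w (FX' p h, FX'' p h v, 0)) = ?u'' p v h" for h
   by (simp add: ti_integrable FX_cone)
  then show ?thesis using * by simp
 qed
 have 3: "continuous_on UNIV (%p. ?u'' p v h)" for v h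
  by (intro continuous_on_add TI_continuous continuous_on_Pair fm.continuous_on_X fm.continuous_on_X' fm.X''_cont
    continuous_on_const) (simp_all add: FX_cone)
 note C = Ck2I[of "hk t g" ?u' ?u'', OF 1 2 3]
 show "Ck 2 (hk t g)" by (rule C(1))
 show d: "dderiv (hk t g) p v = ?u' p v" for p v by (rule C(2))
 have "FX' p (christoffel gfermi p v v') = 1 *R FX'' p v v' + (- gfermi p v v') *R FX p"
  by (simp add: fm.X'_christoffel)
 then have "dderiv (hk t g) p (christoffel gfermi p v v')
   = TI t 0 1 g (FX p, FX'' p v v', 0) - gfermi p v v' * TI t 0 1 g (FX p, FX p, 0)"
  unfolding d using TI_linear[OF FX_cone, of p 1 "FX'' p v v'" "- gfermi p v v'" "FX p"] by simp
 then show "hess gfermi (hk t g) p v v' = TI t 0 0 g (FX p, FX' p v, FX' p v') + gfermi p v v' * TI t 0 1 g (FX p, FX p, 0)"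
  unfolding hess_eq C(3) by simp
qed

text \<open>The third derivative along a geodesic. The point moves with ambient velocity
  \<open>y\<close>, while parallel fields change by the multiples \<open>a\<close> and
  \<open>a'\<close> of the position vector.\<close>

lemma hk_hess_curve:
 assumes k: "geodesic gfermi k" and V: "parallel_along gfermi k V" and W: "parallel_along gfermi k W" and s: "s \<in> {0..1}"
 defines "Y \<equiv> %s. FX (k s)" and "e \<equiv> %s. FX' (k s) (V s)" and "e' \<equiv> %s. FX' (k s) (W s)"
  and "y \<equiv> FX' (k s) (velocity k s)" and "c \<equiv> gfermi (k 0) (V 0) (W 0)"
  and "a \<equiv> gfermi (k s) (velocity k s) (V s)" and "a' \<equiv> gfermi (k s) (velocity k s) (W s)"
 shows "((%s. hess gfermi (hk t g) (k s) (V s) (W s)) has_real_derivative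
   (LINT w|hsN. ker t (Y s) w * ((mm t y w * (mm t (e s) w * mm t (e' s) w)
    + (a * mm t (Y s) w * mm t (e' s) w + mm t (e s) w * (a' * mm t (Y s) w)))
    + c * (mm t y w * mm t (Y s) w + mm t y w)) * g w)) (at s within {0..1})"
proof -
 note vel = geodesic_velocity[OF k s]
 have gc: "gfermi (k s) (V s) (W s) = c" if "s \<in> {0..1}" for s
  unfolding c_def by (rule fm.parallel_inner_const[OF geodesic_velocity[OF k] V W that])
 have heq: "hess gfermi (hk t g) (k s) (V s) (W s) = TI t 0 0 g (Y s, e s, e' s) + c * TI t 0 1 g (Y s, Y s, 0)"
  if "s \<in> {0..1}" for s
  unfolding hk_calculus(3) gc[OF that] Y_def e_def e'_def by simp
 have dY: "(Y has_derivative (%h. h *R y)) (at s within {0..1})"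
  using fm.curve_ambient[OF vel] by (simp add: Y_def y_def has_vector_derivative_def)
 have de: "(e has_derivative (%h. h *R a *R Y s)) (at s within {0..1})"
  using fm.parallel_ambient[OF V s vel] by (simp add: e_def Y_def a_def has_vector_derivative_def)
 have de': "(e' has_derivative (%h. h *R a' *R Y s)) (at s within {0..1})"
  using fm.parallel_ambient[OF W s vel] by (simp add: e'_def Y_def a'_def has_vector_derivative_def)
 have cone: "norm (snd (Y s)) < fst (Y s)" by (simp add: Y_def FX_cone)
 have "((%s. (Y s, e s, e' s)) has_derivative (%h. (h *R y, h *R a *R Y s, h *R a' *R Y s))) (at s within {0..1})"
  by (intro has_derivative_Pair dY de de')
 from TI_compose[OF this, of 0 0] cone
 have D1: "((%s. TI t 0 0 g (Y s, e s, e' s)) has_derivative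
   (%h. LINT w|hsN. di t 0 0 g (Y s, e s, e' s) w (h *R y, h *R a *R Y s, h *R a' *R Y s))) (at s within {0..1})" by simp
 have "((%s. (Y s, Y s, 0)) has_derivative (%h. (h *R y, h *R y, 0))) (at s within {0..1})"
  by (intro has_derivative_Pair dY has_derivative_const)
 from TI_compose[OF this, of 0 1] cone
 have D2: "((%s. TI t 0 1 g (Y s, Y s, 0)) has_derivative
   (%h. LINT w|hsN. di t 0 1 g (Y s, Y s, 0) w (h *R y, h *R y, 0))) (at s within {0..1})" by simp
 let ?d1 = "di t 0 0 g (Y s, e s, e' s)" and ?h1 = "(y, a *R Y s, a' *R Y s)"
 let ?d2 = "di t 0 1 g (Y s, Y s, 0)" and ?h2 = "(y, y, 0)"
 have s1: "?d1 w (h *R y, h *R a *R Y s, h *R a' *R Y s) = h * ?d1 w ?h1" for w h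
  by (simp add: di_def mm_simps algebra_simps)
 have s2: "?d2 w (h *R y, h *R y, 0) = h * ?d2 w ?h2" for w h
  by (simp add: di_def mm_simps algebra_simps)
 have i: "integrable hsN (%w. ?d1 w ?h1)" "integrable hsN (%w. ?d2 w ?h2)"
  by (rule di_integrable(2)[OF t g_meas g_bound]; use cone in simp)+
 have "((%s. TI t 0 0 g (Y s, e s, e' s) + c * TI t 0 1 g (Y s, Y s, 0)) has_derivative
   (%h. (LINT w|hsN. h * ?d1 w ?h1) + c * (LINT w|hsN. h * ?d2 w ?h2))) (at s within {0..1})"
  using has_derivative_add[OF D1 has_derivative_mult_right[OF D2, of c]] unfolding s1 s2 .
 also have "(%h. (LINT w|hsN. h * ?d1 w ?h1) + c * (LINT w|hsN. h * ?d2 w ?h2))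
   = times (LINT w|hsN. ?d1 w ?h1 + c * ?d2 w ?h2)"
  using i by (simp add: fun_eq_iff algebra_simps)
 also have "(%w. ?d1 w ?h1 + c * ?d2 w ?h2) = (%w. ker t (Y s) w * ((mm t y w * (mm t (e s) w * mm t (e' s) w)
    + (a * mm t (Y s) w * mm t (e' s) w + mm t (e s) w * (a' * mm t (Y s) w)))
    + c * (mm t y w * mm t (Y s) w + mm t y w)) * g w)"
  by (simp add: fun_eq_iff di_def mm_simps algebra_simps)
 finally show ?thesis
  unfolding has_field_derivative_def
  by (rule has_derivative_transform[rotated 2]) (use s heq in auto)
qed

end

text \<open>The kernel integral of a constant is constant, because the mass is. Later c is the value
  of the data at the point in question, so that their Hoelder bound gains a power of t.\<close>

lemma gfermi_heat_shift:
 fixes g :: "'a::euclidean_space \<times> real => real"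
 assumes "heat_data t g M"
 shows "heat_data t (%w. g w - c) (M + \<bar>c\<bar>)"
  and "dderiv (hk t g) p v = dderiv (hk t (%w. g w - c)) p v"
  and "hess gfermi (hk t g) p v v' = hess gfermi (hk t (%w. g w - c)) p v v'"
proof -
 interpret heat_data t g M by fact
 interpret c: heat_data t "%w. g w - c" "M + \<bar>c\<bar>"
 proof
  show "\<bar>g w - c\<bar> <= M + \<bar>c\<bar>" for w using g_bound[of w] by linarith
 qed (use t in auto)
 interpret o: heat_data t "%w::'a \<times> real. c" "\<bar>c\<bar>"
  by standard (use t in auto)
 show "heat_data t (%w. g w - c) (M + \<bar>c\<bar>)" by (rule c.heat_data_axioms)
 define m where "m = (LINT w|hsN. ker t (FX (0 :: real * 'a)) w)"
 have int: "integrable hsN (%w. ker t (FX p) w * (g w - c))" "integrable hsN (%w. ker t (FX p) w * c)" for p :: "real * 'a"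
  using c.ti_integrable[of "(FX p, 0, 0)" 1 1] o.ti_integrable[of "(FX p, 0, 0)" 1 1] FX_cone[of p]
  by (simp_all add: ti_def[abs_def] mm_simps)
 have "hk t g p = hk t (%w. g w - c) p + m * c" for p
 proof -
  have "(LINT w|hsN. ker t (FX p) w * (g w - c)) + (LINT w|hsN. ker t (FX p) w * c)
    = (LINT w|hsN. ker t (FX p) w * (g w - c) + ker t (FX p) w * c)"
   by (rule Bochner_Integration.integral_add[symmetric]) (rule int)+
  moreover have "(LINT w|hsN. ker t (FX p) w * c) = m * c" unfolding m_def mass_const[OF t, of 0 p] by simp
  moreover have "ker t (FX p) w * (g w - c) + ker t (FX p) w * c = ker t (FX p) w * g w" for w
   by (simp add: algebra_simps)
  ultimately show ?thesis unfolding hk_def by (simp only:)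
 qed
 then have eq: "hk t g = (%p. hk t (%w. g w - c) p + m * c)" by blast
 show "dderiv (hk t g) p v = dderiv (hk t (%w. g w - c)) p v"
  unfolding eq Ck2_add(2)[OF c.hk_calculus(1) Ck2_const] by simp
 have "hess gfermi (%p::real * 'a. m * c) p v v' = 0" unfolding hess_eq by simp
 then show "hess gfermi (hk t g) p v v' = hess gfermi (hk t (%w. g w - c)) p v v'"
  unfolding eq fm.hess_add[OF c.hk_calculus(1) Ck2_const] by simp
qed

section \<open>Heat estimates for Hoelder data\<close>

text \<open>The moment bound as a property of its constant, so that one constant \<open>C\<close>,
  independent of the data and of K, can be fixed for everything that follows.\<close>

definition mom :: "'a::euclidean_space itself => real => bool" where
 "mom T C \<longleftrightarrow> C > 0 \<and> (\<forall>t (p :: real * 'a) \<phi> B. 0 < t --> t <= 1 --> \<phi> \<in> borel_measurable borel -->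
   (\<forall>w. \<bar>\<phi> w\<bar> <= B * (1 + aa t p w) ^ 6) --> \<bar>LINT w|hsN. ker t (FX p) w * \<phi> w\<bar> <= C * B)"

lemma mom_exists: "\<exists>C. mom TYPE('a::euclidean_space) C"
 by (rule ker_moment_bound[where 'a='a]) (auto simp: mom_def)

lemma momD:
 fixes p :: "real * 'a::euclidean_space"
 assumes "mom TYPE('a) C" "0 < t" "t <= 1" "\<phi> \<in> borel_measurable borel" "B >= 0"
  and "!!w. \<bar>\<phi> w\<bar> <= B * (1 + aa t p w) ^ k" and k: "k <= 6"
 shows "\<bar>LINT w|hsN. ker t (FX p) w * \<phi> w\<bar> <= C * B"
proof -
 have "\<bar>\<phi> w\<bar> <= B * (1 + aa t p w) ^ 6" for w
 proof (rule order_trans[OF assms(6)])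
  show "B * (1 + aa t p w) ^ k <= B * (1 + aa t p w) ^ 6"
   using aa_nonneg[OF assms(2), of p w] by (intro mult_left_mono power_increasing k assms) auto
 qed
 then show ?thesis using assms(1-4) unfolding mom_def by blast
qed

definition gY :: "(real * 'a => real) => 'a::euclidean_space \<times> real => real" where
 "gY g w = g (FXi (hsY w))"

lemma FX_FXi_hsY: "FX (FXi (hsY w)) = hsY w" by (rule fm.X_Xi[OF hsY_in])

lemma Z_hsY: "fm.Z p (FXi (hsY w)) = ZZ p w" by (simp add: fm.Z_def FX_FXi_hsY ZZ_def)

lemma ZZ_aa: "t > 0 ==> ZZ p w = 1 + t * aa t p w" by (simp add: aa_def)

lemma gY_measurable: "continuous_on UNIV g ==> gY g \<in> borel_measurable borel"
proof -
 assume g: "continuous_on UNIV g"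
 have "continuous_on UNIV (%w. FXi (hsY w))"
 proof (rule continuous_on_compose2[OF _ hsY_continuous])
  show "continuous_on (range hsY) FXi"
   by (intro continuous_at_imp_continuous_on ballI has_derivative_continuous[OF fm.Xi_deriv]) (auto intro: hsY_in)
 qed simp
 then show ?thesis
  unfolding gY_def[abs_def] by (intro borel_measurable_continuous_onI continuous_on_compose2[OF g]) auto
qed

text \<open>From d^2 <= 2 (Z - 1) = 2 t a, so that d^\<alpha> is at most t^(\<alpha>/2) times (2 (1
  + a))^(\<alpha>/2) <= 2 (1 + a).\<close>

lemma gY_holder:
 assumes g: "fm.hb \<alpha> g M" and \<alpha>: "0 < \<alpha>" "\<alpha> <= 1" and t: "0 < t"
 shows "\<bar>gY g w - g p\<bar> <= 2 * M * t powr (\<alpha> / 2) * (1 + aa t p w)"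
proof -
 let ?d = "fm.hdist p (FXi (hsY w))" and ?a = "aa t p w"
 have a: "?a >= 0" by (rule aa_nonneg[OF t])
 have M: "M >= 0" by (rule fm.hb_nonneg[OF g])
 have "?d\<^sup>2 <= 2 * (t * ?a)" using fm.hdist_sq_le[of p "FXi (hsY w)"] by (simp add: Z_hsY ZZ_aa[OF t])
 also have "... <= t * (2 * (1 + ?a))" using t by (simp add: algebra_simps)
 finally have d: "?d\<^sup>2 <= t * (2 * (1 + ?a))" .
 have "?d powr \<alpha> = (?d\<^sup>2) powr (\<alpha> / 2)"
 proof -
  have "?d powr \<alpha> = (?d powr 2) powr (\<alpha> / 2)" unfolding powr_powr by simp
  also have "?d powr 2 = ?d\<^sup>2" using powr_numeral[OF fm.hdist_nonneg, of p "FXi (hsY w)"] by (simp add: numeral_2_eq_2)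
  finally show ?thesis .
 qed
 also have "... <= (t * (2 * (1 + ?a))) powr (\<alpha> / 2)" using d \<alpha> by (intro powr_mono2) auto
 also have "... = t powr (\<alpha> / 2) * (2 * (1 + ?a)) powr (\<alpha> / 2)" using t a by (simp add: powr_mult)
 also have "... <= t powr (\<alpha> / 2) * (2 * (1 + ?a))"
 proof (rule mult_left_mono)
  have "(2 * (1 + ?a)) powr (\<alpha> / 2) <= (2 * (1 + ?a)) powr 1" using a \<alpha> by (intro powr_mono) auto
  then show "(2 * (1 + ?a)) powr (\<alpha> / 2) <= 2 * (1 + ?a)" using a by simp
 qed simp
 finally have "?d powr \<alpha> <= t powr (\<alpha> / 2) * (2 * (1 + ?a))" .
 moreover have "\<bar>gY g w - g p\<bar> <= M * ?d powr \<alpha>"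
  using g unfolding fm.hb_def gY_def fm.hdist_sym[of p] by blast
 ultimately have "\<bar>gY g w - g p\<bar> <= M * (t powr (\<alpha> / 2) * (2 * (1 + ?a)))"
  by (meson M mult_left_mono order_trans)
 then show ?thesis by (simp only: mult_ac)
qed

lemma mm_FX_bound: "0 < t ==> t <= 1 ==> \<bar>mm t (FX p) w\<bar> <= (1 + aa t p w) / t"
proof -
 assume t: "0 < t" "t <= 1"
 have a: "aa t p w >= 0" by (rule aa_nonneg[OF t(1)])
 have "\<bar>mm t (FX p) w\<bar> = ZZ p w / (2 * t)" using ZZ_ge1[of p w] t by (simp add: mm_def ZZ_def)
 also have "... <= (2 * (1 + aa t p w)) / (2 * t)"
  unfolding ZZ_aa[OF t(1), of p w] using t a mult_left_le_one_le[OF a, of t] by (intro divide_right_mono) auto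
 also have "... = (1 + aa t p w) / t" by (rule mult_divide_mult_cancel_left) simp
 finally show ?thesis .
qed

lemma mm_FX'_bound: "0 < t ==> t <= 1 ==> \<bar>mm t (FX' p v) w\<bar> <= fm.nrm p v * (1 + aa t p w) / sqrt t"
proof -
 assume t: "0 < t" "t <= 1"
 let ?a = "aa t p w"
 have a: "?a >= 0" by (rule aa_nonneg[OF t(1)])
 have "\<bar>mink (FX' p v) (hsY w)\<bar> <= fm.nrm p v * sqrt ((ZZ p w)\<^sup>2 - 1)"
  using fm.dderiv_Z_bound[of p v "FXi (hsY w)"] by (simp add: Z_hsY FX_FXi_hsY)
 also have "... <= fm.nrm p v * ((1 + ?a) * sqrt t)"
 proof (intro mult_left_mono real_le_lsqrt)
  have "(ZZ p w)\<^sup>2 - 1 = t * (2 * ?a + t * (?a * ?a))"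
   unfolding ZZ_aa[OF t(1), of p w] by (simp add: power2_eq_square algebra_simps)
  also have "... <= t * (1 + 2 * ?a + ?a * ?a)"
   using t a mult_left_le_one_le[of "?a * ?a" t] by (intro mult_left_mono) auto
  also have "... = ((1 + ?a) * sqrt t)\<^sup>2"
   unfolding power_mult_distrib using t by (simp add: power2_eq_square algebra_simps)
  finally show "(ZZ p w)\<^sup>2 - 1 <= ((1 + ?a) * sqrt t)\<^sup>2" .
 qed (use a t in auto)
 finally have "\<bar>mm t (FX' p v) w\<bar> <= fm.nrm p v * ((1 + ?a) * sqrt t) / (2 * t)"
  using t by (simp add: mm_def divide_right_mono)
 also have "... = fm.nrm p v * (1 + ?a) / (2 * sqrt t)"
 proof -
  have "sqrt t / t = 1 / sqrt t" using real_div_sqrt[of t] t by (simp add: field_simps)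
  then have "fm.nrm p v * (1 + ?a) / 2 * (sqrt t / t) = fm.nrm p v * (1 + ?a) / 2 * (1 / sqrt t)" by (simp only:)
  then show ?thesis by simp
 qed
 also have "... <= fm.nrm p v * (1 + ?a) / sqrt t" using a t by (intro divide_left_mono) auto
 finally show ?thesis .
qed

text \<open>The common size of one tangential derivative of the kernel: t^(-1/2) up to a polynomial
  in \<open>aa\<close>. The radial factor \<open>mm t (FX p)\<close> counts as two such
  derivatives.\<close>

definition xx :: "real => real * 'a::euclidean_space => 'a \<times> real => real" where
 "xx t p w = (1 + aa t p w) * t powr (- 1 / 2)"

lemma xx_bounds:
 assumes t: "0 < t" "t <= 1"
 shows "xx t p w >= 1" "\<bar>mm t (FX p) w\<bar> <= xx t p w * xx t p w" "\<bar>mm t (FX' p v) w\<bar> <= fm.nrm p v * xx t p w"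
  "xx t p w * xx t p w = (1 + aa t p w) ^ 2 * t powr (- 1)"
  "xx t p w * (xx t p w * xx t p w) = (1 + aa t p w) ^ 3 * t powr (- 3 / 2)"
proof -
 let ?a = "aa t p w"
 have a: "?a >= 0" by (rule aa_nonneg[OF t(1)])
 have p: "t powr (- 1 / 2) = 1 / sqrt t" using t powr_minus_divide[of t "1 / 2"] by (simp add: powr_half_sqrt)
 have T2: "t powr (- 1 / 2) * t powr (- 1 / 2) = t powr (- 1)" unfolding powr_add[symmetric] by simp
 have T3: "t powr (- 1 / 2) * t powr (- 1) = t powr (- 3 / 2)" unfolding powr_add[symmetric] by simp
 have p1: "t powr (- 1 / 2) >= 1" using powr_mono'[of "- 1 / 2" 0 t] t by simp
 show x1: "xx t p w >= 1" unfolding xx_def using mult_mono[of 1 "1 + ?a" 1 "t powr (- 1 / 2)"] a p1 by simp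
 show "\<bar>mm t (FX' p v) w\<bar> <= fm.nrm p v * xx t p w"
  using mm_FX'_bound[OF t, of p v w] unfolding xx_def p by simp
 show e2: "xx t p w * xx t p w = (1 + ?a) ^ 2 * t powr (- 1)"
  unfolding T2[symmetric] by (simp only: xx_def power2_eq_square mult_ac)
 show "xx t p w * (xx t p w * xx t p w) = (1 + ?a) ^ 3 * t powr (- 3 / 2)"
  unfolding e2 T3[symmetric] by (simp only: xx_def power2_eq_square power3_eq_cube mult_ac)
 have "\<bar>mm t (FX p) w\<bar> <= (1 + ?a) / t" by (rule mm_FX_bound[OF t])
 also have "... <= (1 + ?a) ^ 2 / t"
  using a t mult_left_mono[of 1 "1 + ?a" "1 + ?a"] by (intro divide_right_mono) (auto simp: power2_eq_square)
 also have "... = xx t p w * xx t p w" unfolding e2 using t by simp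
 finally show "\<bar>mm t (FX p) w\<bar> <= xx t p w * xx t p w" .
qed

locale heat_estimate =
 fixes C t \<alpha> M :: real and g :: "real * 'a::euclidean_space => real"
 assumes mom: "mom TYPE('a) C" and tt: "0 < t" "t <= 1" and \<alpha>: "0 < \<alpha>" "\<alpha> <= 1" and g: "fm.hb \<alpha> g M"
begin

lemma M0: "M >= 0" by (rule fm.hb_nonneg[OF g])
lemma C0: "C > 0" using mom by (simp add: mom_def)
lemma g_le: "\<bar>gY g w\<bar> <= M" using g unfolding fm.hb_def gY_def by blast
lemma gY_meas [measurable]: "gY g \<in> borel_measurable borel"
 by (rule gY_measurable[OF fm.hb_continuous[OF \<alpha>(1) g]])

sublocale heat_data t "gY g" M by standard (use tt g_le in auto)

lemma hk_sup: "\<bar>hk t (gY g) p\<bar> <= C * M"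
 unfolding hk_def by (rule momD[OF mom tt _ M0, where k=0]) (use g_le in auto)

lemma hk_grad: "\<bar>dderiv (hk t (gY g)) p v\<bar> <= C * (M * t powr (- 1 / 2) * fm.nrm p v)"
proof -
 have "dderiv (hk t (gY g)) p v = (LINT w|hsN. ker t (FX p) w * (mm t (FX' p v) w * gY g w))"
  unfolding hk_calculus(2) by (simp add: ti_def[abs_def] mm_simps mult.assoc)
 also have "\<bar>...\<bar> <= C * (M * t powr (- 1 / 2) * fm.nrm p v)"
 proof (rule momD[OF mom tt, where k=1])
  fix w
  have "\<bar>mm t (FX' p v) w * gY g w\<bar> <= (fm.nrm p v * xx t p w) * M"
   unfolding abs_mult using xx_bounds(1,3)[OF tt, where p=p and w=w] g_le M0 by (intro mult_mono) auto
  then show "\<bar>mm t (FX' p v) w * gY g w\<bar> <= M * t powr (- 1 / 2) * fm.nrm p v * (1 + aa t p w) ^ 1"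
   by (simp add: xx_def mult_ac)
 qed (use M0 in auto)
 finally show ?thesis .
qed

lemma gY_diff: "\<bar>gY g w - g p\<bar> <= 2 * M * t powr (\<alpha> / 2) * (1 + aa t p w)"
 by (rule gY_holder[OF g \<alpha> tt(1)])

text \<open>Subtracting g p from the data gains t^(\<alpha>/2) over the plain t^(-1), which makes
  the bound integrable at t = 0.\<close>

lemma hk_hess: "\<bar>hess gfermi (hk t (gY g)) p v v'\<bar> <= C * (4 * M * t powr (\<alpha> / 2 - 1) * fm.nrm p v * fm.nrm p v')"
proof -
 interpret c: heat_data t "%w. gY g w - g p" "M + \<bar>g p\<bar>" by (rule gfermi_heat_shift(1)[OF heat_data_axioms])
 let ?\<phi> = "%w. (mm t (FX' p v) w * mm t (FX' p v') w + gfermi p v v' * mm t (FX p) w) * (gY g w - g p)"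
 let ?n = "fm.nrm p v * fm.nrm p v'"
 have "hess gfermi (hk t (gY g)) p v v' = hess gfermi (hk t (%w. gY g w - g p)) p v v'"
  by (rule gfermi_heat_shift(3)[OF heat_data_axioms])
 also have "... = (LINT w|hsN. ti t 0 0 (%w. gY g w - g p) (FX p, FX' p v, FX' p v') w
    + gfermi p v v' * ti t 0 1 (%w. gY g w - g p) (FX p, FX p, 0) w)"
  unfolding c.hk_calculus(3) by (simp add: c.ti_integrable FX_cone)
 also have "... = (LINT w|hsN. ker t (FX p) w * ?\<phi> w)"
  by (simp add: ti_def mm_simps algebra_simps)
 also have "\<bar>...\<bar> <= C * (4 * M * t powr (\<alpha> / 2 - 1) * ?n)"
 proof (rule momD[OF mom tt, where k=3])
  fix w
  note x = xx_bounds[OF tt, where p=p and w=w]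
  let ?x = "xx t p w"
  have "\<bar>mm t (FX' p v) w * mm t (FX' p v') w\<bar> <= (fm.nrm p v * ?x) * (fm.nrm p v' * ?x)"
   unfolding abs_mult using x(1) by (intro mult_mono x(3)) auto
  moreover have "\<bar>gfermi p v v' * mm t (FX p) w\<bar> <= ?n * (?x * ?x)"
   unfolding abs_mult by (intro mult_mono x(2) fm.G_bound) auto
  ultimately have "\<bar>mm t (FX' p v) w * mm t (FX' p v') w + gfermi p v v' * mm t (FX p) w\<bar> <= 2 * ?n * (?x * ?x)"
   by (simp add: mult_ac)
  then have "\<bar>?\<phi> w\<bar> <= (2 * ?n * (?x * ?x)) * (2 * M * t powr (\<alpha> / 2) * (1 + aa t p w))"
   unfolding abs_mult[of "_ + _"] using gY_diff[of w p] by (intro mult_mono) auto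
  also have "... = 4 * M * (t powr (\<alpha> / 2) * t powr (- 1)) * ?n * (1 + aa t p w) ^ 3"
   unfolding x(4) by (simp add: power2_eq_square power3_eq_cube mult_ac)
  also have "t powr (\<alpha> / 2) * t powr (- 1) = t powr (\<alpha> / 2 - 1)" unfolding powr_add[symmetric] by simp
  finally show "\<bar>?\<phi> w\<bar> <= 4 * M * t powr (\<alpha> / 2 - 1) * ?n * (1 + aa t p w) ^ 3" .
 qed (use M0 in auto)
 finally show ?thesis by (simp only: mult.assoc)
qed

text \<open>The third derivative has size t^(\<alpha>/2 - 3/2), again after subtraction of a
  constant. This beats two separate Hessian bounds when the distance is small against sqrt
  t.\<close>

lemma hk_hess_diff:
 assumes z: "geodesic gfermi z" and V: "parallel_along gfermi z V" and W: "parallel_along gfermi z W"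
  and u: "gfermi (z 0) (V 0) (V 0) = 1" "gfermi (z 0) (W 0) (W 0) = 1"
 shows "\<bar>hess gfermi (hk t (gY g)) (z 1) (V 1) (W 1) - hess gfermi (hk t (gY g)) (z 0) (V 0) (W 0)\<bar>
  <= C * (10 * M * t powr (\<alpha> / 2 - 3 / 2) * fm.speed z)"
proof -
 define y where "y s = FX' (z s) (velocity z s)" for s
 define c where "c = gfermi (z 0) (V 0) (W 0)"
 define a where "a s = gfermi (z s) (velocity z s) (V s)" for s
 define a' where "a' s = gfermi (z s) (velocity z s) (W s)" for s
 define \<phi> where "\<phi> s w = ((mm t (y s) w * (mm t (FX' (z s) (V s)) w * mm t (FX' (z s) (W s)) w)
    + (a s * mm t (FX (z s)) w * mm t (FX' (z s) (W s)) w + mm t (FX' (z s) (V s)) w * (a' s * mm t (FX (z s)) w)))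
    + c * (mm t (y s) w * mm t (FX (z s)) w + mm t (y s) w))" for s w
 let ?h = "%s. hess gfermi (hk t (gY g)) (z s) (V s) (W s)"
 let ?\<sigma> = "fm.speed z"
 show ?thesis
 proof (rule mvt01[of ?h "%s. LINT w|hsN. ker t (FX (z s)) w * \<phi> s w * (gY g w - g (z s))"])
  fix s :: real assume s: "s \<in> {0..1}"
  \<comment> \<open>The subtracted value changes with s. This is allowed because the Hessian is the
    same function for every shift, so the derivative at s may be computed with the shift frozen at
    \<open>z s\<close>.\<close>
  interpret c: heat_data t "%w. gY g w - g (z s)" "M + \<bar>g (z s)\<bar>" by (rule gfermi_heat_shift(1)[OF heat_data_axioms])
  show "(?h has_real_derivative (LINT w|hsN. ker t (FX (z s)) w * \<phi> s w * (gY g w - g (z s)))) (at s within {0..1})"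
   unfolding gfermi_heat_shift(3)[OF heat_data_axioms, where c="g (z s)"]
   unfolding \<phi>_def y_def c_def a_def a'_def by (rule c.hk_hess_curve[OF z V W s])
  have nv: "fm.nrm (z s) (velocity z s) = ?\<sigma>"
   using fm.geodesic_speed[OF z s] fm.speed_nonneg[of z] by (simp add: fm.nrm_def)
  have nV: "fm.nrm (z s) (V s) = 1" "fm.nrm (z s) (W s) = 1"
   using fm.parallel_inner_const[OF geodesic_velocity[OF z] V V s] fm.parallel_inner_const[OF geodesic_velocity[OF z] W W s] u
   by (simp_all add: fm.nrm_def)
  have ab: "\<bar>a s\<bar> <= ?\<sigma>" "\<bar>a' s\<bar> <= ?\<sigma>"
   using fm.G_bound[of "z s" "velocity z s"] nv nV unfolding a_def a'_def by (metis mult.right_neutral)+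
  have cb: "\<bar>c\<bar> <= 1" using fm.G_bound[of "z 0" "V 0" "W 0"] u by (simp add: c_def fm.nrm_def)
  have \<sigma>0: "?\<sigma> >= 0" by (rule fm.speed_nonneg)
  have "\<bar>LINT w|hsN. ker t (FX (z s)) w * (\<phi> s w * (gY g w - g (z s)))\<bar> <= C * (10 * M * t powr (\<alpha> / 2 - 3 / 2) * ?\<sigma>)"
  proof (rule momD[OF mom tt, where k=4])
   fix w
   let ?x = "xx t (z s) w"
   note x = xx_bounds[OF tt, where p="z s" and w=w]
   let ?y = "mm t (y s) w" and ?V = "mm t (FX' (z s) (V s)) w" and ?W = "mm t (FX' (z s) (W s)) w" and ?Y = "mm t (FX (z s)) w"
   have b: "\<bar>?y\<bar> <= ?\<sigma> * ?x" "\<bar>?V\<bar> <= ?x" "\<bar>?W\<bar> <= ?x" "\<bar>?Y\<bar> <= ?x * ?x"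
    using x(3)[of "velocity z s"] x(3)[of "V s"] x(3)[of "W s"] x(2) by (simp_all add: nv nV y_def)
   have x0: "0 <= ?x" using x(1) by linarith
   have t1: "\<bar>?y * (?V * ?W)\<bar> <= (?\<sigma> * ?x) * (?x * ?x)"
    unfolding abs_mult using b x0 \<sigma>0 by (intro mult_mono mult_nonneg_nonneg) auto
   have t2: "\<bar>a s * ?Y * ?W\<bar> <= ?\<sigma> * (?x * ?x) * ?x"
    unfolding abs_mult using b x0 \<sigma>0 ab by (intro mult_mono mult_nonneg_nonneg) auto
   have t3: "\<bar>?V * (a' s * ?Y)\<bar> <= ?x * (?\<sigma> * (?x * ?x))"
    unfolding abs_mult using b x0 \<sigma>0 ab by (intro mult_mono mult_nonneg_nonneg) auto
   have t4: "\<bar>?y * ?Y\<bar> <= (?\<sigma> * ?x) * (?x * ?x)"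
    unfolding abs_mult using b x0 \<sigma>0 by (intro mult_mono mult_nonneg_nonneg) auto
   have t5: "\<bar>?y\<bar> <= (?\<sigma> * ?x) * (?x * ?x)"
    using b(1) mult_left_mono[of 1 "?x * ?x" "?\<sigma> * ?x"] mult_mono[of 1 ?x 1 ?x] x(1) x0 \<sigma>0 by simp
   have t6: "\<bar>c * (?y * ?Y + ?y)\<bar> <= 1 * (2 * ((?\<sigma> * ?x) * (?x * ?x)))"
    unfolding abs_mult[of c] using t4 t5 cb by (intro mult_mono) auto
   have "\<bar>\<phi> s w\<bar> <= 5 * ?\<sigma> * (?x * (?x * ?x))"
   proof -
    have tri: "\<bar>A + (B + D) + E\<bar> <= \<bar>A\<bar> + \<bar>B\<bar> + \<bar>D\<bar> + \<bar>E\<bar>" for A B D E :: real by linarith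
    show ?thesis unfolding \<phi>_def
    proof (rule order_trans[OF tri])
     show "\<bar>?y * (?V * ?W)\<bar> + \<bar>a s * ?Y * ?W\<bar> + \<bar>?V * (a' s * ?Y)\<bar> + \<bar>c * (?y * ?Y + ?y)\<bar> <= 5 * ?\<sigma> * (?x * (?x * ?x))"
      using add_mono[OF add_mono[OF add_mono[OF t1 t2] t3] t6] by (simp add: mult_ac)
    qed
   qed
   then have "\<bar>\<phi> s w * (gY g w - g (z s))\<bar> <= (5 * ?\<sigma> * (?x * (?x * ?x))) * (2 * M * t powr (\<alpha> / 2) * (1 + aa t (z s) w))"
    unfolding abs_mult using gY_diff[of w "z s"] by (intro mult_mono) auto
   also have "... = 10 * M * (t powr (\<alpha> / 2) * t powr (- 3 / 2)) * ?\<sigma> * (1 + aa t (z s) w) ^ 4"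
    unfolding x(5) by (simp add: power3_eq_cube power4_eq_xxxx mult_ac)
   also have "t powr (\<alpha> / 2) * t powr (- 3 / 2) = t powr (\<alpha> / 2 - 3 / 2)" unfolding powr_add[symmetric] by simp
   finally show "\<bar>\<phi> s w * (gY g w - g (z s))\<bar> <= 10 * M * t powr (\<alpha> / 2 - 3 / 2) * ?\<sigma> * (1 + aa t (z s) w) ^ 4" .
  next
   show "(%w. \<phi> s w * (gY g w - g (z s))) \<in> borel_measurable borel" unfolding \<phi>_def by measurable
  qed (use M0 \<sigma>0 in auto)
  then show "\<bar>LINT w|hsN. ker t (FX (z s)) w * \<phi> s w * (gY g w - g (z s))\<bar> <= C * (10 * M * t powr (\<alpha> / 2 - 3 / 2) * ?\<sigma>)"
   by (simp only: mult.assoc)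
 qed
qed

end

section \<open>The heat equation up to a bounded error\<close>

text \<open>The terms of the Laplacian that carry no factor 1/t beside \<open>aa\<close>: a^2/4
  comes from Z^2 - 1 = 2 t a + t^2 a^2, and the linear term from Z = 1 + t a in the trace of the
  metric part.\<close>

definition ek :: "real => ('a \<times> real => real) => real * 'a::euclidean_space => real" where
 "ek t g p = (LINT w|hsN. ker t (FX p) w * (((aa t p w)\<^sup>2 / 4 - (real DIM('a) + 1) / 2 * aa t p w) * g w))"

definition hkt :: "real => ('a \<times> real => real) => real * 'a::euclidean_space => real" where
 "hkt t g p = (LINT w|hsN. ker t (FX p) w * ((aa t p w / 2 - (real DIM('a) + 1) / 2) / t * g w))"

lemma aa_mm: "t > 0 ==> aa t p w = - 2 * (1 / (2 * t) + mm t (FX p) w)"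
 by (simp add: aa_def mm_def ZZ_def field_simps)

lemma quad_bound:
 fixes a N :: real
 assumes a: "a >= 0" and N: "N >= 1"
 shows "\<bar>a\<^sup>2 / 4 - N / 2 * a\<bar> <= 2 * N * (1 + a)\<^sup>2" and "\<bar>a\<^sup>2 / 4 - a - N / 2 * a + N\<bar> <= 3 * N * (1 + a)\<^sup>2"
proof -
 have 1: "a\<^sup>2 <= N * a\<^sup>2" "a <= N * a" "a\<^sup>2 >= 0"
  using mult_right_mono[OF N, of "a\<^sup>2"] mult_right_mono[OF N, of a] a by auto
 have 2: "N * (1 + a)\<^sup>2 = N + 2 * (N * a) + N * a\<^sup>2" by (simp add: power2_sum algebra_simps)
 have 3: "\<bar>z / 4 - x / 2\<bar> <= 2 * (N + 2 * x + y) \<and> \<bar>z / 4 - a - x / 2 + N\<bar> <= 3 * (N + 2 * x + y)"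
  if "z <= y" "a <= x" "z >= 0" for x y z using that a N by (auto simp: abs_le_iff)
 show "\<bar>a\<^sup>2 / 4 - N / 2 * a\<bar> <= 2 * N * (1 + a)\<^sup>2" "\<bar>a\<^sup>2 / 4 - a - N / 2 * a + N\<bar> <= 3 * N * (1 + a)\<^sup>2"
  using 3[OF 1] 2 by (simp_all add: mult.assoc)
qed

context heat_data
begin

lemma ek_eq:
 fixes p :: "real * 'a"
 shows "ek t g p = TI t (1 / (2 * t)) (1 / (2 * t)) g (FX p, FX p, FX p)
   + (real DIM('a) + 1) * TI t (1 / (2 * t)) 1 g (FX p, FX p, 0)"
  and "integrable hsN (%w. ker t (FX p) w * (((aa t p w)\<^sup>2 / 4 - (real DIM('a) + 1) / 2 * aa t p w) * g w))"
proof -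
 let ?n = "real DIM('a) + 1" and ?b = "1 / (2 * t)"
 have eq: "ker t (FX p) w * (((aa t p w)\<^sup>2 / 4 - ?n / 2 * aa t p w) * g w)
  = ti t ?b ?b g (FX p, FX p, FX p) w + ?n * ti t ?b 1 g (FX p, FX p, 0) w" for w
 proof -
  define q where "q = ?b + mm t (FX p) w"
  have "(- 2 * q)\<^sup>2 / 4 - ?n / 2 * (- 2 * q) = q * q + ?n * (q * 1)" by (simp add: power2_eq_square)
  then show ?thesis unfolding aa_mm[OF t] ti_def q_def[symmetric] fst_conv snd_conv
   by (simp add: mm_simps q_def[symmetric] algebra_simps)
 qed
 have i: "integrable hsN (ti t ?b ?b g (FX p, FX p, FX p))" "integrable hsN (ti t ?b 1 g (FX p, FX p, 0))"
  by (rule ti_integrable; simp add: FX_cone)+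
 show "ek t g p = TI t ?b ?b g (FX p, FX p, FX p) + ?n * TI t ?b 1 g (FX p, FX p, 0)"
  unfolding ek_def eq using i by simp
 show "integrable hsN (%w. ker t (FX p) w * (((aa t p w)\<^sup>2 / 4 - ?n / 2 * aa t p w) * g w))"
  unfolding eq using i by simp
qed

lemma ek_has_derivative:
 fixes p :: "real * 'a"
 shows "(ek t g has_derivative (%v. LINT w|hsN. ker t (FX p) w * (mm t (FX' p v) w * ((aa t p w)\<^sup>2 / 4 - aa t p w
   - (real DIM('a) + 1) / 2 * aa t p w + (real DIM('a) + 1)) * g w))) (at p)"
proof -
 let ?n = "real DIM('a) + 1" and ?b = "1 / (2 * t)"
 have "((%p. (FX p, FX p, FX p)) has_derivative (%h. (FX' p h, FX' p h, FX' p h))) (at p)"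
  by (intro has_derivative_Pair fm.X_deriv)
 from TI_compose[OF this, of ?b ?b]
 have D1: "((%p. TI t ?b ?b g (FX p, FX p, FX p)) has_derivative
   (%h. LINT w|hsN. di t ?b ?b g (FX p, FX p, FX p) w (FX' p h, FX' p h, FX' p h))) (at p)" by (simp add: FX_cone)
 have "((%p. (FX p, FX p, 0)) has_derivative (%h. (FX' p h, FX' p h, 0))) (at p)"
  by (intro has_derivative_Pair fm.X_deriv has_derivative_const)
 from TI_compose[OF this, of ?b 1]
 have D2: "((%p. TI t ?b 1 g (FX p, FX p, 0)) has_derivative
   (%h. LINT w|hsN. di t ?b 1 g (FX p, FX p, 0) w (FX' p h, FX' p h, 0))) (at p)" by (simp add: FX_cone)
 have eq: "di t ?b ?b g (FX p, FX p, FX p) w (FX' p h, FX' p h, FX' p h) + ?n * di t ?b 1 g (FX p, FX p, 0) w (FX' p h, FX' p h, 0)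
   = ker t (FX p) w * (mm t (FX' p h) w * ((aa t p w)\<^sup>2 / 4 - aa t p w - ?n / 2 * aa t p w + ?n) * g w)" for h w
 proof -
  define q where "q = ?b + mm t (FX p) w"
  have "(- 2 * q)\<^sup>2 / 4 - (- 2 * q) - ?n / 2 * (- 2 * q) + ?n = q * q + 2 * q + ?n * q + ?n" by (simp add: power2_eq_square)
  then show ?thesis unfolding aa_mm[OF t] di_def q_def[symmetric] fst_conv snd_conv
   by (simp add: mm_simps q_def[symmetric] algebra_simps)
 qed
 have i: "integrable hsN (%w. di t ?b ?b g (FX p, FX p, FX p) w (FX' p h, FX' p h, FX' p h))"
  "integrable hsN (%w. di t ?b 1 g (FX p, FX p, 0) w (FX' p h, FX' p h, 0))" for h
  by (rule di_integrable(2)[OF t g_meas g_bound]; simp add: FX_cone)+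
 have "(ek t g has_derivative (%h. (LINT w|hsN. di t ?b ?b g (FX p, FX p, FX p) w (FX' p h, FX' p h, FX' p h))
   + ?n * (LINT w|hsN. di t ?b 1 g (FX p, FX p, 0) w (FX' p h, FX' p h, 0)))) (at p)"
  unfolding ek_eq(1)[abs_def] by (rule has_derivative_add[OF D1 has_derivative_mult_right[OF D2]])
 moreover have "(LINT w|hsN. di t ?b ?b g (FX p, FX p, FX p) w (FX' p h, FX' p h, FX' p h))
   + ?n * (LINT w|hsN. di t ?b 1 g (FX p, FX p, 0) w (FX' p h, FX' p h, 0))
   = (LINT w|hsN. ker t (FX p) w * (mm t (FX' p h) w * ((aa t p w)\<^sup>2 / 4 - aa t p w - ?n / 2 * aa t p w + ?n) * g w))" for h
  unfolding eq[symmetric] using i[of h] by simp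
 ultimately show ?thesis by (simp only:)
qed

text \<open>The Gaussian \<open>t\<^bsup>-n/2\<^esup> exp (- (Z - 1) / (2 t))\<close> in the Minkowski product \<open>Z\<close> solves the heat equation up to
 a bounded multiple of itself, so it can serve as a parametrix.\<close>

lemma laplace_hk: "laplace gfermi (hk t g) p = hkt t g p + ek t g p"
proof -
 let ?n = "real DIM('a) + 1" and ?b = "1 / (2 * t)"
 let ?E = "fm.frame p"
 have E: "fm.orthonormal p ?E" by (rule fm.orthonormal_frame)
 have i: "integrable hsN (ti t 0 0 g (FX p, FX' p (?E b), FX' p (?E b)))" "integrable hsN (ti t 0 1 g (FX p, FX p, 0))"
  "integrable hsN (ti t (?b + ?n / 2) 1 g (FX p, FX p, 0))" for b
  by (rule ti_integrable; simp add: FX_cone)+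
 have 1: "(\<Sum>b\<in>Basis. ti t 0 0 g (FX p, FX' p (?E b), FX' p (?E b)) w) + ?n * ti t 0 1 g (FX p, FX p, 0) w
   = - (1 / t) * ti t (?b + ?n / 2) 1 g (FX p, FX p, 0) w
    + ker t (FX p) w * (((aa t p w)\<^sup>2 / 4 - ?n / 2 * aa t p w) * g w)" for w
 proof -
  \<comment> \<open>Parseval in the tangent space; the tangential part of \<open>hsY w\<close> at
    the point has square length Z^2 - 1.\<close>
  have s: "(\<Sum>b\<in>Basis. mm t (FX' p (?E b)) w * mm t (FX' p (?E b)) w) = ((ZZ p w)\<^sup>2 - 1) / (4 * t\<^sup>2)"
  proof -
   have "(\<Sum>b\<in>Basis. mm t (FX' p (?E b)) w * mm t (FX' p (?E b)) w)
     = (\<Sum>b\<in>Basis. mink (FX' p (?E b)) (hsY w) * mink (FX' p (?E b)) (hsY w)) / (4 * t\<^sup>2)"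
    unfolding sum_divide_distrib by (simp add: mm_def power2_eq_square)
   also have "... = ((ZZ p w)\<^sup>2 - 1) / (4 * t\<^sup>2)"
    unfolding fm.sum_mink_frame[OF E] using hsY_in[of w] by (simp add: hyperboloid_def ZZ_def power2_eq_square)
   finally show ?thesis .
  qed
  have m: "mm t (FX p) w = - (ZZ p w) / (2 * t)" by (simp add: mm_def ZZ_def)
  have "(\<Sum>b\<in>Basis. ti t 0 0 g (FX p, FX' p (?E b), FX' p (?E b)) w)
    = ker t (FX p) w * (\<Sum>b\<in>Basis. mm t (FX' p (?E b)) w * mm t (FX' p (?E b)) w) * g w"
   unfolding sum_distrib_left sum_distrib_right by (simp add: ti_def)
  moreover have "((ZZ p w)\<^sup>2 - 1) / (4 * t\<^sup>2) + ?n * mm t (FX p) w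
    = - (1 / t) * (?b + ?n / 2 + mm t (FX p) w) + ((aa t p w)\<^sup>2 / 4 - ?n / 2 * aa t p w)"
   unfolding m ZZ_aa[OF t, of p w] using t by (simp add: field_simps power2_eq_square)
  then have "ker t (FX p) w * (((ZZ p w)\<^sup>2 - 1) / (4 * t\<^sup>2) + ?n * mm t (FX p) w) * g w
    = ker t (FX p) w * (- (1 / t) * (?b + ?n / 2 + mm t (FX p) w) + ((aa t p w)\<^sup>2 / 4 - ?n / 2 * aa t p w)) * g w"
   by (simp only:)
  ultimately show ?thesis unfolding s by (simp add: ti_def mm_simps algebra_simps)
 qed
 have 2: "- (1 / t) * ti t (?b + ?n / 2) 1 g (FX p, FX p, 0) w
   = ker t (FX p) w * ((aa t p w / 2 - ?n / 2) / t * g w)" for w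
 proof -
  define q where "q = ?b + mm t (FX p) w"
  have "(- 2 * q / 2 - ?n / 2) / t = - (1 / t) * (q + ?n / 2)" using t by (simp add: field_simps)
  moreover have "?b + ?n / 2 + mm t (FX p) w = q + ?n / 2" by (simp add: q_def)
  ultimately show ?thesis unfolding aa_mm[OF t] q_def[symmetric] ti_def fst_conv snd_conv by (simp add: mm_simps)
 qed
 have "laplace gfermi (hk t g) p = (\<Sum>b\<in>Basis. TI t 0 0 g (FX p, FX' p (?E b), FX' p (?E b)) + TI t 0 1 g (FX p, FX p, 0))"
  unfolding fm.laplace_eq[OF hk_calculus(1) E] hk_calculus(3) using E by (simp add: fm.orthonormal_def)
 also have "... = (\<Sum>b\<in>Basis. TI t 0 0 g (FX p, FX' p (?E b), FX' p (?E b))) + ?n * TI t 0 1 g (FX p, FX p, 0)"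
  by (simp add: sum.distrib)
 also have "... = (LINT w|hsN. (\<Sum>b\<in>Basis. ti t 0 0 g (FX p, FX' p (?E b), FX' p (?E b)) w) + ?n * ti t 0 1 g (FX p, FX p, 0) w)"
  using i by (simp add: Bochner_Integration.integral_sum)
 also have "... = (LINT w|hsN. - (1 / t) * ti t (?b + ?n / 2) 1 g (FX p, FX p, 0) w) + ek t g p"
  unfolding 1 ek_def by (rule Bochner_Integration.integral_add) (use i ek_eq(2) in auto)
 also have "... = hkt t g p + ek t g p" unfolding 2 hkt_def ..
 finally show ?thesis .
qed

text \<open>Differentiation under the integral for times in (t/2, 3t/2). There the kernel is at most
  its prefactor at t/2 times exp (-(Z - 1) / (3 t)), and half of this exponent pays for the factor
  produced by differentiation.\<close>

lemma hk_has_time_derivative: "((%t. hk t g p) has_real_derivative hkt t g p) (at t)"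
proof -
 let ?n = "real DIM('a) + 1"
 have nc: "nc TYPE('a) s = exp (- (?n / 2) * ln (4 * pi * s))" if "s > 0" for s
 proof -
  have x: "4 * pi * s > 0" using that by simp
  then have "sqrt (4 * pi * s) = exp (ln (4 * pi * s) / 2)" by (simp add: ln_sqrt[symmetric])
  then have "sqrt (4 * pi * s) ^ (DIM('a) + 1) = exp (real (DIM('a) + 1) * (ln (4 * pi * s) / 2))" by (simp only: exp_of_nat_mult)
  then show ?thesis unfolding nc_def by (simp add: exp_minus inverse_eq_divide)
 qed
 define D where "D s w = ker s (FX p) w * ((aa s p w / 2 - ?n / 2) / s) * g w" for s w
 define N where "N = exp (- (?n / 2) * ln (4 * pi * (t / 2)))"
 define B where "B w = N * (12 + ?n) / t * M * exp (- ((ZZ p w - 1) / (2 * (sqrt (3 * t))\<^sup>2)))" for w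
 have M0: "M >= 0" using g_bound[of undefined] by linarith
 have "((%s. LINT w|hsN. ker s (FX p) w * g w) has_derivative (%h. LINT w|hsN. h * D t w)) (at t)"
 proof (rule has_derivative_integral_dominated[where r="t / 2" and B=B and f'="%s w h. h * D s w"])
  show "t / 2 > 0" using t by simp
  show "integrable hsN B" unfolding B_def using t by (intro integrable_mult_right integrable_ker_exp) simp
  show "(%w. h * D t w) \<in> borel_measurable hsN" for h unfolding D_def aa_def by measurable
  fix s assume "s \<in> ball t (t / 2)"
  then have s: "s > 0" "t / 2 < s" "s < 3 * t / 2" by (auto simp: dist_real_def abs_if split: if_splits)
  interpret s: heat_data s g M by standard (use s g_bound in auto)
  show "integrable hsN (%w. ker s (FX p) w * g w)"
   using s.ti_integrable[of "(FX p, 0, 0)" 1 1] FX_cone[of p] by (simp add: ti_def[abs_def] mm_simps)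
  fix w
  let ?z = "ZZ p w - 1"
  have z: "?z >= 0" using ZZ_ge1[of p w] by simp
  have ker: "ker s (FX p) w = exp (- (?n / 2) * ln (4 * pi * s) - ?z / (2 * s))" if "s > 0" for s
   unfolding ker_FX nc[OF that] exp_add[symmetric] by (rule arg_cong[where f=exp]) simp
  have "((%s. exp (- (?n / 2) * ln (4 * pi * s) - ?z / (2 * s)) * g w) has_real_derivative
    exp (- (?n / 2) * ln (4 * pi * s) - ?z / (2 * s)) * (- (?n / 2) * (1 / s) + ?z / (2 * s\<^sup>2)) * g w) (at s)"
   using s by (auto intro!: derivative_eq_intros simp: power2_eq_square field_simps)
  also have "exp (- (?n / 2) * ln (4 * pi * s) - ?z / (2 * s)) * (- (?n / 2) * (1 / s) + ?z / (2 * s\<^sup>2)) * g w = D s w"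
   unfolding D_def ker[OF s(1)] aa_def using s by (simp add: field_simps power2_eq_square)
  finally have "((%s. exp (- (?n / 2) * ln (4 * pi * s) - ?z / (2 * s)) * g w) has_derivative (%h. h * D s w)) (at s)"
   by (simp add: has_field_derivative_def mult.commute[of "D s w"] mult_commute_abs)
  then show "((%s. ker s (FX p) w * g w) has_derivative (%h. h * D s w)) (at s)"
   by (rule has_derivative_transform_within_open[of _ _ _ _ "{0<..}"]) (use s in "auto simp: ker")
  have k: "ker s (FX p) w <= N * exp (- (?z / (3 * t)))"
  proof -
   have "ln (4 * pi * (t / 2)) <= ln (4 * pi * s)" using s t by simp
   then have "?n / 2 * ln (4 * pi * (t / 2)) <= ?n / 2 * ln (4 * pi * s)" by (rule mult_left_mono) simp
   moreover have "?z / (3 * t) <= ?z / (2 * s)" using z s t by (intro divide_left_mono) auto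
   ultimately show ?thesis unfolding ker[OF s(1)] N_def exp_add[symmetric] exp_le_cancel_iff by linarith
  qed
  have d: "\<bar>(aa s p w / 2 - ?n / 2) / s\<bar> <= (2 * (?z / t) + ?n) / t"
  proof -
   have tri: "\<bar>x - m / 2\<bar> <= y + m / 2" if "x <= y" "0 <= x" "0 <= m" for x y m :: real using that by linarith
   have "aa s p w / 2 <= ?z / t"
    unfolding aa_def using z s t by (simp add: frac_le)
   then have "\<bar>aa s p w / 2 - ?n / 2\<bar> <= ?z / t + ?n / 2" 
    using aa_nonneg[OF s(1), of p w] by (intro tri) auto
   then have "\<bar>(aa s p w / 2 - ?n / 2) / s\<bar> <= (?z / t + ?n / 2) / (t / 2)"
    unfolding abs_divide using s t z by (intro frac_le) auto
   also have "... = (2 * (?z / t) + ?n) / t" using t by (simp add: field_simps)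
   finally show ?thesis .
  qed
  have e: "exp (- (?z / (3 * t))) * (2 * (?z / t) + ?n) <= (12 + ?n) * exp (- (?z / (6 * t)))"
  proof -
   let ?X = "?z / (6 * t)"
   have X0: "?X >= 0" using z t by simp
   have "?X <= exp ?X" "1 <= exp ?X" using exp_ge_add_one_self[of ?X] X0 by linarith+
   then have "12 * ?X + ?n <= 12 * exp ?X + ?n * exp ?X" 
    by (intro add_mono mult_left_mono order_trans[OF eq_refl[OF mult_1_right[symmetric]] mult_left_mono]) auto
   then have "exp (- (2 * ?X)) * (12 * ?X + ?n) <= exp (- (2 * ?X)) * ((12 + ?n) * exp ?X)"
    by (intro mult_left_mono) (auto simp: algebra_simps)
   also have "... = (12 + ?n) * (exp (- (2 * ?X)) * exp ?X)" by (simp only: mult_ac)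
   also have "exp (- (2 * ?X)) * exp ?X = exp (- ?X)" unfolding exp_add[symmetric] by simp
   finally have "exp (- (2 * ?X)) * (12 * ?X + ?n) <= (12 + ?n) * exp (- ?X)" .
   moreover have "?z / (3 * t) = 2 * ?X" "2 * (?z / t) = 12 * ?X" using t by (simp_all add: field_simps)
   ultimately show ?thesis by (simp only:)
  qed
  fix h :: real
  have "\<bar>D s w\<bar> = ker s (FX p) w * \<bar>(aa s p w / 2 - ?n / 2) / s\<bar> * \<bar>g w\<bar>"
   unfolding D_def abs_mult abs_of_nonneg[OF ker_nonneg[OF s(1)]] ..
  also have "... <= (N * exp (- (?z / (3 * t)))) * ((2 * (?z / t) + ?n) / t) * M"
   by (rule mult_mono[OF mult_mono[OF k d]]) (use g_bound ker_nonneg[OF s(1)] t z in "auto simp: N_def")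
  also have "... = N / t * M * (exp (- (?z / (3 * t))) * (2 * (?z / t) + ?n))" by simp
  also have "... <= N / t * M * ((12 + ?n) * exp (- (?z / (6 * t))))"
   using M0 t by (intro mult_left_mono e) (auto simp: N_def)
  also have "... = B w" using t by (simp add: B_def)
  finally show "\<bar>h * D s w\<bar> <= B w * norm h"
   unfolding abs_mult real_norm_def mult.commute[of "\<bar>h\<bar>"] by (rule mult_right_mono) simp
 qed
 then have "((%s. hk s g p) has_derivative (%h. h * hkt t g p)) (at t)"
  by (simp add: hk_def D_def hkt_def mult.assoc)
 then show ?thesis by (simp add: has_field_derivative_def mult_commute_abs)
qed

end

context heat_estimate
begin

text \<open>No negative power of t appears, in contrast to the bound for the Hessian: the error is
  of lower order.\<close>

lemma ek_sup: "\<bar>ek t (gY g) p\<bar> <= C * (2 * (real DIM('a) + 1) * M)"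
 unfolding ek_def
proof (rule momD[OF mom tt, where k=2])
 let ?n = "real DIM('a) + 1"
 fix w
 let ?a = "aa t p w"
 have a: "?a >= 0" by (rule aa_nonneg[OF tt(1)])
 have "\<bar>?a\<^sup>2 / 4 - ?n / 2 * ?a\<bar> <= 2 * ?n * (1 + ?a)\<^sup>2" by (rule quad_bound[OF a]) simp
 then have "\<bar>(?a\<^sup>2 / 4 - ?n / 2 * ?a) * gY g w\<bar> <= (2 * ?n * (1 + ?a)\<^sup>2) * M"
  unfolding abs_mult[of _ "gY g w"] using g_le[of w] by (intro mult_mono) auto
 then show "\<bar>(?a\<^sup>2 / 4 - ?n / 2 * ?a) * gY g w\<bar> <= 2 * ?n * M * (1 + ?a) ^ 2" by (simp add: mult_ac)
next
 show "(%w. ((aa t p w)\<^sup>2 / 4 - (real DIM('a) + 1) / 2 * aa t p w) * gY g w) \<in> borel_measurable borel"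
  unfolding aa_def by measurable
qed (use M0 in auto)

lemma ek_grad: "ek t (gY g) differentiable (at p)"
 "\<bar>dderiv (ek t (gY g)) p v\<bar> <= C * (3 * (real DIM('a) + 1) * M * t powr (- 1 / 2)) * fm.nrm p v"
proof -
 let ?n = "real DIM('a) + 1"
 note d = ek_has_derivative[of p]
 show "ek t (gY g) differentiable (at p)" using d differentiable_def by blast
 have "\<bar>LINT w|hsN. ker t (FX p) w * (mm t (FX' p v) w * ((aa t p w)\<^sup>2 / 4 - aa t p w - ?n / 2 * aa t p w + ?n) * gY g w)\<bar>
   <= C * (3 * ?n * M * t powr (- 1 / 2) * fm.nrm p v)"
 proof (rule momD[OF mom tt, where k=3])
  fix w
  let ?a = "aa t p w"
  have a: "?a >= 0" by (rule aa_nonneg[OF tt(1)])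
   have b: "\<bar>?a\<^sup>2 / 4 - ?a - ?n / 2 * ?a + ?n\<bar> <= 3 * ?n * (1 + ?a)\<^sup>2" by (rule quad_bound[OF a]) simp
  have "\<bar>mm t (FX' p v) w * (?a\<^sup>2 / 4 - ?a - ?n / 2 * ?a + ?n) * gY g w\<bar> <= (fm.nrm p v * xx t p w) * (3 * ?n * (1 + ?a)\<^sup>2) * M"
   unfolding abs_mult using xx_bounds(1)[OF tt, of p w] a
   by (intro mult_mono xx_bounds(3)[OF tt] b g_le mult_nonneg_nonneg) auto
  then show "\<bar>mm t (FX' p v) w * (?a\<^sup>2 / 4 - ?a - ?n / 2 * ?a + ?n) * gY g w\<bar> <= 3 * ?n * M * t powr (- 1 / 2) * fm.nrm p v * (1 + ?a) ^ 3"
   by (simp add: xx_def power2_eq_square power3_eq_cube mult_ac)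
 next
  show "(%w. mm t (FX' p v) w * ((aa t p w)\<^sup>2 / 4 - aa t p w - ?n / 2 * aa t p w + ?n) * gY g w) \<in> borel_measurable borel"
   unfolding aa_def by measurable
 qed (use M0 in auto)
 then show "\<bar>dderiv (ek t (gY g)) p v\<bar> <= C * (3 * ?n * M * t powr (- 1 / 2)) * fm.nrm p v"
  unfolding frechet_derivative_at[OF d, symmetric] by (simp only: mult.assoc)
qed

lemma hk_mass_diff: "\<bar>hk t (gY g) p - g p * (LINT w|hsN. ker t (FX p) w)\<bar> <= C * (2 * M * t powr (\<alpha> / 2))"
proof -
 interpret o: heat_data t "%w::'a \<times> real. 1" 1 by standard (use tt in auto)
 have i: "integrable hsN (%w. ker t (FX p) w * gY g w)" "integrable hsN (%w. ker t (FX p) w)"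
  using ti_integrable[of "(FX p, 0, 0)" 1 1] o.ti_integrable[of "(FX p, 0, 0)" 1 1] FX_cone[of p]
  by (simp_all add: ti_def[abs_def] mm_simps)
 have "hk t (gY g) p - g p * (LINT w|hsN. ker t (FX p) w) = (LINT w|hsN. ker t (FX p) w * gY g w - g p * ker t (FX p) w)"
  using i by (simp add: hk_def)
 also have "... = (LINT w|hsN. ker t (FX p) w * (gY g w - g p))" by (simp add: algebra_simps)
 also have "\<bar>...\<bar> <= C * (2 * M * t powr (\<alpha> / 2))"
  by (rule momD[OF mom tt, where k=1]) (use gY_diff M0 in auto)
 finally show ?thesis .
qed

end

text \<open>By the Hoelder bound the data differ from their value at p by a contribution of order
  t^(\<alpha>/2), and the mass tends to 1.\<close>

lemma hk_initial:
 fixes g :: "real * 'a::euclidean_space => real"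
 assumes \<alpha>: "0 < \<alpha>" "\<alpha> <= 1" and g: "fm.hb \<alpha> g M"
 shows "((%t. hk t (gY g) p) ---> g p) (at_right 0)"
proof -
 obtain C where C: "mom TYPE('a) C" using mom_exists by blast
 let ?m = "%t. g p * (LINT w|hsN. ker t (FX p) w)"
 have "eventually (%t::real. 0 < t \<and> t <= 1) (at_right 0)"
  by (rule eventually_at_rightI[of _ 1]) auto
 then have ev: "eventually (%t. norm (hk t (gY g) p - ?m t) <= C * (2 * M * t powr (\<alpha> / 2))) (at_right 0)"
 proof eventually_elim
  case (elim t)
  interpret heat_estimate C t \<alpha> M g by standard (use C \<alpha> g elim in auto)
  show ?case using hk_mass_diff[of p] by simp
 qed
 have "((%t. C * (2 * M * t powr (\<alpha> / 2))) ---> C * (2 * M * 0)) (at_right 0)"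
  by (intro tendsto_mult tendsto_const tendsto_zero_powrI[where b="\<alpha> / 2"])
    (use \<alpha> in "auto simp: eventually_at_right_less intro!: tendsto_eq_intros eventually_at_rightI[of 0 1]")
 then have "((%t. C * (2 * M * t powr (\<alpha> / 2))) ---> 0) (at_right 0)" by simp
 from Lim_null_comparison[OF ev this] have "((%t. hk t (gY g) p - ?m t) ---> 0) (at_right 0)" .
 from tendsto_add[OF this tendsto_mult[OF tendsto_const[of "g p"] mass_tendsto[of p]]] show ?thesis by simp
qed

section \<open>Integrals of C^2 families over a parameter\<close>

text \<open>A fixed sequence of steps exhibits derivatives as limits of sequences, from which their
  measurability in a parameter follows.\<close>

lemma difference_quotient_LIMSEQ:
 fixes f :: "'b::euclidean_space => real"
 assumes "(f has_derivative f') (at p)"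
 shows "(%n. (f (p + inverse (real (Suc n)) *R v) - f p) / inverse (real (Suc n))) -----> f' v"
proof -
 have "((%s. p + s *R v) has_derivative (%s. s *R v)) (at (0::real))" by (auto intro!: derivative_eq_intros)
 from has_derivative_compose[OF this, of f f'] assms
 have "((%s. f (p + s *R v)) has_derivative (%s. f' (s *R v))) (at 0)" by simp
 moreover have "(%s. f' (s *R v)) = times (f' v)"
  using has_derivative_linear[OF assms] by (simp add: linear_cmul fun_eq_iff)
 ultimately have "((%s. f (p + s *R v)) has_real_derivative f' v) (at 0)" by (simp add: has_field_derivative_def)
 then have "((%h. (f (p + h *R v) - f p) / h) ---> f' v) (at 0)" by (simp add: DERIV_def)
 from this[unfolded tendsto_at_iff_sequentially comp_def, rule_format, OF _ LIMSEQ_inverse_real_of_nat]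
 show ?thesis by simp
qed

lemma nrm_le_cosh: "fm.nrm p v <= cosh (fst p) * norm v"
proof -
 have g: "gfermi p v v = fst v * fst v + (cosh (fst p))\<^sup>2 * ghyp (snd p) (snd v) (snd v)"
  by (cases p; cases v) (simp add: gfermi_def)
 have h: "ghyp (snd p) (snd v) (snd v) <= snd v \<bullet> snd v"
  using inner_ge_zero[of "snd p"] by (simp add: ghyp_def add_nonneg_nonneg)
 have c: "(cosh (fst p))\<^sup>2 >= 1" using cosh_real_ge_1[of "fst p"] by (simp add: one_le_power)
 have "gfermi p v v <= (cosh (fst p))\<^sup>2 * (fst v * fst v) + (cosh (fst p))\<^sup>2 * (snd v \<bullet> snd v)"
  unfolding g using mult_right_mono[OF c, of "fst v * fst v"] h by (intro add_mono mult_left_mono) auto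
 also have "... = (cosh (fst p) * norm v)\<^sup>2"
  by (simp add: power_mult_distrib power2_norm_eq_inner inner_prod_def distrib_left)
 finally have "sqrt (gfermi p v v) <= sqrt ((cosh (fst p) * norm v)\<^sup>2)" by (rule real_sqrt_le_mono)
 also have "... = cosh (fst p) * norm v" using cosh_real_ge_1[of "fst p"] by simp
 finally show ?thesis by (simp add: fm.nrm_def)
qed

text \<open>\<open>has_derivative_integral_dominated\<close> works with the Euclidean norm of the
  chart, the kernel estimates with the Riemannian norm; this links them near a point.\<close>

lemma nrm_local_bound:
 fixes p0 :: "real * 'a::euclidean_space"
 obtains c where "c > 0" "!!p v. p \<in> ball p0 1 ==> fm.nrm p v <= c * norm v"
proof (rule that[of "cosh (\<bar>fst p0\<bar> + 1)"])
 fix p v :: "real * 'a" assume "p \<in> ball p0 1"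
 then have "\<bar>fst p0 - fst p\<bar> < 1" using dist_fst_le[of p0 p] by (simp add: dist_real_def)
 then have "cosh (fst p) <= cosh (\<bar>fst p0\<bar> + 1)"
  unfolding cosh_real_abs[of "fst p", symmetric] by (subst cosh_real_nonneg_le_iff) auto
 then show "fm.nrm p v <= cosh (\<bar>fst p0\<bar> + 1) * norm v"
  using nrm_le_cosh[of p v] mult_right_mono[of "cosh (fst p)" _ "norm v"] by fastforce
qed simp

lemma nrm_christoffel_local_bound:
 fixes p0 :: "real * 'a::euclidean_space"
 obtains c where "c > 0" "!!p. p \<in> ball p0 1 ==> fm.nrm p (christoffel gfermi p v w) <= c"
proof -
 have "fm.nrm p (christoffel gfermi p v w)
   = sqrt (mink (FX'' p v w - gfermi p v w *R FX p) (FX'' p v w - gfermi p v w *R FX p))" for p :: "real * 'a"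
  by (simp only: fm.nrm_def fm.G_eq fm.X'_christoffel)
 moreover have "continuous_on UNIV (%p. sqrt (mink (FX'' p v w - gfermi p v w *R FX p) (FX'' p v w - gfermi p v w *R FX p)))"
  unfolding fm.G_eq by (intro continuous_intros mink.continuous_on fm.continuous_on_X fm.continuous_on_X' fm.X''_cont)
 ultimately have "continuous_on (cball p0 1) (%p. fm.nrm p (christoffel gfermi p v w))"
  by (auto intro: continuous_on_subset)
 then have "compact ((%p. fm.nrm p (christoffel gfermi p v w)) ` cball p0 1)" by (intro compact_continuous_image) auto
 then obtain c where "c > 0" "!!x. x \<in> (%p. fm.nrm p (christoffel gfermi p v w)) ` cball p0 1 ==> norm x <= c"
  using compact_imp_bounded bounded_pos by metis
 note c = this
 show thesis
 proof (rule that[OF c(1)])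
  fix p :: "real * 'a" assume "p \<in> ball p0 1"
  then have "p \<in> cball p0 1" by simp
  from c(2)[OF imageI[OF this]] show "fm.nrm p (christoffel gfermi p v w) <= c" by simp
 qed
qed

text \<open>The C^2 bounds are Riemannian and dominated by one integrable function of the parameter.
  Integral and covariant derivatives then commute.\<close>

locale Ck2_family =
 fixes S :: "'s measure" and u :: "'s => real * 'a::euclidean_space => real" and A :: "'s => real"
 assumes u: "!!t. t \<in> space S ==> Ck 2 (u t)"
  and u_meas: "!!p. (%t. u t p) \<in> borel_measurable S"
  and A: "integrable S A"
  and sup: "!!t p. t \<in> space S ==> \<bar>u t p\<bar> <= A t"
  and grad: "!!t p v. t \<in> space S ==> \<bar>dderiv (u t) p v\<bar> <= A t * fm.nrm p v"
  and hess: "!!t p v w. t \<in> space S ==> \<bar>hess gfermi (u t) p v w\<bar> <= A t * fm.nrm p v * fm.nrm p w"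
begin

abbreviation "U \<equiv> %p. LINT t|S. u t p"

lemma dderiv_meas: "(%t. dderiv (u t) p v) \<in> borel_measurable S"
proof (rule borel_measurable_LIMSEQ_real)
 show "(%n. (u t (p + inverse (real (Suc n)) *R v) - u t p) / inverse (real (Suc n))) -----> dderiv (u t) p v"
  if "t \<in> space S" for t
  by (rule difference_quotient_LIMSEQ[OF Ck2D(1)[OF u[OF that]]])
 show "(%t. (u t (p + inverse (real (Suc n)) *R v) - u t p) / inverse (real (Suc n))) \<in> borel_measurable S" for n
  by (intro borel_measurable_divide borel_measurable_diff u_meas) simp
qed

lemma dd_meas: "(%t. dd2 (u t) v p w) \<in> borel_measurable S"
proof (rule borel_measurable_LIMSEQ_real)
 show "(%n. (dderiv (u t) (p + inverse (real (Suc n)) *R w) v - dderiv (u t) p v) / inverse (real (Suc n)))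
   -----> dd2 (u t) v p w" if "t \<in> space S" for t
  by (rule difference_quotient_LIMSEQ[where f="%p. dderiv (u t) p v", OF Ck2D(2)[OF u[OF that]]])
 show "(%t. (dderiv (u t) (p + inverse (real (Suc n)) *R w) v - dderiv (u t) p v) / inverse (real (Suc n))) \<in> borel_measurable S" for n
  by (intro borel_measurable_divide borel_measurable_diff dderiv_meas) simp
qed

lemma u_int: "integrable S (%t. u t p)"
 by (rule Bochner_Integration.integrable_bound[OF A u_meas]) (use sup[of _ p] in "auto intro!: AE_I2 order_trans[OF _ abs_ge_self]")

lemma dderiv_int: "integrable S (%t. dderiv (u t) p v)"
 by (rule Bochner_Integration.integrable_bound[OF integrable_mult_left[OF A, of "fm.nrm p v"] dderiv_meas])
   (use grad[of _ p v] in "auto intro!: AE_I2 order_trans[OF _ abs_ge_self]")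

lemma hess_int: "integrable S (%t. hess gfermi (u t) p v w)"
proof (rule Bochner_Integration.integrable_bound[OF integrable_mult_left[OF A, of "fm.nrm p v * fm.nrm p w"]])
 show "(%t. hess gfermi (u t) p v w) \<in> borel_measurable S"
  unfolding hess_eq by (intro borel_measurable_diff dd_meas dderiv_meas)
qed (use hess[of _ p v w] in "auto simp: mult.assoc[symmetric] intro!: AE_I2 order_trans[OF _ abs_ge_self]")

text \<open>The coordinate second derivative is the Hessian plus the derivative along a Christoffel
  vector. Both are at most \<open>A t\<close> times constants uniform near \<open>p0\<close>, as
  dominated differentiation requires.\<close>

lemma dd_bound:
 obtains c where "c > 0" "!!p t w. p \<in> ball p0 1 ==> t \<in> space S ==> \<bar>dd2 (u t) v p w\<bar> <= A t * c * norm w"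
proof -
 obtain c where c: "c > 0" "!!p v. p \<in> ball p0 1 ==> fm.nrm p v <= c * norm v"
  by (rule nrm_local_bound[of p0]) (rule that)
 have "\<exists>c>0. \<forall>p\<in>ball p0 1. fm.nrm p (christoffel gfermi p b v) <= c" for b
  by (rule nrm_christoffel_local_bound[of p0 b v]) blast
 then obtain d where d: "!!b. d b > 0" "!!b p. p \<in> ball p0 1 ==> fm.nrm p (christoffel gfermi p b v) <= d b" by metis
 let ?e = "c * (c * norm v) + (\<Sum>b\<in>Basis. d b) + 1"
 show thesis
 proof (rule that[of ?e])
  show "?e > 0" using c(1) d(1) by (intro add_nonneg_pos add_nonneg_nonneg sum_nonneg) (auto intro: less_imp_le)
  fix p w t assume p: "p \<in> ball p0 1" and t: "t \<in> space S"
  have A0: "A t >= 0" using sup[OF t, of p] by linarith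
  have lin: "linear (dderiv (u t) p)" using Ck2D(1)[OF u[OF t]] has_derivative_linear by blast
  have linc: "linear (%w. christoffel gfermi p w v)"
   unfolding fm.christoffel_sym[of p _ v] by (rule fm.christoffel_linear2)
  have "christoffel gfermi p w v = christoffel gfermi p (\<Sum>b\<in>Basis. (w \<bullet> b) *R b) v" by (simp add: euclidean_representation)
  also have "... = (\<Sum>b\<in>Basis. (w \<bullet> b) *R christoffel gfermi p b v)"
   by (simp add: linear_sum[OF linc] linear_cmul[OF linc])
  finally have "dderiv (u t) p (christoffel gfermi p w v) = (\<Sum>b\<in>Basis. (w \<bullet> b) * dderiv (u t) p (christoffel gfermi p b v))"
   by (simp add: linear_sum[OF lin] linear_cmul[OF lin])
  also have "\<bar>...\<bar> <= (\<Sum>b\<in>Basis. norm w * (A t * d b))"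
  proof (rule order_trans[OF sum_abs], rule sum_mono)
   fix b :: "real * 'a" assume b: "b \<in> Basis"
   have "\<bar>dderiv (u t) p (christoffel gfermi p b v)\<bar> <= A t * d b"
    by (rule order_trans[OF grad[OF t] mult_left_mono[OF d(2)[OF p] A0]])
   then show "\<bar>(w \<bullet> b) * dderiv (u t) p (christoffel gfermi p b v)\<bar> <= norm w * (A t * d b)"
    unfolding abs_mult using Basis_le_norm[OF b, of w] by (intro mult_mono) auto
  qed
  also have "... = A t * (\<Sum>b\<in>Basis. d b) * norm w" by (simp add: sum_distrib_left mult_ac)
  finally have 1: "\<bar>dderiv (u t) p (christoffel gfermi p w v)\<bar> <= A t * (\<Sum>b\<in>Basis. d b) * norm w" .
  have "\<bar>hess gfermi (u t) p w v\<bar> <= A t * fm.nrm p w * fm.nrm p v" by (rule hess[OF t])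
  also have "... <= A t * (c * norm w) * (c * norm v)"
   using c(2)[OF p] A0 c(1) by (intro mult_mono mult_left_mono) auto
  finally have 2: "\<bar>hess gfermi (u t) p w v\<bar> <= A t * (c * (c * norm v)) * norm w" by (simp add: mult_ac)
  have "dd2 (u t) v p w = hess gfermi (u t) p w v + dderiv (u t) p (christoffel gfermi p w v)"
   unfolding hess_eq by simp
  moreover have "A t * ?e * norm w = A t * (c * (c * norm v)) * norm w + A t * (\<Sum>b\<in>Basis. d b) * norm w + A t * norm w"
   by (simp add: algebra_simps)
  moreover have "A t * norm w >= 0" using A0 by simp
  ultimately show "\<bar>dd2 (u t) v p w\<bar> <= A t * ?e * norm w" using 1 2 by linarith
 qed
qed

lemma dd_int: "integrable S (%t. dd2 (u t) v p w)"
proof -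
 have "(%t. dd2 (u t) v p w) = (%t. hess gfermi (u t) p w v + dderiv (u t) p (christoffel gfermi p w v))"
  unfolding hess_eq by simp
 then show ?thesis using hess_int dderiv_int by simp
qed

lemma U_calculus:
 shows "Ck 2 U" and "dderiv U p v = (LINT t|S. dderiv (u t) p v)"
  and "hess gfermi U p v w = (LINT t|S. hess gfermi (u t) p v w)"
proof -
 let ?u' = "%p v. LINT t|S. dderiv (u t) p v" and ?u'' = "%p v w. LINT t|S. dd2 (u t) v p w"
 have 1: "(U has_derivative ?u' p) (at p)" for p
 proof -
  obtain c where c: "c > 0" "!!q v. q \<in> ball p 1 ==> fm.nrm q v <= c * norm v"
   by (rule nrm_local_bound[of p]) (rule that)
  show ?thesis
  proof (rule has_derivative_integral_dominated[of 1 p S _ _ "%t. A t * c"])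
   show "\<bar>dderiv (u t) q h\<bar> <= A t * c * norm h" if "q \<in> ball p 1" "t \<in> space S" for q t h
    using grad[OF that(2), of q h] c(2)[OF that(1), of h] sup[OF that(2), of q]
    by (intro order_trans[OF grad[OF that(2)]]) (simp add: mult.assoc mult_left_mono)
  qed (use u_int A dderiv_meas Ck2D(1)[OF u] in auto)
 qed
 have 2: "((%p. ?u' p v) has_derivative ?u'' p v) (at p)" for p v
 proof -
  obtain c where c: "c > 0" "!!q t w. q \<in> ball p 1 ==> t \<in> space S ==> \<bar>dd2 (u t) v q w\<bar> <= A t * c * norm w"
   by (rule dd_bound[of p v]) (rule that)
  show ?thesis
   by (rule has_derivative_integral_dominated[of 1 p S _ _ "%t. A t * c"])
    (use c dderiv_int A dd_meas Ck2D(2)[OF u] in auto)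
 qed
 have 3: "continuous_on UNIV (%p. ?u'' p v w)" for v w
  unfolding continuous_on_sequentially comp_def
 proof (intro allI ballI impI)
  fix P :: "nat => real * 'a" and p assume "(\<forall>n. P n \<in> UNIV) \<and> P -----> p"
  then have P: "P -----> p" by simp
  obtain c where c: "c > 0" "!!q t w. q \<in> ball p 1 ==> t \<in> space S ==> \<bar>dd2 (u t) v q w\<bar> <= A t * c * norm w"
   by (rule dd_bound[of p v]) (rule that)
  obtain N where N: "!!i. i >= N ==> P i \<in> ball p 1"
   using tendstoD[OF P, of 1] by (auto simp: eventually_sequentially dist_commute)
  have "(%i. ?u'' (P (i + N)) v w) -----> ?u'' p v w"
  proof (rule integral_dominated_convergence[where w="%t. A t * c * norm w"])
   show "AE t in S. (%i. dd2 (u t) v (P (i + N)) w) -----> dd2 (u t) v p w"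
   proof (rule AE_I2)
    fix t assume t: "t \<in> space S"
    have "(%i. dd2 (u t) v (P i) w) -----> dd2 (u t) v p w"
     by (rule continuous_on_tendsto_compose[OF Ck2D(3)[OF u[OF t]] P]) auto
    then show "(%i. dd2 (u t) v (P (i + N)) w) -----> dd2 (u t) v p w"
     by (rule LIMSEQ_ignore_initial_segment)
   qed
   show "AE t in S. norm (dd2 (u t) v (P (i + N)) w) <= A t * c * norm w" for i
    by (rule AE_I2) (use c(2)[OF N[OF le_add2]] in simp)
  qed (use A dd_meas in auto)
  then show "(%i. ?u'' (P i) v w) -----> ?u'' p v w" by (rule LIMSEQ_offset)
 qed
 note C = Ck2I[of U ?u' ?u'', OF 1 2 3]
 show "Ck 2 U" by (rule C(1))
 show d: "dderiv U p v = ?u' p v" for p v by (rule C(2))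
 show "hess gfermi U p v w = (LINT t|S. hess gfermi (u t) p v w)"
  unfolding hess_eq unfolding C(3) unfolding d using dd_int dderiv_int by simp
qed

end

section \<open>Time integrals over the unit interval\<close>

text \<open>Open at 0, where the kernel is singular. Time stops at 1 because the moment bounds hold
  for t <= 1; the cut leaves a boundary term with the factor exp (-K).\<close>

definition I1 :: "real measure" where "I1 = restrict_space lborel {0<..<1}"

lemma space_I1 [simp]: "space I1 = {0<..<1}" by (simp add: I1_def space_restrict_space)

lemma measurable_I1:
 fixes f :: "real => real"
 assumes "continuous_on {0<..<1} f"
 shows "f \<in> borel_measurable I1"
proof -
 have "sets I1 = sets (restrict_space borel {0<..<1})" unfolding I1_def by (rule sets_restrict_space_cong) simp
 then show ?thesis using borel_measurable_continuous_on_restrict[OF assms] by (simp cong: measurable_cong_sets)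
qed

lemma I1_has_integral:
 fixes f :: "real => real"
 assumes "f \<in> borel_measurable I1" "!!t. 0 < t ==> t < 1 ==> 0 <= f t" "(f has_integral x) {0..1}"
 shows "has_bochner_integral I1 f x"
proof (rule has_bochner_integral_nn_integral[OF assms(1)])
 have x: "(f has_integral x) {0<..<1}" using assms(3) by (simp add: has_integral_Icc_iff_Ioo)
 show "0 <= x" by (rule has_integral_nonneg[OF x]) (use assms(2) in auto)
 have "(\<integral>\<^sup>+t. ennreal (f t) \<partial>I1) = (\<integral>\<^sup>+t. ennreal (f t) * indicator {0<..<1} t \<partial>lborel)"
  unfolding I1_def by (rule nn_integral_restrict_space) simp
 also have "... = (\<integral>\<^sup>+t. ennreal (indicator {0<..<1} t * f t) \<partial>lborel)"
  by (rule nn_integral_cong) (auto simp: indicator_def)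
 also have "... = ennreal x" by (rule nn_integral_has_integral_lebesgue[OF _ x]) (use assms(2) in auto)
 finally show "(\<integral>\<^sup>+t. ennreal (f t) \<partial>I1) = ennreal x" .
qed (use assms(2) in "auto intro!: AE_I2")

lemma I1_integral_unique:
 fixes f :: "real => real"
 assumes "integrable I1 f" "(f has_integral x) {0..1}"
 shows "(LINT t|I1. f t) = x"
proof -
 have i: "integrable lborel (%t. indicator {0<..<1} t *R f t)"
  using integrable_restrict_space[of "{0<..<1}" lborel f] assms(1) by (simp add: I1_def)
 have "((%t. indicator {0<..<1} t *R f t) has_integral (LINT t|lborel. indicator {0<..<1} t *R f t)) UNIV"
  by (rule has_integral_integral_lborel[OF i])
 also have "(LINT t|lborel. indicator {0<..<1} t *R f t) = (LINT t|I1. f t)"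
  unfolding I1_def by (rule integral_restrict_space[symmetric]) simp
 also have "(%t. indicator {0<..<1} t *R f t) = (%t. if t \<in> {0<..<1} then f t else 0)" by auto
 finally have "(f has_integral (LINT t|I1. f t)) {0<..<1}" by (simp only: has_integral_restrict_UNIV)
 moreover have "(f has_integral x) {0<..<1}" using assms(2) by (simp add: has_integral_Icc_iff_Ioo)
 ultimately show ?thesis by (rule has_integral_unique)
qed

lemma I1_powr:
 assumes "\<alpha> > 0"
 shows "integrable I1 (%t. t powr (\<alpha> / 2 - 1))" "(LINT t|I1. t powr (\<alpha> / 2 - 1)) = 2 / \<alpha>"
proof -
 have "((%t. t powr (\<alpha> / 2 - 1)) has_integral 2 / \<alpha>) {0..1::real}"
  using has_integral_powr_from_0[of "\<alpha> / 2 - 1" 1] assms by simp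
 then have "has_bochner_integral I1 (%t. t powr (\<alpha> / 2 - 1)) (2 / \<alpha>)"
  by (intro I1_has_integral measurable_I1 continuous_intros) auto
 then show "integrable I1 (%t. t powr (\<alpha> / 2 - 1))" "(LINT t|I1. t powr (\<alpha> / 2 - 1)) = 2 / \<alpha>"
  by (simp_all add: has_bochner_integral_iff)
qed

text \<open>Splitting at \<open>t = d\<^sup>2\<close> is what gives the sharp Hoelder exponent.\<close>

lemma I1_split:
 fixes d \<alpha> :: real
 assumes d: "0 < d" "d < 1" and \<alpha>: "0 < \<alpha>" "\<alpha> < 1"
 defines "f \<equiv> %t. if t <= d\<^sup>2 then t powr (\<alpha> / 2 - 1) else d * t powr (\<alpha> / 2 - 3 / 2)"
 shows "integrable I1 f" and "(LINT t|I1. f t) <= (2 / \<alpha> + 2 / (1 - \<alpha>)) * d powr \<alpha>"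
proof -
 have d2: "0 < d\<^sup>2" "d\<^sup>2 < 1" using d by (auto simp: power_less_one_iff abs_square_less_1)
 have p: "(d\<^sup>2) powr e = d powr (2 * e)" for e
 proof -
  have "d\<^sup>2 = d powr 2" using d by simp
  then show ?thesis by (simp only: powr_powr)
 qed
 have 1: "(f has_integral 2 / \<alpha> * d powr \<alpha>) {0..d\<^sup>2}"
 proof (rule has_integral_eq)
  show "((%t. t powr (\<alpha> / 2 - 1)) has_integral 2 / \<alpha> * d powr \<alpha>) {0..d\<^sup>2}"
   using has_integral_powr_from_0[of "\<alpha> / 2 - 1" "d\<^sup>2"] \<alpha> p[of "\<alpha> / 2"] by (simp add: mult.commute)
 qed (simp add: f_def)
 define F where "F t = d * (t powr (\<alpha> / 2 - 1 / 2) / (\<alpha> / 2 - 1 / 2))" for t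
 have "((%t. d * t powr (\<alpha> / 2 - 3 / 2)) has_integral F 1 - F (d\<^sup>2)) {d\<^sup>2..1}"
 proof (rule fundamental_theorem_of_calculus)
  fix t assume "t \<in> {d\<^sup>2..1}"
  then have "t > 0" using d2(1) by (simp add: less_le_trans[OF d2(1)])
  then have "(F has_real_derivative d * t powr (\<alpha> / 2 - 3 / 2)) (at t)"
  proof -
   have e: "\<alpha> / 2 - 1 / 2 ~= 0" "\<alpha> / 2 - 1 / 2 - 1 = \<alpha> / 2 - 3 / 2" using \<alpha> by auto
   have "(F has_real_derivative d * ((\<alpha> / 2 - 1 / 2) * t powr (\<alpha> / 2 - 1 / 2 - 1) / (\<alpha> / 2 - 1 / 2))) (at t)"
    unfolding F_def by (intro DERIV_cmult DERIV_cdivide has_real_derivative_powr \<open>t > 0\<close>)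
   then show ?thesis unfolding e(2) nonzero_mult_div_cancel_left[OF e(1)] .
  qed
  then show "(F has_vector_derivative d * t powr (\<alpha> / 2 - 3 / 2)) (at t within {d\<^sup>2..1})"
   by (simp add: has_real_derivative_iff_has_vector_derivative has_vector_derivative_at_within)
 qed (use d2 in auto)
 then have 2: "(f has_integral F 1 - F (d\<^sup>2)) {d\<^sup>2..1}"
  by (rule has_integral_spike_finite[rotated 2, where S="{d\<^sup>2}"]) (auto simp: f_def)
 have "(f has_integral 2 / \<alpha> * d powr \<alpha> + (F 1 - F (d\<^sup>2))) {0..1}"
  by (rule has_integral_combine[OF _ _ 1 2]) (use d2 in auto)
 moreover have "f \<in> borel_measurable I1"
  unfolding I1_def by (rule measurable_restrict_space1) (simp add: f_def)
 ultimately have B: "has_bochner_integral I1 f (2 / \<alpha> * d powr \<alpha> + (F 1 - F (d\<^sup>2)))"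
  by (intro I1_has_integral) (use d in "auto simp: f_def")
 then show "integrable I1 f" by (simp add: has_bochner_integral_iff)
 have "F 1 - F (d\<^sup>2) <= 2 / (1 - \<alpha>) * d powr \<alpha>"
 proof -
  have F: "F t = - (2 / (1 - \<alpha>)) * (d * t powr (\<alpha> / 2 - 1 / 2))" for t
   unfolding F_def using \<alpha> by (simp add: field_simps)
  have "2 * (\<alpha> / 2 - 1 / 2) = \<alpha> - 1" by simp
  then have "F (d\<^sup>2) = - (2 / (1 - \<alpha>)) * (d powr 1 * d powr (\<alpha> - 1))" unfolding F p using d by simp
  also have "d powr 1 * d powr (\<alpha> - 1) = d powr \<alpha>" unfolding powr_add[symmetric] by simp
  finally have "F (d\<^sup>2) = - (2 / (1 - \<alpha>)) * d powr \<alpha>" .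
  moreover have "F 1 <= 0" unfolding F using \<alpha> d by (simp add: divide_nonneg_pos)
  ultimately show ?thesis by simp
 qed
 then show "(LINT t|I1. f t) <= (2 / \<alpha> + 2 / (1 - \<alpha>)) * d powr \<alpha>"
  using B by (simp add: has_bochner_integral_iff distrib_right)
qed

text \<open>Up to constants, the size of the sup norm, gradient and Hessian of the parametrix. It
  tends to 0 as K grows (\<open>JJ_tendsto\<close>), which makes the residual small.\<close>

definition JJ :: "real => real => real" where
 "JJ \<alpha> K = (LINT t|I1. exp (- (K * t)) * t powr (\<alpha> / 2 - 1))"

lemma JJ_integrable:
 assumes "\<alpha> > 0" "K >= 0"
 shows "integrable I1 (%t. exp (- (K * t)) * t powr (\<alpha> / 2 - 1))"
proof (rule Bochner_Integration.integrable_bound[OF I1_powr(1)[OF assms(1)]])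
 show "(%t. exp (- (K * t)) * t powr (\<alpha> / 2 - 1)) \<in> borel_measurable I1"
  by (intro measurable_I1 continuous_intros) auto
qed (use assms in "auto intro!: AE_I2 mult_left_le_one_le")

text \<open>The lower bound lets \<open>JJ\<close> also absorb the boundary term exp (-K) at time
  1.\<close>

lemma JJ_bounds:
 assumes "\<alpha> > 0" "\<alpha> <= 1" "K >= 0"
 shows "0 <= JJ \<alpha> K" "JJ \<alpha> K <= 2 / \<alpha>" "exp (- K) <= JJ \<alpha> K"
proof -
 show "0 <= JJ \<alpha> K" unfolding JJ_def by (intro integral_nonneg_AE AE_I2) auto
 show "JJ \<alpha> K <= 2 / \<alpha>"
  unfolding JJ_def I1_powr(2)[OF assms(1), symmetric]
  by (intro Bochner_Integration.integral_mono JJ_integrable I1_powr assms) (use assms in "auto intro!: mult_left_le_one_le")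
 have "exp (- K) * 1 <= exp (- K) * (2 / \<alpha>)" using assms by (intro mult_left_mono) (auto simp: field_simps)
 also have "... = (LINT t|I1. exp (- K) * t powr (\<alpha> / 2 - 1))" by (simp add: I1_powr[OF assms(1)])
 also have "... <= JJ \<alpha> K"
  unfolding JJ_def
 proof (intro Bochner_Integration.integral_mono JJ_integrable assms integrable_mult_right I1_powr)
  fix t :: real assume "t \<in> space I1"
  then have "K * t <= K * 1" using assms by (intro mult_left_mono) auto
  then show "exp (- K) * t powr (\<alpha> / 2 - 1) <= exp (- (K * t)) * t powr (\<alpha> / 2 - 1)" by (intro mult_right_mono) auto
 qed
 finally show "exp (- K) <= JJ \<alpha> K" by simp
qed

lemma JJ_tendsto:
 assumes "\<alpha> > 0"
 shows "(%n. JJ \<alpha> (real n)) -----> 0"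
proof -
 have "(%n. LINT t|I1. exp (- (real n * t)) * t powr (\<alpha> / 2 - 1)) -----> (LINT t|I1. 0)"
 proof (rule integral_dominated_convergence[where w="%t. t powr (\<alpha> / 2 - 1)"])
  show "AE t in I1. (%n. exp (- (real n * t)) * t powr (\<alpha> / 2 - 1)) -----> 0"
  proof (rule AE_I2)
   fix t :: real assume t: "t \<in> space I1"
   have "(%n. exp (- t) ^ n * t powr (\<alpha> / 2 - 1)) -----> 0 * t powr (\<alpha> / 2 - 1)"
    by (intro tendsto_mult tendsto_const LIMSEQ_power_zero) (use t in auto)
   then show "(%n. exp (- (real n * t)) * t powr (\<alpha> / 2 - 1)) -----> 0"
    by (simp add: exp_of_nat_mult[symmetric])
  qed
  show "(%t. exp (- (real n * t)) * t powr (\<alpha> / 2 - 1)) \<in> borel_measurable I1" for n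
   using JJ_integrable[OF assms, of "real n"] by auto
 qed (use I1_powr[OF assms] in "auto intro!: AE_I2 mult_left_le_one_le")
 then show ?thesis by (simp add: JJ_def)
qed

section \<open>The parametrix of the resolvent\<close>

locale parametrix =
 fixes C K \<alpha> M :: real and g :: "real * 'a::euclidean_space => real"
 assumes mom: "mom TYPE('a) C" and K: "K >= 0" and \<alpha>: "0 < \<alpha>" "\<alpha> < 1" and g: "fm.hb \<alpha> g M"
begin

lemma heat: "0 < t ==> t <= 1 ==> heat_estimate C t \<alpha> M g"
 by (rule heat_estimate.intro[OF mom _ _ _ _ g]) (use \<alpha> in auto)

lemma M0: "M >= 0" by (rule fm.hb_nonneg[OF g])
lemma C0: "C > 0" using mom by (simp add: mom_def)

lemma data: "t > 0 ==> heat_data t (gY g) M"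
 by (rule heat_data.intro[OF _ gY_measurable[OF fm.hb_continuous[OF \<alpha>(1) g]]])
   (use g in "unfold fm.hb_def gY_def, blast+")

text \<open>The resolvent is the Laplace transform of the heat flow. In \<open>Q\<close> the
  Gaussian evolution takes the place of the heat flow and time stops at 1.\<close>

definition v :: "real => real * 'a => real" where "v t p = exp (- (K * t)) * hk t (gY g) p"
definition A :: "real => real" where "A t = 4 * C * M * (exp (- (K * t)) * t powr (\<alpha> / 2 - 1))"
definition Q :: "real * 'a => real" where "Q p = (LINT t|I1. v t p)"

lemma hk_continuous: "continuous_on {0<..} (%t. hk t (gY g) p)"
 by (intro continuous_at_imp_continuous_on ballI DERIV_isCont[OF heat_data.hk_has_time_derivative[OF data]]) auto

lemma powr_le: "0 < t ==> t <= 1 ==> 1 <= t powr (\<alpha> / 2 - 1)" "0 < t ==> t <= 1 ==> t powr (- 1 / 2) <= t powr (\<alpha> / 2 - 1)"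
 using powr_mono'[of "\<alpha> / 2 - 1" 0 t] powr_mono'[of "\<alpha> / 2 - 1" "- 1 / 2" t] \<alpha> by auto

lemma v_calculus:
 assumes t: "0 < t" "t <= 1"
 shows "Ck 2 (v t)" "\<bar>v t p\<bar> <= A t" "\<bar>dderiv (v t) p x\<bar> <= A t * fm.nrm p x"
  "\<bar>hess gfermi (v t) p x y\<bar> <= A t * fm.nrm p x * fm.nrm p y"
  "hess gfermi (v t) p x y = exp (- (K * t)) * hess gfermi (hk t (gY g)) p x y"
  "laplace gfermi (v t) p = exp (- (K * t)) * hkt t (gY g) p + exp (- (K * t)) * ek t (gY g) p"
proof -
 interpret heat_estimate C t \<alpha> M g by (rule heat[OF t])
 note ck = hk_calculus(1)
 have v: "v t = (%p. exp (- (K * t)) * hk t (gY g) p)" by (simp add: v_def fun_eq_iff)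
 have CM: "C * M >= 0" using C0 M0 by simp
 show "Ck 2 (v t)" unfolding v by (rule Ck2_cmult(1)[OF ck])
 have "\<bar>v t p\<bar> <= exp (- (K * t)) * (C * M)" unfolding v abs_mult using hk_sup[of p] by simp
 also have "... <= exp (- (K * t)) * (C * M * 4 * t powr (\<alpha> / 2 - 1))"
 proof (rule mult_left_mono)
  have "C * M * 1 <= C * M * (4 * t powr (\<alpha> / 2 - 1))" using powr_le(1)[OF tt] by (intro mult_left_mono CM) linarith
  then show "C * M <= C * M * 4 * t powr (\<alpha> / 2 - 1)" by (simp only: mult.assoc mult_1_right)
 qed simp
 finally show "\<bar>v t p\<bar> <= A t" by (simp add: A_def mult_ac)
 have "\<bar>dderiv (v t) p x\<bar> <= exp (- (K * t)) * (C * (M * t powr (- 1 / 2) * fm.nrm p x))"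
  unfolding v Ck2_cmult(2)[OF ck] abs_mult using hk_grad[of p x] by simp
 also have "... <= exp (- (K * t)) * (C * (M * (4 * t powr (\<alpha> / 2 - 1)) * fm.nrm p x))"
  using powr_le[OF tt] C0 M0 by (intro mult_left_mono mult_right_mono) auto
 finally show "\<bar>dderiv (v t) p x\<bar> <= A t * fm.nrm p x" by (simp add: A_def mult_ac)
 show h: "hess gfermi (v t) p x y = exp (- (K * t)) * hess gfermi (hk t (gY g)) p x y"
  unfolding v by (rule fm.hess_cmult[OF ck])
 have "\<bar>hess gfermi (v t) p x y\<bar> <= exp (- (K * t)) * (C * (4 * M * t powr (\<alpha> / 2 - 1) * fm.nrm p x * fm.nrm p y))"
  unfolding h abs_mult using hk_hess[of p x y] by simp
 then show "\<bar>hess gfermi (v t) p x y\<bar> <= A t * fm.nrm p x * fm.nrm p y" by (simp add: A_def mult_ac)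
 show "laplace gfermi (v t) p = exp (- (K * t)) * hkt t (gY g) p + exp (- (K * t)) * ek t (gY g) p"
  unfolding v fm.laplace_cmult[OF ck] laplace_hk by (simp add: distrib_left)
qed

sublocale fam: Ck2_family I1 v A
proof
 show "(%t. v t p) \<in> borel_measurable I1" for p
  unfolding v_def by (intro measurable_I1 continuous_intros continuous_on_subset[OF hk_continuous]) auto
 show "integrable I1 A" unfolding A_def using JJ_integrable[OF \<alpha>(1) K] by simp
qed (use v_calculus in auto)

lemma A_int: "(LINT t|I1. A t) = 4 * C * M * JJ \<alpha> K" by (simp add: A_def JJ_def)

lemma Q_eq: "Q = fam.U" by (simp add: Q_def fun_eq_iff)

lemma Q_bounds:
 shows "Ck 2 Q" "\<bar>Q p\<bar> <= 4 * C * M * JJ \<alpha> K" "fm.grad_bound Q (4 * C * M * JJ \<alpha> K)" "fm.hess_bound Q (4 * C * M * JJ \<alpha> K)"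
proof -
 have le: "\<bar>LINT t|I1. f t\<bar> <= 4 * C * M * JJ \<alpha> K * c"
  if f: "integrable I1 f" and b: "!!t. 0 < t ==> t < 1 ==> \<bar>f t\<bar> <= A t * c" for f c
 proof -
  have "\<bar>LINT t|I1. f t\<bar> <= (LINT t|I1. \<bar>f t\<bar>)" using integral_norm_bound[of I1 f] by simp
  also have "... <= (LINT t|I1. A t * c)" using f b fam.A by (intro Bochner_Integration.integral_mono) auto
  finally show ?thesis by (simp add: A_int)
 qed
 show ck: "Ck 2 Q" unfolding Q_eq by (rule fam.U_calculus(1))
 show "\<bar>Q p\<bar> <= 4 * C * M * JJ \<alpha> K"
  using le[OF fam.u_int, where c=1] v_calculus(2)[of _ p] unfolding Q_def by auto
 show "fm.grad_bound Q (4 * C * M * JJ \<alpha> K)"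
 proof (rule fm.grad_boundI[OF fm.Ck2_differentiable[OF ck]])
  show "\<bar>dderiv Q p x\<bar> <= 4 * C * M * JJ \<alpha> K * fm.nrm p x" for p x
   unfolding Q_eq fam.U_calculus(2) by (rule le[OF fam.dderiv_int]) (use v_calculus(3) in auto)
 qed
 show "fm.hess_bound Q (4 * C * M * JJ \<alpha> K)"
  unfolding fm.hess_bound_def
 proof (intro allI)
  fix p x y
  have "\<bar>hess gfermi Q p x y\<bar> <= 4 * C * M * JJ \<alpha> K * (fm.nrm p x * fm.nrm p y)"
   unfolding Q_eq fam.U_calculus(3) by (rule le[OF fam.hess_int]) (use v_calculus(4)[of _ p x y] in "auto simp: mult.assoc")
  then show "\<bar>hess gfermi Q p x y\<bar> <= 4 * C * M * JJ \<alpha> K * fm.nrm p x * fm.nrm p y" by (simp add: mult.assoc)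
 qed
qed

end

context parametrix
begin

text \<open>For t <= d^2 the two Hessians are bounded separately, for later times the derivative
  along the geodesic is used; \<open>I1_split\<close> integrates both bounds to a multiple of
  d^\<alpha>.\<close>

lemma Q_hess_diff:
 assumes c: "geodesic gfermi c" "c 0 ~= c 1" "fm.hdist (c 0) (c 1) < 1"
  and V: "parallel_along gfermi c V" and W: "parallel_along gfermi c W"
  and u: "gfermi (c 0) (V 0) (V 0) = 1" "gfermi (c 0) (W 0) (W 0) = 1"
 shows "\<bar>hess gfermi Q (c 1) (V 1) (W 1) - hess gfermi Q (c 0) (V 0) (W 0)\<bar>
  <= 10 * C * M * (2 / \<alpha> + 2 / (1 - \<alpha>)) * fm.hdist (c 0) (c 1) powr \<alpha>"
proof -
 let ?d = "fm.hdist (c 0) (c 1)"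
 let ?f = "%t. if t <= ?d\<^sup>2 then t powr (\<alpha> / 2 - 1) else ?d * t powr (\<alpha> / 2 - 3 / 2)"
 let ?h = "%t. hess gfermi (v t) (c 1) (V 1) (W 1) - hess gfermi (v t) (c 0) (V 0) (W 0)"
 have sd: "fm.speed c = ?d" using fm.geodesic_hdist[OF c(1,2), of 1] by simp
 have d0: "?d > 0" using fm.geodesic_speed_pos[OF c(1,2)] sd by simp
 have CM: "C * M >= 0" using C0 M0 by simp
 have n1: "fm.nrm (c s) (V s) = 1" "fm.nrm (c s) (W s) = 1" if "s \<in> {0..1}" for s
  using fm.parallel_inner_const[OF geodesic_velocity[OF c(1)] V V that]
   fm.parallel_inner_const[OF geodesic_velocity[OF c(1)] W W that] u by (simp_all add: fm.nrm_def)
 note n = n1[of 0, simplified] n1[of 1, simplified]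
 note sp = I1_split[OF d0 c(3) \<alpha>]
 have b: "\<bar>?h t\<bar> <= 10 * C * M * ?f t" if t: "0 < t" "t < 1" for t
 proof -
  have t1: "t <= 1" using t by simp
  interpret heat_estimate C t \<alpha> M g by (rule heat[OF t(1) t1])
  let ?k = "%s. hess gfermi (hk t (gY g)) (c s) (V s) (W s)"
  have e: "exp (- (K * t)) <= 1" using K t by simp
  have "\<bar>?h t\<bar> = exp (- (K * t)) * \<bar>?k 1 - ?k 0\<bar>"
   unfolding v_calculus(5)[OF t(1) t1] right_diff_distrib[symmetric] by (simp add: abs_mult)
  also have "... <= \<bar>?k 1 - ?k 0\<bar>" using e by (intro mult_left_le_one_le) auto
  finally have 1: "\<bar>?h t\<bar> <= \<bar>?k 1 - ?k 0\<bar>" .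
  have 2: "\<bar>?k 1 - ?k 0\<bar> <= C * (10 * M * t powr (\<alpha> / 2 - 3 / 2) * ?d)"
   using hk_hess_diff[OF c(1) V W u] unfolding sd .
  have "\<bar>?k 1\<bar> <= C * (4 * M * t powr (\<alpha> / 2 - 1))" "\<bar>?k 0\<bar> <= C * (4 * M * t powr (\<alpha> / 2 - 1))"
   using hk_hess[of "c 1" "V 1" "W 1"] hk_hess[of "c 0" "V 0" "W 0"] by (simp_all add: n)
  then have "\<bar>?k 1 - ?k 0\<bar> <= 8 * (C * M * t powr (\<alpha> / 2 - 1))" by (simp add: mult_ac)
  also have "... <= 10 * (C * M * t powr (\<alpha> / 2 - 1))" using CM by (intro mult_right_mono) auto
  finally have 3: "\<bar>?k 1 - ?k 0\<bar> <= 10 * (C * M * t powr (\<alpha> / 2 - 1))" .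
  show ?thesis
  proof (cases "t <= ?d\<^sup>2")
   case True
   then have "10 * C * M * ?f t = 10 * (C * M * t powr (\<alpha> / 2 - 1))" by (simp add: mult.assoc)
   then show ?thesis using order_trans[OF 1 3] by (simp only:)
  next
   case False
   then have "10 * C * M * ?f t = C * (10 * M * t powr (\<alpha> / 2 - 3 / 2) * ?d)" by (simp add: mult_ac)
   then show ?thesis using order_trans[OF 1 2] by (simp only:)
  qed
 qed
 have eq: "hess gfermi Q (c 1) (V 1) (W 1) - hess gfermi Q (c 0) (V 0) (W 0) = (LINT t|I1. ?h t)"
  unfolding Q_eq fam.U_calculus(3) using fam.hess_int by simp
 have "\<bar>LINT t|I1. ?h t\<bar> <= (LINT t|I1. \<bar>?h t\<bar>)" unfolding real_norm_def[symmetric] by (rule integral_norm_bound)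
 also have "... <= (LINT t|I1. 10 * C * M * ?f t)"
 proof (rule Bochner_Integration.integral_mono)
  show "integrable I1 (%t. \<bar>?h t\<bar>)" by (rule integrable_abs[OF Bochner_Integration.integrable_diff[OF fam.hess_int fam.hess_int]])
  show "integrable I1 (%t. 10 * C * M * ?f t)" by (rule integrable_mult_right[OF sp(1)])
  show "\<bar>?h t\<bar> <= 10 * C * M * ?f t" if "t \<in> space I1" for t using that by (intro b) simp_all
 qed
 also have "... = 10 * C * M * (LINT t|I1. ?f t)" by (rule integral_mult_right_zero)
 also have "... <= 10 * C * M * ((2 / \<alpha> + 2 / (1 - \<alpha>)) * ?d powr \<alpha>)"
  using sp(2) CM by (intro mult_left_mono) auto
 finally show ?thesis unfolding eq by (simp only: mult.assoc)
qed

text \<open>The bound is uniform in K: in \<open>Q_hess_diff\<close> the factor exp (-K t) is merely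
  bounded by 1, and \<open>JJ\<close> by 2/\<alpha>.\<close>

lemma hb2_Q:
 assumes "4 * C * M * (2 / \<alpha>) <= B" "10 * C * M * (2 / \<alpha> + 2 / (1 - \<alpha>)) <= B"
 shows "fm.hb2 \<alpha> Q B"
proof -
 have CM: "4 * C * M >= 0" using C0 M0 by simp
 have "4 * C * M * JJ \<alpha> K <= 4 * C * M * (2 / \<alpha>)"
  using CM JJ_bounds(2)[OF \<alpha>(1) _ K] \<alpha> by (intro mult_left_mono) auto
 then have B: "4 * C * M * JJ \<alpha> K <= B" using assms(1) by linarith
 show ?thesis
  unfolding fm.hb2_def
 proof (intro conjI allI impI)
  show "Ck 2 Q" by (rule Q_bounds(1))
  show "\<bar>Q p\<bar> <= B" for p using Q_bounds(2)[of p] B by linarith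
  show "fm.grad_bound Q B"
   using Q_bounds(3) B unfolding fm.grad_bound_def by (meson fm.nrm_nonneg mult_right_mono order_trans)
  show "fm.hess_bound Q B"
   using Q_bounds(4) B unfolding fm.hess_bound_def by (meson fm.nrm_nonneg mult_right_mono order_trans)
 next
  fix c :: "real => real * 'a" and V W
  assume a: "geodesic gfermi c" "c 0 ~= c 1" "fm.hdist (c 0) (c 1) < 1" "parallel_along gfermi c V" "parallel_along gfermi c W"
   "gfermi (c 0) (V 0) (V 0) = 1" "gfermi (c 0) (W 0) (W 0) = 1"
  show "\<bar>hess gfermi Q (c 1) (V 1) (W 1) - hess gfermi Q (c 0) (V 0) (W 0)\<bar> <= B * fm.hdist (c 0) (c 1) powr \<alpha>"
   by (rule order_trans[OF Q_hess_diff[OF a] mult_right_mono[OF assms(2)]]) simp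
 qed
qed

definition e :: "real => real * 'a => real" where "e t p = exp (- (K * t)) * ek t (gY g) p"
definition H :: "real * 'a => real" where "H p = (LINT t|I1. e t p)"

lemma hkt_measurable: "(%t. hkt t (gY g) p) \<in> borel_measurable I1"
proof (rule borel_measurable_LIMSEQ_real)
 show "(%n. (hk (t + inverse (real (Suc n))) (gY g) p - hk t (gY g) p) / inverse (real (Suc n))) -----> hkt t (gY g) p"
  if "t \<in> space I1" for t
  using difference_quotient_LIMSEQ[OF heat_data.hk_has_time_derivative[OF data, of t p, unfolded has_field_derivative_def], of 1] that
  by simp
 show "(%t. (hk (t + inverse (real (Suc n))) (gY g) p - hk t (gY g) p) / inverse (real (Suc n))) \<in> borel_measurable I1" for n
  by (intro measurable_I1 continuous_on_divide continuous_on_diff continuous_on_compose2[OF hk_continuous]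
    continuous_on_subset[OF hk_continuous] continuous_intros) (auto simp: add_pos_pos)
qed

lemma laplace_v_integrable: "integrable I1 (%t. laplace gfermi (v t) p)"
 and laplace_Q: "laplace gfermi Q p = (LINT t|I1. laplace gfermi (v t) p)"
proof -
 let ?E = "fm.frame p"
 have l: "laplace gfermi (v t) p = (\<Sum>b\<in>Basis. hess gfermi (v t) p (?E b) (?E b))" if "t \<in> space I1" for t
  by (rule fm.laplace_eq[OF v_calculus(1) fm.orthonormal_frame]) (use that in auto)
 have "integrable I1 (%t. \<Sum>b\<in>Basis. hess gfermi (v t) p (?E b) (?E b))"
  by (intro Bochner_Integration.integrable_sum fam.hess_int)
 then show "integrable I1 (%t. laplace gfermi (v t) p)"
  by (subst Bochner_Integration.integrable_cong[OF refl l])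
 have "laplace gfermi Q p = (\<Sum>b\<in>Basis. LINT t|I1. hess gfermi (v t) p (?E b) (?E b))"
  unfolding fm.laplace_eq[OF Q_bounds(1) fm.orthonormal_frame] unfolding Q_eq fam.U_calculus(3) ..
 also have "... = (LINT t|I1. (\<Sum>b\<in>Basis. hess gfermi (v t) p (?E b) (?E b)))"
  by (rule Bochner_Integration.integral_sum[symmetric, OF fam.hess_int])
 also have "... = (LINT t|I1. laplace gfermi (v t) p)"
  by (rule Bochner_Integration.integral_cong[OF refl l[symmetric]])
 finally show "laplace gfermi Q p = (LINT t|I1. laplace gfermi (v t) p)" .
qed

lemma e_bound: "0 < t ==> t <= 1 ==> \<bar>e t p\<bar> <= C * (3 * (real DIM('a) + 1) * M) * (exp (- (K * t)) * t powr (\<alpha> / 2 - 1))"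
 and e_Lipschitz: "0 < t ==> t <= 1 ==>
  \<bar>e t p - e t q\<bar> <= C * (3 * (real DIM('a) + 1) * M) * fm.hdist p q * (exp (- (K * t)) * t powr (\<alpha> / 2 - 1))"
proof -
 assume t: "0 < t" "t <= 1"
 let ?n = "real DIM('a) + 1"
 interpret heat_estimate C t \<alpha> M g by (rule heat[OF t])
 have CM: "C * ?n * M >= 0" using C0 M0 by simp
 have "C * (2 * ?n * M) * 1 <= C * (3 * ?n * M) * t powr (\<alpha> / 2 - 1)"
  using CM powr_le(1)[OF tt] C0 M0 by (intro mult_mono) auto
 then have 1: "\<bar>ek t (gY g) p\<bar> <= C * (3 * ?n * M) * t powr (\<alpha> / 2 - 1)" using ek_sup[of p] by linarith
 show "\<bar>e t p\<bar> <= C * (3 * ?n * M) * (exp (- (K * t)) * t powr (\<alpha> / 2 - 1))"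
  unfolding e_def abs_mult using mult_left_mono[OF 1, of "exp (- (K * t))"] by (simp add: mult_ac)
 have "fm.grad_bound (ek t (gY g)) (C * (3 * ?n * M * t powr (- 1 / 2)))"
  by (rule fm.grad_boundI[OF ek_grad])
 then have "\<bar>ek t (gY g) p - ek t (gY g) q\<bar> <= C * (3 * ?n * M * t powr (- 1 / 2)) * fm.hdist p q"
  by (rule fm.grad_bound_Lipschitz)
 also have "... <= C * (3 * ?n * M * t powr (\<alpha> / 2 - 1)) * fm.hdist p q"
  using powr_le(2)[OF tt] C0 M0 fm.hdist_nonneg[of p q] by (intro mult_right_mono mult_left_mono) auto
 finally have 2: "\<bar>ek t (gY g) p - ek t (gY g) q\<bar> <= C * (3 * ?n * M * t powr (\<alpha> / 2 - 1)) * fm.hdist p q" .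
 have "\<bar>e t p - e t q\<bar> = exp (- (K * t)) * \<bar>ek t (gY g) p - ek t (gY g) q\<bar>"
  unfolding e_def right_diff_distrib[symmetric] by (simp add: abs_mult)
 also have "... <= exp (- (K * t)) * (C * (3 * ?n * M * t powr (\<alpha> / 2 - 1)) * fm.hdist p q)"
  using 2 by (rule mult_left_mono) simp
 finally show "\<bar>e t p - e t q\<bar> <= C * (3 * ?n * M) * fm.hdist p q * (exp (- (K * t)) * t powr (\<alpha> / 2 - 1))"
  by (simp only: mult_ac)
qed

text \<open>Measurability in t holds because \<open>e\<close> is the Laplacian minus the time
  derivative of the evolution, both of which are known to be measurable.\<close>

lemma e_integrable: "integrable I1 (%t. e t p)"
proof (rule Bochner_Integration.integrable_bound[OF integrable_mult_right[OF JJ_integrable[OF \<alpha>(1) K]]])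
 have "e t p = laplace gfermi (v t) p - exp (- (K * t)) * hkt t (gY g) p" if "t \<in> space I1" for t
  using v_calculus(6)[of t p] that by (simp add: e_def)
 moreover have "(%t. laplace gfermi (v t) p - exp (- (K * t)) * hkt t (gY g) p) \<in> borel_measurable I1"
  by (intro borel_measurable_diff borel_measurable_times hkt_measurable borel_measurable_integrable[OF laplace_v_integrable]
    measurable_I1 continuous_intros)
 ultimately show "(%t. e t p) \<in> borel_measurable I1"
  using measurable_cong[of I1 "%t. e t p" "%t. laplace gfermi (v t) p - exp (- (K * t)) * hkt t (gY g) p" borel] by blast
 show "AE t in I1. norm (e t p) <= norm (C * (3 * (real DIM('a) + 1) * M) * (exp (- (K * t)) * t powr (\<alpha> / 2 - 1)))"
  unfolding real_norm_def by (rule AE_I2, rule order_trans[OF e_bound abs_ge_self]) auto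
qed

text \<open>A gradient of \<open>ek\<close> costs only t^(-1/2), so \<open>H\<close> is even
  Lipschitz, with a constant proportional to \<open>JJ\<close>.\<close>

lemma H_hb: "fm.hb \<alpha> H (2 * (C * (3 * (real DIM('a) + 1) * M) * JJ \<alpha> K))"
proof -
 let ?c = "C * (3 * (real DIM('a) + 1) * M)"
 have le: "\<bar>LINT t|I1. f t\<bar> <= c * JJ \<alpha> K"
  if f: "integrable I1 f" and b: "!!t. 0 < t ==> t < 1 ==> \<bar>f t\<bar> <= c * (exp (- (K * t)) * t powr (\<alpha> / 2 - 1))" for f c
 proof -
  have "\<bar>LINT t|I1. f t\<bar> <= (LINT t|I1. \<bar>f t\<bar>)" using integral_norm_bound[of I1 f] by simp
  also have "... <= (LINT t|I1. c * (exp (- (K * t)) * t powr (\<alpha> / 2 - 1)))"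
   using f b JJ_integrable[OF \<alpha>(1) K] by (intro Bochner_Integration.integral_mono) auto
  finally show ?thesis by (simp add: JJ_def)
 qed
 show ?thesis
 proof (rule fm.hb_LipschitzI[OF \<alpha>(1)])
  show "\<bar>H p\<bar> <= ?c * JJ \<alpha> K" for p unfolding H_def by (rule le[OF e_integrable]) (use e_bound[of _ p] in auto)
  show "\<bar>H p - H q\<bar> <= ?c * JJ \<alpha> K * fm.hdist p q" for p q
  proof -
   have "H p - H q = (LINT t|I1. e t p - e t q)" unfolding H_def using e_integrable by simp
   also have "\<bar>...\<bar> <= (?c * fm.hdist p q) * JJ \<alpha> K"
    by (rule le) (use e_integrable e_Lipschitz[of _ p q] in auto)
   finally show ?thesis by (simp add: mult_ac)
  qed
 qed (use \<alpha> in auto)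
qed

text \<open>The time derivative of exp (-K t) times the evolution, integrated over (0, 1): the lower
  end contributes g by \<open>hk_initial\<close>, the upper end the term with exp (-K), and the
  error \<open>ek\<close> the term \<open>H\<close>.\<close>

lemma heat_equation: "K * Q p - laplace gfermi Q p = g p - exp (- K) * hk 1 (gY g) p - H p"
proof -
 let ?u = "%t. hk t (gY g) p" and ?f = "%t. exp (- (K * t)) * (K * hk t (gY g) p - hkt t (gY g) p)"
 \<comment> \<open>The antiderivative, extended to t = 0 by its limit, since the kernel has no
   meaning there.\<close>
 define F where "F t = (if t = 0 then - g p else - (exp (- (K * t)) * hk t (gY g) p))" for t
 have dF: "((%t. - (exp (- (K * t)) * ?u t)) has_real_derivative ?f t) (at t)" if "t > 0" for t
  using heat_data.hk_has_time_derivative[OF data[OF that], of p]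
  by (auto intro!: derivative_eq_intros simp: algebra_simps)
 have dF': "(F has_real_derivative ?f t) (at t)" if "t > 0" for t
  by (rule DERIV_cong_ev[THEN iffD1, OF refl _ refl dF])
    (use that in \<open>auto simp: F_def eventually_nhds intro!: exI[of _ "{0<..}"]\<close>)
 have "(?f has_integral F 1 - F 0) {0..1}"
 proof (rule fundamental_theorem_of_calculus_interior)
  show "(F has_vector_derivative ?f t) (at t)" if "t \<in> {0<..<1}" for t
   using dF'[of t] that by (simp add: has_real_derivative_iff_has_vector_derivative)
  show "continuous_on {0..1} F"
   unfolding continuous_on_eq_continuous_within
  proof
   fix t :: real assume t: "t \<in> {0..1}"
   show "continuous (at t within {0..1}) F"
   proof (cases "t = 0")
    case True
    have "((%t. - (exp (- (K * t)) * ?u t)) ---> - (exp (- (K * 0)) * g p)) (at_right 0)"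
     using \<alpha> by (intro tendsto_intros hk_initial[OF _ _ g]) auto
    then have "((%t. - (exp (- (K * t)) * ?u t)) ---> F 0) (at_right 0)" by (simp add: F_def)
    then have "(F ---> F 0) (at_right 0)"
     by (rule Lim_transform_eventually) (auto simp: F_def eventually_at_filter)
    then have "(F ---> F 0) (at 0 within {0..1})" by (simp add: at_within_Icc_at_right)
    then show ?thesis using True by (simp add: continuous_within)
   next
    case False
    then have t0: "t > 0" using t by auto
    show ?thesis by (rule continuous_at_imp_continuous_at_within[OF DERIV_isCont[OF dF'[OF t0]]])
   qed
  qed
 qed simp
 then have hi: "(?f has_integral g p - exp (- K) * hk 1 (gY g) p) {0..1}" by (simp add: F_def)
 have eq: "?f t = K * v t p - (laplace gfermi (v t) p - e t p)" if "t \<in> space I1" for t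
  using v_calculus(6)[of t p] that by (simp add: v_def e_def algebra_simps)
 have int: "integrable I1 (%t. K * v t p - (laplace gfermi (v t) p - e t p))"
  by (intro Bochner_Integration.integrable_diff integrable_mult_right fam.u_int laplace_v_integrable e_integrable)
 then have fi: "integrable I1 ?f" by (subst Bochner_Integration.integrable_cong[OF refl eq])
 have "g p - exp (- K) * hk 1 (gY g) p = (LINT t|I1. ?f t)" by (rule I1_integral_unique[symmetric, OF fi hi])
 also have "... = (LINT t|I1. K * v t p - (laplace gfermi (v t) p - e t p))"
  by (rule Bochner_Integration.integral_cong[OF refl eq])
 also have "... = K * Q p - (laplace gfermi Q p - H p)"
  unfolding laplace_Q Q_def H_def using fam.u_int laplace_v_integrable e_integrable by simp
 finally show ?thesis by simp
qed

lemma hk1_hb: "fm.hb \<alpha> (hk 1 (gY g)) (2 * C * M)"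
proof -
 interpret heat_estimate C 1 \<alpha> M g by (rule heat) auto
 have "fm.grad_bound (hk 1 (gY g)) (C * M)"
  by (rule fm.grad_boundI[OF fm.Ck2_differentiable[OF hk_calculus(1)]]) (use hk_grad in "simp add: mult.assoc")
 then have "fm.hb \<alpha> (hk 1 (gY g)) (2 * (C * M))"
  using \<alpha> hk_sup fm.grad_bound_Lipschitz by (intro fm.hb_LipschitzI) auto
 then show ?thesis by (simp add: mult.assoc)
qed

end

section \<open>Neumann series and the resolvent for large K\<close>

text \<open>In place of a complete normed space there is a predicate \<open>S f x\<close>, two
  families of pointwise bounds with constant x. Such bounds pass to pointwise limits, and the bound
  \<open>B\<close> on \<open>A\<close> makes the series converge pointwise; together these replace
  completeness. The same shape covers \<open>hb\<close> and the weighted norm of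
  \<open>Lt_solvable\<close>.\<close>

lemma neumann:
 fixes S :: "('p => real) => real => bool" and T :: "('p => real) => 'p => real"
 assumes S: "!!f x. S f x \<longleftrightarrow> (\<forall>p. \<bar>f p\<bar> <= x * A p) \<and> (\<forall>p q. \<bar>f p - f q\<bar> <= x * D p q)"
  and AD: "!!p. 0 < A p" "!!p. A p <= B" "!!p q. 0 <= D p q"
  and T: "!!f a. S f a ==> S (T f) (\<theta> * a)"
  and Tlin: "!!f g a b x y. S f a ==> S g b ==> T (%p. x * f p + y * g p) = (%p. x * T f p + y * T g p)"
  and \<theta>: "0 <= \<theta>" "\<theta> < 1" and g: "S g a"
 shows "\<exists>h. S h (a / (1 - \<theta>)) \<and> (\<forall>p. h p = g p + T h p)"
proof -
 have S1: "\<bar>f p\<bar> <= x * A p" and S2: "\<bar>f p - f q\<bar> <= x * D p q" if "S f x" for f x p q using that S by blast+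
 have add: "S (%p. 1 * f p + 1 * g p) (x + y)" if "S f x" "S g y" for f g x y
  unfolding S
 proof (intro conjI allI)
  show "\<bar>1 * f p + 1 * g p\<bar> <= (x + y) * A p" for p
   using S1[OF that(1), of p] S1[OF that(2), of p] unfolding distrib_right by linarith
  show "\<bar>1 * f p + 1 * g p - (1 * f q + 1 * g q)\<bar> <= (x + y) * D p q" for p q
   using S2[OF that(1), of p q] S2[OF that(2), of p q] unfolding distrib_right by linarith
 qed
 have nonneg: "x >= 0" if "S f x" for f x
  using order_trans[OF abs_ge_zero S1[OF that]] AD(1) by (metis less_le_not_le mult_neg_pos not_le)
 have sup: "\<bar>f p\<bar> <= B * x" if "S f x" for f x p
  using S1[OF that, of p] mult_left_mono[OF AD(2)[of p] nonneg[OF that]] by (simp add: mult.commute)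
 have mono: "S f y" if "S f x" "x <= y" for f x y
  unfolding S using S1[OF that(1)] S2[OF that(1)] mult_right_mono[OF that(2)] AD by (meson less_imp_le order_trans)
 have lim: "S h x" if f: "!!n. S (f n) x" and l: "!!p. (%n. f n p) -----> h p" for f h x
  unfolding S
 proof (intro conjI allI)
  show "\<bar>h p\<bar> <= x * A p" for p by (rule LIMSEQ_le_const2[OF tendsto_rabs[OF l]]) (use S1[OF f] in blast)
  show "\<bar>h p - h q\<bar> <= x * D p q" for p q
   by (rule LIMSEQ_le_const2[OF tendsto_rabs[OF tendsto_diff[OF l l]]]) (use S2[OF f] in blast)
 qed
 define r where "r n = (T ^^ n) g" for n
 define d where "d n j p = (\<Sum>k<j. r (n + k) p)" for n j p
 have a0: "a >= 0" by (rule nonneg[OF g])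
 have Sr: "S (r n) (\<theta> ^ n * a)" for n
 proof (induction n)
  case (Suc n)
  from T[OF Suc.IH] show ?case by (simp add: r_def mult.assoc)
 qed (simp add: r_def g)
 have S0: "S (%p. 0) 0" by (simp add: S)
 have Sd: "S (d n j) (\<Sum>k<j. \<theta> ^ (n + k) * a)" for n j
 proof (induction j)
  case (Suc j)
  from add[OF Suc.IH Sr[of "n + j"]] show ?case by (simp add: d_def[abs_def])
 qed (use S0 in "simp add: d_def[abs_def]")
 have geo: "(\<Sum>k<j. \<theta> ^ (n + k) * a) <= \<theta> ^ n * (a / (1 - \<theta>))" for n j
 proof -
  have "(\<Sum>k<j. \<theta> ^ (n + k) * a) = \<theta> ^ n * a * (\<Sum>k<j. \<theta> ^ k)"
   by (simp add: power_add sum_distrib_left mult_ac)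
  also have "... <= \<theta> ^ n * a * (1 / (1 - \<theta>))"
  proof (rule mult_left_mono)
   show "(\<Sum>k<j. \<theta> ^ k) <= 1 / (1 - \<theta>)"
    using \<theta> sum_le_suminf[OF summable_geometric[of \<theta>], of "{..<j}"] by (simp add: suminf_geometric)
  qed (use \<theta> a0 in simp)
  finally show ?thesis by simp
 qed
 have sm: "summable (%k. r (n + k) p)" for n p
 proof (rule summable_comparison_test'[where N=0])
  show "summable (%k. B * (\<theta> ^ n * a) * \<theta> ^ k)" using \<theta> by (intro summable_mult summable_geometric) simp
  show "norm (r (n + k) p) <= B * (\<theta> ^ n * a) * \<theta> ^ k" for k
   using sup[OF Sr[of "n + k"], of p] by (simp add: power_add mult_ac)
 qed
 define h where "h n p = (\<Sum>k. r (n + k) p)" for n p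
 have dh: "(%j. d n j p) -----> h n p" for n p unfolding d_def h_def by (rule summable_LIMSEQ[OF sm])
 have Sh: "S (h n) (\<theta> ^ n * (a / (1 - \<theta>)))" for n
  by (rule lim[OF mono[OF Sd geo] dh])
 have hs: "h 0 = (%p. 1 * d 0 n p + 1 * h n p)" for n
 proof
  fix p
  show "h 0 p = 1 * d 0 n p + 1 * h n p"
   using suminf_split_initial_segment[OF sm[of 0 p], of n] by (simp add: h_def d_def add.commute)
 qed
 have T0: "T (%p. 0) = (%p. 0)" using Tlin[OF S0 S0, of 0 0] by simp
 have Td: "T (d 0 n) p = d 0 (Suc n) p - g p" for n p
 proof (induction n)
  case 0
  then show ?case using T0 by (simp add: d_def[abs_def] r_def)
 next
  case (Suc n)
  have "d 0 (Suc n) = (%p. 1 * d 0 n p + 1 * r n p)" by (simp add: d_def fun_eq_iff)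
  then have "T (d 0 (Suc n)) p = T (d 0 n) p + T (r n) p" using Tlin[OF Sd Sr, of 1 0 n 1 n] by simp
  also have "T (r n) p = r (Suc n) p" by (simp add: r_def)
  finally show ?case unfolding Suc.IH by (simp add: d_def)
 qed
 have "T (h 0) p = h 0 p - g p" for p
 proof -
  have e: "T (h 0) p - (d 0 (Suc n) p - g p) = T (h n) p" for n
   by (subst hs[of n], subst Tlin[OF Sd Sh]) (simp add: Td)
  have "(%n. T (h n) p) -----> 0"
  proof (rule tendsto_rabs_zero_cancel, rule tendsto_sandwich[OF _ _ tendsto_const])
   show "\<forall>\<^sub>F n in sequentially. \<bar>T (h n) p\<bar> <= B * (\<theta> * (\<theta> ^ n * (a / (1 - \<theta>))))"
    using sup[OF T[OF Sh]] by simp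
   have "(%n. B * (\<theta> * (\<theta> ^ n * (a / (1 - \<theta>))))) -----> B * (\<theta> * (0 * (a / (1 - \<theta>))))"
    using \<theta> by (intro tendsto_intros LIMSEQ_power_zero) simp
   then show "(%n. B * (\<theta> * (\<theta> ^ n * (a / (1 - \<theta>))))) -----> 0" by simp
  qed simp
  then have "(%n. T (h 0) p - (d 0 (Suc n) p - g p)) -----> 0" unfolding e .
  moreover have "(%n. T (h 0) p - (d 0 (Suc n) p - g p)) -----> T (h 0) p - (h 0 p - g p)"
   by (intro tendsto_intros LIMSEQ_Suc dh)
  ultimately have "T (h 0) p - (h 0 p - g p) = 0" using LIMSEQ_unique by blast
  then show ?thesis by simp
 qed
 then show ?thesis using Sh[of 0] by (intro exI[of _ "h 0"]) simp
qed

lemma hb_lin: "fm.hb \<alpha> f a ==> fm.hb \<alpha> g b ==> fm.hb \<alpha> (%p. x * f p + y * g p) (\<bar>x\<bar> * a + \<bar>y\<bar> * b)"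
 by (intro fm.hb_add fm.hb_cmult)

lemma Q_lin:
 fixes f g :: "real * 'a::euclidean_space => real"
 assumes K: "K >= 0" and \<alpha>: "0 < \<alpha>" "\<alpha> < 1" and f: "fm.hb \<alpha> f a" and g: "fm.hb \<alpha> g b"
 shows "parametrix.Q K (%p. x * f p + y * g p) = (%p. x * parametrix.Q K f p + y * parametrix.Q K g p)"
proof
 fix p :: "real * 'a"
 obtain C where C: "mom TYPE('a) C" using mom_exists by blast
 interpret f: parametrix C K \<alpha> a f by standard (use C K \<alpha> f in auto)
 interpret g: parametrix C K \<alpha> b g by standard (use C K \<alpha> g in auto)
 interpret s: parametrix C K \<alpha> "\<bar>x\<bar> * a + \<bar>y\<bar> * b" "%p. x * f p + y * g p"
  by standard (use C K \<alpha> hb_lin[OF f g] in auto)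
 have i: "integrable hsN (%w. ker t (FX p) w * gY k w)" if "heat_data t (gY k) M" for t k M
  using heat_data.ti_integrable[OF that, of "(FX p, 0, 0)" 1 1] FX_cone[of p] by (simp add: ti_def[abs_def] mm_simps)
 have "s.v t p = x * f.v t p + y * g.v t p" if t: "t > 0" for t
 proof -
  have "hk t (gY (%p. x * f p + y * g p)) p = (LINT w|hsN. x * (ker t (FX p) w * gY f w) + y * (ker t (FX p) w * gY g w))"
   by (simp add: hk_def gY_def algebra_simps)
  also have "... = x * hk t (gY f) p + y * hk t (gY g) p"
   unfolding hk_def using i[OF f.data[OF t]] i[OF g.data[OF t]] by simp
  finally show ?thesis by (simp add: f.v_def g.v_def s.v_def algebra_simps)
 qed
 then have "s.Q p = (LINT t|I1. x * f.v t p + y * g.v t p)"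
  unfolding s.Q_def by (intro Bochner_Integration.integral_cong) auto
 then show "s.Q p = x * f.Q p + y * g.Q p"
  unfolding f.Q_def g.Q_def using f.fam.u_int g.fam.u_int by simp
qed

text \<open>The residual consists of the boundary term at time 1, the error \<open>H\<close>, the
  drift and the zeroth-order term. Each is a constant times \<open>JJ \<alpha> K\<close> in
  \<open>hb\<close>, because it involves \<open>Q\<close> up to bounds on two derivatives but not
  the seminorm of the Hessian.\<close>

lemma parametrix_residual:
 assumes \<alpha>: "0 < \<alpha>" "\<alpha> < 1" and V: "!!t. \<bar>V t\<bar> <= B" "!!s t. \<bar>V s - V t\<bar> <= B * \<bar>s - t\<bar>"
 obtains K C where "K > 0" "C >= 0"
  "!!(g :: real * 'a => real) M. fm.hb \<alpha> g M ==> fm.hb2 \<alpha> (parametrix.Q K g) (C * M)"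
  "!!(g :: real * 'a => real) M. fm.hb \<alpha> g M ==>
    fm.hb \<alpha> (%p. K * parametrix.Q K g p - Lt (q :: 'a::euclidean_space) \<mu> \<delta> V (parametrix.Q K g) p - g p) (1 / 2 * M)"
proof -
 obtain C where C: "mom TYPE('a) C" using mom_exists by blast
 have C0: "C > 0" using C by (simp add: mom_def)
 obtain A where A: "fm.grad_bound (omega q \<mu> \<delta>) A" "fm.hess_bound (omega q \<mu> \<delta>) A" using omega_bounds(2) by blast
 obtain D where D: "fm.hb \<alpha> (cc q \<mu> \<delta> V) D" using hb_cc[OF \<alpha>(1) _ V] \<alpha> by fastforce
 let ?n = "real DIM('a) + 1" and ?N = "real DIM(real * 'a)"
 \<comment> \<open>The sum of the constants of the four residual terms, in the order of the facts 1
   to 4 below.\<close>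
 define E where "E = 2 * C + 6 * C * ?n + 2 * (4 * ?N * A * (4 * C)) + 2 * D * (8 * C)"
 have "(%n. \<bar>E\<bar> * JJ \<alpha> (real n)) -----> \<bar>E\<bar> * 0" by (intro tendsto_intros JJ_tendsto \<alpha>)
 then have "\<forall>\<^sub>F n in sequentially. \<bar>E\<bar> * JJ \<alpha> (real n) < 1 / 2" by (rule order_tendstoD) simp
 then obtain n0 where n0: "!!n. n >= n0 ==> \<bar>E\<bar> * JJ \<alpha> (real n) < 1 / 2" by (auto simp: eventually_sequentially)
 define K where "K = real (Suc n0)"
 have K: "K > 0" "\<bar>E\<bar> * JJ \<alpha> K < 1 / 2" using n0[of "Suc n0"] by (simp_all add: K_def)
 note KE = K(2)
 define CQ where "CQ = 4 * C * (2 / \<alpha>) + 10 * C * (2 / \<alpha> + 2 / (1 - \<alpha>))"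
 have CQ: "4 * C * (2 / \<alpha>) >= 0" "10 * C * (2 / \<alpha> + 2 / (1 - \<alpha>)) >= 0" using C0 \<alpha> by (auto intro!: mult_nonneg_nonneg add_nonneg_nonneg)
 show thesis
 proof (rule that[of K CQ])
  show "CQ >= 0" unfolding CQ_def using CQ by linarith
  fix g :: "real * 'a => real" and M assume g: "fm.hb \<alpha> g M"
  interpret parametrix C K \<alpha> M g by standard (use C K \<alpha> g in auto)
  have M0: "M >= 0" by (rule fm.hb_nonneg[OF g])
  let ?J = "JJ \<alpha> K"
  have J: "0 <= ?J" "exp (- K) <= ?J" using JJ_bounds[OF \<alpha>(1)] \<alpha> K by auto
  show "fm.hb2 \<alpha> Q (CQ * M)"
  proof (rule hb2_Q)
   have e: "4 * C * M * (2 / \<alpha>) = 4 * C * (2 / \<alpha>) * M"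
    "10 * C * M * (2 / \<alpha> + 2 / (1 - \<alpha>)) = 10 * C * (2 / \<alpha> + 2 / (1 - \<alpha>)) * M" by (simp_all only: mult_ac)
   show "4 * C * M * (2 / \<alpha>) <= CQ * M" unfolding e CQ_def using CQ(2) by (intro mult_right_mono M0) linarith
   show "10 * C * M * (2 / \<alpha> + 2 / (1 - \<alpha>)) <= CQ * M" unfolding e CQ_def using CQ(1) by (intro mult_right_mono M0) linarith
  qed
  let ?b = "4 * C * M * ?J"
  have 1: "fm.hb \<alpha> (%p. - exp (- K) * hk 1 (gY g) p) (2 * C * M * ?J)"
  proof (rule fm.hb_mono[OF fm.hb_cmult[OF hk1_hb]])
   have "exp (- K) * (2 * C * M) <= ?J * (2 * C * M)" using J(2) C0 M0 by (intro mult_right_mono) auto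
   then show "\<bar>- exp (- K)\<bar> * (2 * C * M) <= 2 * C * M * ?J" by (simp add: mult.commute)
  qed
  have 2: "fm.hb \<alpha> (%p. - 1 * H p) (6 * C * ?n * M * ?J)"
   by (rule fm.hb_mono[OF fm.hb_cmult[OF H_hb]]) (simp add: algebra_simps)
  have 3: "fm.hb \<alpha> (%p. - 2 * fm.gdot (omega q \<mu> \<delta>) Q p) (2 * (4 * ?N * A * ?b))"
   using fm.hb_cmult[OF fm.gdot_hb[OF \<alpha>(1) _ omega_bounds(1) A Q_bounds(1,3,4)], of "- 2"] \<alpha> by simp
  have "fm.hb \<alpha> Q (2 * ?b)"
   using \<alpha> Q_bounds(2) fm.grad_bound_Lipschitz[OF Q_bounds(3)] by (intro fm.hb_LipschitzI) auto
  then have 4: "fm.hb \<alpha> (%p. - 1 * (cc q \<mu> \<delta> V p * Q p)) (2 * D * (2 * ?b))"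
   using fm.hb_cmult[OF fm.hb_mult[OF D], of Q "2 * ?b" "- 1"] by simp
  have "fm.hb \<alpha> (%p. - exp (- K) * hk 1 (gY g) p + - 1 * H p + - 2 * fm.gdot (omega q \<mu> \<delta>) Q p + - 1 * (cc q \<mu> \<delta> V p * Q p))
    (2 * C * M * ?J + 6 * C * ?n * M * ?J + 2 * (4 * ?N * A * ?b) + 2 * D * (2 * ?b))"
   by (rule fm.hb_add[OF fm.hb_add[OF fm.hb_add[OF 1 2] 3] 4])
  moreover have "2 * C * M * ?J + 6 * C * ?n * M * ?J + 2 * (4 * ?N * A * ?b) + 2 * D * (2 * ?b) = (E * ?J) * M"
   by (simp add: E_def algebra_simps)
  moreover have "(E * ?J) * M <= 1 / 2 * M"
  proof (rule mult_right_mono[OF _ M0])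
   show "E * ?J <= 1 / 2" using KE mult_right_mono[OF abs_ge_self[of E] J(1)] by linarith
  qed
  moreover have "- exp (- K) * hk 1 (gY g) p + - 1 * H p + - 2 * fm.gdot (omega q \<mu> \<delta>) Q p + - 1 * (cc q \<mu> \<delta> V p * Q p)
    = K * Q p - Lt q \<mu> \<delta> V Q p - g p" for p
   using heat_equation[of p] by (simp add: Lt_def)
  ultimately show "fm.hb \<alpha> (%p. K * Q p - Lt q \<mu> \<delta> V Q p - g p) (1 / 2 * M)"
   using fm.hb_mono by (simp only:)
 qed (rule K)
qed

text \<open>\<open>T\<close> is the negative of the residual, so h = g + T h says exactly that the
  parametrix applied to h solves the equation with right side g.\<close>

lemma resolvent_exists:
 assumes \<alpha>: "0 < \<alpha>" "\<alpha> < 1" and V: "!!t. \<bar>V t\<bar> <= B" "!!s t. \<bar>V s - V t\<bar> <= B * \<bar>s - t\<bar>"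
 obtains K C where "K > 0" "C >= 0" "!!(g :: real * 'a => real) M. fm.hb \<alpha> g M ==>
    \<exists>w. fm.hb2 \<alpha> w (C * M) \<and> (\<forall>p. K * w p - Lt (q :: 'a::euclidean_space) \<mu> \<delta> V w p = g p)"
proof -
 obtain K C where K: "K > 0" "C >= 0"
  "!!(g :: real * 'a => real) M. fm.hb \<alpha> g M ==> fm.hb2 \<alpha> (parametrix.Q K g) (C * M)"
  "!!(g :: real * 'a => real) M. fm.hb \<alpha> g M ==>
    fm.hb \<alpha> (%p. K * parametrix.Q K g p - Lt (q :: 'a) \<mu> \<delta> V (parametrix.Q K g) p - g p) (1 / 2 * M)"
  by (rule parametrix_residual[OF \<alpha> V, where q=q and \<mu>=\<mu> and \<delta>=\<delta>]) (rule that)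
 define P where "P = (parametrix.Q K :: (real * 'a => real) => _)"
 define T where "T f p = - 1 * (K * P f p - Lt q \<mu> \<delta> V (P f) p - f p)" for f p
 show thesis
 proof (rule that[of K "2 * C"])
  fix g :: "real * 'a => real" and M assume g: "fm.hb \<alpha> g M"
  have "\<exists>h. fm.hb \<alpha> h (M / (1 - 1 / 2)) \<and> (\<forall>p. h p = g p + T h p)"
  proof (rule neumann[where S="fm.hb \<alpha>" and B=1 and A="%_. 1" and D="%p q. fm.hdist p q powr \<alpha>"])
   show "fm.hb \<alpha> (T f) (1 / 2 * a)" if "fm.hb \<alpha> f a" for f a
    using fm.hb_cmult[OF K(4)[OF that], of "- 1"] unfolding T_def[abs_def] P_def by simp
   show "T (%p. x * f p + y * k p) = (%p. x * T f p + y * T k p)" if f: "fm.hb \<alpha> f a" and k: "fm.hb \<alpha> k b" for f k a b x y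
   proof
    fix p
    have e: "P (%p. x * f p + y * k p) = (%p. x * P f p + y * P k p)"
     unfolding P_def by (rule Q_lin[OF _ \<alpha> f k]) (use K in simp)
    have "Ck 2 (P f)" "Ck 2 (P k)" unfolding P_def using fm.hb2_D(1)[OF K(3)[OF f]] fm.hb2_D(1)[OF K(3)[OF k]] by auto
    then show "T (%p. x * f p + y * k p) p = x * T f p + y * T k p"
     unfolding T_def e by (simp add: Lt_linear algebra_simps)
   qed
  qed (use g in "simp_all add: fm.hb_def")
  moreover have "M / (1 - 1 / 2) = 2 * M" by simp
  ultimately obtain h where h: "fm.hb \<alpha> h (2 * M)" "\<forall>p. h p = g p + T h p" by metis
  have "K * P h p - Lt q \<mu> \<delta> V (P h) p = g p" for p using h(2)[rule_format, of p] by (simp add: T_def)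
  moreover have "fm.hb2 \<alpha> (P h) (2 * C * M)" using K(3)[OF h(1)] by (simp add: P_def mult_ac)
  ultimately show "\<exists>w. fm.hb2 \<alpha> w (2 * C * M) \<and> (\<forall>p. K * w p - Lt q \<mu> \<delta> V w p = g p)" by blast
 qed (use K in auto)
qed

section \<open>Solving the equation at K = 0\<close>

context heteroclinic
begin

lemma potential_bounds:
 obtains B where "!!t. \<bar>f1 (U t)\<bar> <= B" "!!s t. \<bar>f1 (U s) - f1 (U t)\<bar> <= B * \<bar>s - t\<bar>"
proof -
 obtain R where R: "!!t. \<bar>U t\<bar> <= R" by (rule bounded_U) (rule that)
 then have R': "U t \<in> {- R..R}" for t using abs_le_D1[OF R[of t]] abs_le_D2[OF R[of t]] by auto
 obtain B1 where B1: "!!s. s \<in> {- R..R} ==> \<bar>f1 s\<bar> <= B1" using range_bound[OF cont(4) R] by blast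
 obtain B2 where B2: "!!s. s \<in> {- R..R} ==> \<bar>f2 s\<bar> <= B2" using range_bound[OF f2 R] by blast
 obtain B3 where B3: "!!t. \<bar>U' t\<bar> <= B3" using bounded_of_limits[OF cont(2) U'_lim] by blast
 have b0: "B2 >= 0" "B3 >= 0" using B2[OF R'[of 0]] B3[of 0] by linarith+
 have "\<bar>f1 (U s) - f1 (U t)\<bar> <= B2 * B3 * \<bar>s - t\<bar>" for s t
 proof (rule DERIV_Lipschitz)
  show "((%t. f1 (U t)) has_real_derivative f2 (U t) * U' t) (at t)" for t
   by (rule DERIV_chain2[OF f1 U])
  show "\<bar>f2 (U t) * U' t\<bar> <= B2 * B3" for t
   unfolding abs_mult by (intro mult_mono B2 B3 R') (use b0 in auto)
 qed
 then have "\<bar>f1 (U s) - f1 (U t)\<bar> <= max B1 (B2 * B3) * \<bar>s - t\<bar>" for s t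
  using mult_right_mono[of "B2 * B3" "max B1 (B2 * B3)" "\<bar>s - t\<bar>"] by (meson abs_ge_zero max.cobounded2 order_trans)
 then show thesis using B1[OF R'] by (intro that[of "max B1 (B2 * B3)"]) (auto simp: le_max_iff_disj)
qed

text \<open>The term \<open>K w\<close> is a contraction in a norm which weighs the Hoelder seminorm lightly against the weighted sup
 norm, because the resolvent maps into a space in which the seminorm can be interpolated.\<close>

lemma Lt_solvable:
 fixes q :: "'a::euclidean_space"
 assumes m': "m = real DIM('a)" and d: "0 < \<delta>" "\<delta> <= m - 1"
  and mu: "0 < \<mu>" "\<mu> < ind (f1 1)" "\<mu> < ind (f1 (-1))" and \<alpha>: "0 < \<alpha>" "\<alpha> < 1"
 obtains C where "C >= 0"
  "!!g M. fm.hb \<alpha> g M ==> \<exists>w. fm.hb2 \<alpha> w (C * M) \<and> (\<forall>p. Lt q \<mu> \<delta> (%t. f1 (U t)) w p = g p)"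
  "!!w1 w2. Ck 2 w1 ==> Ck 2 w2 ==> (\<exists>B. \<forall>p. \<bar>w1 p\<bar> <= B) ==> (\<exists>B. \<forall>p. \<bar>w2 p\<bar> <= B) ==>
   (\<forall>p. Lt q \<mu> \<delta> (%t. f1 (U t)) w1 p = Lt q \<mu> \<delta> (%t. f1 (U t)) w2 p) ==> w1 = w2"
proof -
 let ?L = "Lt q \<mu> \<delta> (%t. f1 (U t))"
 show thesis
 proof (rule sup_estimate[OF m' d mu, where q=q])
 fix h :: "real => real" and c0 a b :: real
 assume h: "c0 > 0" "a > 0" "!!t. a <= h t" "!!t. h t <= b"
  and est: "!!K M w p. K >= 0 ==> M >= 0 ==> Ck 2 w ==> (\<exists>B. \<forall>p. \<bar>w p\<bar> <= B) ==>
   (!!p :: real * 'a. \<bar>K * w p - ?L w p\<bar> <= M * h (fst p)) ==> \<bar>w p\<bar> <= M / (K + c0) * h (fst p)"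
 have h0: "h t > 0" "h t >= 0" for t using h(2) h(3)[of t] by linarith+
 have ab: "a <= b" "b > 0" using h(2) h(3)[of 0] h(4)[of 0] by linarith+
 obtain B where B: "!!t. \<bar>f1 (U t)\<bar> <= B" "!!s t. \<bar>f1 (U s) - f1 (U t)\<bar> <= B * \<bar>s - t\<bar>"
  by (rule potential_bounds) (rule that)
 obtain K C where K: "K > 0" "C >= 0" and res: "!!(g :: real * 'a => real) M. fm.hb \<alpha> g M ==>
    \<exists>w. fm.hb2 \<alpha> w (C * M) \<and> (\<forall>p. K * w p - ?L w p = g p)"
  by (rule resolvent_exists[OF \<alpha> B, where q=q and \<mu>=\<mu> and \<delta>=\<delta>]) (rule that)
 define bd :: "(real * 'a => real) => bool" where "bd w \<longleftrightarrow> Ck 2 w \<and> (\<exists>B. \<forall>p. \<bar>w p\<bar> <= B)" for w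
 have bd_lin: "bd (%p. x * w1 p + y * w2 p)" if w: "bd w1" "bd w2" for w1 w2 x y
 proof -
  obtain B1 B2 where b: "!!p. \<bar>w1 p\<bar> <= B1" "!!p. \<bar>w2 p\<bar> <= B2" using w by (auto simp: bd_def)
  have "\<bar>x * w1 p + y * w2 p\<bar> <= \<bar>x\<bar> * B1 + \<bar>y\<bar> * B2" for p
   using mult_left_mono[OF b(1)[of p], of "\<bar>x\<bar>"] mult_left_mono[OF b(2)[of p], of "\<bar>y\<bar>"]
   by (simp add: abs_mult[symmetric])
  moreover have "Ck 2 (%p. x * w1 p + y * w2 p)" using w by (intro Ck2_add Ck2_cmult) (auto simp: bd_def)
  ultimately show ?thesis unfolding bd_def by blast
 qed
 have uniq: "w1 = w2" if w: "bd w1" "bd w2" and k: "k >= 0" and e: "!!p. k * w1 p - ?L w1 p = k * w2 p - ?L w2 p" for k w1 w2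
 proof
  fix p
  let ?w = "%p. 1 * w1 p + (- 1) * w2 p"
  have L: "?L ?w p = 1 * ?L w1 p + (- 1) * ?L w2 p" for p
   using w by (intro Lt_linear) (auto simp: bd_def)
  have "\<bar>?w p\<bar> <= 0 / (k + c0) * h (fst p)"
  proof (rule est[OF k order_refl])
   show "Ck 2 ?w" "\<exists>B. \<forall>p. \<bar>?w p\<bar> <= B" using bd_lin[OF w, of 1 "- 1"] by (auto simp: bd_def)
   show "\<bar>k * ?w p - ?L ?w p\<bar> <= 0 * h (fst p)" for p unfolding L using e[of p] by (simp add: algebra_simps)
  qed
  then show "w1 p = w2 p" by simp
 qed
 have bd_hb2: "bd w" if "fm.hb2 \<alpha> w M" for w M using fm.hb2_D(1,2)[OF that] by (auto simp: bd_def)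
 \<comment> \<open>\<open>resolvent_exists\<close> provides some solution, and the sup estimate
   makes it unique among bounded C^2 functions. The choice therefore inherits the norm bound, and
   \<open>R\<close> is linear.\<close>
 define R where "R f = (SOME w. bd w \<and> (\<forall>p. K * w p - ?L w p = f p))" for f :: "real * 'a => real"
 have R: "fm.hb2 \<alpha> (R f) (C * M)" "K * R f p - ?L (R f) p = f p" if f: "fm.hb \<alpha> f M" for f M p
 proof -
  obtain w where w: "fm.hb2 \<alpha> w (C * M)" "\<forall>p. K * w p - ?L w p = f p" using res[OF f] by blast
  have "bd (R f) \<and> (\<forall>p. K * R f p - ?L (R f) p = f p)"
   unfolding R_def by (rule someI[of _ w]) (use bd_hb2[OF w(1)] w(2) in blast)
  note Rp = conjunct1[OF this] conjunct2[OF this, rule_format]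
  show "K * R f p - ?L (R f) p = f p" by (rule Rp(2))
  have "R f = w"
   by (rule uniq[OF Rp(1) bd_hb2[OF w(1)] less_imp_le[OF K(1)]]) (simp only: Rp(2) w(2)[rule_format])
  then show "fm.hb2 \<alpha> (R f) (C * M)" using w(1) by simp
 qed
 \<comment> \<open>The contraction factor of K R in the sup norm weighted by \<open>h\<close>, as
   given by the sup estimate.\<close>
 define \<theta> where "\<theta> = K / (K + c0)"
 have \<theta>: "0 < \<theta>" "\<theta> < 1" using K h(1) by (simp_all add: \<theta>_def)
 \<comment> \<open>The interpolation length: below it the gradient bound of \<open>R f\<close>
   reduces the Hoelder quotient by the factor \<theta>. The value is chosen so that 2 C K \<eta>^(1
   - \<alpha>) <= \<theta>.\<close>
 define \<eta> where "\<eta> = (1 / (2 * (C + 1) * (K + c0))) powr (1 / (1 - \<alpha>))"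
 have \<eta>0: "\<eta> > 0" using K h(1) by (simp add: \<eta>_def add_nonneg_pos less_imp_neq[symmetric])
 have \<eta>: "2 * C * K * \<eta> powr (1 - \<alpha>) <= \<theta>"
 proof -
  have "\<eta> powr (1 - \<alpha>) = 1 / (2 * (C + 1) * (K + c0))"
   unfolding \<eta>_def powr_powr using \<alpha> K h(1) by simp
  moreover have "2 * C * K * (1 / (2 * x * y)) = C / x * (K / y)" for x y by simp
  ultimately have "2 * C * K * \<eta> powr (1 - \<alpha>) = C / (C + 1) * \<theta>" unfolding \<theta>_def by (simp only:)
  also have "... <= 1 * \<theta>" using K \<theta> by (intro mult_right_mono) auto
  finally show ?thesis by simp
 qed
 \<comment> \<open>The Hoelder part of \<open>S\<close> is allowed to be \<Lambda> times as large as
   the sup part. The second summand settles distances above \<eta>, where a difference is at most 2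
   b times the bound and d^\<alpha> >= \<eta>^\<alpha>.\<close>
 define \<Lambda> where "\<Lambda> = b + 2 * b / \<eta> powr \<alpha>"
 have \<Lambda>: "b <= \<Lambda>" "2 * b / \<eta> powr \<alpha> <= \<Lambda>" "\<Lambda> > 0" using ab by (auto simp: \<Lambda>_def add_pos_nonneg)
 define S where "S f x \<longleftrightarrow> (\<forall>p. \<bar>f p\<bar> <= x * h (fst p)) \<and> (\<forall>p q. \<bar>f p - f q\<bar> <= x * (\<Lambda> * fm.hdist p q powr \<alpha>))"
  for f :: "real * 'a => real" and x
 have S0: "x >= 0" if "S f x" for f x
 proof -
  have "0 <= x * h (fst (0 :: real * 'a))" using that abs_ge_zero[of "f 0"] unfolding S_def by (meson order_trans)
  then show ?thesis using h0(1)[of "fst (0 :: real * 'a)"] by (simp add: zero_le_mult_iff)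
 qed
 have S_hb: "fm.hb \<alpha> f (2 * \<Lambda> * x)" if "S f x" for f x
  unfolding fm.hb_def
 proof (intro conjI allI)
  have x: "x >= 0" by (rule S0[OF that])
  fix p q :: "real * 'a"
  have "\<bar>f p\<bar> <= x * h (fst p)" using that unfolding S_def by blast
  also have "... <= x * (2 * \<Lambda>)" using x h(4)[of "fst p"] \<Lambda> ab by (intro mult_left_mono) auto
  finally show "\<bar>f p\<bar> <= 2 * \<Lambda> * x" by (simp add: mult.commute)
  have "\<bar>f p - f q\<bar> <= x * (\<Lambda> * fm.hdist p q powr \<alpha>)" using that unfolding S_def by blast
  also have "... <= 2 * \<Lambda> * x * fm.hdist p q powr \<alpha>" using x \<Lambda>(3) by (simp add: mult_ac mult_left_mono)
  finally show "\<bar>f p - f q\<bar> <= 2 * \<Lambda> * x * fm.hdist p q powr \<alpha>" .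
 qed
 define T where "T f p = K * R f p" for f p
 have ST: "S (T f) (\<theta> * x)" if f: "S f x" for f x
 proof -
  have x: "x >= 0" by (rule S0[OF f])
  note Rf = R[OF S_hb[OF f]]
  have Rb: "\<bar>K * R f p\<bar> <= \<theta> * x * h (fst p)" for p
  proof -
   have "\<bar>R f p\<bar> <= x / (K + c0) * h (fst p)"
    using bd_hb2[OF Rf(1)] f K x by (intro est) (auto simp: bd_def Rf(2) S_def)
   then have "K * \<bar>R f p\<bar> <= K * (x / (K + c0) * h (fst p))" using K by (intro mult_left_mono) auto
   then show ?thesis using K by (simp add: abs_mult \<theta>_def)
  qed
  have "\<bar>K * R f p - K * R f q\<bar> <= \<theta> * x * (\<Lambda> * fm.hdist p q powr \<alpha>)" for p q
  proof -
   let ?d = "fm.hdist p q"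
   have d0: "?d >= 0" by (rule fm.hdist_nonneg)
   show ?thesis
   proof (cases "?d <= \<eta>")
    case True
    have "\<bar>R f p - R f q\<bar> <= C * (2 * \<Lambda> * x) * ?d" by (rule fm.grad_bound_Lipschitz[OF fm.hb2_D(3)[OF Rf(1)]])
    then have "K * \<bar>R f p - R f q\<bar> <= K * (C * (2 * \<Lambda> * x) * ?d)" using K by (intro mult_left_mono) auto
    also have "?d = ?d powr (1 - \<alpha>) * ?d powr \<alpha>" using d0 by (cases "?d = 0") (auto simp: powr_add[symmetric])
    also have "K * (C * (2 * \<Lambda> * x) * (?d powr (1 - \<alpha>) * ?d powr \<alpha>)) = (2 * C * K * ?d powr (1 - \<alpha>)) * (\<Lambda> * x * ?d powr \<alpha>)"
     by (simp only: mult_ac)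
    also have "... <= \<theta> * (\<Lambda> * x * ?d powr \<alpha>)"
    proof (rule mult_right_mono)
     have "?d powr (1 - \<alpha>) <= \<eta> powr (1 - \<alpha>)" using True d0 \<alpha> by (intro powr_mono2) auto
     then have "2 * C * K * ?d powr (1 - \<alpha>) <= 2 * C * K * \<eta> powr (1 - \<alpha>)" using K by (intro mult_left_mono) auto
     then show "2 * C * K * ?d powr (1 - \<alpha>) <= \<theta>" using \<eta> by linarith
    qed (use \<Lambda> x in auto)
    finally have "K * \<bar>R f p - R f q\<bar> <= \<theta> * (\<Lambda> * x * ?d powr \<alpha>)" .
    moreover have "\<bar>K * R f p - K * R f q\<bar> = K * \<bar>R f p - R f q\<bar>"
     using K unfolding right_diff_distrib[symmetric] abs_mult by simp
    ultimately show ?thesis by (simp only: mult_ac)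
   next
    case False
    have b: "\<bar>K * R f p\<bar> <= \<theta> * x * b" for p
     using Rb[of p] mult_left_mono[OF h(4)[of "fst p"], of "\<theta> * x"] \<theta> x by (meson less_imp_le mult_nonneg_nonneg order_trans)
    have "\<bar>K * R f p - K * R f q\<bar> <= \<theta> * x * (2 * b)" using b[of p] b[of q] by linarith
    also have "... <= \<theta> * x * (\<Lambda> * ?d powr \<alpha>)"
    proof (rule mult_left_mono)
     have "\<eta> powr \<alpha> <= ?d powr \<alpha>" using False \<eta>0 \<alpha> by (intro powr_mono2) auto
     moreover have "2 * b <= \<Lambda> * \<eta> powr \<alpha>" using \<Lambda>(2) \<eta>0 by (simp add: divide_le_eq)
     ultimately show "2 * b <= \<Lambda> * ?d powr \<alpha>" using \<Lambda>(3) mult_left_mono[of "\<eta> powr \<alpha>" "?d powr \<alpha>" \<Lambda>] by linarith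
    qed (use \<theta> x in auto)
    finally show ?thesis by (simp only: mult_ac)
   qed
  qed
  then show ?thesis unfolding S_def T_def using Rb by blast
 qed
 have solve: "\<exists>w. fm.hb2 \<alpha> w (C * (2 * \<Lambda> * (1 / a / (1 - \<theta>))) * M) \<and> (\<forall>p. ?L w p = g p)" if g: "fm.hb \<alpha> g M" for g M
 proof -
  have M0: "M >= 0" by (rule fm.hb_nonneg[OF g])
  have "\<exists>k. S k (M / a / (1 - \<theta>)) \<and> (\<forall>p. k p = (- 1) * g p + T k p)"
  proof (rule neumann[where S=S and B=b and A="%p. h (fst p)" and D="%p q. \<Lambda> * fm.hdist p q powr \<alpha>"])
   show "T (%p. x * f p + y * k p) = (%p. x * T f p + y * T k p)" if f: "S f r" and k: "S k s" for f k r s x y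
   proof -
    note Rf = R[OF S_hb[OF f]] and Rk = R[OF S_hb[OF k]] and Rs = R[OF hb_lin[OF S_hb[OF f] S_hb[OF k]]]
    have "R (%p. x * f p + y * k p) = (%p. x * R f p + y * R k p)"
    proof (rule uniq[OF bd_hb2[OF Rs(1)] bd_lin[OF bd_hb2[OF Rf(1)] bd_hb2[OF Rk(1)]] less_imp_le[OF K(1)]])
     fix p
     have "?L (%p. x * R f p + y * R k p) p = x * ?L (R f) p + y * ?L (R k) p"
      by (rule Lt_linear[OF fm.hb2_D(1)[OF Rf(1)] fm.hb2_D(1)[OF Rk(1)]])
     then have "K * (x * R f p + y * R k p) - ?L (%p. x * R f p + y * R k p) p
       = x * (K * R f p - ?L (R f) p) + y * (K * R k p - ?L (R k) p)" by (simp add: algebra_simps)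
     then show "K * R (%p. x * f p + y * k p) p - ?L (R (%p. x * f p + y * k p)) p
       = K * (x * R f p + y * R k p) - ?L (%p. x * R f p + y * R k p) p"
      by (simp only: Rf(2) Rk(2) Rs(2))
    qed
    then show ?thesis by (simp add: T_def fun_eq_iff algebra_simps)
   qed
   show "S (%p. (- 1) * g p) (M / a)"
    unfolding S_def
   proof (intro conjI allI)
    fix p q :: "real * 'a"
    have "M <= M / a * h (fst p)" using h(2,3) M0 mult_left_mono[OF h(3)[of "fst p"] M0] by (simp add: le_divide_eq)
    moreover have "\<bar>g p\<bar> <= M" using g unfolding fm.hb_def by blast
    ultimately show "\<bar>(- 1) * g p\<bar> <= M / a * h (fst p)" by simp
    have "M <= M / a * \<Lambda>" using ab(1) \<Lambda>(1) M0 h(2) mult_left_mono[of a \<Lambda> M] by (simp add: le_divide_eq)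
    moreover have "\<bar>g p - g q\<bar> <= M * fm.hdist p q powr \<alpha>" using g unfolding fm.hb_def by blast
    ultimately show "\<bar>(- 1) * g p - (- 1) * g q\<bar> <= M / a * (\<Lambda> * fm.hdist p q powr \<alpha>)"
     using mult_right_mono[of M "M / a * \<Lambda>" "fm.hdist p q powr \<alpha>"] by (simp add: abs_minus_commute mult_ac)
   qed
  qed (use h0 h(4) \<Lambda> ST \<theta> in "auto simp: S_def")
  then obtain k where k: "S k (M / a / (1 - \<theta>))" "!!p. k p = (- 1) * g p + T k p" by blast
  note Rk = R[OF S_hb[OF k(1)]]
  have "?L (R k) p = g p" for p using Rk(2)[of p] k(2)[of p] by (simp add: T_def)
  moreover have "C * (2 * \<Lambda> * (M / a / (1 - \<theta>))) = C * (2 * \<Lambda> * (1 / a / (1 - \<theta>))) * M" by simp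
  ultimately show ?thesis using Rk(1) by (intro exI[of _ "R k"]) (simp only: simp_thms)
 qed
 show thesis
 proof (rule that[OF _ solve])
  show "C * (2 * \<Lambda> * (1 / a / (1 - \<theta>))) >= 0" using K \<Lambda>(3) h(2) \<theta> by (intro mult_nonneg_nonneg divide_nonneg_nonneg) auto
  show "w1 = w2" if "Ck 2 w1" "Ck 2 w2" "\<exists>B. \<forall>p. \<bar>w1 p\<bar> <= B" "\<exists>B. \<forall>p. \<bar>w2 p\<bar> <= B" "\<forall>p. ?L w1 p = ?L w2 p" for w1 w2
   by (rule uniq[of _ _ 0]) (simp_all add: bd_def that del: split_paired_All)
 qed
 qed
qed

end

section \<open>The isomorphism of the weighted spaces\<close>

lemma heteroclinic_one_dim_solution:
 assumes F: "double_well F" and U: "one_dim_solution n F U" and n: "n >= 3"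
 shows "heteroclinic U (deriv U) (deriv (deriv U)) F (deriv F) (deriv (deriv F)) (deriv (deriv (deriv F))) (real n - 1)"
proof -
 have ckF: "Ck k F" for k using F by (simp add: double_well_def)
 have ck: "Ck k (deriv F)" "Ck k (deriv (deriv F))" "Ck k (deriv (deriv (deriv F)))" for k
  using Ck_Suc_real(2) ckF by blast+
 have "F 1 = 0" "F (- 1) = 0"
 proof -
  have "{s. F s = 0} = {- 1, 1}" using F by (simp add: double_well_def)
  then show "F 1 = 0" "F (- 1) = 0" by auto
 qed
 moreover have "Ck 2 U" using U by (simp add: one_dim_solution_def)
 then have "Ck (Suc (Suc 0)) U" by (simp only: numeral_2_eq_2)
 note cU = this Ck_Suc_real(2)[OF this]
 show ?thesis
 proof
  show "(U has_real_derivative deriv U t) (at t)" for t by (rule Ck_Suc_real(1)[OF cU(1)])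
  show "(deriv U has_real_derivative deriv (deriv U) t) (at t)" for t by (rule Ck_Suc_real(1)[OF cU(2)])
  show "deriv (deriv U) t = deriv F (U t) - (real n - 1) * tanh t * deriv U t" for t
  proof -
   have "deriv (deriv U) t + (real n - 1) * tanh t * deriv U t - deriv F (U t) = 0"
    using U by (simp add: one_dim_solution_def)
   then show ?thesis by linarith
  qed
  show "(F has_real_derivative deriv F s) (at s)" for s by (rule Ck_Suc_real(1)[OF ckF])
  show "(deriv F has_real_derivative deriv (deriv F) s) (at s)"
   "(deriv (deriv F) has_real_derivative deriv (deriv (deriv F)) s) (at s)" for s
   by (rule Ck_Suc_real(1)[OF ck(1)], rule Ck_Suc_real(1)[OF ck(2)])
  show "continuous_on UNIV (deriv (deriv (deriv F)))" by (rule Ck_real_continuous[OF ck(3)])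
 qed (use n F U calculation in "auto simp: double_well_def one_dim_solution_def")
qed

lemma holder_space_hbD:
 assumes "0 < \<alpha>" "g \<in> holder_space gfermi 0 \<alpha>"
 shows "fm.hb \<alpha> g (2 * enn2real (holder_enorm gfermi 0 \<alpha> g))"
 by (rule fm.holder_imp_hb[OF assms(1)]) (use assms(2) in "auto simp: holder_space_def")

lemma holder_space_hb2D:
 assumes "w \<in> holder_space gfermi 2 \<alpha>"
 shows "fm.hb2 \<alpha> w (enn2real (holder_enorm gfermi 2 \<alpha> w))"
 by (rule fm.holder_imp_hb2) (use assms in "auto simp: holder_space_def")

lemma hb_holder_spaceI:
 assumes "0 < \<alpha>" "fm.hb \<alpha> g M"
 shows "g \<in> holder_space gfermi 0 \<alpha>" "enn2real (holder_enorm gfermi 0 \<alpha> g) <= 2 * M"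
proof -
 note h = fm.hb_imp_holder[OF assms] and M = fm.hb_nonneg[OF assms(2)]
 show "g \<in> holder_space gfermi 0 \<alpha>" unfolding holder_space_def using h by (auto intro: le_less_trans)
 show "enn2real (holder_enorm gfermi 0 \<alpha> g) <= 2 * M" using enn2real_mono[OF h(2)] M by simp
qed

lemma hb2_holder_spaceI:
 assumes "0 < \<alpha>" "fm.hb2 \<alpha> w M"
 shows "w \<in> holder_space gfermi 2 \<alpha>" "enn2real (holder_enorm gfermi 2 \<alpha> w) <= 5 * M"
proof -
 note h = fm.hb2_D(1)[OF assms(2)] fm.hb2_imp_holder[OF assms] and M = fm.hb2_nonneg[OF assms(2)]
 show "w \<in> holder_space gfermi 2 \<alpha>" unfolding holder_space_def using h by (auto intro: le_less_trans)
 show "enn2real (holder_enorm gfermi 2 \<alpha> w) <= 5 * M" using enn2real_mono[OF h(2)] M by simp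
qed

lemma weighted_norm_weight:
 "weighted_norm q k \<alpha> \<mu> \<delta> (%z. weight q \<mu> \<delta> z * w z) = enn2real (holder_enorm gfermi k \<alpha> w)"
proof -
 have "(%z. weight q \<mu> \<delta> z * w z / weight q \<mu> \<delta> z) = w"
  using less_imp_neq[OF weight_pos[of q \<mu> \<delta>], symmetric] by (intro ext nonzero_mult_div_cancel_left)
 then show ?thesis by (simp add: weighted_norm_def)
qed

theorem proposition2p2:
  fixes n :: nat and \<alpha> \<delta> \<mu> :: real and F U0 :: "real \<Rightarrow> real" and q :: "'a::euclidean_space"
  assumes "n \<ge> 3" and "DIM('a) = n - 1"
    and "0 < \<alpha>" and "\<alpha> < 1"
    and "double_well F"
    and "one_dim_solution n F U0"
    and "\<delta> \<in> {0<..<(real n - 2) / 2}"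
    and "\<mu> \<in> {0<..<beta n F}"
  shows "normed_isomorphism
           (weighted_space q 2 \<alpha> \<mu> \<delta>) (weighted_norm q 2 \<alpha> \<mu> \<delta>)
           (weighted_space q 0 \<alpha> \<mu> \<delta>) (weighted_norm q 0 \<alpha> \<mu> \<delta>)
           (L0 F U0)"
proof -
 note \<alpha> = assms(3,4)
 interpret heteroclinic U0 "deriv U0" "deriv (deriv U0)" F "deriv F" "deriv (deriv F)" "deriv (deriv (deriv F))" "real n - 1"
  by (rule heteroclinic_one_dim_solution[OF assms(5,6,1)])
 let ?L = "Lt q \<mu> \<delta> (%t. deriv (deriv F) (U0 t))" and ?W = "%w z. weight q \<mu> \<delta> z * w z"
 have m: "real n - 1 = real DIM('a)" using assms(1,2) by (simp add: of_nat_diff)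
 \<comment> \<open>Here m - 1 = n - 2, and (n - 2) / 2 <= n - 2; this is the range in which the
   barriers are supersolutions.\<close>
 have \<delta>: "0 < \<delta>" "\<delta> <= (real n - 1) - 1" using assms(1,7) by auto
 have \<mu>: "0 < \<mu>" "\<mu> < ind (deriv (deriv F) 1)" "\<mu> < ind (deriv (deriv F) (- 1))"
  using assms(8) by (auto simp: beta_def indicial_def ind_def)
 obtain C where C: "C >= 0"
  and solve: "!!(g :: real * 'a => real) M. fm.hb \<alpha> g M ==> \<exists>w. fm.hb2 \<alpha> w (C * M) \<and> (\<forall>p. ?L w p = g p)"
  and uniq: "!!w1 w2. Ck 2 w1 ==> Ck 2 w2 ==> (\<exists>B. \<forall>p. \<bar>w1 p\<bar> <= B) ==> (\<exists>B. \<forall>p. \<bar>w2 p\<bar> <= B) ==>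
   (\<forall>p. ?L w1 p = ?L w2 p) ==> w1 = w2"
  by (rule Lt_solvable[OF m \<delta> \<mu> \<alpha>, where q=q]) (rule that)
 obtain B where B: "!!t. \<bar>deriv (deriv F) (U0 t)\<bar> <= B" "!!s t. \<bar>deriv (deriv F) (U0 s) - deriv (deriv F) (U0 t)\<bar> <= B * \<bar>s - t\<bar>"
  by (rule potential_bounds) (rule that)
 obtain D where D: "D >= 0" and Lb: "!!w M. fm.hb2 \<alpha> w M ==> fm.hb \<alpha> (?L w) (D * M)"
  by (rule Lt_hb[OF \<alpha>(1) less_imp_le[OF \<alpha>(2)] B, where q=q and \<mu>=\<mu> and \<delta>=\<delta>]) (rule that)
 have L: "L0 F U0 (?W w) = ?W (?L w)" if "w \<in> holder_space gfermi 2 \<alpha>" for w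
  by (rule ext, rule L0_weight) (use that in "simp add: holder_space_def")
 have W_eq: "w1 = w2" if "?W w1 = ?W w2" for w1 w2
 proof
  fix z
  show "w1 z = w2 z" using fun_cong[OF that, of z] less_imp_neq[OF weight_pos[of q \<mu> \<delta> z]] by simp
 qed
 have inj: "w1 = w2" if "w1 \<in> holder_space gfermi 2 \<alpha>" "w2 \<in> holder_space gfermi 2 \<alpha>" "?L w1 = ?L w2" for w1 w2
  using fm.hb2_D(1,2)[OF holder_space_hb2D[OF that(1)]] fm.hb2_D(1,2)[OF holder_space_hb2D[OF that(2)]] fun_cong[OF that(3)]
  by (intro uniq) blast+
 have V: "\<exists>w\<in>holder_space gfermi k \<alpha>. u = ?W w" if "u \<in> weighted_space q k \<alpha> \<mu> \<delta>" for u k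
  using that by (auto simp: weighted_space_def)
 have VI: "?W w \<in> weighted_space q k \<alpha> \<mu> \<delta>" if "w \<in> holder_space gfermi k \<alpha>" for w k
  using that by (auto simp: weighted_space_def)
 show ?thesis
  unfolding normed_isomorphism_def
 proof (intro conjI ballI allI)
  fix u v a b assume "u \<in> weighted_space q 2 \<alpha> \<mu> \<delta>" "v \<in> weighted_space q 2 \<alpha> \<mu> \<delta>"
  then obtain w1 w2 where w: "w1 \<in> holder_space gfermi 2 \<alpha>" "u = ?W w1" "w2 \<in> holder_space gfermi 2 \<alpha>" "v = ?W w2"
   using V by blast
  have ck: "Ck 2 w1" "Ck 2 w2" using w by (simp_all add: holder_space_def)
  have eq: "(%x. a * u x + b * v x) = ?W (%x. a * w1 x + b * w2 x)" unfolding w by (simp add: fun_eq_iff algebra_simps)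
  have "L0 F U0 (%x. a * u x + b * v x) = ?W (?L (%x. a * w1 x + b * w2 x))"
   unfolding eq by (rule ext, rule L0_weight, intro Ck2_add(1) Ck2_cmult(1) ck)
  also have "... = (%y. a * L0 F U0 u y + b * L0 F U0 v y)"
   unfolding w(2,4) L[OF w(1)] L[OF w(3)] using Lt_linear[OF ck] by (simp add: fun_eq_iff algebra_simps)
  finally show "L0 F U0 (%x. a * u x + b * v x) = (%y. a * L0 F U0 u y + b * L0 F U0 v y)" .
 next
  show "bij_betw (L0 F U0) (weighted_space q 2 \<alpha> \<mu> \<delta>) (weighted_space q 0 \<alpha> \<mu> \<delta>)"
   unfolding bij_betw_def
  proof
   show "inj_on (L0 F U0) (weighted_space q 2 \<alpha> \<mu> \<delta>)"
   proof (rule inj_onI)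
    fix u v assume uv: "u \<in> weighted_space q 2 \<alpha> \<mu> \<delta>" "v \<in> weighted_space q 2 \<alpha> \<mu> \<delta>" and e: "L0 F U0 u = L0 F U0 v"
    obtain w1 w2 where w: "w1 \<in> holder_space gfermi 2 \<alpha>" "u = ?W w1" "w2 \<in> holder_space gfermi 2 \<alpha>" "v = ?W w2"
     using V uv by blast
    have "?L w1 = ?L w2" by (rule W_eq) (use e L w in simp)
    then show "u = v" using inj w by blast
   qed
   show "L0 F U0 ` weighted_space q 2 \<alpha> \<mu> \<delta> = weighted_space q 0 \<alpha> \<mu> \<delta>"
   proof (intro equalityI subsetI)
    fix y assume "y \<in> L0 F U0 ` weighted_space q 2 \<alpha> \<mu> \<delta>"
    then obtain w where w: "w \<in> holder_space gfermi 2 \<alpha>" "y = L0 F U0 (?W w)" using V by blast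
    then show "y \<in> weighted_space q 0 \<alpha> \<mu> \<delta>"
     unfolding w(2) L[OF w(1)] by (intro VI hb_holder_spaceI(1)[OF \<alpha>(1) Lb[OF holder_space_hb2D[OF w(1)]]])
   next
    fix y assume "y \<in> weighted_space q 0 \<alpha> \<mu> \<delta>"
    then obtain g where g: "g \<in> holder_space gfermi 0 \<alpha>" "y = ?W g" using V by blast
    obtain w where w: "fm.hb2 \<alpha> w (C * (2 * enn2real (holder_enorm gfermi 0 \<alpha> g)))" "\<forall>p. ?L w p = g p"
     using solve[OF holder_space_hbD[OF \<alpha>(1) g(1)]] by blast
    have "?L w = g" using w(2) by blast
    moreover have h: "w \<in> holder_space gfermi 2 \<alpha>" by (rule hb2_holder_spaceI(1)[OF \<alpha>(1) w(1)])
    ultimately have "y = L0 F U0 (?W w)" unfolding g(2) L[OF h] by simp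
    then show "y \<in> L0 F U0 ` weighted_space q 2 \<alpha> \<mu> \<delta>" using VI[OF h] by blast
   qed
  qed
 next
  show "\<exists>K. \<forall>u\<in>weighted_space q 2 \<alpha> \<mu> \<delta>. weighted_norm q 0 \<alpha> \<mu> \<delta> (L0 F U0 u) <= K * weighted_norm q 2 \<alpha> \<mu> \<delta> u"
  proof (intro exI ballI)
   fix u assume "u \<in> weighted_space q 2 \<alpha> \<mu> \<delta>"
   then obtain w where w: "w \<in> holder_space gfermi 2 \<alpha>" "u = ?W w" using V by blast
   show "weighted_norm q 0 \<alpha> \<mu> \<delta> (L0 F U0 u) <= (2 * D) * weighted_norm q 2 \<alpha> \<mu> \<delta> u"
    unfolding w(2) L[OF w(1)] weighted_norm_weight
    using hb_holder_spaceI(2)[OF \<alpha>(1) Lb[OF holder_space_hb2D[OF w(1)]]] by (simp only: mult.assoc)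
  qed
 next
  show "\<exists>K. \<forall>u\<in>weighted_space q 2 \<alpha> \<mu> \<delta>. weighted_norm q 2 \<alpha> \<mu> \<delta> u <= K * weighted_norm q 0 \<alpha> \<mu> \<delta> (L0 F U0 u)"
  proof (intro exI ballI)
   fix u assume "u \<in> weighted_space q 2 \<alpha> \<mu> \<delta>"
   then obtain w where w: "w \<in> holder_space gfermi 2 \<alpha>" "u = ?W w" using V by blast
   have g: "?L w \<in> holder_space gfermi 0 \<alpha>" by (rule hb_holder_spaceI(1)[OF \<alpha>(1) Lb[OF holder_space_hb2D[OF w(1)]]])
   \<comment> \<open>\<open>solve\<close> returns some solution with a norm bound, and injectivity
     identifies it with \<open>w\<close>. The a priori estimate is thus a consequence of solvability
     and uniqueness.\<close>
   obtain w' where w': "fm.hb2 \<alpha> w' (C * (2 * enn2real (holder_enorm gfermi 0 \<alpha> (?L w))))" "\<forall>p. ?L w' p = ?L w p"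
    using solve[OF holder_space_hbD[OF \<alpha>(1) g]] by blast
   have "?L w' = ?L w" using w'(2) by blast
   then have "w' = w" by (rule inj[OF hb2_holder_spaceI(1)[OF \<alpha>(1) w'(1)] w(1)])
   then show "weighted_norm q 2 \<alpha> \<mu> \<delta> u <= (5 * C * 2) * weighted_norm q 0 \<alpha> \<mu> \<delta> (L0 F U0 u)"
    unfolding w(2) L[OF w(1)] weighted_norm_weight
    using hb2_holder_spaceI(2)[OF \<alpha>(1) w'(1)] by (simp only: mult.assoc)
  qed
 qed
qed

end
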